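(* Let $d\sigma^2$ be a Whitney metric defined on a neighborhood of a point $p$ of a $2$-manifold $M^2$, and suppose $p$ is a singular point of $d\sigma^2$. Let $b\in C^\infty_o(\mathbb{R})$ be any $C^\infty$ function germ at $0$ with $b(0)=b'(0)=b''(0)=0$. Then there exists a $C^\infty$ map germ $f$ at $p$ into $\mathbb{R}^3$ having a cross cap singularity at $p$ such that (1) the first fundamental form $f^*ds^2_{\mathbb{R}^3}$ of $f$ is formally isometric to $d\sigma^2$ at $p$, and (2) the characteristic function of $f$ has the same Taylor series at $0$ as $b$. Moreover, such an $f$ is unique up to addition of flat functions: the Taylor series of $f$ (written, after an orientation-preserving isometry of $\mathbb{R}^3$, in the form $(x,\,xy+b(y),\,z)$ in a coordinate system $(u,v)$ centered at $p$ as in the context below, normalized by $x_u(0,0)=1$) is uniquely determined as a formal power series.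
   Context: A $C^\infty$ map germ $f:(\mathbb{R}^2,p)\to\mathbb{R}^3$ has a cross cap (Whitney umbrella) at $p$ if there are local diffeomorphisms $\phi$ of $\mathbb{R}^2$ and $\Phi$ of $\mathbb{R}^3$ with $\phi(p)=(0,0)$, $\Phi(f(p))=0$ and $\Phi\circ f=f_0\circ\phi$, where $f_0(u,v)=(u,uv,v^2)$. Normal form: for a cross cap germ $f$ there exist an orientation-preserving isometry $T$ of $\mathbb{R}^3$ and local coordinates $(x,y)$ centered at $p$ with $T\circ f(x,y)=(x,\;xy+b(y),\;z(x,y))$, where $b,z$ are smooth, $b(0)=b'(0)=b''(0)=0$, $z(0,0)=z_x(0,0)=z_y(0,0)=0$, $z_{yy}(0,0)>0$; requiring that the Jacobian of $(x,y)$ with respect to any fixed oriented original coordinates be positive at $p$, the germs $x,y,z,b$ are uniquely determined. The function $b$ is called the characteristic function of $f$. A positive semi-definite metric $d\sigma^2=E\,du^2+2F\,du\,dv+G\,dv^2$ on a 2-manifold has a singular point at $p$ if it is not positive definite at $p$. Local coordinates $(u,v)$ centered at a singular point are admissible if $F=G=0$ at $p$. A singular point $p$ is admissible if there is an admissible coordinate system with $E_v=2F_u$ and $G_u=G_v=0$ at $p$. An admissible singular point $p$ is an intrinsic cross cap if, for an admissible coordinate system, $\delta:=EG-F^2$ satisfies $\delta_{uu}\delta_{vv}-\delta_{uv}^2\neq 0$ at $p$. A Whitney metric is a positive semi-definite metric all of whose singular points are admissible intrinsic cross caps. Such a metric admits local coordinates $(u,v)$ centered at its singular point $p$ in which the Taylor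 series satisfy $[E]=1+a_{2,0}^2u^2+2a_{2,0}a_{1,1}uv+(1+a_{1,1}^2)v^2+O(3)$, $[F]=a_{2,0}a_{1,1}u^2+(a_{2,0}a_{0,2}+a_{1,1}^2+1)uv+a_{1,1}a_{0,2}v^2+O(3)$, $[G]=(1+a_{1,1}^2)u^2+2a_{1,1}a_{0,2}uv+a_{0,2}^2v^2+O(3)$, for real constants $a_{2,0},a_{1,1}$ and $a_{0,2}>0$, where $O(3)$ denotes terms of total degree $\ge 3$. For a smooth function germ $h$, $[h]$ denotes its Taylor series at the origin. Two metrics $d\sigma_j^2=E_j\,du^2+2F_j\,du\,dv+G_j\,dv^2$ $(j=1,2)$ near $p$ are formally isometric at $p$ if there exists a local coordinate system $(u,v)$ centered at $p$ in which $[E_1]=[E_2]$, $[F_1]=[F_2]$, $[G_1]=[G_2]$. A function is flat at $p$ if all its partial derivatives of all orders vanish at $p$. *)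

theory Defs
  imports "HOL-Analysis.Analysis"
begin

definition partial :: "'n::finite \<Rightarrow> (real^'n \<Rightarrow> real) \<Rightarrow> real^'n \<Rightarrow> real" where
  "partial k h x = deriv (\<lambda>t. h (x + t *\<^sub>R axis k 1)) 0"

definition pd :: "'n::finite list \<Rightarrow> (real^'n \<Rightarrow> real) \<Rightarrow> real^'n \<Rightarrow> real" where
  "pd ks h = foldr partial ks h"

definition smooth_fn :: "(real^'n::finite) set \<Rightarrow> (real^'n \<Rightarrow> real) \<Rightarrow> bool" where
  "smooth_fn U h \<longleftrightarrow>
     (\<forall>ks. continuous_on U (pd ks h) \<and>
       (\<forall>k. \<forall>x\<in>U. (\<lambda>t. pd ks h (x + t *\<^sub>R axis k 1)) differentiable (at 0)))"

definition smooth_map :: "(real^'n::finite) set \<Rightarrow> (real^'n \<Rightarrow> real^'m::finite) \<Rightarrow> bool" where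
  "smooth_map U f \<longleftrightarrow> (\<forall>i. smooth_fn U (\<lambda>x. f x $ i))"

definition smooth_germ_fn :: "real^'n::finite \<Rightarrow> (real^'n \<Rightarrow> real) \<Rightarrow> bool" where
  "smooth_germ_fn p h \<longleftrightarrow> (\<exists>U. open U \<and> p \<in> U \<and> smooth_fn U h)"

definition smooth_germ_map :: "real^'n::finite \<Rightarrow> (real^'n \<Rightarrow> real^'m::finite) \<Rightarrow> bool" where
  "smooth_germ_map p f \<longleftrightarrow> (\<exists>U. open U \<and> p \<in> U \<and> smooth_map U f)"

definition smooth_germ_real :: "real \<Rightarrow> (real \<Rightarrow> real) \<Rightarrow> bool" where
  "smooth_germ_real t0 b \<longleftrightarrow>
     (\<exists>e>0. \<forall>n. \<forall>t\<in>ball t0 e. ((deriv ^^ n) b) differentiable (at t))"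

definition jet_eq :: "real^'n::finite \<Rightarrow> (real^'n \<Rightarrow> real) \<Rightarrow> (real^'n \<Rightarrow> real) \<Rightarrow> bool" where
  "jet_eq p h1 h2 \<longleftrightarrow> (\<forall>ks. pd ks h1 p = pd ks h2 p)"

definition jet_eq_real :: "real \<Rightarrow> (real \<Rightarrow> real) \<Rightarrow> (real \<Rightarrow> real) \<Rightarrow> bool" where
  "jet_eq_real t0 b1 b2 \<longleftrightarrow> (\<forall>n. (deriv ^^ n) b1 t0 = (deriv ^^ n) b2 t0)"

definition local_diffeo :: "(real^'n::finite \<Rightarrow> real^'n) \<Rightarrow> real^'n \<Rightarrow> bool" where
  "local_diffeo \<phi> p \<longleftrightarrow>
     (\<exists>U V \<psi>. open U \<and> p \<in> U \<and> open V \<and> \<phi> ` U = V \<and>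
        smooth_map U \<phi> \<and> smooth_map V \<psi> \<and>
        (\<forall>x\<in>U. \<psi> (\<phi> x) = x) \<and> (\<forall>y\<in>V. \<phi> (\<psi> y) = y))"

definition jac_det2 :: "(real^2 \<Rightarrow> real^2) \<Rightarrow> real^2 \<Rightarrow> real" where
  "jac_det2 xy p =
     partial 1 (\<lambda>y. xy y $ 1) p * partial 2 (\<lambda>y. xy y $ 2) p
     - partial 2 (\<lambda>y. xy y $ 1) p * partial 1 (\<lambda>y. xy y $ 2) p"

text \<open>A local coordinate system (u,v) centered at p, given by its parametrization
  psi : (u,v) |-> point, with psi 0 = p.\<close>
definition coords_at :: "real^2 \<Rightarrow> (real^2 \<Rightarrow> real^2) \<Rightarrow> bool" where
  "coords_at p \<psi> \<longleftrightarrow> local_diffeo \<psi> 0 \<and> \<psi> 0 = p"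

text \<open>Coefficients of the metric E du^2 + 2F du dv + G dv^2 in new coordinates given by psi:
  the bilinear form evaluated on psi_k, psi_l.\<close>
definition pb_form :: "(real^2 \<Rightarrow> real) \<Rightarrow> (real^2 \<Rightarrow> real) \<Rightarrow> (real^2 \<Rightarrow> real)
    \<Rightarrow> (real^2 \<Rightarrow> real^2) \<Rightarrow> 2 \<Rightarrow> 2 \<Rightarrow> real^2 \<Rightarrow> real" where
  "pb_form E F G \<psi> k l w =
     (let a = partial k (\<lambda>y. \<psi> y $ 1) w; c = partial k (\<lambda>y. \<psi> y $ 2) w;
          a' = partial l (\<lambda>y. \<psi> y $ 1) w; c' = partial l (\<lambda>y. \<psi> y $ 2) w
      in E (\<psi> w) * a * a' + F (\<psi> w) * (a * c' + c * a') + G (\<psi> w) * c * c')"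

definition pbE where "pbE E F G \<psi> = pb_form E F G \<psi> 1 1"
definition pbF where "pbF E F G \<psi> = pb_form E F G \<psi> 1 2"
definition pbG where "pbG E F G \<psi> = pb_form E F G \<psi> 2 2"

definition psd_metric :: "(real^2) set \<Rightarrow> (real^2 \<Rightarrow> real) \<Rightarrow> (real^2 \<Rightarrow> real) \<Rightarrow> (real^2 \<Rightarrow> real) \<Rightarrow> bool" where
  "psd_metric U E F G \<longleftrightarrow> smooth_fn U E \<and> smooth_fn U F \<and> smooth_fn U G \<and>
     (\<forall>x\<in>U. E x \<ge> 0 \<and> G x \<ge> 0 \<and> E x * G x - (F x)\<^sup>2 \<ge> 0)"

definition pos_def_at :: "(real^2 \<Rightarrow> real) \<Rightarrow> (real^2 \<Rightarrow> real) \<Rightarrow> (real^2 \<Rightarrow> real) \<Rightarrow> real^2 \<Rightarrow> bool" where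
  "pos_def_at E F G x \<longleftrightarrow> E x > 0 \<and> E x * G x - (F x)\<^sup>2 > 0"

definition admissible_coords where
  "admissible_coords E F G p \<psi> \<longleftrightarrow>
     coords_at p \<psi> \<and> pbF E F G \<psi> 0 = 0 \<and> pbG E F G \<psi> 0 = 0"

definition admissible_point where
  "admissible_point E F G p \<longleftrightarrow>
     (\<exists>\<psi>. admissible_coords E F G p \<psi> \<and>
        partial 2 (pbE E F G \<psi>) 0 = 2 * partial 1 (pbF E F G \<psi>) 0 \<and>
        partial 1 (pbG E F G \<psi>) 0 = 0 \<and> partial 2 (pbG E F G \<psi>) 0 = 0)"

definition intrinsic_cross_cap where
  "intrinsic_cross_cap E F G p \<longleftrightarrow> admissible_point E F G p \<and>
     (\<exists>\<psi>. admissible_coords E F G p \<psi> \<and>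
        (let \<delta> = (\<lambda>w. pbE E F G \<psi> w * pbG E F G \<psi> w - (pbF E F G \<psi> w)\<^sup>2)
         in pd [1,1] \<delta> 0 * pd [2,2] \<delta> 0 - (pd [1,2] \<delta> 0)\<^sup>2 \<noteq> 0))"

definition whitney_metric where
  "whitney_metric U E F G \<longleftrightarrow> open U \<and> psd_metric U E F G \<and>
     (\<forall>x\<in>U. \<not> pos_def_at E F G x \<longrightarrow> intrinsic_cross_cap E F G x)"

definition taylor2_at0 :: "(real^2 \<Rightarrow> real) \<Rightarrow> real \<Rightarrow> real \<Rightarrow> real \<Rightarrow> real \<Rightarrow> real \<Rightarrow> real \<Rightarrow> bool" where
  "taylor2_at0 h c0 cu cv cuu cuv cvv \<longleftrightarrow>
     h 0 = c0 \<and> partial 1 h 0 = cu \<and> partial 2 h 0 = cv \<and>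
     pd [1,1] h 0 = cuu \<and> pd [1,2] h 0 = cuv \<and> pd [2,2] h 0 = cvv"

definition whitney_normal_coords where
  "whitney_normal_coords E F G p \<psi> \<longleftrightarrow> coords_at p \<psi> \<and>
     (\<exists>a20 a11 a02::real. a02 > 0 \<and>
        taylor2_at0 (pbE E F G \<psi>) 1 0 0 (2 * a20\<^sup>2) (2 * a20 * a11) (2 * (1 + a11\<^sup>2)) \<and>
        taylor2_at0 (pbF E F G \<psi>) 0 0 0 (2 * a20 * a11) (a20 * a02 + a11\<^sup>2 + 1) (2 * a11 * a02) \<and>
        taylor2_at0 (pbG E F G \<psi>) 0 0 0 (2 * (1 + a11\<^sup>2)) (2 * a11 * a02) (2 * a02\<^sup>2))"

definition formally_isometric where
  "formally_isometric E1 F1 G1 E2 F2 G2 p \<longleftrightarrow>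
     (\<exists>\<psi>. coords_at p \<psi> \<and>
        jet_eq 0 (pbE E1 F1 G1 \<psi>) (pbE E2 F2 G2 \<psi>) \<and>
        jet_eq 0 (pbF E1 F1 G1 \<psi>) (pbF E2 F2 G2 \<psi>) \<and>
        jet_eq 0 (pbG E1 F1 G1 \<psi>) (pbG E2 F2 G2 \<psi>))"

definition vpartial :: "2 \<Rightarrow> (real^2 \<Rightarrow> real^3) \<Rightarrow> real^2 \<Rightarrow> real^3" where
  "vpartial k f x = (\<chi> i. partial k (\<lambda>y. f y $ i) x)"

definition ffE where "ffE f = (\<lambda>x. vpartial 1 f x \<bullet> vpartial 1 f x)"
definition ffF where "ffF f = (\<lambda>x. vpartial 1 f x \<bullet> vpartial 2 f x)"
definition ffG where "ffG f = (\<lambda>x. vpartial 2 f x \<bullet> vpartial 2 f x)"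

definition std_cross_cap :: "real^2 \<Rightarrow> real^3" where
  "std_cross_cap w = vector [w $ 1, w $ 1 * w $ 2, (w $ 2)\<^sup>2]"

definition cross_cap :: "(real^2 \<Rightarrow> real^3) \<Rightarrow> real^2 \<Rightarrow> bool" where
  "cross_cap f p \<longleftrightarrow>
     (\<exists>\<phi> \<Phi>. local_diffeo \<phi> p \<and> \<phi> p = 0 \<and> local_diffeo \<Phi> (f p) \<and> \<Phi> (f p) = 0 \<and>
        (\<forall>\<^sub>F x in nhds p. \<Phi> (f x) = std_cross_cap (\<phi> x)))"

definition orient_isometry :: "(real^3 \<Rightarrow> real^3) \<Rightarrow> bool" where
  "orient_isometry T \<longleftrightarrow> (\<exists>Q c. rotation_matrix Q \<and> (\<forall>x. T x = Q *v x + c))"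

definition cc_normal_form ::
  "(real^2 \<Rightarrow> real^3) \<Rightarrow> real^2 \<Rightarrow> (real^3 \<Rightarrow> real^3) \<Rightarrow> (real^2 \<Rightarrow> real^2)
     \<Rightarrow> (real \<Rightarrow> real) \<Rightarrow> (real^2 \<Rightarrow> real) \<Rightarrow> bool" where
  "cc_normal_form f p T xy b z \<longleftrightarrow>
     orient_isometry T \<and> local_diffeo xy p \<and> xy p = 0 \<and> jac_det2 xy p > 0 \<and>
     smooth_germ_real 0 b \<and> b 0 = 0 \<and> deriv b 0 = 0 \<and> deriv (deriv b) 0 = 0 \<and>
     smooth_germ_fn 0 z \<and> z 0 = 0 \<and> partial 1 z 0 = 0 \<and> partial 2 z 0 = 0 \<and>
     pd [2,2] z 0 > 0 \<and>
     (\<forall>\<^sub>F q in nhds p.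
        T (f q) = vector [xy q $ 1, xy q $ 1 * xy q $ 2 + b (xy q $ 2), z (xy q)])"

text \<open>b is the characteristic function of f at p (unique by the normal form theorem).\<close>
definition characteristic_function :: "(real^2 \<Rightarrow> real^3) \<Rightarrow> real^2 \<Rightarrow> (real \<Rightarrow> real) \<Rightarrow> bool" where
  "characteristic_function f p b \<longleftrightarrow> (\<exists>T xy z. cc_normal_form f p T xy b z)"

end

theory Submission
  imports Defs
begin

text \<open>
  The first fundamental form of $f = (x,\, xy + b(y),\, z)$ is matched with the metric order by order.
  Once the base jets of $x, y, z$ are fixed, corrections of the components in the next degree change
  the terms of degree $n$ of the first fundamental form by a linear map between spaces of forms.
  Eliminating the correction of $x$ leaves a recursion of $2 \times 2$ systems for the coefficients
  of the other two, with determinants proportional to $2n - 2 - i$, $i < n$; so for $n \ge 3$ the linear map is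
  bijective, which gives both existence and uniqueness of the formal solution. The base jets are
  determined by the metric except for the sign of $y_v$, which the orientation fixes.

  The formal solution is made smooth by Borel summation, with oscillating factors
  $\lambda^{-n}\sin^n(\lambda t)$ in place of cut-off functions. To obtain a genuine cross cap, $z$ is kept in
  the form $Z(x) + W^2$ and, in the coordinates $(x, W)$, Whitney's theorem on even functions writes
  the second component as $A(x, W^2) + W B(x, W^2)$; diffeomorphisms of the target then remove $Z$ and $A$.
\<close>

text \<open>A count of unknowns explains why exactly \<open>b\<close> can be prescribed. Degree n
  carries 3(n+1) equations. The correction of x starts one degree higher, because x_u is a unit
  while the gradients of the other two components vanish at the origin; it has n+2 coefficients. The
  third component has n+1. The second one, x y + b(y), changes to leading order by u times the
  change of y, so its v^n coefficient is out of reach and n remain: 3n+3 in all. For the same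
  reasons x is always known to one order more than the third component, and y to one order less.
  Eliminating the correction of x amounts to equating its two mixed derivatives. The equations for
  the 2-jet of the metric are quadratic and are solved by hand; a real solution exists because EG -
  F^2 has a nondegenerate minimum at the singular point. Borel summation controls Taylor series
  only, while cross cap and normal form are exact identities of germs. Hence x, y, W, Z are summed
  separately and the map is assembled from them, so that all flat errors fall on the metric.\<close>

lemma pd_Nil [simp]: "pd [] h = h"
  by (simp add: pd_def)

lemma pd_Cons: "pd (k # ks) h = partial k (pd ks h)"
  by (simp add: pd_def)

lemma pd_append: "pd (ks @ ls) h = pd ks (pd ls h)"
  by (simp add: pd_def)

section \<open>Calculus of smooth functions defined by iterated partial derivatives\<close>

lemma eventually_along_axis:
  assumes "open U" "x \<in> U"
  shows "\<forall>\<^sub>F t in nhds 0. x + t *\<^sub>R axis k 1 \<in> (U :: (real^'n::finite) set)"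
proof -
  have "open ((\<lambda>t. x + t *\<^sub>R axis k 1) -` U)"
    using assms(1) by (intro open_vimage continuous_intros) auto
  thus ?thesis using assms(2) by (auto simp: eventually_nhds)
qed

lemma partial_eqI:
  "((\<lambda>t. (h :: real^'n::finite \<Rightarrow> real) (x + t *\<^sub>R axis k 1)) has_real_derivative d) (at 0) \<Longrightarrow> partial k h x = d"
  unfolding partial_def by (rule DERIV_imp_deriv)

lemma axis_deriv_cong:
  fixes g h :: "real^'n::finite \<Rightarrow> real"
  assumes "open U" "x \<in> U" "\<And>y. y \<in> U \<Longrightarrow> g y = h y"
  shows "((\<lambda>t. g (x + t *\<^sub>R axis k 1)) has_real_derivative d) (at 0)
     \<longleftrightarrow> ((\<lambda>t. h (x + t *\<^sub>R axis k 1)) has_real_derivative d) (at 0)"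
proof (rule DERIV_cong_ev)
  show "\<forall>\<^sub>F t in nhds 0. g (x + t *\<^sub>R axis k 1) = h (x + t *\<^sub>R axis k 1)"
    using eventually_along_axis[OF assms(1,2), of k] by eventually_elim (rule assms(3))
qed auto

lemma smooth_fn_axis_deriv:
  assumes "smooth_fn U h" "x \<in> U"
  shows "((\<lambda>t. pd ks h (x + t *\<^sub>R axis k 1)) has_real_derivative partial k (pd ks h) x) (at 0)"
  using assms unfolding smooth_fn_def partial_def
  by (metis DERIV_deriv_iff_real_differentiable)

lemma smooth_fn_line_deriv:
  assumes "smooth_fn U h" "x + s *\<^sub>R axis k 1 \<in> U"
  shows "((\<lambda>t. h (x + t *\<^sub>R axis k 1)) has_real_derivative partial k h (x + s *\<^sub>R axis k 1)) (at s)"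
proof -
  have "((\<lambda>t. h (x + s *\<^sub>R axis k 1 + t *\<^sub>R axis k 1)) has_real_derivative
      partial k h (x + s *\<^sub>R axis k 1)) (at 0)"
    using smooth_fn_axis_deriv[OF assms, of "[]"] by simp
  hence "((\<lambda>t. h (x + (t + s) *\<^sub>R axis k 1)) has_real_derivative
      partial k h (x + s *\<^sub>R axis k 1)) (at 0)"
    by (simp add: scaleR_add_left add_ac)
  thus ?thesis
    using DERIV_shift[of "\<lambda>t. h (x + t *\<^sub>R axis k 1)" "partial k h (x + s *\<^sub>R axis k 1)" 0 s] by simp
qed

lemma smooth_fn_continuous: "smooth_fn U h \<Longrightarrow> continuous_on U h"
  unfolding smooth_fn_def by (metis pd_Nil)

lemma smooth_fn_pd: "smooth_fn U h \<Longrightarrow> smooth_fn U (pd ks h)"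
  unfolding smooth_fn_def by (metis pd_append)

lemma smooth_fn_partial: "smooth_fn U h \<Longrightarrow> smooth_fn U (partial k h)"
  using smooth_fn_pd[of U h "[k]"] by (simp add: pd_Cons)

text \<open>Induction on the word of derivatives: each \<open>pd ks h\<close> agrees on
  \<open>U\<close> with a member of \<open>P\<close>, and openness lets the next axis derivative see
  only \<open>U\<close>. Closure of a class under derivation thus replaces the computation of
  iterated derivatives, here and later for inverse maps, series and square-root
  substitutions.\<close>

lemma smooth_fn_coinduct:
  assumes U: "open U" and h: "P h"
    and cont: "\<And>h. P h \<Longrightarrow> continuous_on U h"
    and step: "\<And>h k. P h \<Longrightarrow> \<exists>h'. P h' \<and>
        (\<forall>x\<in>U. ((\<lambda>t. h (x + t *\<^sub>R axis k 1)) has_real_derivative h' x) (at 0))"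
  shows "smooth_fn U h"
proof -
  have *: "\<exists>h'. P h' \<and> (\<forall>x\<in>U. pd ks h x = h' x)" for ks
  proof (induction ks)
    case (Cons k ks)
    then obtain h' where h': "P h'" "\<forall>x\<in>U. pd ks h x = h' x" by blast
    obtain h'' where h'': "P h''"
      "\<forall>x\<in>U. ((\<lambda>t. h' (x + t *\<^sub>R axis k 1)) has_real_derivative h'' x) (at 0)"
      using step[OF h'(1)] by blast
    have "partial k (pd ks h) x = h'' x" if "x \<in> U" for x
      using h''(2) that axis_deriv_cong[OF U that, of "pd ks h" h'] h'(2)
      by (intro partial_eqI) auto
    thus ?case using h''(1) by (auto simp: pd_Cons)
  qed (use h in auto)
  show ?thesis
    unfolding smooth_fn_def
  proof (intro allI conjI ballI)
    fix ks
    obtain h' where h': "P h'" "\<forall>x\<in>U. pd ks h x = h' x" using * by blast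
    show "continuous_on U (pd ks h)"
      using cont[OF h'(1)] continuous_on_cong[of U U "pd ks h" h'] h'(2) by auto
    fix k x assume x: "x \<in> U"
    obtain h'' where h'':
      "\<forall>x\<in>U. ((\<lambda>t. h' (x + t *\<^sub>R axis k 1)) has_real_derivative h'' x) (at 0)"
      using step[OF h'(1)] by blast
    hence "((\<lambda>t. pd ks h (x + t *\<^sub>R axis k 1)) has_real_derivative h'' x) (at 0)"
      using x axis_deriv_cong[OF U x, of "pd ks h" h'] h'(2) by auto
    thus "(\<lambda>t. pd ks h (x + t *\<^sub>R axis k 1)) differentiable at 0"
      using real_differentiable_def by blast
  qed
qed

text \<open>The real algebra generated by \<open>G\<close>. Product, chain and quotient rules
  produce polynomials in the generators, so closure under derivation has to be checked on generators
  only.\<close>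

inductive alg :: "((real^'n::finite) \<Rightarrow> real) set \<Rightarrow> (real^'n \<Rightarrow> real) \<Rightarrow> bool" for G where
  alg_gen: "g \<in> G \<Longrightarrow> alg G g"
| alg_const: "alg G (\<lambda>x. c)"
| alg_add: "alg G f \<Longrightarrow> alg G g \<Longrightarrow> alg G (\<lambda>x. f x + g x)"
| alg_mult: "alg G f \<Longrightarrow> alg G g \<Longrightarrow> alg G (\<lambda>x. f x * g x)"

lemma alg_sum: "finite A \<Longrightarrow> (\<And>i. i \<in> A \<Longrightarrow> alg G (f i)) \<Longrightarrow> alg G (\<lambda>x. \<Sum>i\<in>A. f i x)"
  by (induction A rule: finite_induct) (auto intro: alg_const alg_add)

lemma alg_minus: "alg G f \<Longrightarrow> alg G (\<lambda>x. - f x)"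
  using alg_mult[OF alg_const[of G "-1"], of f] by simp

lemma alg_imp_smooth_fn:
  assumes U: "open U"
    and cont: "\<And>g. g \<in> G \<Longrightarrow> continuous_on U g"
    and step: "\<And>g k. g \<in> G \<Longrightarrow> \<exists>g'. alg G g' \<and>
        (\<forall>x\<in>U. ((\<lambda>t. g (x + t *\<^sub>R axis k 1)) has_real_derivative g' x) (at 0))"
    and h: "alg G h"
  shows "smooth_fn U h"
proof (rule smooth_fn_coinduct[OF U, of "alg G", OF h])
  show "continuous_on U g" if "alg G g" for g
    using that by induction (simp_all add: cont continuous_on_add continuous_on_mult)
  show "\<exists>g'. alg G g' \<and>
      (\<forall>x\<in>U. ((\<lambda>t. g (x + t *\<^sub>R axis k 1)) has_real_derivative g' x) (at 0))"
    if "alg G g" for g k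
    using that
  proof induction
    case (alg_gen g)
    then show ?case using step by blast
  next
    case (alg_const c)
    show ?case by (intro exI[of _ "\<lambda>x. 0"]) (auto intro: alg.alg_const)
  next
    case (alg_add f g)
    then obtain f' g' where "alg G f'" "alg G g'"
      "\<forall>x\<in>U. ((\<lambda>t. f (x + t *\<^sub>R axis k 1)) has_real_derivative f' x) (at 0)"
      "\<forall>x\<in>U. ((\<lambda>t. g (x + t *\<^sub>R axis k 1)) has_real_derivative g' x) (at 0)" by blast
    thus ?case
      by (intro exI[of _ "\<lambda>x. f' x + g' x"]) (auto intro!: alg.alg_add DERIV_add)
  next
    case (alg_mult f g)
    then obtain f' g' where *: "alg G f'" "alg G g'"
      "\<forall>x\<in>U. ((\<lambda>t. f (x + t *\<^sub>R axis k 1)) has_real_derivative f' x) (at 0)"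
      "\<forall>x\<in>U. ((\<lambda>t. g (x + t *\<^sub>R axis k 1)) has_real_derivative g' x) (at 0)" by blast
    have "((\<lambda>t. f (x + t *\<^sub>R axis k 1) * g (x + t *\<^sub>R axis k 1)) has_real_derivative
      (f x * g' x + f' x * g x)) (at 0)" if "x \<in> U" for x
      using DERIV_mult'[OF *(3)[rule_format, OF that] *(4)[rule_format, OF that]] by simp
    with * alg_mult.hyps show ?case
      by (intro exI[of _ "\<lambda>x. f x * g' x + f' x * g x"]) (auto intro!: alg.alg_add alg.alg_mult)
  qed
qed

lemma smooth_alg:
  assumes U: "open U" and h: "alg {g. smooth_fn U g} h"
  shows "smooth_fn U h"
proof (rule alg_imp_smooth_fn[OF U _ _ h])
  show "\<exists>g'. alg {g. smooth_fn U g} g' \<and>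
      (\<forall>x\<in>U. ((\<lambda>t. g (x + t *\<^sub>R axis k 1)) has_real_derivative g' x) (at 0))"
    if "g \<in> {g. smooth_fn U g}" for g k
    using that smooth_fn_axis_deriv[of U g _ "[]" k]
    by (intro exI[of _ "partial k g"]) (auto intro!: alg_gen smooth_fn_partial)
qed (auto intro: smooth_fn_continuous)

lemma smooth_fn_const: "open U \<Longrightarrow> smooth_fn U (\<lambda>x. c)"
  by (rule smooth_alg) (auto intro: alg.intros)

lemma smooth_fn_add:
  "open U \<Longrightarrow> smooth_fn U f \<Longrightarrow> smooth_fn U g \<Longrightarrow> smooth_fn U (\<lambda>x. f x + g x)"
  by (rule smooth_alg) (auto intro: alg.intros)

lemma smooth_fn_mult:
  "open U \<Longrightarrow> smooth_fn U f \<Longrightarrow> smooth_fn U g \<Longrightarrow> smooth_fn U (\<lambda>x. f x * g x)"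
  by (rule smooth_alg) (auto intro: alg.intros)

lemma smooth_fn_minus: "open U \<Longrightarrow> smooth_fn U f \<Longrightarrow> smooth_fn U (\<lambda>x. - f x)"
  by (rule smooth_alg) (auto intro: alg.intros alg_minus)

lemma smooth_fn_diff:
  "open U \<Longrightarrow> smooth_fn U f \<Longrightarrow> smooth_fn U g \<Longrightarrow> smooth_fn U (\<lambda>x. f x - g x)"
  using smooth_fn_add[of U f "\<lambda>x. - g x"] smooth_fn_minus by auto

lemma smooth_fn_power: "open U \<Longrightarrow> smooth_fn U f \<Longrightarrow> smooth_fn U (\<lambda>x. f x ^ n)"
  by (induction n) (auto intro: smooth_fn_const smooth_fn_mult)

lemma smooth_fn_subset: "smooth_fn U h \<Longrightarrow> V \<subseteq> U \<Longrightarrow> smooth_fn V h"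
  unfolding smooth_fn_def by (meson continuous_on_subset subsetD)

lemma smooth_fn_cong:
  assumes "open U" "\<And>x. x \<in> U \<Longrightarrow> g x = h x" "smooth_fn U g"
  shows "smooth_fn U h"
proof (rule smooth_fn_coinduct[OF assms(1), where P = "\<lambda>h. \<exists>g. smooth_fn U g \<and> (\<forall>x\<in>U. g x = h x)"])
  show "continuous_on U f" if "\<exists>g. smooth_fn U g \<and> (\<forall>x\<in>U. g x = f x)" for f
    using that by (metis continuous_on_cong smooth_fn_continuous)
next
  fix f k assume "\<exists>g. smooth_fn U g \<and> (\<forall>x\<in>U. g x = f x)"
  then obtain g where g: "smooth_fn U g" "\<forall>x\<in>U. g x = f x" by blast
  have "((\<lambda>t. f (x + t *\<^sub>R axis k 1)) has_real_derivative partial k g x) (at 0)" if "x \<in> U" for x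
    using axis_deriv_cong[OF assms(1) that, of g f k] g smooth_fn_axis_deriv[OF g(1) that, of "[]" k]
    by auto
  thus "\<exists>h'. (\<exists>g. smooth_fn U g \<and> (\<forall>x\<in>U. g x = h' x)) \<and>
     (\<forall>x\<in>U. ((\<lambda>t. f (x + t *\<^sub>R axis k 1)) has_real_derivative h' x) (at 0))"
    using smooth_fn_partial[OF g(1)] by blast
qed (use assms in blast)

lemma smooth_fn_proj:
  fixes U :: "(real^'n::finite) set"
  assumes "open U"
  shows "smooth_fn U (\<lambda>x. x $ i)"
  using assms
proof (rule alg_imp_smooth_fn[where G = "{\<lambda>x. x $ i}"])
  fix g :: "real^'n \<Rightarrow> real" and k assume "g \<in> {\<lambda>x. x $ i}"
  hence "\<forall>x\<in>U. ((\<lambda>t. g (x + t *\<^sub>R axis k 1)) has_real_derivative axis k 1 $ i) (at 0)"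
    by (auto intro!: derivative_eq_intros)
  thus "\<exists>g'. alg {\<lambda>x. x $ i} g' \<and>
      (\<forall>x\<in>U. ((\<lambda>t. g (x + t *\<^sub>R axis k 1)) has_real_derivative g' x) (at 0))"
    by (intro exI[of _ "\<lambda>x. axis k 1 $ i"]) (auto intro: alg.intros)
qed (auto intro!: continuous_intros alg.intros)

text \<open>The classical passage from continuous partial derivatives to Frechet differentiability.
  The set \<open>S\<close> holds the coordinates in which the increment may be nonzero; the
  induction adds one coordinate at a time and pays for it with the mean value theorem along that
  axis.\<close>

lemma smooth_fn_has_derivative_aux:
  fixes h :: "real^'n::finite \<Rightarrow> real"
  assumes U: "open U" and h: "smooth_fn U h" and x: "x \<in> U" and "finite S"
  shows "\<forall>e>0. \<exists>d>0. \<forall>v. norm v < d \<and> (\<forall>i. i \<notin> S \<longrightarrow> v $ i = 0) \<longrightarrow>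
     \<bar>h (x + v) - h x - (\<Sum>k\<in>S. v $ k * partial k h x)\<bar> \<le> e * norm v"
  using \<open>finite S\<close>
proof (induction S rule: finite_induct)
  case empty
  have "v = 0" if "\<forall>i. v $ i = 0" for v :: "real^'n" using that by (simp add: vec_eq_iff)
  thus ?case by (intro allI impI exI[of _ 1]) (force intro: zero_less_one)
next
  case (insert k S)
  show ?case
  proof (intro allI impI)
    fix e :: real assume "e > 0"
    then obtain d1 where d1: "d1 > 0" "\<And>v. norm v < d1 \<Longrightarrow> (\<forall>i. i \<notin> S \<longrightarrow> v $ i = 0) \<Longrightarrow>
     \<bar>h (x + v) - h x - (\<Sum>k\<in>S. v $ k * partial k h x)\<bar> \<le> e / 2 * norm v"
      using insert.IH[rule_format, of "e/2"] by auto
    have "continuous_on U (partial k h)" using smooth_fn_partial[OF h] smooth_fn_continuous by blast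
    hence "isCont (partial k h) x" using U x continuous_on_eq_continuous_at by blast
    then obtain d2 where d2: "d2 > 0"
      "\<And>y. dist y x < d2 \<Longrightarrow> \<bar>partial k h y - partial k h x\<bar> < e / 2"
      using \<open>e > 0\<close> unfolding continuous_at_eps_delta by (metis dist_real_def half_gt_zero)
    obtain d3 where d3: "d3 > 0" "ball x d3 \<subseteq> U" using U x openE by blast
    define d where "d = Min {d1, d2, d3}"
    have "d > 0" "d \<le> d1" "d \<le> d2" "d \<le> d3" using d1 d2 d3 by (auto simp: d_def)
    show "\<exists>d>0. \<forall>v. norm v < d \<and> (\<forall>i. i \<notin> insert k S \<longrightarrow> v $ i = 0) \<longrightarrow>
       \<bar>h (x + v) - h x - (\<Sum>k\<in>insert k S. v $ k * partial k h x)\<bar> \<le> e * norm v"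
    proof (intro exI[of _ d] conjI allI impI \<open>d > 0\<close>)
      fix v :: "real^'n" assume v: "norm v < d \<and> (\<forall>i. i \<notin> insert k S \<longrightarrow> v $ i = 0)"
      \<comment> \<open>The increment without its \<open>k\<close>-th coordinate: the induction
        hypothesis covers the step from \<open>x\<close> to \<open>x + w\<close>, the mean value
        theorem the rest along axis \<open>k\<close>. Each is allowed half of
        \<open>e\<close>.\<close>
      define w where "w = v - (v $ k) *\<^sub>R axis k 1"
      have w: "w $ i = (if i = k then 0 else v $ i)" for i by (simp add: w_def axis_def)
      have nw: "norm (w + t *\<^sub>R axis k 1) \<le> norm v" if "\<bar>t\<bar> \<le> \<bar>v $ k\<bar>" for t
      proof (rule norm_le_componentwise_cart)
        show "norm ((w + t *\<^sub>R axis k 1) $ i) \<le> norm (v $ i)" for i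
          using that by (cases "i = k") (auto simp: w axis_def)
      qed
      have inU: "x + w + t *\<^sub>R axis k 1 \<in> U \<and> dist (x + w + t *\<^sub>R axis k 1) x < d2"
        if "\<bar>t\<bar> \<le> \<bar>v $ k\<bar>" for t
      proof -
        have "dist (x + w + t *\<^sub>R axis k 1) x = norm (w + t *\<^sub>R axis k 1)"
          by (simp add: dist_norm algebra_simps)
        hence "dist (x + w + t *\<^sub>R axis k 1) x < d" using nw[OF that] v by simp
        thus ?thesis using d3 \<open>d \<le> d2\<close> \<open>d \<le> d3\<close> by (auto simp: subset_iff dist_commute)
      qed
      have sv: "v = w + (v $ k) *\<^sub>R axis k 1" by (simp add: w_def)
      have part1: "\<bar>h (x + v) - h (x + w) - v $ k * partial k h x\<bar> \<le> e / 2 * norm v"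
      proof -
        have "\<exists>t. \<bar>t\<bar> \<le> \<bar>v $ k\<bar> \<and> h (x + w + (v $ k) *\<^sub>R axis k 1) - h (x + w) =
            v $ k * partial k h (x + w + t *\<^sub>R axis k 1)"
        proof (cases "v $ k = 0")
          case False
          have D: "((\<lambda>t. h (x + w + t *\<^sub>R axis k 1)) has_real_derivative
               partial k h (x + w + t *\<^sub>R axis k 1)) (at t)" if "\<bar>t\<bar> \<le> \<bar>v $ k\<bar>" for t
            using smooth_fn_line_deriv[OF h] inU[OF that] by blast
          show ?thesis
          proof (cases "v $ k > 0")
            case True
            from MVT2[OF True D] obtain z where "0 < z" "z < v $ k"
              "h (x + w + (v $ k) *\<^sub>R axis k 1) - h (x + w + 0 *\<^sub>R axis k 1) =
               (v $ k - 0) * partial k h (x + w + z *\<^sub>R axis k 1)" by auto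
            thus ?thesis by (intro exI[of _ z]) auto
          next
            case F: False
            hence "v $ k < 0" using False by simp
            from MVT2[OF this D] obtain z where "v $ k < z" "z < 0"
              "h (x + w + 0 *\<^sub>R axis k 1) - h (x + w + (v $ k) *\<^sub>R axis k 1) =
               (0 - v $ k) * partial k h (x + w + z *\<^sub>R axis k 1)" by auto
            thus ?thesis by (intro exI[of _ z]) auto
          qed
        qed (auto intro!: exI[of _ 0])
        then obtain t where t: "\<bar>t\<bar> \<le> \<bar>v $ k\<bar>" "h (x + w + (v $ k) *\<^sub>R axis k 1) - h (x + w) =
            v $ k * partial k h (x + w + t *\<^sub>R axis k 1)" by blast
        have "h (x + v) - h (x + w) = v $ k * partial k h (x + w + t *\<^sub>R axis k 1)"
          using t(2) sv by (metis add.assoc)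
        hence "\<bar>h (x + v) - h (x + w) - v $ k * partial k h x\<bar>
            = \<bar>v $ k\<bar> * \<bar>partial k h (x + w + t *\<^sub>R axis k 1) - partial k h x\<bar>"
          by (simp add: abs_mult[symmetric] algebra_simps)
        also have "\<dots> \<le> norm v * (e / 2)"
          using d2(2)[of "x + w + t *\<^sub>R axis k 1"] inU[OF t(1)]
          by (intro mult_mono) (auto simp: component_le_norm_cart)
        finally show ?thesis by (simp add: mult.commute)
      qed
      have nw0: "norm w \<le> norm v" using nw[of 0] by simp
      have part2: "\<bar>h (x + w) - h x - (\<Sum>k\<in>S. w $ k * partial k h x)\<bar> \<le> e / 2 * norm w"
        using nw0 v \<open>d \<le> d1\<close> by (intro d1) (auto simp: w)
      have "(\<Sum>k\<in>S. w $ k * partial k h x) = (\<Sum>k\<in>S. v $ k * partial k h x)"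
        using insert.hyps by (intro sum.cong) (auto simp: w)
      moreover have "e / 2 * norm w \<le> e / 2 * norm v" using nw0 \<open>e > 0\<close> by simp
      ultimately show "\<bar>h (x + v) - h x - (\<Sum>k\<in>insert k S. v $ k * partial k h x)\<bar> \<le> e * norm v"
        using part1 part2 insert.hyps
        by (simp only: sum.insert[OF insert.hyps])
    qed
  qed
qed

lemma smooth_fn_has_derivative:
  fixes h :: "real^'n::finite \<Rightarrow> real"
  assumes "open U" "smooth_fn U h" "x \<in> U"
  shows "(h has_derivative (\<lambda>v. \<Sum>k\<in>UNIV. v $ k * partial k h x)) (at x)"
  unfolding has_derivative_at_alt
proof (intro conjI allI impI)
  show "bounded_linear (\<lambda>v. \<Sum>k\<in>UNIV. v $ k * partial k h x)"
    by (intro bounded_linear_sum bounded_linear_mult_const bounded_linear_vec_nth)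
  fix e :: real assume "e > 0"
  from smooth_fn_has_derivative_aux[OF assms finite[of UNIV], rule_format, OF this]
  obtain d where d: "d > 0" "\<And>v. norm v < d \<Longrightarrow>
     \<bar>h (x + v) - h x - (\<Sum>k\<in>UNIV. v $ k * partial k h x)\<bar> \<le> e * norm v" by auto
  show "\<exists>d>0. \<forall>y. norm (y - x) < d \<longrightarrow>
     norm (h y - h x - (\<Sum>k\<in>UNIV. (y - x) $ k * partial k h x)) \<le> e * norm (y - x)"
    using d(1) d(2)[of "_ - x"] by (intro exI[of _ d]) auto
qed

lemma smooth_map_component: "smooth_map U f \<Longrightarrow> smooth_fn U (\<lambda>x. f x $ i)"
  by (simp add: smooth_map_def)

lemma smooth_map_has_derivative:
  fixes f :: "real^'n::finite \<Rightarrow> real^'m::finite"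
  assumes "open U" "smooth_map U f" "x \<in> U"
  shows "(f has_derivative (\<lambda>v. \<chi> i. \<Sum>k\<in>UNIV. v $ k * partial k (\<lambda>y. f y $ i) x)) (at x)"
proof -
  have "((\<lambda>x. \<chi> i. f x $ i) has_derivative
      (\<lambda>v. \<chi> i. \<Sum>k\<in>UNIV. v $ k * partial k (\<lambda>y. f y $ i) x)) (at x)"
  proof (rule has_derivative_componentwise_within[THEN iffD2], intro ballI)
    fix b :: "real^'m" assume "b \<in> Basis"
    then obtain j where b: "b = axis j 1" by (auto simp: Basis_vec_def)
    show "((\<lambda>x. (\<chi> i. f x $ i) \<bullet> b) has_derivative
       (\<lambda>v. (\<chi> i. \<Sum>k\<in>UNIV. v $ k * partial k (\<lambda>y. f y $ i) x) \<bullet> b)) (at x)"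
      using smooth_fn_has_derivative[OF assms(1) smooth_map_component[OF assms(2)] assms(3), of j]
      by (simp add: b inner_axis)
  qed
  thus ?thesis by simp
qed

lemma smooth_map_continuous:
  "open U \<Longrightarrow> smooth_map U f \<Longrightarrow> continuous_on U f"
  by (intro continuous_at_imp_continuous_on ballI has_derivative_continuous[OF smooth_map_has_derivative])

text \<open>Only the velocity of \<open>f\<close> along one axis at one point is assumed, not
  smoothness of \<open>f\<close>. This allows its use for an inverse map whose smoothness is still
  to be shown.\<close>

lemma compose_axis_deriv:
  fixes f :: "real^'n::finite \<Rightarrow> real^'m::finite"
  assumes "open U" "open V" "smooth_fn V h" "x \<in> U" "f x \<in> V" 
    and f: "\<And>i. ((\<lambda>t. f (x + t *\<^sub>R axis k 1) $ i) has_real_derivative f' i) (at 0)"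
  shows "((\<lambda>t. h (f (x + t *\<^sub>R axis k 1))) has_real_derivative
     (\<Sum>j\<in>UNIV. partial j h (f x) * f' j)) (at 0)"
proof -
  have c: "((\<lambda>t. \<chi> i. f (x + t *\<^sub>R axis k 1) $ i) has_derivative (\<lambda>t. \<chi> i. t * f' i)) (at 0)"
  proof (rule has_derivative_componentwise_within[THEN iffD2], intro ballI)
    fix b :: "real^'m" assume "b \<in> Basis"
    then obtain j where b: "b = axis j 1" by (auto simp: Basis_vec_def)
    show "((\<lambda>t. (\<chi> i. f (x + t *\<^sub>R axis k 1) $ i) \<bullet> b) has_derivative
       (\<lambda>t. (\<chi> i. t * f' i) \<bullet> b)) (at 0)"
      using f[of j] by (simp add: b inner_axis has_field_derivative_def mult_commute_abs)
  qed
  have "(h has_derivative (\<lambda>v. \<Sum>k\<in>UNIV. v $ k * partial k h (f x))) (at (f (x + 0 *\<^sub>R axis k 1)))"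
    using smooth_fn_has_derivative[OF assms(2,3,5)] by simp
  hence "(h has_derivative (\<lambda>v. \<Sum>k\<in>UNIV. v $ k * partial k h (f x)))
      (at (\<chi> i. f (x + 0 *\<^sub>R axis k 1) $ i))" by simp
  from has_derivative_compose[OF c this]
  have "((\<lambda>t. h (f (x + t *\<^sub>R axis k 1))) has_derivative
     (\<lambda>t. \<Sum>j\<in>UNIV. t * f' j * partial j h (f x))) (at 0)"
    by simp
  thus ?thesis
    unfolding has_field_derivative_def
    by (rule has_derivative_eq_rhs) (auto simp: sum_distrib_left sum_distrib_right mult_ac fun_eq_iff)
qed

lemma smooth_fn_compose:
  fixes f :: "real^'n::finite \<Rightarrow> real^'m::finite"
  assumes U: "open U" and V: "open V" and h: "smooth_fn V h" and f: "smooth_map U f"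
    and fU: "\<And>x. x \<in> U \<Longrightarrow> f x \<in> V"
  shows "smooth_fn U (\<lambda>x. h (f x))"
proof (rule alg_imp_smooth_fn[OF U, where G = "{g. smooth_fn U g} \<union> {\<lambda>x. h (f x) |h. smooth_fn V h}"])
  \<comment> \<open>The chain rule expresses the derivative of a pullback by pullbacks and smooth
    functions of \<open>U\<close>, so these together generate an algebra closed under
    derivation.\<close>
  let ?G = "{g. smooth_fn U g} \<union> {\<lambda>x. h (f x) |h. smooth_fn V h}"
  fix g and k :: 'n assume "g \<in> ?G"
  then consider "smooth_fn U g" | h where "smooth_fn V h" "g = (\<lambda>x. h (f x))" by blast
  thus "\<exists>g'. alg ?G g' \<and>
      (\<forall>x\<in>U. ((\<lambda>t. g (x + t *\<^sub>R axis k 1)) has_real_derivative g' x) (at 0))"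
  proof cases
    case 1
    thus ?thesis using smooth_fn_axis_deriv[of U g _ "[]" k]
      by (intro exI[of _ "partial k g"]) (auto intro!: alg_gen smooth_fn_partial)
  next
    case 2
    have "((\<lambda>t. g (x + t *\<^sub>R axis k 1)) has_real_derivative
        (\<Sum>j::'m\<in>UNIV. partial j h (f x) * partial k (\<lambda>x. f x $ j) x)) (at 0)" if "x \<in> U" for x
      unfolding 2(2)
      using smooth_fn_axis_deriv[OF smooth_map_component[OF f] that, where ks = "[]" and k = k]
      by (intro compose_axis_deriv[where f = f and x = x, OF U V 2(1) that fU[OF that]]) auto
    moreover have "alg ?G (\<lambda>x. \<Sum>j\<in>UNIV. partial j h (f x) * partial k (\<lambda>x. f x $ j) x)"
      using smooth_fn_partial[OF 2(1)] smooth_fn_partial[OF smooth_map_component[OF f]]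
      by (intro alg_sum alg_mult alg_gen) auto
    ultimately show ?thesis by blast
  qed
next
  show "continuous_on U g"
    if "g \<in> {g. smooth_fn U g} \<union> {\<lambda>x. h (f x) |h. smooth_fn V h}" for g
    using that
  proof
    assume "g \<in> {\<lambda>x. h (f x) |h. smooth_fn V h}"
    then obtain h where "smooth_fn V h" "g = (\<lambda>x. h (f x))" by blast
    thus ?thesis using smooth_map_continuous[OF U f] smooth_fn_continuous fU
      by (auto intro!: continuous_on_compose2[of V h U f])
  qed (use smooth_fn_continuous in blast)
qed (use h in \<open>auto intro!: alg_gen\<close>)

lemma partial_compose:
  fixes f :: "real^'n::finite \<Rightarrow> real^'m::finite"
  assumes "open U" "open V" "smooth_fn V h" "smooth_map U f" "x \<in> U" "f x \<in> V"
  shows "partial k (\<lambda>x. h (f x)) x = (\<Sum>j\<in>UNIV. partial j h (f x) * partial k (\<lambda>x. f x $ j) x)"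
  using smooth_fn_axis_deriv[OF smooth_map_component[OF assms(4)] assms(5), where ks = "[]" and k = k]
  by (intro partial_eqI compose_axis_deriv[where f = f and x = x, OF assms(1-3,5,6)]) auto

lemma smooth_map_compose:
  fixes f :: "real^'n::finite \<Rightarrow> real^'m::finite" and g :: "real^'m \<Rightarrow> real^'l::finite"
  assumes "open U" "open V" "smooth_map V g" "smooth_map U f" "\<And>x. x \<in> U \<Longrightarrow> f x \<in> V"
  shows "smooth_map U (\<lambda>x. g (f x))"
  using assms smooth_fn_compose[OF assms(1,2) _ assms(4,5)] by (auto simp: smooth_map_def)

text \<open>The derivative of 1/h is a polynomial in 1/h and smooth functions, so adjoining 1/h to
  the smooth functions gives generators closed under derivation.\<close>

lemma smooth_fn_inverse:
  fixes h :: "real^'n::finite \<Rightarrow> real"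
  assumes U: "open U" and h: "smooth_fn U h" and nz: "\<And>x. x \<in> U \<Longrightarrow> h x \<noteq> 0"
  shows "smooth_fn U (\<lambda>x. inverse (h x))"
proof (rule alg_imp_smooth_fn[OF U, where G = "insert (\<lambda>x. inverse (h x)) {g. smooth_fn U g}"])
  let ?G = "insert (\<lambda>x. inverse (h x)) {g. smooth_fn U g}"
  fix g and k :: 'n assume "g \<in> ?G"
  then consider "smooth_fn U g" | "g = (\<lambda>x. inverse (h x))" by blast
  thus "\<exists>g'. alg ?G g' \<and>
      (\<forall>x\<in>U. ((\<lambda>t. g (x + t *\<^sub>R axis k 1)) has_real_derivative g' x) (at 0))"
  proof cases
    case 1
    thus ?thesis using smooth_fn_axis_deriv[of U g _ "[]" k]
      by (intro exI[of _ "partial k g"]) (auto intro!: alg_gen smooth_fn_partial)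
  next
    case 2
    have "((\<lambda>t. g (x + t *\<^sub>R axis k 1)) has_real_derivative
        - (inverse (h x) * partial k h x * inverse (h x))) (at 0)" if "x \<in> U" for x
      using smooth_fn_axis_deriv[OF h that, of "[]" k] nz[OF that]
      unfolding 2 by (auto intro!: derivative_eq_intros)
    moreover have "alg ?G (\<lambda>x. - (inverse (h x) * partial k h x * inverse (h x)))"
      using smooth_fn_partial[OF h] by (intro alg_mult alg_gen alg_minus) auto
    ultimately show ?thesis by blast
  qed
next
  show "continuous_on U g" if "g \<in> insert (\<lambda>x. inverse (h x)) {g. smooth_fn U g}" for g
    using that smooth_fn_continuous[of U] h nz by (auto intro: continuous_on_inverse)
qed (auto intro: alg_gen)

lemma smooth_fn_divide:
  assumes "open U" "smooth_fn U g" "smooth_fn U h" "\<And>x. x \<in> U \<Longrightarrow> h x \<noteq> 0"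
  shows "smooth_fn U (\<lambda>x. g x / h x)"
  unfolding divide_inverse using assms by (intro smooth_fn_mult smooth_fn_inverse)

text \<open>Both mixed derivatives arise from the same second difference over a small square: two
  uses of the mean value theorem, in either order, produce them at two points of the ball, and
  continuity then identifies them at \<open>x\<close>.\<close>

lemma smooth_fn_partial_commute:
  fixes h :: "real^'n::finite \<Rightarrow> real"
  assumes U: "open U" and h: "smooth_fn U h" and x: "x \<in> U"
  shows "partial k (partial l h) x = partial l (partial k h) x"
proof -
  have key: "\<exists>y z. y \<in> ball x e \<and> z \<in> ball x e \<and>
      partial k (partial l h) y = partial l (partial k h) z"
    if e: "e > 0" "ball x e \<subseteq> U" for e
  proof -
    define s where "s = e / 4"
    have s: "s > 0" using e by (simp add: s_def)
    have inb: "x + a *\<^sub>R axis k 1 + b *\<^sub>R axis l 1 \<in> ball x e"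
      if "0 \<le> a" "a \<le> s" "0 \<le> b" "b \<le> s" for a b
    proof -
      have "dist x (x + a *\<^sub>R axis k 1 + b *\<^sub>R axis l 1) = norm (a *\<^sub>R axis k 1 + b *\<^sub>R axis l (1::real))"
        by (simp add: dist_norm algebra_simps norm_minus_commute)
      also have "\<dots> \<le> norm (a *\<^sub>R axis k (1::real)) + norm (b *\<^sub>R axis l (1::real))"
        by (rule norm_triangle_ineq)
      also have "\<dots> \<le> 2 * s" using that by simp
      finally show ?thesis using e by (simp add: s_def)
    qed
    have main: "\<exists>a b. 0 \<le> a \<and> a \<le> s \<and> 0 \<le> b \<and> b \<le> s \<and>
       h (x + s *\<^sub>R axis k 1 + s *\<^sub>R axis l 1) - h (x + s *\<^sub>R axis k 1) - h (x + s *\<^sub>R axis l 1) + h x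
       = s * s * partial l (partial k h) (x + a *\<^sub>R axis k 1 + b *\<^sub>R axis l 1)"
      if inb: "\<And>a b. 0 \<le> a \<Longrightarrow> a \<le> s \<Longrightarrow> 0 \<le> b \<Longrightarrow> b \<le> s \<Longrightarrow>
         x + a *\<^sub>R axis k 1 + b *\<^sub>R axis l 1 \<in> U" for k l
    proof -
      define \<phi> where "\<phi> t = h (x + s *\<^sub>R axis l 1 + t *\<^sub>R axis k 1) - h (x + t *\<^sub>R axis k 1)" for t
      have D: "(\<phi> has_real_derivative (partial k h (x + s *\<^sub>R axis l 1 + t *\<^sub>R axis k 1) -
          partial k h (x + t *\<^sub>R axis k 1))) (at t)" if "0 \<le> t" "t \<le> s" for t
        unfolding \<phi>_def
        using inb[of t s] inb[of t 0] that s
        by (intro DERIV_diff smooth_fn_line_deriv[OF h]) (auto simp: add_ac)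
      from MVT2[OF s D] obtain a where a: "0 < a" "a < s" "\<phi> s - \<phi> 0 = (s - 0) *
         (partial k h (x + s *\<^sub>R axis l 1 + a *\<^sub>R axis k 1) - partial k h (x + a *\<^sub>R axis k 1))" by auto
      have D2: "((\<lambda>t. partial k h (x + a *\<^sub>R axis k 1 + t *\<^sub>R axis l 1)) has_real_derivative
          partial l (partial k h) (x + a *\<^sub>R axis k 1 + t *\<^sub>R axis l 1)) (at t)"
        if "0 \<le> t" "t \<le> s" for t
        using inb[of a t] that a
        by (intro smooth_fn_line_deriv[OF smooth_fn_partial[OF h]]) auto
      from MVT2[OF s D2] obtain b where b: "0 < b" "b < s"
        "partial k h (x + a *\<^sub>R axis k 1 + s *\<^sub>R axis l 1) - partial k h (x + a *\<^sub>R axis k 1 + 0 *\<^sub>R axis l 1) =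
         (s - 0) * partial l (partial k h) (x + a *\<^sub>R axis k 1 + b *\<^sub>R axis l 1)" by auto
      have "\<phi> s - \<phi> 0 = s * (s * partial l (partial k h) (x + a *\<^sub>R axis k 1 + b *\<^sub>R axis l 1))"
        using a(3) b(3) by (simp add: add_ac)
      moreover have "\<phi> s - \<phi> 0 = h (x + s *\<^sub>R axis k 1 + s *\<^sub>R axis l 1) -
          h (x + s *\<^sub>R axis k 1) - h (x + s *\<^sub>R axis l 1) + h x"
        by (simp add: \<phi>_def add_ac)
      ultimately have "h (x + s *\<^sub>R axis k 1 + s *\<^sub>R axis l 1) -
          h (x + s *\<^sub>R axis k 1) - h (x + s *\<^sub>R axis l 1) + h x =
          s * s * partial l (partial k h) (x + a *\<^sub>R axis k 1 + b *\<^sub>R axis l 1)" by simp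
      thus ?thesis using a(1,2) b(1,2) by (meson less_imp_le)
    qed
    from main[of k l] inb e obtain a b where ab: "0 \<le> a" "a \<le> s" "0 \<le> b" "b \<le> s"
       "h (x + s *\<^sub>R axis k 1 + s *\<^sub>R axis l 1) - h (x + s *\<^sub>R axis k 1) - h (x + s *\<^sub>R axis l 1) + h x
       = s * s * partial l (partial k h) (x + a *\<^sub>R axis k 1 + b *\<^sub>R axis l 1)" by blast
    have inb': "x + a *\<^sub>R axis l 1 + b *\<^sub>R axis k 1 \<in> ball x e"
      if "0 \<le> a" "a \<le> s" "0 \<le> b" "b \<le> s" for a b
      using inb[of b a] that by (simp add: add_ac)
    from main[of l k] inb' e obtain c d where cd: "0 \<le> c" "c \<le> s" "0 \<le> d" "d \<le> s"
       "h (x + s *\<^sub>R axis l 1 + s *\<^sub>R axis k 1) - h (x + s *\<^sub>R axis l 1) - h (x + s *\<^sub>R axis k 1) + h x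
       = s * s * partial k (partial l h) (x + c *\<^sub>R axis l 1 + d *\<^sub>R axis k 1)" by blast
    have eq: "x + s *\<^sub>R axis l 1 + s *\<^sub>R axis k 1 = x + s *\<^sub>R axis k 1 + s *\<^sub>R axis l 1" by simp
    have "s * s * partial k (partial l h) (x + c *\<^sub>R axis l 1 + d *\<^sub>R axis k 1) =
      s * s * partial l (partial k h) (x + a *\<^sub>R axis k 1 + b *\<^sub>R axis l 1)"
      using ab(5) cd(5)[unfolded eq] by linarith
    with s have "partial k (partial l h) (x + c *\<^sub>R axis l 1 + d *\<^sub>R axis k 1) =
      partial l (partial k h) (x + a *\<^sub>R axis k 1 + b *\<^sub>R axis l 1)" by simp
    thus ?thesis using inb[OF ab(1-4)] inb'[OF cd(1-4)] by blast
  qed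
  have c1: "isCont (partial k (partial l h)) x" and c2: "isCont (partial l (partial k h)) x"
    using smooth_fn_continuous[OF smooth_fn_partial[OF smooth_fn_partial[OF h]]] U x
      continuous_on_eq_continuous_at by blast+
  show ?thesis
  proof (rule ccontr)
    assume "partial k (partial l h) x \<noteq> partial l (partial k h) x"
    define r where "r = \<bar>partial k (partial l h) x - partial l (partial k h) x\<bar> / 2"
    have "r > 0" using \<open>_ \<noteq> _\<close> by (simp add: r_def)
    from c1 this obtain d1 where d1: "d1 > 0"
      "\<And>y. dist y x < d1 \<Longrightarrow> \<bar>partial k (partial l h) y - partial k (partial l h) x\<bar> < r"
      unfolding continuous_at_eps_delta dist_real_def by blast
    from c2 \<open>r > 0\<close> obtain d2 where d2: "d2 > 0"
      "\<And>y. dist y x < d2 \<Longrightarrow> \<bar>partial l (partial k h) y - partial l (partial k h) x\<bar> < r"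
      unfolding continuous_at_eps_delta dist_real_def by blast
    obtain d3 where d3: "d3 > 0" "ball x d3 \<subseteq> U" using U x openE by blast
    define d where "d = Min {d1, d2, d3}"
    have d: "d > 0" "d \<le> d1" "d \<le> d2" "d \<le> d3" using d1 d2 d3 by (auto simp: d_def)
    have "ball x d \<subseteq> U" using d3(2) d(4) by auto
    from key[OF d(1) this] obtain y z where yz: "y \<in> ball x d" "z \<in> ball x d"
      "partial k (partial l h) y = partial l (partial k h) z" by blast
    have "\<bar>partial k (partial l h) y - partial k (partial l h) x\<bar> < r"
      "\<bar>partial l (partial k h) z - partial l (partial k h) x\<bar> < r"
      using yz d d1(2)[of y] d2(2)[of z] by (auto simp: dist_commute)
    thus False using yz(3) unfolding r_def by (simp add: abs_if split: if_splits)
  qed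
qed

section \<open>Smooth maps, planar Jacobians and local diffeomorphisms\<close>

lemma smooth_map_subset: "smooth_map U f \<Longrightarrow> V \<subseteq> U \<Longrightarrow> smooth_map V f"
  by (auto simp: smooth_map_def intro: smooth_fn_subset)

lemma smooth_map_vec2:
  "smooth_fn U f \<Longrightarrow> smooth_fn U g \<Longrightarrow> smooth_map U (\<lambda>x. vector [f x, g x] :: real^2)"
  by (simp add: smooth_map_def forall_2)

lemma smooth_map_vec3:
  "smooth_fn U f \<Longrightarrow> smooth_fn U g \<Longrightarrow> smooth_fn U h \<Longrightarrow>
     smooth_map U (\<lambda>x. vector [f x, g x, h x] :: real^3)"
  by (simp add: smooth_map_def forall_3)

lemma open_smooth_vimage:
  assumes "open U" "open V" "smooth_map U f"
  shows "open {x \<in> U. f x \<in> V}"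
  using continuous_open_preimage[OF smooth_map_continuous[OF assms(1,3)] assms(1,2)]
  by (simp add: vimage_def Int_def)

lemma smooth_fn_jac_det2:
  assumes "open U" "smooth_map U f"
  shows "smooth_fn U (jac_det2 f)"
  unfolding jac_det2_def
  using assms by (intro smooth_fn_diff smooth_fn_mult smooth_fn_partial smooth_map_component)

lemma partial_compose2:
  fixes f :: "real^'n::finite \<Rightarrow> real^2"
  assumes "open U" "open V" "smooth_fn V h" "smooth_map U f" "x \<in> U" "f x \<in> V"
  shows "partial k (\<lambda>x. h (f x)) x =
    partial 1 h (f x) * partial k (\<lambda>x. f x $ 1) x + partial 2 h (f x) * partial k (\<lambda>x. f x $ 2) x"
  using partial_compose[OF assms] by (simp add: sum_2)

lemma jac_det2_compose:
  assumes "open U" "open V" "smooth_map V g" "smooth_map U f" "x \<in> U" "f x \<in> V"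
  shows "jac_det2 (\<lambda>x. g (f x)) x = jac_det2 g (f x) * jac_det2 f x"
  unfolding jac_det2_def
  by (subst (1 2 3 4) partial_compose2[OF assms(1,2) smooth_map_component[OF assms(3)] assms(4-6)])
     (simp add: algebra_simps)

lemma partial_cong:
  fixes g h :: "real^'n::finite \<Rightarrow> real"
  assumes "\<forall>\<^sub>F y in nhds x. g y = h y"
  shows "partial k g x = partial k h x"
proof -
  obtain U where U: "open U" "x \<in> U" "\<And>y. y \<in> U \<Longrightarrow> g y = h y"
    using assms by (auto simp: eventually_nhds)
  show ?thesis
    unfolding partial_def deriv_def
    using axis_deriv_cong[where g = g and h = h and U = U and x = x and k = k] U by simp
qed

lemma jac_det2_cong:
  assumes "\<forall>\<^sub>F y in nhds x. f y = g y"
  shows "jac_det2 f x = jac_det2 g x"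
  unfolding jac_det2_def
  by (intro arg_cong2[of _ _ _ _ "(-)"] arg_cong2[of _ _ _ _ "(*)"] partial_cong)
     (use assms in \<open>eventually_elim, simp\<close>)+

lemma partial_proj: "partial k (\<lambda>x. x $ i) x = (axis k 1 :: real^'n::finite) $ i"
  by (rule partial_eqI) (auto intro!: derivative_eq_intros)

lemma jac_det2_id: "jac_det2 (\<lambda>x. x) x = 1"
  by (simp add: jac_det2_def partial_proj axis_def)

lemma local_diffeoE:
  fixes \<phi> :: "real^2 \<Rightarrow> real^2"
  assumes "local_diffeo \<phi> p"
  obtains U V \<psi> where "open U" "p \<in> U" "open V" "\<phi> ` U = V" "\<psi> ` V = U"
    "smooth_map U \<phi>" "smooth_map V \<psi>" "\<And>x. x \<in> U \<Longrightarrow> \<psi> (\<phi> x) = x"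
    "\<And>y. y \<in> V \<Longrightarrow> \<phi> (\<psi> y) = y" "\<And>x. x \<in> U \<Longrightarrow> jac_det2 \<psi> (\<phi> x) * jac_det2 \<phi> x = 1"
proof -
  obtain U V \<psi> where *: "open U" "p \<in> U" "open V" "\<phi> ` U = V"
    "smooth_map U \<phi>" "smooth_map V \<psi>" "\<forall>x\<in>U. \<psi> (\<phi> x) = x" "\<forall>y\<in>V. \<phi> (\<psi> y) = y"
    using assms unfolding local_diffeo_def by blast
  have "jac_det2 \<psi> (\<phi> x) * jac_det2 \<phi> x = 1" if "x \<in> U" for x
  proof -
    have "jac_det2 (\<lambda>x. \<psi> (\<phi> x)) x = jac_det2 (\<lambda>x. x) x"
      by (rule jac_det2_cong) (use * that in \<open>auto simp: eventually_nhds\<close>)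
    thus ?thesis
      using jac_det2_compose[OF *(1,3,6,5) that] that * by (auto simp: jac_det2_id)
  qed
  moreover have "\<psi> ` V = U" using * by force
  ultimately show ?thesis using that[of U V \<psi>] * by auto
qed

lemma local_diffeo_inverse:
  assumes "open U" "p \<in> U" "open V" "\<phi> ` U = V" "smooth_map U \<phi>" "smooth_map V \<psi>"
    "\<And>x. x \<in> U \<Longrightarrow> \<psi> (\<phi> x) = x" 
  shows "local_diffeo \<psi> (\<phi> p)"
proof -
  have "\<psi> ` V = U" using assms(4,7) by (force simp: image_image)
  moreover have "\<forall>y\<in>V. \<phi> (\<psi> y) = y" using assms(4,7) by force
  ultimately show ?thesis
    unfolding local_diffeo_def using assms by blast
qed

lemma local_diffeo_compose:
  assumes "local_diffeo f p" "local_diffeo g (f p)"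
  shows "local_diffeo (\<lambda>x. g (f x)) p"
proof -
  obtain U V f' where f: "open U" "p \<in> U" "open V" "f ` U = V"
    "smooth_map U f" "smooth_map V f'" "\<forall>x\<in>U. f' (f x) = x" "\<forall>y\<in>V. f (f' y) = y"
    using assms(1) unfolding local_diffeo_def by blast
  obtain U2 W g' where g: "open U2" "f p \<in> U2" "open W" "g ` U2 = W"
    "smooth_map U2 g" "smooth_map W g'" "\<forall>x\<in>U2. g' (g x) = x" "\<forall>y\<in>W. g (g' y) = y"
    using assms(2) unfolding local_diffeo_def by blast
  define A where "A = {x \<in> U. f x \<in> U2}"
  define B where "B = {y \<in> W. g' y \<in> V}"
  have AB: "open A" "open B"
    unfolding A_def B_def using f g by (auto intro: open_smooth_vimage)
  have img: "(\<lambda>x. g (f x)) ` A = B"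
  proof (intro equalityI subsetI)
    fix y assume "y \<in> B"
    hence y: "y \<in> W" "g' y \<in> V" by (auto simp: B_def)
    have "g' y \<in> U2" using y(1) g(4,7) by force
    hence "f' (g' y) \<in> A" using y f(4,7,8) by (force simp: A_def)
    moreover have "y = g (f (f' (g' y)))" using y f(8) g(8) by simp
    ultimately show "y \<in> (\<lambda>x. g (f x)) ` A" by blast
  qed (use f g in \<open>auto simp: A_def B_def\<close>)
  show ?thesis
    unfolding local_diffeo_def
  proof (rule exI[of _ A], rule exI[of _ B], rule exI[of _ "\<lambda>y. f' (g' y)"], intro conjI AB img ballI)
    show "smooth_map A (\<lambda>x. g (f x))"
      by (rule smooth_map_compose[OF AB(1) g(1,5) smooth_map_subset[OF f(5)]]) (auto simp: A_def)
    show "smooth_map B (\<lambda>x. f' (g' x))"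
      by (rule smooth_map_compose[OF AB(2) f(3,6) smooth_map_subset[OF g(6)]]) (auto simp: B_def)
  qed (use f g in \<open>auto simp: A_def B_def\<close>)
qed

lemma local_diffeo_imp_smooth_germ: "local_diffeo f p \<Longrightarrow> smooth_germ_map p f"
  unfolding local_diffeo_def smooth_germ_map_def by blast

lemma local_diffeo_jac_nonzero: 
  fixes f :: "real^2 \<Rightarrow> real^2"
  shows "local_diffeo f p \<Longrightarrow> jac_det2 f p \<noteq> 0"
  by (metis local_diffeoE mult_zero_right zero_neq_one)

text \<open>The inverse function theorem yields an inverse \<open>g\<close> that is differentiable
  with derivative the inverse matrix. The entries of that matrix are smooth functions evaluated at
  \<open>g\<close>, so the functions of the form \<open>h (g y)\<close> with smooth \<open>h\<close>
  are closed under derivation, and coinduction upgrades \<open>g\<close> to a smooth map.\<close>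

theorem local_diffeoI_jac:
  fixes f :: "real^2 \<Rightarrow> real^2"
  assumes U: "open U" and f: "smooth_map U f" and x0: "x0 \<in> U" and J: "jac_det2 f x0 \<noteq> 0"
  shows "local_diffeo f x0"
proof -
  define U0 where "U0 = {x \<in> U. jac_det2 f x \<in> - {0}}"
  have U0: "open U0"
    using continuous_open_preimage[OF smooth_fn_continuous[OF smooth_fn_jac_det2[OF U f]] U, of "- {0}"]
    by (simp add: U0_def vimage_def Int_def open_Compl)
  have f0: "smooth_map U0 f" by (rule smooth_map_subset[OF f]) (auto simp: U0_def)
  define J where "J = jac_det2 f"
  have J0: "J x \<noteq> 0" if "x \<in> U0" for x using that by (auto simp: U0_def J_def)
  have x00: "x0 \<in> U0" using x0 assms(4) by (simp add: U0_def)
  define P where "P k i x = partial k (\<lambda>y. f y $ i) x" for k i :: "2" and x :: "real^2"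
  define L where "L x v = (\<chi> i. \<Sum>k\<in>UNIV. v $ k * P k i x)" for x v
  \<comment> \<open>Entries of the inverse Jacobian matrix by Cramer's rule. \<open>D k i\<close> is
    the slope of component \<open>i\<close> of the inverse map in direction
    \<open>k\<close>.\<close>
  define D where "D k i x = (if k = 1 then (if i = 1 then P 2 2 x else - P 1 2 x)
     else (if i = 1 then - P 2 1 x else P 1 1 x)) / J x" for k i :: "2" and x :: "real^2"
  define Mi where "Mi x w = (\<chi> i. \<Sum>k\<in>UNIV. w $ k * D k i x)" for x w
  have two: "(2::2) \<noteq> 1" "(1::2) \<noteq> 2" by auto
  have JP: "J x = P 1 1 x * P 2 2 x - P 2 1 x * P 1 2 x" for x
    by (simp add: J_def jac_det2_def P_def)
  have MiL: "Mi x (L x v) = v" if "x \<in> U0" for x v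
    using J0[OF that] 
    by (simp add: vec_eq_iff forall_2 Mi_def L_def sum_2 D_def two field_simps) (simp add: JP algebra_simps)
  have LMi: "L x (Mi x v) = v" if "x \<in> U0" for x v
    using J0[OF that] 
    by (simp add: vec_eq_iff forall_2 Mi_def L_def sum_2 D_def two field_simps) (simp add: JP algebra_simps)
  have blL: "bounded_linear (L x)" for x
    unfolding L_def by (rule linear_conv_bounded_linear[THEN iffD1], rule linearI)
      (auto simp: vec_eq_iff sum.distrib algebra_simps sum_distrib_left)
  have blM: "bounded_linear (Mi x)" for x
    unfolding Mi_def by (rule linear_conv_bounded_linear[THEN iffD1], rule linearI)
      (auto simp: vec_eq_iff sum.distrib algebra_simps sum_distrib_left)
  have smP: "smooth_fn U0 (P k i)" for k i
    unfolding P_def using smooth_fn_partial[OF smooth_map_component[OF f0]] by simp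
  have smJ: "smooth_fn U0 J" unfolding J_def by (rule smooth_fn_jac_det2[OF U0 f0])
  have smD: "smooth_fn U0 (D k i)" for k i
    unfolding D_def by (cases "k = 1"; cases "i = 1")
      (auto intro!: smooth_fn_divide[OF U0 _ smJ J0] smP smooth_fn_minus[OF U0])
  define f' where "f' x = Blinfun (L x)" for x
  have f': "blinfun_apply (f' x) = L x" for x
    unfolding f'_def using blL by (simp add: bounded_linear_Blinfun_apply)
  have cont: "continuous_on U0 f'"
  proof (rule continuous_on_blinfun_componentwise)
    fix i :: "real^2"
    show "continuous_on U0 (\<lambda>x. blinfun_apply (f' x) i)"
      unfolding f' L_def by (intro continuous_intros smooth_fn_continuous[OF smP])
  qed
  have der: "(f has_derivative blinfun_apply (f' x)) (at x)" if "x \<in> U0" for x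
    using smooth_map_has_derivative[OF U0 f0 that] by (simp add: f' L_def[abs_def] P_def)
  have inv0: "Blinfun (Mi x0) o\<^sub>L f' x0 = id_blinfun"
    by (rule blinfun_eqI) (simp add: bounded_linear_Blinfun_apply[OF blM] f' MiL[OF x00])
  obtain U' V g g' where g: "open U'" "U' \<subseteq> U0" "x0 \<in> U'" "open V" "f x0 \<in> V"
    "homeomorphism U' V f g" "\<And>y. y \<in> V \<Longrightarrow> (g has_derivative (g' y)) (at y)"
    "\<And>y. y \<in> V \<Longrightarrow> g' y = inv (blinfun_apply (f'(g y)))"
    "\<And>y. y \<in> V \<Longrightarrow> bij (blinfun_apply (f'(g y)))"
  proof (rule inverse_function_theorem[OF U0 der cont x00 inv0], goal_cases)
    case (2 U' V g g')
    show ?case by (rule 2(1)[OF 2(2-)])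
  qed
  have gV: "g y \<in> U'" if "y \<in> V" for y using g(6) that by (auto simp: homeomorphism_def)
  have g': "g' y = Mi (g y)" if "y \<in> V" for y
    unfolding g(8)[OF that] f' using gV[OF that] g(2) LMi MiL by (intro inv_equality) auto
  have Dg: "((\<lambda>t. g (y + t *\<^sub>R axis k 1) $ i) has_real_derivative D k i (g y)) (at 0)"
    if "y \<in> V" for y k i
  proof -
    have "((\<lambda>t. y + t *\<^sub>R axis k 1) has_derivative (\<lambda>t. t *\<^sub>R axis k 1)) (at 0)"
      by (auto intro!: derivative_eq_intros)
    moreover have "(g has_derivative Mi (g y)) (at (y + 0 *\<^sub>R axis k 1))"
      using g(7)[OF that] g'[OF that] by simp
    ultimately have "((\<lambda>t. g (y + t *\<^sub>R axis k 1)) has_derivative (\<lambda>t. Mi (g y) (t *\<^sub>R axis k 1))) (at 0)"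
      by (rule has_derivative_compose)
    hence "((\<lambda>t. g (y + t *\<^sub>R axis k 1) $ i) has_derivative (\<lambda>t. Mi (g y) (t *\<^sub>R axis k 1) $ i)) (at 0)"
      by (rule bounded_linear.has_derivative[OF bounded_linear_vec_nth])
    moreover have "Mi (g y) (t *\<^sub>R axis k 1) $ i = D k i (g y) * t" for t
      using exhaust_2[of k] by (auto simp: Mi_def sum_2 axis_def two)
    ultimately show ?thesis by (simp add: has_field_derivative_def)
  qed
  have smg: "smooth_fn V (\<lambda>y. h (g y))" if h: "smooth_fn U' h" for h
  proof (rule smooth_fn_coinduct[OF g(4), where P = "\<lambda>F. \<exists>h. smooth_fn U' h \<and> F = (\<lambda>y. h (g y))"])
    fix F and k :: "2" assume "\<exists>h. smooth_fn U' h \<and> F = (\<lambda>y. h (g y))"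
    then obtain h where h: "smooth_fn U' h" "F = (\<lambda>y. h (g y))" by blast
    define h' where "h' x = (\<Sum>j\<in>UNIV. partial j h x * D k j x)" for x
    have "smooth_fn U' h'"
      unfolding h'_def sum_2
      by (intro smooth_fn_add smooth_fn_mult g(1) smooth_fn_partial[OF h(1)]
          smooth_fn_subset[OF smD g(2)])
    moreover have "((\<lambda>t. F (y + t *\<^sub>R axis k 1)) has_real_derivative h' (g y)) (at 0)"
      if "y \<in> V" for y
      unfolding h(2) h'_def
      by (rule compose_axis_deriv[where f = g and x = y, OF g(4,1) h(1) that gV[OF that] Dg[OF that]])
    ultimately show "\<exists>h'. (\<exists>h. smooth_fn U' h \<and> h' = (\<lambda>y. h (g y))) \<and>
        (\<forall>x\<in>V. ((\<lambda>t. F (x + t *\<^sub>R axis k 1)) has_real_derivative h' x) (at 0))"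
      by (intro exI[of _ "\<lambda>y. h' (g y)"]) auto
  next
    fix F assume "\<exists>h. smooth_fn U' h \<and> F = (\<lambda>y. h (g y))"
    moreover have "continuous_on V g" using g(6) by (simp add: homeomorphism_def)
    ultimately show "continuous_on V F"
      using gV by (auto intro!: continuous_on_compose2[OF smooth_fn_continuous])
  qed (use h in blast)
  show ?thesis
    unfolding local_diffeo_def
  proof (rule exI[of _ U'], rule exI[of _ V], rule exI[of _ g], intro conjI)
    show "smooth_map U' f" by (rule smooth_map_subset[OF f0 g(2)])
    show "smooth_map V g" unfolding smooth_map_def using smg[OF smooth_fn_proj[OF g(1)]] by blast
  qed (use g in \<open>auto simp: homeomorphism_def\<close>)
qed

section \<open>Germs of smooth functions at the origin of the plane\<close>

abbreviation sg :: "(real^2 \<Rightarrow> real) \<Rightarrow> bool" where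
  "sg h \<equiv> smooth_germ_fn 0 h"

abbreviation geq :: "(real^2 \<Rightarrow> real) \<Rightarrow> (real^2 \<Rightarrow> real) \<Rightarrow> bool" (infix "\<simeq>" 50) where
  "f \<simeq> g \<equiv> \<forall>\<^sub>F w in nhds 0. f w = g w"

lemma geq_trans: "f \<simeq> g \<Longrightarrow> g \<simeq> h \<Longrightarrow> f \<simeq> h"
  by (auto elim: eventually_elim2)

lemma geq_sym: "f \<simeq> g \<Longrightarrow> g \<simeq> f"
  by (auto elim: eventually_mono)

lemma geq_at0: "f \<simeq> g \<Longrightarrow> f 0 = g 0"
  by (rule eventually_nhds_x_imp_x)

lemma sgE:
  assumes "sg h"
  obtains U where "open U" "0 \<in> U" "smooth_fn U h"
  using assms unfolding smooth_germ_fn_def by blast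

lemma sg_common:
  assumes "sg f" "sg g"
  obtains U where "open U" "0 \<in> U" "smooth_fn U f" "smooth_fn U g"
proof -
  obtain U V where "open U" "0 \<in> U" "smooth_fn U f" "open V" "0 \<in> V" "smooth_fn V g"
    using assms unfolding smooth_germ_fn_def by blast
  thus ?thesis using that[of "U \<inter> V"] by (auto intro: smooth_fn_subset)
qed

lemma sgI: "open U \<Longrightarrow> 0 \<in> U \<Longrightarrow> smooth_fn U h \<Longrightarrow> sg h"
  unfolding smooth_germ_fn_def by blast

lemma sg_const [intro, simp]: "sg (\<lambda>w. c)"
  by (rule sgI[of UNIV]) (auto intro: smooth_fn_const)

lemma sg_proj [intro, simp]: "sg (\<lambda>w. w $ i)"
  by (rule sgI[of UNIV]) (auto intro: smooth_fn_proj)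

lemma sg_add [intro, simp]: "sg f \<Longrightarrow> sg g \<Longrightarrow> sg (\<lambda>w. f w + g w)"
  by (erule (1) sg_common) (auto intro: sgI smooth_fn_add)

lemma sg_diff [intro, simp]: "sg f \<Longrightarrow> sg g \<Longrightarrow> sg (\<lambda>w. f w - g w)"
  by (erule (1) sg_common) (auto intro: sgI smooth_fn_diff)

lemma sg_mult [intro, simp]: "sg f \<Longrightarrow> sg g \<Longrightarrow> sg (\<lambda>w. f w * g w)"
  by (erule (1) sg_common) (auto intro: sgI smooth_fn_mult)

lemma sg_minus [intro, simp]: "sg f \<Longrightarrow> sg (\<lambda>w. - f w)"
  by (erule sgE) (auto intro: sgI smooth_fn_minus)

lemma sg_power [intro, simp]: "sg f \<Longrightarrow> sg (\<lambda>w. f w ^ n)"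
  by (erule sgE) (auto intro: sgI smooth_fn_power)

lemma sg_sum [intro, simp]: "(\<And>i. i \<in> A \<Longrightarrow> sg (f i)) \<Longrightarrow> sg (\<lambda>w. \<Sum>i\<in>A. f i w)"
  by (induction A rule: infinite_finite_induct) auto

lemma sg_partial [intro, simp]: "sg f \<Longrightarrow> sg (partial k f)"
  by (erule sgE) (auto intro: sgI smooth_fn_partial)

lemma sg_pd: "sg f \<Longrightarrow> sg (pd ks f)"
  by (induction ks) (auto simp: pd_Cons)

lemma sg_cong:
  assumes "f \<simeq> g" "sg f"
  shows "sg g"
proof -
  obtain N where N: "open N" "0 \<in> N" "\<And>w. w \<in> N \<Longrightarrow> f w = g w"
    using assms(1) by (auto simp: eventually_nhds)
  obtain U where U: "open U" "0 \<in> U" "smooth_fn U f" using assms(2) by (rule sgE)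
  have "smooth_fn (U \<inter> N) g"
    using U N by (intro smooth_fn_cong[of "U \<inter> N" f g]) (auto intro: smooth_fn_subset)
  thus ?thesis using U N by (intro sgI[of "U \<inter> N"]) auto
qed

lemma geq_partial:
  assumes "f \<simeq> g"
  shows "partial k f \<simeq> partial k g"
proof -
  have "\<forall>\<^sub>F x in nhds 0. \<forall>\<^sub>F w in nhds x. f w = g w"
    using assms by (simp add: eventually_eventually)
  thus ?thesis by (rule eventually_mono) (rule partial_cong)
qed

lemma geq_pd: "f \<simeq> g \<Longrightarrow> pd ks f \<simeq> pd ks g"
  by (induction ks) (auto simp: pd_Cons geq_partial)

lemma partial_const [simp]: "partial k (\<lambda>w. c) = (\<lambda>w. 0)"
  by (rule ext, rule partial_eqI) auto

lemma partial_add: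
  assumes "sg f" "sg g"
  shows "partial k (\<lambda>w. f w + g w) \<simeq> (\<lambda>w. partial k f w + partial k g w)"
proof -
  obtain U where U: "open U" "0 \<in> U" "smooth_fn U f" "smooth_fn U g"
    using assms by (rule sg_common)
  have "partial k (\<lambda>w. f w + g w) w = partial k f w + partial k g w" if "w \<in> U" for w
    using smooth_fn_axis_deriv[OF U(3) that, of "[]" k] smooth_fn_axis_deriv[OF U(4) that, of "[]" k]
    by (intro partial_eqI DERIV_add) auto
  thus ?thesis using U by (auto simp: eventually_nhds)
qed

lemma partial_mult:
  assumes "sg f" "sg g"
  shows "partial k (\<lambda>w. f w * g w) \<simeq> (\<lambda>w. f w * partial k g w + partial k f w * g w)"
proof -
  obtain U where U: "open U" "0 \<in> U" "smooth_fn U f" "smooth_fn U g"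
    using assms by (rule sg_common)
  have "partial k (\<lambda>w. f w * g w) w = f w * partial k g w + partial k f w * g w" if "w \<in> U" for w
    using DERIV_mult'[OF smooth_fn_axis_deriv[OF U(3) that, of "[]" k]
        smooth_fn_axis_deriv[OF U(4) that, of "[]" k]]
    by (intro partial_eqI) auto
  thus ?thesis using U by (auto simp: eventually_nhds)
qed

lemma partial_cmult: "sg f \<Longrightarrow> partial k (\<lambda>w. c * f w) \<simeq> (\<lambda>w. c * partial k f w)"
  using partial_mult[of "\<lambda>w. c" f k] by simp

lemma partial_diff:
  assumes "sg f" "sg g"
  shows "partial k (\<lambda>w. f w - g w) \<simeq> (\<lambda>w. partial k f w - partial k g w)"
  using eventually_conj[OF partial_add[OF assms(1), of "\<lambda>w. - 1 * g w" k] partial_cmult[OF assms(2), of k "-1"]]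
    assms(2) by (auto elim!: eventually_mono)

lemma partial_germ_commute: "sg f \<Longrightarrow> partial k (partial l f) \<simeq> partial l (partial k f)"
  by (erule sgE) (auto simp: eventually_nhds intro: smooth_fn_partial_commute)

definition pairm :: "(real^2 \<Rightarrow> real) \<Rightarrow> (real^2 \<Rightarrow> real) \<Rightarrow> real^2 \<Rightarrow> real^2" where
  "pairm x y w = vector [x w, y w]"

lemma pairm_nth [simp]: "pairm x y w $ 1 = x w" "pairm x y w $ 2 = y w"
  by (simp_all add: pairm_def)

lemma pairm_0: "x 0 = 0 \<Longrightarrow> y 0 = 0 \<Longrightarrow> pairm x y 0 = 0"
  by (simp add: vec_eq_iff forall_2)

lemma pairm_eta: "pairm (\<lambda>w. f w $ 1) (\<lambda>w. f w $ 2) = f"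
  by (simp add: vec_eq_iff forall_2 fun_eq_iff)

lemma sg_compose_domain:
  assumes "sg h" "sg x" "sg y" "x 0 = 0" "y 0 = 0"
  obtains U V where "open U" "0 \<in> U" "open V" "smooth_fn V h" "smooth_map U (pairm x y)"
     "\<forall>w\<in>U. pairm x y w \<in> V"
proof -
  obtain V where V: "open V" "0 \<in> V" "smooth_fn V h" using assms(1) by (rule sgE)
  obtain U where U: "open U" "0 \<in> U" "smooth_fn U x" "smooth_fn U y"
    using assms(2,3) by (rule sg_common)
  have s: "smooth_map U (pairm x y)"
    using smooth_map_vec2[OF U(3,4)] by (simp add: pairm_def[abs_def])
  show ?thesis
  proof (rule that[of "{w \<in> U. pairm x y w \<in> V}" V])
    show "open {w \<in> U. pairm x y w \<in> V}" by (rule open_smooth_vimage[OF U(1) V(1) s])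
    show "smooth_map {w \<in> U. pairm x y w \<in> V} (pairm x y)" by (rule smooth_map_subset[OF s]) auto
  qed (use U V assms in \<open>auto simp: pairm_0\<close>)
qed

lemma sg_compose:
  assumes "sg h" "sg x" "sg y" "x 0 = 0" "y 0 = 0"
  shows "sg (\<lambda>w. h (pairm x y w))"
proof -
  obtain U V where UV: "open U" "0 \<in> U" "open V" "smooth_fn V h" "smooth_map U (pairm x y)"
     "\<forall>w\<in>U. pairm x y w \<in> V" by (rule sg_compose_domain[OF assms])
  show ?thesis
    by (rule sgI[OF UV(1,2) smooth_fn_compose[OF UV(1,3-5)]]) (use UV(6) in blast)
qed

lemma partial_compose_germ:
  assumes "sg h" "sg x" "sg y" "x 0 = 0" "y 0 = 0"
  shows "partial k (\<lambda>w. h (pairm x y w)) \<simeq>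
    (\<lambda>w. partial 1 h (pairm x y w) * partial k x w + partial 2 h (pairm x y w) * partial k y w)"
proof -
  obtain U V where UV: "open U" "0 \<in> U" "open V" "smooth_fn V h" "smooth_map U (pairm x y)"
     "\<forall>w\<in>U. pairm x y w \<in> V" by (rule sg_compose_domain[OF assms])
  have "partial k (\<lambda>w. h (pairm x y w)) w =
      partial 1 h (pairm x y w) * partial k x w + partial 2 h (pairm x y w) * partial k y w"
    if "w \<in> U" for w
    using partial_compose2[OF UV(1,3,4,5) that] UV(6) that by simp
  thus ?thesis using UV by (auto simp: eventually_nhds)
qed

lemma continuous_pairm_0:
  assumes "sg x" "sg y" "x 0 = 0" "y 0 = 0"
  shows "filterlim (pairm x y) (nhds 0) (nhds 0)"
proof -
  obtain U where U: "open U" "0 \<in> U" "smooth_fn U x" "smooth_fn U y"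
    using assms(1,2) by (rule sg_common)
  have "smooth_map U (pairm x y)"
    using smooth_map_vec2[OF U(3,4)] by (simp add: pairm_def[abs_def])
  hence "isCont (pairm x y) 0"
    using smooth_map_continuous[OF U(1)] U continuous_on_eq_continuous_at by blast
  moreover have "pairm x y 0 = 0" using assms by (simp add: pairm_0)
  ultimately show ?thesis by (metis isCont_def tendsto_at_iff_tendsto_nhds)
qed

lemma geq_compose:
  assumes "f \<simeq> g" "sg x" "sg y" "x 0 = 0" "y 0 = 0"
  shows "(\<lambda>w. f (pairm x y w)) \<simeq> (\<lambda>w. g (pairm x y w))"
  using eventually_compose_filterlim[OF assms(1) continuous_pairm_0[OF assms(2-5)]] .

section \<open>Order of vanishing at the origin\<close>

definition vo :: "nat \<Rightarrow> (real^2 \<Rightarrow> real) \<Rightarrow> bool" where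
  "vo N h \<longleftrightarrow> (\<forall>ks. length ks < N \<longrightarrow> pd ks h 0 = 0)"

lemma vo_0 [simp]: "vo 0 h"
  by (simp add: vo_def)

text \<open>\<open>pd\<close> applies the last letter of a word first, so splitting words at their
  end gives a recursion through \<open>partial k h\<close>. This form lets the product rule and the
  chain rule drive inductions on the order.\<close>

lemma vo_Suc: "vo (Suc N) h \<longleftrightarrow> h 0 = 0 \<and> (\<forall>k. vo N (partial k h))"
proof
  assume *: "vo (Suc N) h"
  have "pd ks (partial k h) 0 = 0" if "length ks < N" for ks k
    using *[unfolded vo_def, rule_format, of "ks @ [k]"] that by (simp add: pd_append pd_Cons)
  thus "h 0 = 0 \<and> (\<forall>k. vo N (partial k h))"
    using *[unfolded vo_def, rule_format, of "[]"] by (simp add: vo_def)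
next
  assume *: "h 0 = 0 \<and> (\<forall>k. vo N (partial k h))"
  show "vo (Suc N) h"
    unfolding vo_def
  proof (intro allI impI)
    fix ks :: "2 list" assume "length ks < Suc N"
    thus "pd ks h 0 = 0"
      using * by (cases ks rule: rev_exhaust) (auto simp: vo_def pd_append pd_Cons)
  qed
qed

lemma vo_mono: "vo N h \<Longrightarrow> M \<le> N \<Longrightarrow> vo M h"
  by (auto simp: vo_def)

lemma vo_cong:
  assumes "f \<simeq> g"
  shows "vo N f \<longleftrightarrow> vo N g"
  unfolding vo_def using geq_at0[OF geq_pd[OF assms]] by simp

lemma vo_partial: "vo N h \<Longrightarrow> vo (N - 1) (partial k h)"
  by (cases N) (auto simp: vo_Suc)

lemma vo_at0: "vo N h \<Longrightarrow> 0 < N \<Longrightarrow> h 0 = 0"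
  by (cases N) (auto simp: vo_Suc)

lemma vo_zero [simp]: "vo N (\<lambda>w. 0)"
  by (induction N) (auto simp: vo_Suc)

lemma vo_add: "sg f \<Longrightarrow> sg g \<Longrightarrow> vo N f \<Longrightarrow> vo N g \<Longrightarrow> vo N (\<lambda>w. f w + g w)"
proof (induction N arbitrary: f g)
  case (Suc N)
  thus ?case
    unfolding vo_Suc by (auto simp: vo_cong[OF partial_add])
qed auto

text \<open>Leibniz rule and induction on the total order. Truncated subtraction is harmless: when
  one of the two orders is 0, the other one alone already exceeds \<open>N\<close>.\<close>

lemma vo_mult: 
  "sg f \<Longrightarrow> sg g \<Longrightarrow> vo m f \<Longrightarrow> vo n g \<Longrightarrow> N \<le> m + n \<Longrightarrow> vo N (\<lambda>w. f w * g w)"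
proof (induction N arbitrary: f g m n)
  case (Suc N)
  have "f 0 * g 0 = 0" using Suc.prems(5) vo_at0[OF Suc.prems(3)] vo_at0[OF Suc.prems(4)]
    by (cases m) auto
  moreover have "vo N (partial k (\<lambda>w. f w * g w))" for k
  proof -
    have "vo N (\<lambda>w. f w * partial k g w)"
      using Suc.prems by (intro Suc.IH[of _ _ m "n - 1"] vo_partial) auto
    moreover have "vo N (\<lambda>w. partial k f w * g w)"
      using Suc.prems by (intro Suc.IH[of _ _ "m - 1" n] vo_partial) auto
    ultimately show ?thesis
      using Suc.prems by (simp add: vo_cong[OF partial_mult] vo_add)
  qed
  ultimately show ?case by (simp add: vo_Suc)
qed auto

lemma vo_mult_left: "sg f \<Longrightarrow> sg g \<Longrightarrow> vo n g \<Longrightarrow> vo n (\<lambda>w. f w * g w)"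
  using vo_mult[of f g 0 n n] by simp

lemma vo_mult_right: "sg f \<Longrightarrow> sg g \<Longrightarrow> vo n f \<Longrightarrow> vo n (\<lambda>w. f w * g w)"
  using vo_mult[of f g n 0 n] by simp

lemma vo_minus: "sg f \<Longrightarrow> vo n f \<Longrightarrow> vo n (\<lambda>w. - f w)"
  using vo_mult_left[of "\<lambda>w. - 1" f n] by simp

lemma vo_diff: "sg f \<Longrightarrow> sg g \<Longrightarrow> vo N f \<Longrightarrow> vo N g \<Longrightarrow> vo N (\<lambda>w. f w - g w)"
  using vo_add[of f "\<lambda>w. - g w" N] vo_minus[of g N] by simp

lemma vo_swap: "sg f \<Longrightarrow> sg g \<Longrightarrow> vo n (\<lambda>w. f w - g w) \<Longrightarrow> vo n (\<lambda>w. g w - f w)"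
  using vo_minus[of "\<lambda>w. f w - g w" n] by simp

lemma vo_trans:
  "sg f \<Longrightarrow> sg g \<Longrightarrow> sg h \<Longrightarrow> vo n (\<lambda>w. f w - g w) \<Longrightarrow> vo n (\<lambda>w. g w - h w) \<Longrightarrow> vo n (\<lambda>w. f w - h w)"
  using vo_add[of "\<lambda>w. f w - g w" "\<lambda>w. g w - h w" n] by simp

lemma vo_mult_diff:
  assumes "sg f" "sg g" "sg f'" "sg g'" "vo i f" "vo j g'"
    "vo k (\<lambda>w. f w - f' w)" "vo l (\<lambda>w. g w - g' w)" "N \<le> i + l" "N \<le> k + j"
  shows "vo N (\<lambda>w. f w * g w - f' w * g' w)"
proof -
  have "vo N (\<lambda>w. f w * (g w - g' w))" using assms by (intro vo_mult[of _ _ i l]) auto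
  moreover have "vo N (\<lambda>w. (f w - f' w) * g' w)" using assms by (intro vo_mult[of _ _ k j]) auto
  ultimately have "vo N (\<lambda>w. f w * (g w - g' w) + (f w - f' w) * g' w)"
    using assms by (intro vo_add) auto
  thus ?thesis by (simp add: algebra_simps)
qed

lemma vo_partial_diff:
  assumes "sg f" "sg g" "vo N (\<lambda>w. f w - g w)"
  shows "vo (N - 1) (\<lambda>w. partial k f w - partial k g w)"
  using vo_partial[OF assms(3), of k] vo_cong[OF partial_diff[OF assms(1,2)]] by simp

lemma vo_compose:
  assumes "sg h" "sg x" "sg y" "x 0 = 0" "y 0 = 0" "vo N h"
  shows "vo N (\<lambda>w. h (pairm x y w))"
  using assms
proof (induction N arbitrary: h)
  case (Suc N)
  have "vo N (partial k (\<lambda>w. h (pairm x y w)))" for k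
    unfolding vo_cong[OF partial_compose_germ[OF Suc.prems(1-5)]]
    using Suc.prems
    by (intro vo_add vo_mult_right Suc.IH sg_mult sg_compose sg_partial) (auto simp: vo_Suc)
  thus ?case using Suc.prems by (simp add: vo_Suc pairm_0)
qed auto

text \<open>To first order the difference is the gradient of \<open>h\<close> times the difference
  of the inner maps. The gradient has order k - 1, which explains the bound
  \<open>m + (k - 1)\<close>.\<close>

lemma vo_compose_diff:
  assumes "sg h" "sg x" "sg y" "x 0 = 0" "y 0 = 0" "sg x'" "sg y'" "x' 0 = 0" "y' 0 = 0"
    "vo m (\<lambda>w. x w - x' w)" "vo m (\<lambda>w. y w - y' w)" "vo k h" "N \<le> m + (k - 1)"
  shows "vo N (\<lambda>w. h (pairm x y w) - h (pairm x' y' w))"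
  using assms
proof (induction N arbitrary: h k m)
  case (Suc N)
  note sgs = Suc.prems(1-3,6,7)
  note zs = Suc.prems(4,5,8,9)
  have IH: "vo N (\<lambda>w. partial j h (pairm x y w) - partial j h (pairm x' y' w))" for j
  \<comment> \<open>A derivative lowers the order of \<open>h\<close>; once that order is exhausted,
    one order of agreement of the inner maps is given up instead.\<close>
  proof (cases "k \<ge> 2")
    case True
    show ?thesis
      using Suc.prems True by (intro Suc.IH[of _ m "k - 1"]) (auto intro: vo_partial[unfolded One_nat_def])
  next
    case False
    show ?thesis
      using Suc.prems False by (intro Suc.IH[of _ "m - 1" 0]) (auto elim: vo_mono)
  qed
  have sec: "vo N (\<lambda>w. partial j h (pairm x' y' w) * (partial l a w - partial l a' w))"
    if "sg a" "sg a'" "vo m (\<lambda>w. a w - a' w)" for j l a a'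
    using that Suc.prems
    by (intro vo_mult[of _ _ "k - 1" "m - 1"] vo_compose vo_partial vo_partial_diff sg_compose) auto
  have fst: "vo N (\<lambda>w. (partial j h (pairm x y w) - partial j h (pairm x' y' w)) * partial l a w)"
    if "sg a" for j l a
    using that IH sgs zs by (intro vo_mult_right sg_diff sg_compose) auto
  have "vo N (partial l (\<lambda>w. h (pairm x y w) - h (pairm x' y' w)))" for l
  proof -
    have E: "partial l (\<lambda>w. h (pairm x y w) - h (pairm x' y' w)) \<simeq>
      (\<lambda>w. ((partial 1 h (pairm x y w) - partial 1 h (pairm x' y' w)) * partial l x w
         + partial 1 h (pairm x' y' w) * (partial l x w - partial l x' w))
         + ((partial 2 h (pairm x y w) - partial 2 h (pairm x' y' w)) * partial l y w
         + partial 2 h (pairm x' y' w) * (partial l y w - partial l y' w)))"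
      using partial_diff[OF sg_compose[OF Suc.prems(1-5)] sg_compose[OF Suc.prems(1,6-9)], of l]
        partial_compose_germ[OF Suc.prems(1-5), of l] partial_compose_germ[OF Suc.prems(1,6-9), of l]
      by eventually_elim (simp add: algebra_simps)
    show ?thesis
      unfolding vo_cong[OF E]
      using sgs zs Suc.prems(10,11)
      by (intro vo_add fst sec sg_add sg_mult sg_diff sg_compose sg_partial)
  qed
  thus ?case using zs by (simp add: vo_Suc pairm_0)
qed auto

lemma jet_eq_iff_vo:
  assumes "sg f" "sg g"
  shows "jet_eq 0 f g \<longleftrightarrow> (\<forall>N. vo N (\<lambda>w. f w - g w))"
proof -
  have "pd ks (\<lambda>w. f w - g w) \<simeq> (\<lambda>w. pd ks f w - pd ks g w)" for ks
  proof (induction ks)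
    case (Cons k ks)
    from geq_trans[OF geq_partial[OF Cons] partial_diff[OF sg_pd[OF assms(1)] sg_pd[OF assms(2)]]]
    show ?case by (simp add: pd_Cons)
  qed auto
  hence *: "pd ks (\<lambda>w. f w - g w) 0 = pd ks f 0 - pd ks g 0" for ks by (rule geq_at0)
  show ?thesis
  proof
    assume "\<forall>N. vo N (\<lambda>w. f w - g w)"
    hence "pd ks f 0 - pd ks g 0 = 0" for ks
      using *[of ks] unfolding vo_def by (metis lessI)
    thus "jet_eq 0 f g" by (simp add: jet_eq_def)
  qed (simp add: jet_eq_def vo_def *)
qed

subsection \<open>Taylor coefficients\<close>

definition tc :: "(real^2 \<Rightarrow> real) \<Rightarrow> nat \<Rightarrow> nat \<Rightarrow> real" where
  "tc h i j = pd (replicate i 1 @ replicate j 2) h 0 / (fact i * fact j)"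

lemma tc_cong:
  assumes "f \<simeq> g"
  shows "tc f i j = tc g i j"
  unfolding tc_def using geq_at0[OF geq_pd[OF assms]] by simp

lemma tc_00 [simp]: "tc h 0 0 = h 0"
  by (simp add: tc_def)

lemma pd_partial_commute: "sg h \<Longrightarrow> pd ks (partial k h) \<simeq> partial k (pd ks h)"
proof (induction ks)
  case (Cons l ks)
  have "partial l (pd ks (partial k h)) \<simeq> partial l (partial k (pd ks h))"
    using geq_partial[OF Cons.IH[OF Cons.prems]] .
  moreover have "partial l (partial k (pd ks h)) \<simeq> partial k (partial l (pd ks h))"
    using partial_germ_commute[OF sg_pd[OF Cons.prems]] .
  ultimately show ?case unfolding pd_Cons by (rule geq_trans)
qed auto

lemma tc_partial_1: "sg h \<Longrightarrow> tc (partial 1 h) i j = real (Suc i) * tc h (Suc i) j"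
proof -
  assume h: "sg h"
  have "pd (replicate i 1) (pd (replicate j 2) (partial 1 h)) 0
      = pd (replicate i 1) (partial 1 (pd (replicate j 2) h)) 0"
    by (rule geq_at0[OF geq_pd[OF pd_partial_commute[OF h]]])
  also have "\<dots> = pd (replicate i 1 @ [1]) (pd (replicate j 2) h) 0"
    by (simp add: pd_append pd_Cons)
  also have "replicate i (1::2) @ [1] = replicate (Suc i) 1"
    by (simp add: replicate_append_same)
  finally show ?thesis
    by (simp add: tc_def pd_append fact_Suc mult.assoc del: of_nat_Suc replicate_Suc)
qed

lemma tc_partial_2: "tc (partial 2 h) i j = real (Suc j) * tc h i (Suc j)"
proof -
  have "replicate j (2::2) @ [2] = replicate (Suc j) 2"
    by (simp add: replicate_append_same)
  hence "pd (replicate j 2) (partial 2 h) = pd (replicate (Suc j) 2) h"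
    by (metis pd_append pd_Cons pd_Nil)
  thus ?thesis
    by (simp add: tc_def pd_append fact_Suc mult.left_commute del: of_nat_Suc replicate_Suc)
qed

lemma tc_Suc_1: "sg h \<Longrightarrow> tc h (Suc i) j = tc (partial 1 h) i j / real (Suc i)"
  by (simp add: tc_partial_1)

lemma tc_Suc_2: "tc h i (Suc j) = tc (partial 2 h) i j / real (Suc j)"
  by (simp add: tc_partial_2)

lemma tc_zero [simp]: "tc (\<lambda>w. 0) i j = 0"
proof -
  have "pd ks (\<lambda>w::real^2. 0) = (\<lambda>w. 0)" for ks by (induction ks) (auto simp: pd_Cons)
  thus ?thesis by (simp add: tc_def)
qed

lemma tc_add [simp]: "sg f \<Longrightarrow> sg g \<Longrightarrow> tc (\<lambda>w. f w + g w) i j = tc f i j + tc g i j"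
proof (induction i arbitrary: f g)
  case 0
  thus ?case
  proof (induction j arbitrary: f g)
    case (Suc j)
    thus ?case by (simp add: tc_Suc_2 tc_cong[OF partial_add] add_divide_distrib)
  qed auto
next
  case (Suc i)
  thus ?case by (simp add: tc_Suc_1 tc_cong[OF partial_add] add_divide_distrib)
qed

lemma tc_cmult [simp]: "sg f \<Longrightarrow> tc (\<lambda>w. c * f w) i j = c * tc f i j"
proof (induction i arbitrary: f)
  case 0
  thus ?case
  proof (induction j arbitrary: f)
    case (Suc j)
    thus ?case by (simp add: tc_Suc_2 tc_cong[OF partial_cmult])
  qed auto
next
  case (Suc i)
  thus ?case by (simp add: tc_Suc_1 tc_cong[OF partial_cmult])
qed

lemma tc_minus [simp]: "sg f \<Longrightarrow> tc (\<lambda>w. - f w) i j = - tc f i j"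
  using tc_cmult[of f "-1"] by simp

lemma tc_diff [simp]: "sg f \<Longrightarrow> sg g \<Longrightarrow> tc (\<lambda>w. f w - g w) i j = tc f i j - tc g i j"
  using tc_add[of f "\<lambda>w. - g w"] by simp

lemma tc_sum: "(\<And>k. k \<in> A \<Longrightarrow> sg (f k)) \<Longrightarrow> tc (\<lambda>w. \<Sum>k\<in>A. f k w) i j = (\<Sum>k\<in>A. tc (f k) i j)"
  by (induction A rule: infinite_finite_induct) auto

text \<open>Sorted words of derivatives suffice because partial derivatives of germs commute; the
  commutation sits in \<open>tc_partial_1\<close>, which moves a u-derivative past the
  v-derivatives.\<close>

lemma vo_iff_tc: "sg h \<Longrightarrow> vo N h \<longleftrightarrow> (\<forall>i j. i + j < N \<longrightarrow> tc h i j = 0)"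
proof (induction N arbitrary: h)
  case (Suc N)
  have "vo (Suc N) h \<longleftrightarrow> h 0 = 0 \<and> vo N (partial 1 h) \<and> vo N (partial 2 h)"
    by (simp add: vo_Suc forall_2)
  also have "\<dots> \<longleftrightarrow> tc h 0 0 = 0 \<and> (\<forall>i j. i + j < N \<longrightarrow> tc h (Suc i) j = 0) \<and>
      (\<forall>i j. i + j < N \<longrightarrow> tc h i (Suc j) = 0)"
    using Suc by (simp add: tc_partial_1 tc_partial_2)
  also have "\<dots> \<longleftrightarrow> (\<forall>i j. i + j < Suc N \<longrightarrow> tc h i j = 0)"
  proof (intro iffI allI impI conjI)
    assume *: "\<forall>i j. i + j < Suc N \<longrightarrow> tc h i j = 0"
    show "tc h 0 0 = 0" using *[rule_format, of 0 0] by simp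
    fix i j assume "i + j < N"
    thus "tc h (Suc i) j = 0" "tc h i (Suc j) = 0" using * by simp_all
  next
    fix i j assume "tc h 0 0 = 0 \<and> (\<forall>i j. i + j < N \<longrightarrow> tc h (Suc i) j = 0) \<and>
      (\<forall>i j. i + j < N \<longrightarrow> tc h i (Suc j) = 0)" "i + j < Suc N"
    thus "tc h i j = 0" by (cases i; cases j) auto
  qed
  finally show ?case .
qed auto

lemma vo_tcD: "sg h \<Longrightarrow> vo N h \<Longrightarrow> i + j < N \<Longrightarrow> tc h i j = 0"
  using vo_iff_tc by blast

lemma vo_Suc_iff_tc:
  assumes "sg h" "vo n h"
  shows "vo (Suc n) h \<longleftrightarrow> (\<forall>i\<le>n. tc h i (n - i) = 0)"
proof
  assume "vo (Suc n) h"
  thus "\<forall>i\<le>n. tc h i (n - i) = 0" using vo_iff_tc[OF assms(1), of "Suc n"] by auto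
next
  assume *: "\<forall>i\<le>n. tc h i (n - i) = 0"
  show "vo (Suc n) h"
    unfolding vo_iff_tc[OF assms(1)]
  proof (intro allI impI)
    fix i j assume "i + j < Suc n"
    then consider "i + j < n" | "i \<le> n" "j = n - i" by linarith
    thus "tc h i j = 0" using vo_tcD[OF assms] * by cases auto
  qed
qed

lemma partial_proj_fun: "partial k (\<lambda>w::real^2. w $ i) = (\<lambda>w. if i = k then 1 else 0)"
  by (auto simp: fun_eq_iff partial_proj axis_def)

lemma tc_mult_u_0: "sg h \<Longrightarrow> tc (\<lambda>w. w $ 1 * h w) 0 j = 0"
proof (induction j arbitrary: h)
  case (Suc j)
  have "tc (partial 2 (\<lambda>w. w $ 1 * h w)) 0 j = tc (\<lambda>w. w $ 1 * partial 2 h w) 0 j"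
    using tc_cong[OF partial_mult[OF sg_proj Suc.prems], of 2 1 0 j] by (simp add: partial_proj_fun)
  thus ?case using Suc by (simp add: tc_Suc_2)
qed auto

lemma tc_mult_u_Suc: "sg h \<Longrightarrow> tc (\<lambda>w. w $ 1 * h w) (Suc i) j = tc h i j"
proof (induction i arbitrary: h)
  case 0
  have "tc (partial 1 (\<lambda>w. w $ 1 * h w)) 0 j = tc (\<lambda>w. w $ 1 * partial 1 h w + h w) 0 j"
    using tc_cong[OF partial_mult[OF sg_proj 0], of 1 1 0 j] by (simp add: partial_proj_fun)
  thus ?case using 0 tc_mult_u_0[of "partial 1 h" j] by (simp add: tc_Suc_1)
next
  case (Suc i)
  have "tc (partial 1 (\<lambda>w. w $ 1 * h w)) (Suc i) j = tc (\<lambda>w. w $ 1 * partial 1 h w + h w) (Suc i) j"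
    using tc_cong[OF partial_mult[OF sg_proj Suc.prems], of 1 1 "Suc i" j] by (simp add: partial_proj_fun)
  also have "\<dots> = real (Suc (Suc i)) * tc h (Suc i) j"
    using Suc.IH[of "partial 1 h"] Suc.prems by (simp add: tc_partial_1 algebra_simps)
  finally show ?case using Suc.prems by (subst tc_Suc_1) auto
qed

lemma tc_mult_v_Suc: "sg h \<Longrightarrow> tc (\<lambda>w. w $ 2 * h w) i (Suc j) = tc h i j"
proof (induction j arbitrary: h)
  case 0
  have z: "tc (\<lambda>w. w $ 2 * h w) i 0 = 0" if "sg h" for h
    using that
  proof (induction i arbitrary: h)
    case (Suc i)
    have "tc (partial 1 (\<lambda>w. w $ 2 * h w)) i 0 = tc (\<lambda>w. w $ 2 * partial 1 h w) i 0"
      using tc_cong[OF partial_mult[OF sg_proj Suc.prems], of 1 2 i 0] by (simp add: partial_proj_fun)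
    thus ?case using Suc by (simp add: tc_Suc_1)
  qed auto
  have "tc (partial 2 (\<lambda>w. w $ 2 * h w)) i 0 = tc (\<lambda>w. w $ 2 * partial 2 h w + h w) i 0"
    using tc_cong[OF partial_mult[OF sg_proj 0], of 2 2 i 0] by (simp add: partial_proj_fun)
  thus ?case using 0 z[of "partial 2 h"] by (simp add: tc_Suc_2)
next
  case (Suc j)
  have "tc (partial 2 (\<lambda>w. w $ 2 * h w)) i (Suc j) = tc (\<lambda>w. w $ 2 * partial 2 h w + h w) i (Suc j)"
    using tc_cong[OF partial_mult[OF sg_proj Suc.prems], of 2 2 i "Suc j"] by (simp add: partial_proj_fun)
  also have "\<dots> = real (Suc (Suc j)) * tc h i (Suc j)"
    using Suc.IH[of "partial 2 h"] Suc.prems by (simp add: tc_partial_2 algebra_simps)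
  finally show ?case using Suc.prems by (subst tc_Suc_2) auto
qed

lemma tc_mult_v_0: "sg h \<Longrightarrow> tc (\<lambda>w. w $ 2 * h w) i 0 = 0"
proof (induction i arbitrary: h)
  case (Suc i)
  have "tc (partial 1 (\<lambda>w. w $ 2 * h w)) i 0 = tc (\<lambda>w. w $ 2 * partial 1 h w) i 0"
    using tc_cong[OF partial_mult[OF sg_proj Suc.prems], of 1 2 i 0] by (simp add: partial_proj_fun)
  thus ?case using Suc by (simp add: tc_Suc_1)
qed auto

lemma tc_mult_u: "sg h \<Longrightarrow> tc (\<lambda>w. w $ 1 * h w) i j = (if i = 0 then 0 else tc h (i - 1) j)"
  by (cases i) (auto simp: tc_mult_u_0 tc_mult_u_Suc)

lemma tc_mult_v: "sg h \<Longrightarrow> tc (\<lambda>w. w $ 2 * h w) i j = (if j = 0 then 0 else tc h i (j - 1))"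
  by (cases j) (auto simp: tc_mult_v_0 tc_mult_v_Suc)

lemma tc_const: "tc (\<lambda>w. c) i j = (if i = 0 \<and> j = 0 then c else 0)"
proof (cases i)
  case 0
  thus ?thesis by (cases j) (auto simp: tc_Suc_2)
qed (auto simp: tc_Suc_1)

lemma tc_monom: "tc (\<lambda>w. w $ 1 ^ a * w $ 2 ^ b) i j = (if i = a \<and> j = b then 1 else 0)"
proof (induction a arbitrary: i)
  case 0
  have "tc (\<lambda>w. w $ 2 ^ b) i j = (if i = 0 \<and> j = b then 1 else 0)"
  proof (induction b arbitrary: j)
    case (Suc b)
    thus ?case by (auto simp: tc_mult_v)
  qed (auto simp: tc_const)
  thus ?case by simp
next
  case (Suc a)
  have "tc (\<lambda>w. w $ 1 ^ Suc a * w $ 2 ^ b) i j = tc (\<lambda>w. w $ 1 * (w $ 1 ^ a * w $ 2 ^ b)) i j"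
    by (simp add: mult_ac)
  also have "\<dots> = (if i = 0 then 0 else tc (\<lambda>w. w $ 1 ^ a * w $ 2 ^ b) (i - 1) j)"
    by (rule tc_mult_u) auto
  finally show ?case using Suc by auto
qed

text \<open>The index counts the power of u, the convention of all coefficient sequences in the
  linear system below.\<close>

definition hpoly :: "nat \<Rightarrow> (nat \<Rightarrow> real) \<Rightarrow> real^2 \<Rightarrow> real" where
  "hpoly n c w = (\<Sum>i\<le>n. c i * (w $ 1 ^ i * w $ 2 ^ (n - i)))"

lemma sg_hpoly [simp, intro]: "sg (hpoly n c)"
  unfolding hpoly_def[abs_def] by (intro sg_sum sg_mult sg_power sg_proj sg_const)

lemma tc_hpoly: "tc (hpoly n c) i j = (if i + j = n then c i else 0)"
proof -
  have "tc (hpoly n c) i j = (\<Sum>k\<le>n. c k * tc (\<lambda>w. w $ 1 ^ k * w $ 2 ^ (n - k)) i j)"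
    unfolding hpoly_def[abs_def] by (subst tc_sum) auto
  also have "\<dots> = (\<Sum>k\<le>n. if k = i then (if i + j = n then c i else 0) else 0)"
    by (intro sum.cong refl) (auto simp: tc_monom)
  finally show ?thesis by (auto simp: sum.delta)
qed

lemma vo_hpoly: "vo n (hpoly n c)"
  by (subst vo_iff_tc) (auto simp: tc_hpoly)

text \<open>The Cauchy product in degrees one and two, phrased with \<open>Suc\<close> so that the
  explicit 2-jets of metric coefficients can be computed by rewriting.\<close>

lemma tc_mult_low:
  assumes "sg f" "sg g"
  shows "tc (\<lambda>w. f w * g w) (Suc 0) 0 = tc f (Suc 0) 0 * g 0 + f 0 * tc g (Suc 0) 0"
    "tc (\<lambda>w. f w * g w) 0 (Suc 0) = tc f 0 (Suc 0) * g 0 + f 0 * tc g 0 (Suc 0)"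
    "tc (\<lambda>w. f w * g w) (Suc (Suc 0)) 0 =
       tc f (Suc (Suc 0)) 0 * g 0 + tc f (Suc 0) 0 * tc g (Suc 0) 0 + f 0 * tc g (Suc (Suc 0)) 0"
    "tc (\<lambda>w. f w * g w) 0 (Suc (Suc 0)) =
       tc f 0 (Suc (Suc 0)) * g 0 + tc f 0 (Suc 0) * tc g 0 (Suc 0) + f 0 * tc g 0 (Suc (Suc 0))"
    "tc (\<lambda>w. f w * g w) (Suc 0) (Suc 0) = tc f (Suc 0) (Suc 0) * g 0 + tc f (Suc 0) 0 * tc g 0 (Suc 0)
       + tc f 0 (Suc 0) * tc g (Suc 0) 0 + f 0 * tc g (Suc 0) (Suc 0)"
proof -
  have 1: "tc (\<lambda>w. f w * g w) (Suc 0) 0 = tc f (Suc 0) 0 * g 0 + f 0 * tc g (Suc 0) 0"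
    if "sg f" "sg g" for f g
    using that by (simp add: tc_Suc_1 geq_at0[OF partial_mult] algebra_simps)
  have 2: "tc (\<lambda>w. f w * g w) 0 (Suc 0) = tc f 0 (Suc 0) * g 0 + f 0 * tc g 0 (Suc 0)"
    if "sg f" "sg g" for f g
    using that by (simp add: tc_Suc_2 geq_at0[OF partial_mult] algebra_simps)
  show "tc (\<lambda>w. f w * g w) (Suc 0) 0 = tc f (Suc 0) 0 * g 0 + f 0 * tc g (Suc 0) 0"
    "tc (\<lambda>w. f w * g w) 0 (Suc 0) = tc f 0 (Suc 0) * g 0 + f 0 * tc g 0 (Suc 0)"
    using 1 2 assms by auto
  have "tc (\<lambda>w. f w * g w) (Suc (Suc 0)) 0 =
      tc (\<lambda>w. f w * partial 1 g w + partial 1 f w * g w) (Suc 0) 0 / 2"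
    using assms by (subst tc_Suc_1) (auto simp: tc_cong[OF partial_mult])
  thus "tc (\<lambda>w. f w * g w) (Suc (Suc 0)) 0 =
       tc f (Suc (Suc 0)) 0 * g 0 + tc f (Suc 0) 0 * tc g (Suc 0) 0 + f 0 * tc g (Suc (Suc 0)) 0"
    using assms tc_partial_1[of f 0 0] tc_partial_1[of g 0 0]
    by (simp add: 1 tc_partial_1 algebra_simps)
  have "tc (\<lambda>w. f w * g w) 0 (Suc (Suc 0)) =
      tc (\<lambda>w. f w * partial 2 g w + partial 2 f w * g w) 0 (Suc 0) / 2"
    using assms by (subst tc_Suc_2) (auto simp: tc_cong[OF partial_mult])
  thus "tc (\<lambda>w. f w * g w) 0 (Suc (Suc 0)) =
       tc f 0 (Suc (Suc 0)) * g 0 + tc f 0 (Suc 0) * tc g 0 (Suc 0) + f 0 * tc g 0 (Suc (Suc 0))"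
    using assms tc_partial_2[of f 0 0] tc_partial_2[of g 0 0]
    by (simp add: 2 tc_partial_2 algebra_simps)
  have "tc (\<lambda>w. f w * g w) (Suc 0) (Suc 0) =
      tc (\<lambda>w. f w * partial 2 g w + partial 2 f w * g w) (Suc 0) 0"
    using assms by (subst tc_Suc_2) (auto simp: tc_cong[OF partial_mult])
  thus "tc (\<lambda>w. f w * g w) (Suc 0) (Suc 0) = tc f (Suc 0) (Suc 0) * g 0 + tc f (Suc 0) 0 * tc g 0 (Suc 0)
       + tc f 0 (Suc 0) * tc g (Suc 0) 0 + f 0 * tc g (Suc 0) (Suc 0)"
    using assms tc_partial_2[of f 0 0] tc_partial_2[of g 0 0]
    by (simp add: 1 tc_partial_2 algebra_simps)
qed

subsection \<open>Borel's theorem with a parameter\<close>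

lemma pd_cong_on:
  fixes f g :: "real^'n::finite \<Rightarrow> real"
  assumes "open U" "\<And>x. x \<in> U \<Longrightarrow> f x = g x" "x \<in> U"
  shows "pd ks f x = pd ks g x"
  using assms(3)
proof (induction ks arbitrary: x)
  case (Cons k ks)
  show ?case unfolding pd_Cons
    by (rule partial_cong) (use Cons assms in \<open>auto simp: eventually_nhds\<close>)
qed (use assms in simp)

lemma partial_add_on:
  fixes f g :: "real^'n::finite \<Rightarrow> real"
  assumes "smooth_fn U f" "smooth_fn U g" "x \<in> U"
  shows "partial k (\<lambda>w. f w + g w) x = partial k f x + partial k g x"
  using smooth_fn_axis_deriv[OF assms(1,3), of "[]" k] smooth_fn_axis_deriv[OF assms(2,3), of "[]" k]
  by (intro partial_eqI DERIV_add) auto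

lemma partial_mult_on:
  fixes f g :: "real^'n::finite \<Rightarrow> real"
  assumes "smooth_fn U f" "smooth_fn U g" "x \<in> U"
  shows "partial k (\<lambda>w. f w * g w) x = f x * partial k g x + partial k f x * g x"
  using DERIV_mult'[OF smooth_fn_axis_deriv[OF assms(1,3), of "[]" k]
      smooth_fn_axis_deriv[OF assms(2,3), of "[]" k]]
  by (intro partial_eqI) auto

lemma pd_add_on:
  fixes f g :: "real^'n::finite \<Rightarrow> real"
  assumes "open U" "smooth_fn U f" "smooth_fn U g" "x \<in> U"
  shows "pd ks (\<lambda>w. f w + g w) x = pd ks f x + pd ks g x"
  using assms(4)
proof (induction ks arbitrary: x)
  case (Cons k ks)
  have "pd (k # ks) (\<lambda>w. f w + g w) x = partial k (\<lambda>w. pd ks f w + pd ks g w) x"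
    unfolding pd_Cons
    by (rule partial_cong) (use Cons assms(1) in \<open>auto simp: eventually_nhds\<close>)
  thus ?case
    using partial_add_on[OF smooth_fn_pd[OF assms(2)] smooth_fn_pd[OF assms(3)] Cons.prems]
    by (simp add: pd_Cons)
qed auto

lemma pd_zero: "pd ks (\<lambda>w::real^'n::finite. 0) = (\<lambda>w. 0)"
proof (induction ks)
  case (Cons k ks)
  have "partial k (\<lambda>w::real^'n. 0) = (\<lambda>w. 0)" by (rule ext, rule partial_eqI) auto
  thus ?case using Cons by (simp add: pd_Cons)
qed auto

lemma pd_sum_on:
  fixes f :: "nat \<Rightarrow> real^'n::finite \<Rightarrow> real"
  assumes "open U" "\<And>i. smooth_fn U (f i)" "x \<in> U"
  shows "smooth_fn U (\<lambda>w. \<Sum>i<n. f i w) \<and> pd ks (\<lambda>w. \<Sum>i<n. f i w) x = (\<Sum>i<n. pd ks (f i) x)"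
proof (induction n)
  case (Suc n)
  thus ?case using assms pd_add_on[of U "\<lambda>w. \<Sum>i<n. f i w" "f n" x ks]
    by (auto intro: smooth_fn_add)
qed (auto simp: pd_zero smooth_fn_const[OF assms(1)])

lemma smooth_fn_sum:
  fixes f :: "nat \<Rightarrow> real^'n::finite \<Rightarrow> real"
  assumes "open U" "\<And>i. smooth_fn U (f i)"
  shows "smooth_fn U (\<lambda>w. \<Sum>i<n. f i w)"
  by (induction n) (auto intro: smooth_fn_add smooth_fn_const assms)

text \<open>Crude Leibniz estimate: every derivative doubles the number of terms, and each term is a
  derivative of \<open>f\<close> times a derivative of \<open>g\<close>.\<close>

lemma pd_mult_bound:
  fixes f g :: "real^'n::finite \<Rightarrow> real"
  assumes "open U" "smooth_fn U f" "smooth_fn U g" "x \<in> U" "0 \<le> M" "0 \<le> d"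
    and "\<And>ls. length ls \<le> length ks \<Longrightarrow> \<bar>pd ls f x\<bar> \<le> M"
    and "\<And>ls. length ls \<le> length ks \<Longrightarrow> \<bar>pd ls g x\<bar> \<le> d"
  shows "\<bar>pd ks (\<lambda>w. f w * g w) x\<bar> \<le> 2 ^ length ks * (M * d)"
  using assms(2-)
proof (induction ks arbitrary: f g rule: rev_induct)
  case Nil
  thus ?case using Nil(6)[of "[]"] Nil(7)[of "[]"] by (auto simp: abs_mult intro: mult_mono)
next
  case (snoc k ks)
  note sm = smooth_fn_partial[OF snoc.prems(1), of k] smooth_fn_partial[OF snoc.prems(2), of k]
  have "pd (ks @ [k]) (\<lambda>w. f w * g w) x = pd ks (\<lambda>w. f w * partial k g w + partial k f w * g w) x"
    unfolding pd_append pd_Cons pd_Nil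
    by (rule pd_cong_on[OF assms(1) partial_mult_on[OF snoc.prems(1,2)] snoc.prems(3)])
  also have "\<dots> = pd ks (\<lambda>w. f w * partial k g w) x + pd ks (\<lambda>w. partial k f w * g w) x"
    using snoc.prems sm assms(1) by (intro pd_add_on[OF assms(1)] smooth_fn_mult) auto
  also have "\<bar>\<dots>\<bar> \<le> \<bar>pd ks (\<lambda>w. f w * partial k g w) x\<bar> + \<bar>pd ks (\<lambda>w. partial k f w * g w) x\<bar>"
    by (rule abs_triangle_ineq)
  also have "\<dots> \<le> 2 ^ length ks * (M * d) + 2 ^ length ks * (M * d)"
  proof (rule add_mono)
    have "\<bar>pd ls (partial k g) x\<bar> \<le> d" if "length ls \<le> length ks" for ls
      using snoc.prems(7)[of "ls @ [k]"] that by (simp add: pd_append pd_Cons)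
    thus "\<bar>pd ks (\<lambda>w. f w * partial k g w) x\<bar> \<le> 2 ^ length ks * (M * d)"
      using snoc.prems sm by (intro snoc.IH) auto
    have "\<bar>pd ls (partial k f) x\<bar> \<le> M" if "length ls \<le> length ks" for ls
      using snoc.prems(6)[of "ls @ [k]"] that by (simp add: pd_append pd_Cons)
    thus "\<bar>pd ks (\<lambda>w. partial k f w * g w) x\<bar> \<le> 2 ^ length ks * (M * d)"
      using snoc.prems sm by (intro snoc.IH) auto
  qed
  finally show ?case by (simp add: mult_ac)
qed

text \<open>The bound on the \<open>n\<close>-th term is required only for derivatives of order
  below \<open>n\<close>. The series of any fixed derivative is thus dominated by a geometric one
  from some index on, converges uniformly, and may be differentiated term by term.\<close>

lemma smooth_fn_suminf:
  fixes T :: "nat \<Rightarrow> real^'n::finite \<Rightarrow> real"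
  assumes U: "open U" and T: "\<And>n. smooth_fn U (T n)"
    and bound: "\<And>n ks x. length ks < n \<Longrightarrow> x \<in> U \<Longrightarrow> \<bar>pd ks (T n) x\<bar> \<le> (1/2) ^ n"
  shows "smooth_fn U (\<lambda>x. \<Sum>n. T n x)"
    and "\<And>x ks. x \<in> U \<Longrightarrow> pd ks (\<lambda>x. \<Sum>n. T n x) x = (\<Sum>n. pd ks (T n) x)"
proof -
  define F where "F ks x = (\<Sum>n. pd ks (T n) x)" for ks x
  have ul: "uniform_limit U (\<lambda>n x. \<Sum>i<n. pd ks (T i) x) (F ks) sequentially" for ks
    unfolding F_def[abs_def]
  proof (rule Weierstrass_m_test_ev)
    show "\<forall>\<^sub>F n in sequentially. \<forall>x\<in>U. norm (pd ks (T n) x) \<le> (1/2) ^ n"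
      using eventually_gt_at_top[of "length ks"] by eventually_elim (use bound in auto)
  qed (auto intro: summable_geometric)
  have sums: "summable (\<lambda>n. pd ks (T n) x)" if "x \<in> U" for ks x
    using tendsto_uniform_limitI[OF ul that] by (auto simp: summable_def sums_def)
  have deriv: "((\<lambda>t. F ks (x + t *\<^sub>R axis k 1)) has_real_derivative F (k # ks) x) (at 0)"
    if x: "x \<in> U" for ks k x
  proof -
    obtain r where r: "r > 0" "ball x r \<subseteq> U" using U x openE by blast
    have inU: "x + t *\<^sub>R axis k 1 \<in> U" if "t \<in> ball 0 r" for t
    proof -
      have "dist x (x + t *\<^sub>R axis k 1) = \<bar>t\<bar>" by (simp add: dist_norm)
      thus ?thesis using that r by (auto simp: subset_iff)
    qed
    have "((\<lambda>t. \<Sum>n. pd ks (T n) (x + t *\<^sub>R axis k 1)) has_real_derivative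
        (\<Sum>n. pd (k # ks) (T n) (x + 0 *\<^sub>R axis k 1))) (at 0)"
    proof (rule has_field_derivative_series'(2)[of "ball 0 r" _ "\<lambda>n t. pd (k # ks) (T n) (x + t *\<^sub>R axis k 1)" 0])
      show "((\<lambda>t. pd ks (T n) (x + t *\<^sub>R axis k 1)) has_real_derivative
          pd (k # ks) (T n) (x + t *\<^sub>R axis k 1)) (at t within ball 0 r)" if "t \<in> ball 0 r" for n t
        unfolding pd_Cons
        by (rule DERIV_subset[OF smooth_fn_line_deriv[OF smooth_fn_pd[OF T] inU[OF that]]]) simp
      have "uniform_limit (ball 0 r) (\<lambda>n t. \<Sum>i<n. pd (k # ks) (T i) (x + t *\<^sub>R axis k 1))
          (\<lambda>t. F (k # ks) (x + t *\<^sub>R axis k 1)) sequentially"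
        unfolding uniform_limit_iff
      proof (intro allI impI)
        fix e :: real assume "e > 0"
        from ul[of "k # ks", unfolded uniform_limit_iff, rule_format, OF this]
        show "\<forall>\<^sub>F n in sequentially. \<forall>t\<in>ball 0 r. dist (\<Sum>i<n. pd (k # ks) (T i) (x + t *\<^sub>R axis k 1))
          (F (k # ks) (x + t *\<^sub>R axis k 1)) < e"
          by eventually_elim (use inU in blast)
      qed
      thus "uniformly_convergent_on (ball 0 r) (\<lambda>n t. \<Sum>i<n. pd (k # ks) (T i) (x + t *\<^sub>R axis k 1))"
        by (auto simp: uniformly_convergent_on_def)
      show "summable (\<lambda>n. pd ks (T n) (x + 0 *\<^sub>R axis k 1))" using sums[OF x] by simp
    qed (use r in auto)
    thus ?thesis by (simp add: F_def)
  qed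
  have cont: "continuous_on U (F ks)" for ks
    by (rule uniform_limit_theorem[OF always_eventually ul])
      (auto intro!: smooth_fn_continuous smooth_fn_sum smooth_fn_pd T U)
  have F0: "F [] = (\<lambda>x. \<Sum>n. T n x)" by (simp add: F_def[abs_def])
  have "smooth_fn U (F [])"
    by (rule smooth_fn_coinduct[OF U, where P = "\<lambda>h. \<exists>ks. h = F ks"]) (use cont deriv in blast)+
  thus "smooth_fn U (\<lambda>x. \<Sum>n. T n x)" by (simp add: F0)
  have "pd ks (F []) x = F ks x" if "x \<in> U" for ks x
    using that
  proof (induction ks arbitrary: x)
    case (Cons k ks)
    have "partial k (pd ks (F [])) x = partial k (F ks) x"
      by (rule partial_cong) (use Cons U in \<open>auto simp: eventually_nhds\<close>)
    thus ?case using partial_eqI[OF deriv[OF Cons.prems]] by (simp add: pd_Cons)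
  qed auto
  thus "pd ks (\<lambda>x. \<Sum>n. T n x) x = (\<Sum>n. pd ks (T n) x)" if "x \<in> U" for ks x
    using that by (simp add: F0[symmetric]) (simp add: F_def)
qed

text \<open>A class that contains the powers of sine, is closed under derivation and consists of
  bounded functions. It bounds all derivatives of a power of sine without a formula for
  them.\<close>

inductive trig_poly :: "(real \<Rightarrow> real) \<Rightarrow> bool" where
  "trig_poly (\<lambda>x. c)"
| "trig_poly sin"
| "trig_poly cos"
| "trig_poly f \<Longrightarrow> trig_poly g \<Longrightarrow> trig_poly (\<lambda>x. f x + g x)"
| "trig_poly f \<Longrightarrow> trig_poly g \<Longrightarrow> trig_poly (\<lambda>x. f x * g x)"

lemma trig_poly_deriv:
  "trig_poly f \<Longrightarrow> \<exists>f'. trig_poly f' \<and> (\<forall>x. (f has_real_derivative f' x) (at x))"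
proof (induction rule: trig_poly.induct)
  case 3
  have "trig_poly (\<lambda>x. - 1 * sin x)" by (intro trig_poly.intros)
  thus ?case by (intro exI[of _ "\<lambda>x. - 1 * sin x"]) (auto intro!: derivative_eq_intros)
next
  case (5 f g)
  then obtain f' g' where *: "trig_poly f'" "trig_poly g'"
    "\<forall>x. (f has_real_derivative f' x) (at x)" "\<forall>x. (g has_real_derivative g' x) (at x)" by blast
  hence "((\<lambda>x. f x * g x) has_real_derivative (f x * g' x + f' x * g x)) (at x)" for x
    by (intro DERIV_mult') auto
  thus ?case using * 5(1,2)
    by (intro exI[of _ "\<lambda>x. f x * g' x + f' x * g x"]) (auto intro: trig_poly.intros)
next
  case (4 f g)
  then obtain f' g' where *: "trig_poly f'" "trig_poly g'"
    "\<forall>x. (f has_real_derivative f' x) (at x)" "\<forall>x. (g has_real_derivative g' x) (at x)" by blast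
  thus ?case
    by (intro exI[of _ "\<lambda>x. f' x + g' x"]) (auto intro!: trig_poly.intros DERIV_add)
next
  case (1 c)
  thus ?case by (intro exI[of _ "\<lambda>x. 0"]) (auto intro: trig_poly.intros)
next
  case 2
  thus ?case by (intro exI[of _ cos]) (auto intro: trig_poly.intros)
qed

lemma trig_poly_bounded: "trig_poly f \<Longrightarrow> \<exists>B. \<forall>x. \<bar>f x\<bar> \<le> B"
proof (induction rule: trig_poly.induct)
  case (4 f g)
  then obtain A B where "\<forall>x. \<bar>f x\<bar> \<le> A" "\<forall>x. \<bar>g x\<bar> \<le> B" by blast
  thus ?case by (intro exI[of _ "A + B"]) (meson abs_triangle_ineq add_mono order_trans)
next
  case (5 f g)
  then obtain A B where *: "\<forall>x. \<bar>f x\<bar> \<le> A" "\<forall>x. \<bar>g x\<bar> \<le> B" by blast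
  hence "0 \<le> A" using abs_ge_zero order_trans by blast
  thus ?case using * by (intro exI[of _ "A * B"]) (auto simp: abs_mult intro: mult_mono)
qed (auto intro: exI[of _ 1] simp: abs_sin_le_one abs_cos_le_one)

lemma trig_poly_derivs:
  assumes "trig_poly f"
  obtains D where "D 0 = f" "\<And>j x. (D j has_real_derivative D (Suc j) x) (at x)"
    "\<And>j. \<exists>B. \<forall>x. \<bar>D j x\<bar> \<le> B"
proof -
  have "\<exists>D. \<forall>n. (trig_poly (D n) \<and> (n = 0 \<longrightarrow> D n = f)) \<and>
      (\<forall>x. (D n has_real_derivative D (Suc n) x) (at x))"
    by (rule dependent_nat_choice) (use assms trig_poly_deriv in auto)
  then obtain D where "\<And>n. trig_poly (D n)" "D 0 = f"
     "\<And>n x. (D n has_real_derivative D (Suc n) x) (at x)" by blast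
  thus ?thesis using trig_poly_bounded that by blast
qed

lemma partial_of_second:
  assumes "\<And>x. (g has_real_derivative g' x) (at x)"
  shows "((\<lambda>t. c * g (a * (w + t *\<^sub>R axis k 1 :: real^2) $ 2)) has_real_derivative
     (if k = 2 then c * a * g' (a * w $ 2) else 0)) (at 0)"
proof (cases "k = 2")
  case True
  have "((\<lambda>t. g (a * (w $ 2 + t))) has_real_derivative g' (a * (w $ 2 + 0)) * a) (at 0)"
    by (rule DERIV_chain2[where f = g]) (use assms in \<open>auto intro!: derivative_eq_intros\<close>)
  from DERIV_cmult[OF this, of c] show ?thesis using True by (simp add: mult_ac)
qed (auto simp: axis_def)

lemma pd_of_second:
  assumes "\<And>j x. (D j has_real_derivative D (Suc j) x) (at x)"
  shows "pd ks (\<lambda>w. c * D j (a * (w :: real^2) $ 2)) =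
    (if set ks \<subseteq> {2} then (\<lambda>w. c * a ^ length ks * D (j + length ks) (a * w $ 2)) else (\<lambda>w. 0))"
proof (induction ks)
  case (Cons k ks)
  have "partial k (\<lambda>w. c * a ^ length ks * D (j + length ks) (a * w $ 2)) =
     (if k = 2 then (\<lambda>w. c * a ^ length (k # ks) * D (j + length (k # ks)) (a * w $ 2)) else (\<lambda>w. 0))"
    by (rule ext, rule partial_eqI[OF DERIV_cong[OF partial_of_second[OF assms]]]) (auto simp: mult_ac)
  thus ?case using Cons by (auto simp: pd_Cons)
qed auto

lemma smooth_of_second:
  assumes "\<And>j x. (D j has_real_derivative D (Suc j) x) (at x)"
  shows "smooth_fn UNIV (\<lambda>w::real^2. c * D j (a * w $ 2))"
proof (rule smooth_fn_coinduct[OF open_UNIV, where P = "\<lambda>h. \<exists>c j. h = (\<lambda>w::real^2. c * D j (a * w $ 2))"])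
  fix h and k :: "2" assume "\<exists>c j. h = (\<lambda>w::real^2. c * D j (a * w $ 2))"
  then obtain c j where h: "h = (\<lambda>w::real^2. c * D j (a * w $ 2))" by blast
  have "((\<lambda>t. h (x + t *\<^sub>R axis k 1)) has_real_derivative
     (if k = 2 then c * a else 0) * D (Suc j) (a * x $ 2)) (at 0)" for x
    unfolding h by (rule DERIV_cong[OF partial_of_second[OF assms]]) auto
  thus "\<exists>h'. (\<exists>c j. h' = (\<lambda>w. c * D j (a * w $ 2))) \<and>
     (\<forall>x\<in>UNIV. ((\<lambda>t. h (x + t *\<^sub>R axis k 1)) has_real_derivative h' x) (at 0))"
    by (intro exI[of _ "\<lambda>x. (if k = 2 then c * a else 0) * D (Suc j) (a * x $ 2)"] conjI
        exI[of _ "if k = 2 then c * a else 0"] exI[of _ "Suc j"]) auto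
next
  fix h assume "\<exists>c j. h = (\<lambda>w::real^2. c * D j (a * w $ 2))"
  then obtain c j where h: "h = (\<lambda>w::real^2. c * D j (a * w $ 2))" by blast
  have "isCont (D j) x" for x using assms DERIV_isCont by blast
  hence "continuous_on UNIV (D j)" by (simp add: continuous_at_imp_continuous_on)
  moreover have "continuous_on UNIV (\<lambda>w::real^2. a * w $ 2)" by (intro continuous_intros)
  ultimately have "continuous_on UNIV (\<lambda>w::real^2. D j (a * w $ 2))"
    by (rule continuous_on_compose2) simp
  thus "continuous_on UNIV h" unfolding h by (rule continuous_on_mult_left)
qed blast

definition sine_power :: "real \<Rightarrow> nat \<Rightarrow> real^2 \<Rightarrow> real" where
  "sine_power l n w = (sin (l * w $ 2) / l) ^ n"

text \<open>A derivative of order j < n costs a factor l^j against the normalising l^n and so is at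
  most a constant over l. A high frequency therefore suppresses a coefficient of any size.\<close>

lemma sine_power_facts:
  obtains B where "0 \<le> B"
    "\<And>l ks w. 1 \<le> l \<Longrightarrow> length ks < n \<Longrightarrow> \<bar>pd ks (sine_power l n) w\<bar> \<le> B / l"
    "\<And>l. smooth_fn UNIV (sine_power l n)"
proof -
  have tp: "trig_poly (\<lambda>x. sin x ^ m)" for m
  proof (induction m)
    case (Suc m)
    have "trig_poly (\<lambda>x. sin x * sin x ^ m)" by (intro trig_poly.intros Suc)
    thus ?case by simp
  qed (simp add: trig_poly.intros)
  obtain D where D: "D 0 = (\<lambda>x. sin x ^ n)" "\<And>j x. (D j has_real_derivative D (Suc j) x) (at x)"
    "\<And>j. \<exists>B. \<forall>x. \<bar>D j x\<bar> \<le> B" using trig_poly_derivs[OF tp] by blast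
  have eq: "sine_power l n = (\<lambda>w. (1 / l ^ n) * D 0 (l * w $ 2))" for l
    by (simp add: sine_power_def[abs_def] D(1) power_divide)
  from D(3) obtain b where b: "\<And>j x. \<bar>D j x\<bar> \<le> b j" by metis
  hence b0: "0 \<le> b j" for j using abs_ge_zero order_trans by blast
  define B where "B = (\<Sum>j<n. b j)"
  have bB: "b j \<le> B" if "j < n" for j unfolding B_def by (rule member_le_sum) (use that b0 in auto)
  show ?thesis
  proof (rule that[of B])
    show "0 \<le> B" unfolding B_def by (rule sum_nonneg) (use b0 in auto)
    show "\<bar>pd ks (sine_power l n) w\<bar> \<le> B / l" if "1 \<le> l" "length ks < n" for l ks w
    proof (cases "set ks \<subseteq> {2}")
      case True
      have "l ^ Suc (length ks) \<le> l ^ n" using that by (intro power_increasing) auto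
      hence "l ^ length ks / l ^ n \<le> 1 / l" using that by (simp add: field_simps)
      moreover have "\<bar>D (length ks) (l * w $ 2)\<bar> \<le> B" using b bB[OF that(2)] order_trans by blast
      ultimately have "(l ^ length ks / l ^ n) * \<bar>D (length ks) (l * w $ 2)\<bar> \<le> (1 / l) * B"
        using that by (intro mult_mono) auto
      moreover have "pd ks (sine_power l n) w = (1 / l ^ n) * l ^ length ks * D (length ks) (l * w $ 2)"
        unfolding eq pd_of_second[where D = D, OF D(2)] using True by simp
      ultimately show ?thesis using that by (simp add: abs_mult)
    next
      case False
      hence "pd ks (sine_power l n) w = 0"
        unfolding eq pd_of_second[where D = D, OF D(2)] by simp
      thus ?thesis using that \<open>0 \<le> B\<close> by simp
    qed
    show "smooth_fn UNIV (sine_power l n)" for l unfolding eq by (rule smooth_of_second[where D = D, OF D(2)])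
  qed
qed

lemma smooth_sine_power: "smooth_fn U (sine_power l n)"
proof -
  have "smooth_fn UNIV (sine_power l n)" by (rule sine_power_facts[of n]) blast
  thus ?thesis by (rule smooth_fn_subset) auto
qed

lemma sine_power_Suc: "sine_power l (Suc n) = (\<lambda>w. sine_power l n w * sine_power l (Suc 0) w)"
  by (auto simp: sine_power_def fun_eq_iff)

lemma partial_sine_power_1:
  assumes "l \<noteq> 0"
  shows "partial 2 (sine_power l (Suc 0)) = (\<lambda>w. cos (l * w $ 2))"
proof
  fix w :: "real^2"
  have "(sin has_real_derivative cos x) (at x)" for x :: real by (rule DERIV_sin)
  from partial_of_second[OF this, of "1 / l" l w 2] assms
  show "partial 2 (sine_power l (Suc 0)) w = cos (l * w $ 2)"
    by (intro partial_eqI) (simp add: sine_power_def)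
qed

lemma smooth_cos_second: "smooth_fn U (\<lambda>w. cos (l * (w::real^2) $ 2))"
proof (cases "l = 0")
  case True
  thus ?thesis using smooth_fn_subset[OF smooth_fn_const[OF open_UNIV]] by simp
next
  case False
  thus ?thesis using smooth_fn_partial[OF smooth_sine_power, of U 2 l "Suc 0"] by (simp add: partial_sine_power_1)
qed

text \<open>The derivative of $C\sigma^{n+1}$ with $\sigma = \sin(lt)/l$ is $C'\sigma^n$ with
  $C' = (n+1) C \cos(lt) + \sigma C_t$, which equals $(n+1) C$ on $t = 0$.\<close>

lemma pd2_mult_sine_power:
  assumes "open U" "smooth_fn U c" "w \<in> U" "w $ 2 = 0" "l \<noteq> 0" "m \<le> n"
  shows "pd (replicate m 2) (\<lambda>w. c w * sine_power l n w) w = (if m = n then fact n * c w else 0)"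
  using assms(2,6)
proof (induction m arbitrary: n c)
  case 0
  thus ?case using assms(4) by (auto simp: sine_power_def)
next
  case (Suc m)
  then obtain n' where n: "n = Suc n'" by (cases n) auto
  define c' where "c' w = real n * c w * cos (l * w $ 2) + sine_power l (Suc 0) w * partial 2 c w" for w
  note sm = smooth_fn_partial[OF Suc.prems(1)] smooth_sine_power smooth_cos_second Suc.prems(1)
  have c': "smooth_fn U c'"
    unfolding c'_def[abs_def] using assms(1) sm
    by (intro smooth_fn_add smooth_fn_mult smooth_fn_const)
  have p: "partial 2 (sine_power l (Suc k)) x = real (Suc k) * sine_power l k x * cos (l * x $ 2)"
    for k x
  proof (induction k)
    case 0
    thus ?case using partial_sine_power_1[OF assms(5)] by (simp add: sine_power_def[of l 0])
  next
    case (Suc k)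
    have "partial 2 (sine_power l (Suc (Suc k))) x =
       sine_power l (Suc k) x * cos (l * x $ 2) +
       (real (Suc k) * sine_power l k x * cos (l * x $ 2)) * sine_power l (Suc 0) x"
      unfolding sine_power_Suc[of l "Suc k"]
      using partial_mult_on[OF smooth_sine_power[of UNIV l "Suc k"] smooth_sine_power[of UNIV l "Suc 0"], of x 2]
        Suc partial_sine_power_1[OF assms(5)] by simp
    also have "\<dots> = real (Suc (Suc k)) * sine_power l (Suc k) x * cos (l * x $ 2)"
      unfolding sine_power_Suc[of l k] by (simp add: algebra_simps)
    finally show ?case .
  qed
  have eq: "partial 2 (\<lambda>w. c w * sine_power l n w) x = c' x * sine_power l n' x" if "x \<in> U" for x
  proof -
    have "partial 2 (\<lambda>w. c w * sine_power l n w) x =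
       c x * (real n * sine_power l n' x * cos (l * x $ 2)) + partial 2 c x * sine_power l n x"
      using partial_mult_on[OF Suc.prems(1) smooth_sine_power that, of 2 l n] p[of n' x]
      by (simp add: n)
    thus ?thesis unfolding c'_def n sine_power_Suc[of l n'] by (simp add: algebra_simps)
  qed
  have "pd (replicate (Suc m) 2) (\<lambda>w. c w * sine_power l n w) w =
     pd (replicate m 2) (partial 2 (\<lambda>w. c w * sine_power l n w)) w"
    unfolding replicate_Suc replicate_append_same[symmetric] pd_append pd_Cons by simp
  also have "\<dots> = pd (replicate m 2) (\<lambda>w. c' w * sine_power l n' w) w"
    by (rule pd_cong_on[OF assms(1) eq assms(3)])
  also have "\<dots> = (if m = n' then fact n' * c' w else 0)"
    using Suc.prems n by (intro Suc.IH[OF c']) auto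
  also have "c' w = real n * c w" using assms(4) by (simp add: c'_def sine_power_def)
  finally show ?case by (simp add: n)
qed

lemma finite_lists_lt: "finite {ks :: 'a::finite list. length ks < n}"
  by (rule finite_subset[OF _ finite_lists_length_le[of "UNIV :: 'a set" n]]) auto

text \<open>Since sin(lt)/l differs from t, every term of the series also disturbs higher Taylor
  coefficients in t. The coefficient of the next term is therefore not \<open>A n\<close> but the
  defect \<open>C n p\<close> that the partial sum so far leaves on the line t = 0. Compactness of
  \<open>K\<close> bounds these defects uniformly in the parameter.\<close>

theorem borel_with_parameter:
  fixes A :: "nat \<Rightarrow> real^2 \<Rightarrow> real"
  assumes W: "open W" and A: "\<And>n. smooth_fn W (A n)" and K: "compact K" "K \<subseteq> W"
    and V: "open V" "V \<subseteq> K"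
  obtains H where "smooth_fn V H"
    "\<And>n w. w \<in> V \<Longrightarrow> w $ 2 = 0 \<Longrightarrow> pd (replicate n 2) H w = fact n * A n w"
proof -
  define C where "C n p w = A n w - pd (replicate n 2) p w / fact n" for n p w
  define T where "T n p l w = C n p w * sine_power l n w" for n p l w
  have smC: "smooth_fn W (C n p)" if "smooth_fn W p" for n p
    unfolding C_def[abs_def] divide_inverse
    by (intro smooth_fn_diff smooth_fn_mult smooth_fn_const A W smooth_fn_pd that)
  have smT: "smooth_fn W (T n p l)" if "smooth_fn W p" for n p l
    unfolding T_def[abs_def] by (intro smooth_fn_mult W smC[OF that] smooth_sine_power)
  have step: "\<exists>l\<ge>1. \<forall>ks. length ks < n \<longrightarrow> (\<forall>w\<in>V. \<bar>pd ks (T n p l) w\<bar> \<le> (1/2) ^ n)"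
    if p: "smooth_fn W p" for n p
  proof -
    have "\<exists>b. \<forall>w\<in>K. \<bar>pd ls (C n p) w\<bar> \<le> b" for ls
    proof -
      have "continuous_on K (pd ls (C n p))"
        using smooth_fn_continuous[OF smooth_fn_pd[OF smC[OF p]]] K(2) continuous_on_subset by blast
      hence "bounded (pd ls (C n p) ` K)" using K(1) compact_continuous_image compact_imp_bounded by blast
      thus ?thesis by (auto simp: bounded_iff)
    qed
    then obtain b where b: "\<And>ls w. w \<in> K \<Longrightarrow> \<bar>pd ls (C n p) w\<bar> \<le> b ls" by metis
    define M where "M = (\<Sum>ls | length ls < n. \<bar>b ls\<bar>)"
    have bM: "\<bar>pd ls (C n p) w\<bar> \<le> M" if "w \<in> K" "length ls < n" for ls w
    proof -
      have "\<bar>b ls\<bar> \<le> M" unfolding M_def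
        by (rule member_le_sum[of ls]) (use that finite_lists_lt in auto)
      thus ?thesis using b[OF that(1), of ls] by linarith
    qed
    have M0: "0 \<le> M" unfolding M_def by (rule sum_nonneg) auto
    obtain B where B: "0 \<le> B"
      "\<And>l ks w. 1 \<le> l \<Longrightarrow> length ks < n \<Longrightarrow> \<bar>pd ks (sine_power l n) w\<bar> \<le> B / l"
      by (rule sine_power_facts[of n]) blast
    \<comment> \<open>The product estimate is at most 2^n M B / l, and the factor 4^n turns it into
      (1/2)^n. The summand 1 secures that \<open>l\<close> is at least 1 even if M B is 0.\<close>
    define l where "l = 1 + 4 ^ n * (M * B)"
    have l: "1 \<le> l" "4 ^ n * (M * B) \<le> l" using M0 B by (auto simp: l_def)
    have "\<bar>pd ks (T n p l) w\<bar> \<le> (1/2) ^ n" if "length ks < n" "w \<in> V" for ks w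
    proof -
      have "\<bar>pd ks (T n p l) w\<bar> \<le> 2 ^ length ks * (M * (B / l))"
        unfolding T_def[abs_def]
        by (rule pd_mult_bound[OF W smC[OF p] smooth_sine_power])
           (use that V K l B M0 bM in auto)
      also have "\<dots> \<le> 2 ^ n * (M * (B / l))"
        using that M0 B l by (intro mult_right_mono power_increasing) auto
      also have "\<dots> \<le> (1/2) ^ n"
      proof -
        have "(2::real) ^ n * 2 ^ n = 4 ^ n" by (simp flip: power_mult_distrib)
        hence "2 ^ n * (M * B) * 2 ^ n \<le> l" using l(2) by (simp add: mult_ac)
        thus ?thesis using l(1) by (simp add: power_one_over field_simps)
      qed
      finally show ?thesis .
    qed
    thus ?thesis using l(1) by blast
  qed
  \<comment> \<open>Frequencies and partial sums are chosen together: the admissible frequency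
    depends on the defect, which depends on all earlier terms.\<close>
  have "\<exists>P. \<forall>n. (smooth_fn W (P n) \<and> (n = 0 \<longrightarrow> P n = (\<lambda>w. 0))) \<and>
     (\<exists>l\<ge>1. P (Suc n) = (\<lambda>w. P n w + T n (P n) l w) \<and>
        (\<forall>ks. length ks < n \<longrightarrow> (\<forall>w\<in>V. \<bar>pd ks (T n (P n) l) w\<bar> \<le> (1/2) ^ n)))"
  proof (rule dependent_nat_choice)
    show "\<exists>p. smooth_fn W p \<and> ((0::nat) = 0 \<longrightarrow> p = (\<lambda>w. 0))"
      by (intro exI[of _ "\<lambda>w. 0"]) (auto intro: smooth_fn_const W)
    fix p and n :: nat assume p: "smooth_fn W p \<and> (n = 0 \<longrightarrow> p = (\<lambda>w. 0))"
    then obtain l where "l \<ge> 1" "\<forall>ks. length ks < n \<longrightarrow> (\<forall>w\<in>V. \<bar>pd ks (T n p l) w\<bar> \<le> (1/2) ^ n)"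
      using step by blast
    thus "\<exists>q. (smooth_fn W q \<and> (Suc n = 0 \<longrightarrow> q = (\<lambda>w. 0))) \<and>
      (\<exists>l\<ge>1. q = (\<lambda>w. p w + T n p l w) \<and>
        (\<forall>ks. length ks < n \<longrightarrow> (\<forall>w\<in>V. \<bar>pd ks (T n p l) w\<bar> \<le> (1/2) ^ n)))"
      using p by (intro exI[of _ "\<lambda>w. p w + T n p l w"]) (auto intro: smooth_fn_add W smT)
  qed
  then obtain P where P: "\<And>n. smooth_fn W (P n)" "P 0 = (\<lambda>w. 0)"
     "\<And>n. \<exists>l\<ge>1. P (Suc n) = (\<lambda>w. P n w + T n (P n) l w) \<and>
        (\<forall>ks. length ks < n \<longrightarrow> (\<forall>w\<in>V. \<bar>pd ks (T n (P n) l) w\<bar> \<le> (1/2) ^ n))" by blast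
  then obtain l where l: "\<And>n. 1 \<le> l n" "\<And>n. P (Suc n) = (\<lambda>w. P n w + T n (P n) (l n) w)"
     "\<And>n ks w. length ks < n \<Longrightarrow> w \<in> V \<Longrightarrow> \<bar>pd ks (T n (P n) (l n)) w\<bar> \<le> (1/2) ^ n" by metis
  define S where "S n = T n (P n) (l n)" for n
  have PS: "P n = (\<lambda>w. \<Sum>i<n. S i w)" for n
    by (induction n) (auto simp: P(2) l(2) S_def)
  have VW: "V \<subseteq> W" using V K by auto
  have smS: "smooth_fn V (S n)" for n
    unfolding S_def by (rule smooth_fn_subset[OF smT[OF P(1)] VW])
  have bS: "\<bar>pd ks (S n) w\<bar> \<le> (1/2) ^ n" if "length ks < n" "w \<in> V" for n ks w
    using l(3)[OF that] by (simp add: S_def)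
  show ?thesis
  proof (rule that[of "\<lambda>w. \<Sum>n. S n w"])
    show "smooth_fn V (\<lambda>w. \<Sum>n. S n w)" by (rule smooth_fn_suminf(1)[OF V(1) smS bS])
    fix n w assume w: "w \<in> V" "w $ 2 = 0"
    \<comment> \<open>On the line, terms of index above \<open>n\<close> do not reach the
      \<open>n\<close>-th derivative, and the term of index \<open>n\<close> supplies exactly the
      defect of \<open>P n\<close>.\<close>
    have Sm: "pd (replicate n 2) (S m) w = (if m = n then fact n * C n (P n) w else 0)" if "n \<le> m" for m
      using pd2_mult_sine_power[OF W smC[OF P(1), of m m] _ w(2) _ that, of "l m"] w(1) VW l(1)[of m]
      by (auto simp: S_def T_def[abs_def])
    have "pd (replicate n 2) (\<lambda>w. \<Sum>n. S n w) w = (\<Sum>m. pd (replicate n 2) (S m) w)"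
      by (rule smooth_fn_suminf(2)[OF V(1) smS bS w(1)])
    also have "\<dots> = (\<Sum>m<Suc n. pd (replicate n 2) (S m) w)"
      by (rule suminf_finite) (use Sm in auto)
    also have "\<dots> = pd (replicate n 2) (P n) w + fact n * C n (P n) w"
      using pd_sum_on[where f = S and n = n and ks = "replicate n 2", OF V(1) smS w(1)] Sm[of n] by (simp add: PS)
    also have "\<dots> = fact n * A n w" by (simp add: C_def field_simps)
    finally show "pd (replicate n 2) (\<lambda>w. \<Sum>n. S n w) w = fact n * A n w" .
  qed
qed

text \<open>Moving along the first axis stays on the line v = 0, so values on that line determine
  all pure u-derivatives there.\<close>

lemma pd1_cong_line:
  assumes "\<And>w. w \<in> U \<Longrightarrow> w $ 2 = 0 \<Longrightarrow> f w = g (w::real^2)" "open U" "w \<in> U" "w $ 2 = 0"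
  shows "pd (replicate n 1) f w = pd (replicate n 1) g w"
  using assms(3,4)
proof (induction n arbitrary: w)
  case (Suc n)
  let ?f = "pd (replicate n 1) f" and ?g = "pd (replicate n 1) g"
  have ev: "\<forall>\<^sub>F t in nhds 0. ?f (w + t *\<^sub>R axis 1 1) = ?g (w + t *\<^sub>R axis 1 1)"
    using eventually_along_axis[OF assms(2) Suc.prems(1), of 1]
    by eventually_elim (use Suc in \<open>auto simp: axis_def\<close>)
  have "((\<lambda>t. ?f (w + t *\<^sub>R axis 1 1)) has_real_derivative d) (at 0) \<longleftrightarrow>
     ((\<lambda>t. ?g (w + t *\<^sub>R axis 1 1)) has_real_derivative d) (at 0)" for d
    by (rule DERIV_cong_ev[OF refl ev refl])
  thus ?case by (simp add: pd_Cons partial_def deriv_def)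
qed (use assms in auto)

text \<open>Two rounds of the preceding theorem: for each \<open>j\<close> a function of one
  variable with Taylor coefficients \<open>c i j\<close>, and then a function whose expansion in v
  has these functions of u as coefficients.\<close>

theorem borel_2d:
  obtains h where "sg h" "\<And>i j. tc h i j = c i j"
proof -
  have "\<exists>h. smooth_fn (ball (0::real^2) 1) h \<and> (\<forall>n. pd (replicate n 2) h 0 = fact n * c n j)" for j
    by (rule borel_with_parameter[of UNIV "\<lambda>n w. c n j" "cball 0 1" "ball 0 1"])
       (auto intro: smooth_fn_const)
  hence "\<exists>h. \<forall>j. smooth_fn (ball (0::real^2) 1) (h j) \<and>
     (\<forall>n. pd (replicate n 2) (h j) 0 = fact n * c n j)" by (intro choice allI)
  then obtain h :: "nat \<Rightarrow> real^2 \<Rightarrow> real" where h: "\<And>j. smooth_fn (ball 0 1) (h j)"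
    "\<And>j n. pd (replicate n 2) (h j) 0 = fact n * c n j" by blast
  \<comment> \<open>The parameter theorem prescribes derivatives in the second variable; composing
    with \<open>sw\<close> turns them into derivatives in u.\<close>
  define sw :: "real^2 \<Rightarrow> real^2" where "sw = pairm (\<lambda>w. 0) (\<lambda>w. w $ 1)"
  have sw: "smooth_map (ball 0 1) sw"
    unfolding sw_def pairm_def[abs_def]
    by (intro smooth_map_vec2 smooth_fn_const smooth_fn_proj) auto
  have swb: "sw w \<in> ball 0 1" if "w \<in> ball 0 1" for w
  proof -
    have "norm (sw w) \<le> norm w"
      unfolding sw_def norm_vec_def L2_set_def by (simp add: sum_2)
    thus ?thesis using that by simp
  qed
  have ob: "open (ball 0 1 :: (real^2) set)" by simp
  define G where "G j w = h j (sw w)" for j w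
  have smG: "smooth_fn (ball 0 1) (G j)" for j
    unfolding G_def[abs_def] by (rule smooth_fn_compose[OF ob ob h(1) sw swb])
  have G: "pd (replicate n 1) (G j) w = pd (replicate n 2) (h j) (sw w)" if "w \<in> ball 0 1" for n j w
    using that
  proof (induction n arbitrary: w)
    case (Suc n)
    have "pd (replicate (Suc n) 1) (G j) w = partial 1 (\<lambda>w. pd (replicate n 2) (h j) (sw w)) w"
      unfolding replicate_Suc pd_Cons
      by (rule partial_cong) (use Suc in \<open>auto simp: eventually_nhds intro!: exI[of _ "ball 0 1"]\<close>)
    also have "\<dots> = partial 2 (pd (replicate n 2) (h j)) (sw w)"
      using partial_compose2[OF ob ob smooth_fn_pd[OF h(1)] sw Suc.prems swb[OF Suc.prems], of 1 "replicate n 2" j]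
      by (simp add: sw_def partial_proj_fun)
    finally show ?case by (simp add: pd_Cons)
  qed (simp add: G_def)
  obtain H where H: "smooth_fn (ball 0 (1/2)) H"
    "\<And>n w. w \<in> ball 0 (1/2) \<Longrightarrow> w $ 2 = 0 \<Longrightarrow> pd (replicate n 2) H w = fact n * G n w"
    by (rule borel_with_parameter[of "ball 0 1" G "cball 0 (1/2)" "ball 0 (1/2)"]) (auto simp: smG)
  have "tc H i j = c i j" for i j
  proof -
    have "pd (replicate i 1) (pd (replicate j 2) H) 0 = pd (replicate i 1) (\<lambda>w. fact j * G j w) 0"
      by (rule pd1_cong_line[of "ball 0 (1/2)"]) (use H(2) in auto)
    also have "\<dots> = tc (\<lambda>w. fact j * G j w) i 0 * fact i" by (simp add: tc_def)
    also have "sg (G j)" using smG by (intro sgI[of "ball 0 1"]) auto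
    hence "tc (\<lambda>w. fact j * G j w) i 0 = fact j * tc (G j) i 0" by simp
    also have "tc (G j) i 0 = c i j"
      using G[of 0 i j] by (simp add: tc_def sw_def pairm_0 h(2))
    finally show ?thesis by (simp add: tc_def pd_append)
  qed
  thus ?thesis using that[of H] H(1) sgI[of "ball 0 (1/2)" H] by auto
qed

text \<open>The coefficient at u^i v^j no longer changes from index i + j + 1 on, and Borel's
  theorem realises the array of stable values.\<close>

theorem germ_completeness:
  assumes "\<And>n. sg (x n)" "\<And>n. vo n (\<lambda>w. x (Suc n) w - x n w)"
  obtains y where "sg y" "\<And>n. vo n (\<lambda>w. y w - x n w)"
proof -
  obtain y where y: "sg y" "\<And>i j. tc y i j = tc (x (Suc (i + j))) i j"
    by (rule borel_2d[of "\<lambda>i j. tc (x (Suc (i + j))) i j"]) blast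
  have st: "tc (x (Suc (i + j) + m)) i j = tc (x (Suc (i + j))) i j" for i j m
  proof (induction m)
    case (Suc m)
    let ?n = "Suc (i + j) + m"
    have "tc (\<lambda>w. x (Suc ?n) w - x ?n w) i j = 0"
      using assms by (intro vo_tcD[of _ ?n]) auto
    thus ?case using Suc assms(1) by simp
  qed auto
  have "vo n (\<lambda>w. y w - x n w)" for n
  proof (subst vo_iff_tc)
    have "tc (x n) i j = tc (x (Suc (i + j))) i j" if "i + j < n" for i j
      using st[of i j "n - Suc (i + j)"] that by simp
    thus "\<forall>i j. i + j < n \<longrightarrow> tc (\<lambda>w. y w - x n w) i j = 0" using assms y by simp
  qed (use assms y in auto)
  thus ?thesis using that y by blast
qed

subsection \<open>Whitney's parity theorem with a parameter\<close>

definition box2 :: "real \<Rightarrow> (real^2) set" where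
  "box2 e = {w. \<bar>w $ 1\<bar> < e \<and> \<bar>w $ 2\<bar> < e}"

lemma open_box2: "open (box2 e)"
  unfolding box2_def by (intro open_Collect_conj open_Collect_less continuous_intros)

lemma box2_subset_nbhd:
  assumes "open U" "0 \<in> U"
  obtains e where "0 < e" "e < 1" "box2 e \<subseteq> U"
proof -
  obtain r where r: "r > 0" "ball 0 r \<subseteq> U" using assms openE by blast
  define e where "e = min (r / 2) (1 / 2)"
  have "box2 e \<subseteq> ball 0 r"
  proof
    fix w assume w: "w \<in> box2 e"
    have "norm w \<le> \<bar>w $ 1\<bar> + \<bar>w $ 2\<bar>" using norm_le_l1_cart[of w] by (simp add: sum_2)
    also have "\<dots> < r" using w by (auto simp: box2_def e_def)
    finally show "w \<in> ball 0 r" by simp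
  qed
  thus ?thesis using that[of e] r by (auto simp: e_def)
qed

lemma compact_cbox2: "compact {w::real^2. \<bar>w $ 1\<bar> \<le> e \<and> \<bar>w $ 2\<bar> \<le> e}"
proof -
  have "{w::real^2. \<bar>w $ 1\<bar> \<le> e \<and> \<bar>w $ 2\<bar> \<le> e} = cbox (vector [-e, -e]) (vector [e, e])"
    by (auto simp: mem_box_cart forall_2 abs_le_iff)
  thus ?thesis by simp
qed

abbreviation (input) D2n :: "nat \<Rightarrow> (real^2 \<Rightarrow> real) \<Rightarrow> real^2 \<Rightarrow> real" where
  "D2n m h \<equiv> pd (replicate m 2) h"

lemma D2n_Suc: "D2n (Suc m) h = D2n m (partial 2 h)"
  unfolding replicate_Suc replicate_append_same[symmetric] pd_append pd_Cons by simp

lemma pd_cmult_on: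
  fixes f :: "real^'n::finite \<Rightarrow> real"
  assumes "open U" "smooth_fn U f" "x \<in> U"
  shows "pd ks (\<lambda>w. c * f w) x = c * pd ks f x"
  using assms(3)
proof (induction ks arbitrary: x)
  case (Cons k ks)
  have "partial k (pd ks (\<lambda>w. c * f w)) x = partial k (\<lambda>w. c * pd ks f w) x"
    by (rule partial_cong) (use Cons assms(1) in \<open>auto simp: eventually_nhds\<close>)
  also have "\<dots> = c * partial k (pd ks f) x"
    using smooth_fn_axis_deriv[OF assms(2) Cons.prems] by (intro partial_eqI DERIV_cmult)
  finally show ?case by (simp add: pd_Cons)
qed auto

lemma D2n_mult_second:
  assumes "open U" "smooth_fn U h" "w \<in> U"
  shows "D2n m (\<lambda>w. w $ 2 * h w) w = w $ 2 * D2n m h w + real m * D2n (m - 1) h w"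
  using assms(2)
proof (induction m arbitrary: h)
  case (Suc m)
  have sm: "smooth_fn U (\<lambda>w. w $ 2 * partial 2 h w)" "smooth_fn U (partial 2 h)"
    using smooth_fn_partial[OF Suc.prems] assms(1) by (auto intro: smooth_fn_mult smooth_fn_proj)
  have "D2n (Suc m) (\<lambda>w. w $ 2 * h w) w = D2n m (\<lambda>w. w $ 2 * partial 2 h w + h w) w"
    unfolding D2n_Suc
    by (rule pd_cong_on[OF assms(1) _ assms(3)])
       (simp add: partial_mult_on[OF smooth_fn_proj[OF assms(1)] Suc.prems] partial_proj_fun)
  also have "\<dots> = D2n m (\<lambda>w. w $ 2 * partial 2 h w) w + D2n m h w"
    by (rule pd_add_on[OF assms(1) sm(1) Suc.prems assms(3)])
  also have "\<dots> = w $ 2 * D2n m (partial 2 h) w + real m * D2n (m - 1) (partial 2 h) w + D2n m h w"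
    using Suc.IH[OF sm(2)] by simp
  also have "real m * D2n (m - 1) (partial 2 h) w = real m * D2n m h w"
    by (cases m) (auto simp: D2n_Suc simp del: replicate_Suc)
  finally show ?case by (simp add: D2n_Suc algebra_simps del: replicate_Suc)
qed simp

definition sq2 :: "real^2 \<Rightarrow> real^2" where
  "sq2 = pairm (\<lambda>w. w $ 1) (\<lambda>w. (w $ 2)\<^sup>2)"

lemma sq2_nth [simp]: "sq2 w $ 1 = w $ 1" "sq2 w $ 2 = (w $ 2)\<^sup>2"
  by (simp_all add: sq2_def)

lemma smooth_map_sq2: "open U \<Longrightarrow> smooth_map U sq2"
  unfolding sq2_def pairm_def[abs_def] by (intro smooth_map_vec2 smooth_fn_power smooth_fn_proj)

lemma sq2_box2: 
  assumes "w \<in> box2 e" "e < 1"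
  shows "sq2 w \<in> box2 e"
proof -
  have "\<bar>w $ 2\<bar> * \<bar>w $ 2\<bar> \<le> \<bar>w $ 2\<bar> * 1" using assms by (intro mult_left_mono) (auto simp: box2_def)
  thus ?thesis using assms by (auto simp: box2_def power2_eq_square abs_mult)
qed

text \<open>Substituting v^2 moves the coefficient of v^n to v^(2n). The resulting quotient (2n)!/n!
  is kept in multiplied form, so that the recursion needs no division.\<close>

lemma D2n_sq2:
  assumes e: "e < 1" and K: "smooth_fn (box2 e) K" and w: "w \<in> box2 e" "w $ 2 = 0"
  shows "fact n * D2n (2 * n) (\<lambda>w. K (sq2 w)) w = fact (2 * n) * D2n n K w"
    and "D2n (Suc (2 * n)) (\<lambda>w. K (sq2 w)) w = 0"
proof -
  have sc: "smooth_fn (box2 e) (\<lambda>w. K (sq2 w))" if "smooth_fn (box2 e) K" for K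
    by (rule smooth_fn_compose[OF open_box2 open_box2 that smooth_map_sq2[OF open_box2]])
       (use sq2_box2 e in blast)
  have d: "partial 2 (\<lambda>w. K (sq2 w)) x = x $ 2 * (2 * partial 2 K (sq2 x))"
    if "x \<in> box2 e" "smooth_fn (box2 e) K" for x K
  proof -
    have "partial 2 (\<lambda>w. (w $ 2)\<^sup>2) x = 2 * x $ 2"
      by (rule partial_eqI) (auto intro!: derivative_eq_intros)
    thus ?thesis
      using partial_compose2[OF open_box2 open_box2 that(2) smooth_map_sq2[OF open_box2] that(1)
          sq2_box2[OF that(1) e], of 2]
      by (simp add: partial_proj_fun)
  qed
  have rec0: "D2n (Suc m) (\<lambda>w. K (sq2 w)) w = 2 * real m * D2n (m - 1) (\<lambda>w. partial 2 K (sq2 w)) w"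
    if "smooth_fn (box2 e) K" for m K
  proof -
    note s = sc[OF smooth_fn_partial[OF that, of 2]]
    have "D2n (Suc m) (\<lambda>w. K (sq2 w)) w = D2n m (\<lambda>w. w $ 2 * (2 * partial 2 K (sq2 w))) w"
      unfolding D2n_Suc by (rule pd_cong_on[OF open_box2 d[OF _ that] w(1)])
    also have "\<dots> = real m * D2n (m - 1) (\<lambda>w. 2 * partial 2 K (sq2 w)) w"
      by (subst D2n_mult_second[OF open_box2 smooth_fn_mult[OF open_box2 smooth_fn_const[OF open_box2] s] w(1)])
        (simp add: w)
    finally show ?thesis by (simp add: pd_cmult_on[OF open_box2 s w(1)])
  qed
  have w0: "sq2 w = w" using w(2) by (simp add: vec_eq_iff forall_2)
  show "fact n * D2n (2 * n) (\<lambda>w. K (sq2 w)) w = fact (2 * n) * D2n n K w"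
    using K
  proof (induction n arbitrary: K)
    case (Suc n)
    have "fact (Suc n) * D2n (2 * Suc n) (\<lambda>w. K (sq2 w)) w =
      fact (Suc n) * (2 * real (Suc (2 * n)) * D2n (2 * n) (\<lambda>w. partial 2 K (sq2 w)) w)"
      using rec0[OF Suc.prems, of "Suc (2 * n)"] by simp
    also have "\<dots> = 2 * real (Suc n) * real (Suc (2 * n)) * 
       (fact n * D2n (2 * n) (\<lambda>w. partial 2 K (sq2 w)) w)"
      by (simp add: algebra_simps)
    also have "fact n * D2n (2 * n) (\<lambda>w. partial 2 K (sq2 w)) w = fact (2 * n) * D2n (Suc n) K w"
      using Suc.IH[OF smooth_fn_partial[OF Suc.prems]] by (simp only: D2n_Suc)
    finally show ?case by (simp del: replicate_Suc add: algebra_simps)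
  qed (simp add: w0)
  show "D2n (Suc (2 * n)) (\<lambda>w. K (sq2 w)) w = 0"
    using K
  proof (induction n arbitrary: K)
    case 0
    thus ?case using rec0[of K 0] by simp
  next
    case (Suc n)
    have "D2n (Suc (2 * n)) (\<lambda>w. partial 2 K (sq2 w)) w = 0"
      using Suc.IH[OF smooth_fn_partial[OF Suc.prems]] .
    thus ?case using rec0[OF Suc.prems, of "2 * Suc n"] by simp
  qed
qed

section \<open>Functions flat along a line and the square-root substitution\<close>

definition line_flat :: "real \<Rightarrow> (real^2 \<Rightarrow> real) \<Rightarrow> bool" where
  "line_flat e h \<longleftrightarrow> smooth_fn (box2 e) h \<and> (\<forall>w\<in>box2 e. w $ 2 = 0 \<longrightarrow> (\<forall>m. D2n m h w = 0))"

lemma line_flat_partial_2: "line_flat e h \<Longrightarrow> line_flat e (partial 2 h)"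
  unfolding line_flat_def by (metis D2n_Suc smooth_fn_partial)

lemma pd_partial_commute_on:
  fixes h :: "real^'n::finite \<Rightarrow> real"
  assumes "open U" "smooth_fn U h" "x \<in> U"
  shows "pd ks (partial k h) x = partial k (pd ks h) x"
  using assms(3)
proof (induction ks arbitrary: x)
  case (Cons l ks)
  have "partial l (pd ks (partial k h)) x = partial l (partial k (pd ks h)) x"
    by (rule partial_cong) (use Cons assms(1) in \<open>auto simp: eventually_nhds\<close>)
  thus ?case
    using smooth_fn_partial_commute[OF assms(1) smooth_fn_pd[OF assms(2)] Cons.prems, of l k ks]
    by (simp add: pd_Cons)
qed auto

lemma line_flat_partial_1:
  assumes "line_flat e h"
  shows "line_flat e (partial 1 h)"
  unfolding line_flat_def
proof (intro conjI ballI impI allI)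
  show "smooth_fn (box2 e) (partial 1 h)" using assms smooth_fn_partial by (auto simp: line_flat_def)
  fix w m assume w: "w \<in> box2 e" "w $ 2 = 0"
  have "D2n m (partial 1 h) w = pd (replicate 1 1) (D2n m h) w"
    using pd_partial_commute_on[OF open_box2 _ w(1)] assms by (auto simp: line_flat_def pd_Cons)
  also have "\<dots> = pd (replicate 1 1) (\<lambda>w. 0) w"
    by (rule pd1_cong_line[OF _ open_box2 w]) (use assms in \<open>auto simp: line_flat_def\<close>)
  finally show "D2n m (partial 1 h) w = 0" by (simp add: pd_zero)
qed

definition refl2 :: "real^2 \<Rightarrow> real^2" where
  "refl2 = pairm (\<lambda>w. w $ 1) (\<lambda>w. - w $ 2)"

lemma refl2_nth [simp]: "refl2 w $ 1 = w $ 1" "refl2 w $ 2 = - w $ 2"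
  by (simp_all add: refl2_def)

lemma line_flat_refl2:
  assumes "line_flat e h"
  shows "line_flat e (\<lambda>w. h (refl2 w))"
proof -
  have sm: "smooth_map (box2 e) refl2"
    unfolding refl2_def pairm_def[abs_def]
    by (intro smooth_map_vec2 smooth_fn_minus smooth_fn_proj open_box2)
  have rb: "refl2 w \<in> box2 e" if "w \<in> box2 e" for w using that by (simp add: box2_def)
  have h: "smooth_fn (box2 e) h" using assms by (simp add: line_flat_def)
  have p: "partial 2 (\<lambda>w. - w $ 2) w = - 1" for w :: "real^2"
    by (rule partial_eqI) (auto intro!: derivative_eq_intros)
  have "D2n m (\<lambda>w. h (refl2 w)) w = (-1) ^ m * D2n m h (refl2 w)" if "w \<in> box2 e" for m w
    using that
  proof (induction m arbitrary: w)
    case (Suc m)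
    have sh: "smooth_fn (box2 e) (\<lambda>w. D2n m h (refl2 w))"
      by (rule smooth_fn_compose[OF open_box2 open_box2 smooth_fn_pd[OF h] sm rb])
    have "D2n (Suc m) (\<lambda>w. h (refl2 w)) w = partial 2 (\<lambda>w. (-1) ^ m * D2n m h (refl2 w)) w"
      unfolding replicate_Suc pd_Cons
      by (rule partial_cong) (use Suc open_box2 in \<open>auto simp: eventually_nhds\<close>)
    also have "\<dots> = (-1) ^ m * partial 2 (\<lambda>w. D2n m h (refl2 w)) w"
      using smooth_fn_axis_deriv[OF sh Suc.prems, of "[]"] by (intro partial_eqI DERIV_cmult) simp
    also have "partial 2 (\<lambda>w. D2n m h (refl2 w)) w = - partial 2 (D2n m h) (refl2 w)"
      using partial_compose2[OF open_box2 open_box2 smooth_fn_pd[OF h] sm Suc.prems rb[OF Suc.prems], of 2]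
      by (simp add: p partial_proj_fun)
    finally show ?case by (simp add: pd_Cons)
  qed simp
  moreover have "refl2 w = w" if "w $ 2 = 0" for w using that by (simp add: vec_eq_iff forall_2)
  moreover have "smooth_fn (box2 e) (\<lambda>w. h (refl2 w))"
    by (rule smooth_fn_compose[OF open_box2 open_box2 h sm rb])
  ultimately show ?thesis using assms by (auto simp: line_flat_def)
qed

lemma line_flat_lincomb:
  assumes "line_flat e f" "line_flat e g"
  shows "line_flat e (\<lambda>w. a * f w + b * g w)"
proof -
  note s = assms[THEN conjunct1[OF line_flat_def[THEN iffD1]]]
  have s': "smooth_fn (box2 e) (\<lambda>w. a * f w)" "smooth_fn (box2 e) (\<lambda>w. b * g w)"
    by (intro smooth_fn_mult smooth_fn_const open_box2 s)+
  show ?thesis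
    using assms pd_add_on[OF open_box2 s'] pd_cmult_on[OF open_box2 s(1)] pd_cmult_on[OF open_box2 s(2)]
      smooth_fn_add[OF open_box2 s']
    by (simp add: line_flat_def)
qed

text \<open>Induction on \<open>N\<close>: a bound on the v-derivative, fed into the mean value
  theorem starting from the line v = 0, gains one power of v.\<close>

lemma line_flat_bound:
  assumes "line_flat e h" "0 \<le> d" "d < e"
  shows "\<exists>C\<ge>0. \<forall>w. \<bar>w $ 1\<bar> \<le> d \<longrightarrow> 0 \<le> w $ 2 \<longrightarrow> w $ 2 \<le> d \<longrightarrow> \<bar>h w\<bar> \<le> C * (w $ 2) ^ N"
  using assms(1)
proof (induction N arbitrary: h)
  case 0
  let ?K = "{w::real^2. \<bar>w $ 1\<bar> \<le> d \<and> \<bar>w $ 2\<bar> \<le> d}"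
  have "?K \<subseteq> box2 e" using assms(3) by (auto simp: box2_def)
  moreover have "continuous_on (box2 e) h" using 0 smooth_fn_continuous[of "box2 e" h] by (simp add: line_flat_def)
  ultimately have "continuous_on ?K h" using continuous_on_subset by blast
  hence "bounded (h ` ?K)" using compact_cbox2 compact_continuous_image compact_imp_bounded by blast
  then obtain C where C: "\<forall>w\<in>?K. \<bar>h w\<bar> \<le> C" by (auto simp: bounded_iff)
  have "\<bar>h 0\<bar> \<le> C" using C assms(2) by auto
  hence "C \<ge> 0" by linarith
  thus ?case using C by (intro exI[of _ C]) auto
next
  case (Suc N)
  from Suc.IH[OF line_flat_partial_2[OF Suc.prems]] obtain C where C: "C \<ge> 0"
    "\<And>w. \<bar>w $ 1\<bar> \<le> d \<Longrightarrow> 0 \<le> w $ 2 \<Longrightarrow> w $ 2 \<le> d \<Longrightarrow> \<bar>partial 2 h w\<bar> \<le> C * (w $ 2) ^ N" by blast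
  have "\<bar>h w\<bar> \<le> C * (w $ 2) ^ Suc N" if w: "\<bar>w $ 1\<bar> \<le> d" "0 \<le> w $ 2" "w $ 2 \<le> d" for w
  proof -
    define v where "v = w - (w $ 2) *\<^sub>R axis 2 1"
    have v: "v $ 1 = w $ 1" "v $ 2 = 0" by (auto simp: v_def axis_def)
    have vt: "v + t *\<^sub>R axis 2 1 \<in> box2 e" if "0 \<le> t" "t \<le> w $ 2" for t
      using that w assms by (auto simp: box2_def v axis_def)
    have h0: "h v = 0"
      using Suc.prems vt[of 0] w v by (auto simp: line_flat_def dest!: bspec[of _ _ v] spec[of _ 0])
    show ?thesis
    proof (cases "w $ 2 = 0")
      case True
      hence "v = w" by (simp add: v_def)
      thus ?thesis using h0 True by simp
    next
      case False
      hence "0 < w $ 2" using w by simp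
      have D: "((\<lambda>t. h (v + t *\<^sub>R axis 2 1)) has_real_derivative
          partial 2 h (v + t *\<^sub>R axis 2 1)) (at t)" if "0 \<le> t" "t \<le> w $ 2" for t
        using Suc.prems vt[OF that] by (intro smooth_fn_line_deriv) (auto simp: line_flat_def)
      from MVT2[OF \<open>0 < w $ 2\<close> D] obtain z where z: "0 < z" "z < w $ 2"
        "h (v + (w $ 2) *\<^sub>R axis 2 1) - h (v + 0 *\<^sub>R axis 2 1) =
          (w $ 2 - 0) * partial 2 h (v + z *\<^sub>R axis 2 1)" by auto
      have "\<bar>partial 2 h (v + z *\<^sub>R axis 2 1)\<bar> \<le> C * z ^ N"
        using C(2)[of "v + z *\<^sub>R axis 2 1"] z w v by (simp add: axis_def)
      also have "\<dots> \<le> C * (w $ 2) ^ N" using z C(1) by (intro mult_left_mono power_mono) auto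
      finally have "w $ 2 * \<bar>partial 2 h (v + z *\<^sub>R axis 2 1)\<bar> \<le> w $ 2 * (C * (w $ 2) ^ N)"
        using w by (intro mult_left_mono) auto
      moreover have "\<bar>h w\<bar> = w $ 2 * \<bar>partial 2 h (v + z *\<^sub>R axis 2 1)\<bar>"
        using z(3) h0 w by (simp add: v_def abs_mult)
      ultimately show ?thesis by (simp add: mult_ac)
    qed
  qed
  thus ?case using C(1) by blast
qed

text \<open>Each derivative in the second variable costs two powers of the square root; \<open>m\<close> counts them.\<close>
definition root_glue :: "nat \<Rightarrow> (real^2 \<Rightarrow> real) \<Rightarrow> real^2 \<Rightarrow> real" where
  "root_glue m h w = (if w $ 2 > 0 then h (vector [w $ 1, sqrt (w $ 2)]) / sqrt (w $ 2) ^ m else 0)"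

lemma deriv_zero_quadratic:
  assumes "\<forall>\<^sub>F t in nhds 0. \<bar>f t\<bar> \<le> C * t\<^sup>2"
  shows "(f has_real_derivative 0) (at 0)"
proof -
  have f0: "f 0 = 0" using eventually_nhds_x_imp_x[OF assms] by simp
  have "\<forall>\<^sub>F t in at 0. \<bar>f t\<bar> \<le> C * t\<^sup>2" using assms by (simp add: eventually_nhds_conv_at)
  hence ev: "\<forall>\<^sub>F t in at 0. norm (f t / t) \<le> C * \<bar>t\<bar>"
  proof eventually_elim
    case (elim t)
    have "C * t\<^sup>2 = C * \<bar>t\<bar> * \<bar>t\<bar>" by (simp add: power2_eq_square mult.assoc flip: abs_mult)
    thus ?case using elim by (cases "t = 0") (auto simp: divide_le_eq)
  qed
  have "((\<lambda>t::real. C * \<bar>t\<bar>) \<longlongrightarrow> C * \<bar>0\<bar>) (at 0)" by (intro tendsto_intros)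
  hence "((\<lambda>t. f t / t) \<longlongrightarrow> 0) (at 0)" using Lim_null_comparison[OF ev] by simp
  thus ?thesis by (simp add: DERIV_def f0)
qed

text \<open>Flatness is used with m + 2N powers: after the square-root substitution m of them cancel
  the denominator, and the remaining 2N become the N-th power of v.\<close>

lemma root_glue_bound:
  assumes "line_flat e h" "0 < d" "d < e"
  shows "\<exists>C\<ge>0. \<forall>w. \<bar>w $ 1\<bar> \<le> d \<longrightarrow> w $ 2 \<le> d\<^sup>2 \<longrightarrow> \<bar>root_glue m h w\<bar> \<le> C * \<bar>w $ 2\<bar> ^ N"
proof -
  obtain C where C: "C \<ge> 0" "\<And>w. \<bar>w $ 1\<bar> \<le> d \<Longrightarrow> 0 \<le> w $ 2 \<Longrightarrow> w $ 2 \<le> d \<Longrightarrow> \<bar>h w\<bar> \<le> C * (w $ 2) ^ (m + 2 * N)"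
    using line_flat_bound[OF assms(1), of d "m + 2 * N"] assms by auto
  have "\<bar>root_glue m h w\<bar> \<le> C * \<bar>w $ 2\<bar> ^ N" if w: "\<bar>w $ 1\<bar> \<le> d" "w $ 2 \<le> d\<^sup>2" for w
  proof (cases "w $ 2 > 0")
    case True
    have "sqrt (w $ 2) \<le> d" using w assms(2) real_sqrt_le_mono[of "w $ 2" "d\<^sup>2"] by simp
    hence "\<bar>h (vector [w $ 1, sqrt (w $ 2)])\<bar> \<le> C * sqrt (w $ 2) ^ (m + 2 * N)"
      using C(2)[of "vector [w $ 1, sqrt (w $ 2)]"] w True by simp
    also have "sqrt (w $ 2) ^ (m + 2 * N) = sqrt (w $ 2) ^ m * (w $ 2) ^ N"
      using True by (simp add: power_add power_mult)
    finally show ?thesis using True by (simp add: root_glue_def field_simps abs_mult)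
  qed (use C in \<open>auto simp: root_glue_def\<close>)
  thus ?thesis using C(1) by blast
qed

lemma vec2_axis: "vector [a, b] + t *\<^sub>R axis 1 1 = (vector [a + t, b] :: real^2)"
  "vector [a, b] + t *\<^sub>R axis 2 1 = (vector [a, b + t] :: real^2)"
  by (simp_all add: vec_eq_iff forall_2 axis_def)

lemma axis2_nth [simp]: "axis 1 (1::real) $ (1::2) = 1" "axis 1 (1::real) $ (2::2) = 0"
  "axis 2 (1::real) $ (1::2) = 0" "axis 2 (1::real) $ (2::2) = 1"
  by (simp_all add: axis_def)

lemma root_glue_deriv_1:
  assumes h: "line_flat e h" and d: "0 < d" "d < e" and w: "\<bar>w $ 1\<bar> < d" "w $ 2 < d\<^sup>2"
  shows "((\<lambda>t. root_glue m h (w + t *\<^sub>R axis 1 1)) has_real_derivative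
     root_glue m (partial 1 h) w) (at 0)"
proof (cases "w $ 2 > 0")
  case True
  have "sqrt (w $ 2) < d" using w True d real_sqrt_less_mono[of "w $ 2" "d\<^sup>2"] by simp
  hence "vector [w $ 1, sqrt (w $ 2)] \<in> box2 e" using w d True by (simp add: box2_def)
  moreover have "smooth_fn (box2 e) h" using h by (simp add: line_flat_def)
  ultimately have "((\<lambda>t. h (vector [w $ 1, sqrt (w $ 2)] + t *\<^sub>R axis 1 1)) has_real_derivative
      partial 1 h (vector [w $ 1, sqrt (w $ 2)])) (at 0)"
    using smooth_fn_axis_deriv[of "box2 e" h _ "[]" 1] by simp
  from DERIV_cdivide[OF this, of "sqrt (w $ 2) ^ m"] True
  show ?thesis by (simp add: root_glue_def vec2_axis)
qed (simp add: root_glue_def)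

text \<open>For v > 0 this differentiates h(u, sqrt v) v^(-m/2), and both resulting terms are again
  of the form \<open>root_glue\<close>. At v = 0 the function is quadratically small along the axis,
  which makes the difference quotient tend to 0.\<close>

lemma root_glue_deriv_2:
  assumes h: "line_flat e h" and d: "0 < d" "d < e" and w: "\<bar>w $ 1\<bar> < d" "w $ 2 < d\<^sup>2"
  shows "((\<lambda>t. root_glue m h (w + t *\<^sub>R axis 2 1)) has_real_derivative
     1 / 2 * root_glue (Suc m) (partial 2 h) w + - real m / 2 * root_glue (Suc (Suc m)) h w) (at 0)"
proof -
  consider "w $ 2 > 0" | "w $ 2 < 0" | "w $ 2 = 0" by linarith
  thus ?thesis
  proof cases
    case 1
    let ?r = "sqrt (w $ 2)"
    have "?r < d" using w 1 d real_sqrt_less_mono[of "w $ 2" "d\<^sup>2"] by simp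
    hence "vector [w $ 1, ?r] \<in> box2 e" using w d 1 by (simp add: box2_def)
    moreover have "smooth_fn (box2 e) h" using h by (simp add: line_flat_def)
    moreover have "vector [w $ 1, 0] + ?r *\<^sub>R axis 2 1 = (vector [w $ 1, ?r] :: real^2)"
      by (simp add: vec2_axis)
    ultimately have "((\<lambda>t. h (vector [w $ 1, 0] + t *\<^sub>R axis 2 1)) has_real_derivative
        partial 2 h (vector [w $ 1, ?r])) (at ?r)"
      using smooth_fn_line_deriv[of "box2 e" h "vector [w $ 1, 0]" ?r 2] by simp
    hence A: "((\<lambda>t. h (vector [w $ 1, t])) has_real_derivative partial 2 h (vector [w $ 1, ?r]))
        (at (sqrt (w $ 2 + 0)))" by (simp add: vec2_axis)
    have B: "((\<lambda>t. sqrt (w $ 2 + t)) has_real_derivative (1 / (2 * ?r))) (at 0)"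
      using 1 by (auto intro!: derivative_eq_intros simp: field_simps)
    have C: "((\<lambda>t. h (vector [w $ 1, sqrt (w $ 2 + t)])) has_real_derivative
        (partial 2 h (vector [w $ 1, ?r]) * (1 / (2 * ?r)))) (at 0)"
      by (rule DERIV_chain2[OF A B])
    have r0: "?r \<noteq> 0" using 1 by simp
    have E: "((\<lambda>t. 1 / sqrt (w $ 2 + t) ^ m) has_real_derivative (- real m / 2 / ?r ^ (m + 2))) (at 0)"
    proof (cases m)
      case (Suc k)
      have "((\<lambda>t. 1 / sqrt (w $ 2 + t) ^ m) has_real_derivative
         (- (real m * ?r ^ (m - 1) * (1 / (2 * ?r))) / (?r ^ m)\<^sup>2)) (at 0)"
        using 1 by (auto intro!: derivative_eq_intros B simp: power2_eq_square field_simps)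
      moreover have "- (real m * ?r ^ (m - 1) * (1 / (2 * ?r))) / (?r ^ m)\<^sup>2 = - real m / 2 / ?r ^ (m + 2)"
        using r0 by (simp add: Suc field_simps power2_eq_square)
      ultimately show ?thesis by (rule DERIV_cong)
    qed simp
    have F: "((\<lambda>t. h (vector [w $ 1, sqrt (w $ 2 + t)]) * (1 / sqrt (w $ 2 + t) ^ m)) has_real_derivative
      (h (vector [w $ 1, ?r]) * (- real m / 2 / ?r ^ (m + 2)) +
       (partial 2 h (vector [w $ 1, ?r]) * (1 / (2 * ?r))) * (1 / ?r ^ m))) (at 0)"
      using DERIV_mult'[OF C E] by simp
    have ev: "\<forall>\<^sub>F t in nhds 0. root_glue m h (w + t *\<^sub>R axis 2 1) =
        h (vector [w $ 1, sqrt (w $ 2 + t)]) * (1 / sqrt (w $ 2 + t) ^ m)"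
    proof -
      have "\<forall>\<^sub>F t in nhds 0. t \<in> {- (w $ 2)<..}" using 1 by (intro eventually_nhds_in_open) auto
      thus ?thesis by eventually_elim (auto simp: root_glue_def axis_def)
    qed
    show ?thesis
      using F 1 r0 unfolding DERIV_cong_ev[OF refl ev refl]
      by (elim DERIV_cong) (auto simp: root_glue_def field_simps)
  next
    case 2
    have "\<forall>\<^sub>F t in nhds 0. t \<in> {..< - (w $ 2)}" using 2 by (intro eventually_nhds_in_open) auto
    hence "\<forall>\<^sub>F t in nhds 0. root_glue m h (w + t *\<^sub>R axis 2 1) = 0"
      by eventually_elim (auto simp: root_glue_def axis_def)
    from DERIV_cong_ev[OF refl this refl] 2 show ?thesis by (simp add: root_glue_def)
  next
    case 3
    obtain C where C: "\<And>w. \<bar>w $ 1\<bar> \<le> d \<Longrightarrow> w $ 2 \<le> d\<^sup>2 \<Longrightarrow> \<bar>root_glue m h w\<bar> \<le> C * \<bar>w $ 2\<bar> ^ 2"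
      using root_glue_bound[OF h d, of m 2] by blast
    have "\<forall>\<^sub>F t in nhds 0. t \<in> {..< d\<^sup>2}" using d by (intro eventually_nhds_in_open) auto
    hence "\<forall>\<^sub>F t in nhds 0. \<bar>root_glue m h (w + t *\<^sub>R axis 2 1)\<bar> \<le> C * t\<^sup>2"
    proof eventually_elim
      case (elim t)
      thus ?case using C[of "w + t *\<^sub>R axis 2 1"] w 3 by (simp add: axis_def)
    qed
    from deriv_zero_quadratic[OF this] 3 show ?thesis by (simp add: root_glue_def)
  qed
qed

lemma continuous_root_glue:
  assumes h: "line_flat e h" and d: "0 < d" "d < e"
  shows "continuous_on {w. \<bar>w $ 1\<bar> < d \<and> w $ 2 < d\<^sup>2} (root_glue m h)"
proof (rule continuous_at_imp_continuous_on, intro ballI)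
  fix w :: "real^2" assume "w \<in> {w. \<bar>w $ 1\<bar> < d \<and> w $ 2 < d\<^sup>2}"
  hence w: "\<bar>w $ 1\<bar> < d" "w $ 2 < d\<^sup>2" by auto
  have op: "open {w::real^2. \<bar>w $ 1\<bar> < d \<and> w $ 2 < d\<^sup>2}"
    by (intro open_Collect_conj open_Collect_less continuous_intros)
  show "isCont (root_glue m h) w"
  proof (cases "w $ 2 > 0")
    case True
    have "sqrt (w $ 2) < d" using w True d real_sqrt_less_mono[of "w $ 2" "d\<^sup>2"] by simp
    hence "vector [w $ 1, sqrt (w $ 2)] \<in> box2 e" using w d True by (simp add: box2_def)
    hence ch: "isCont h (vector [w $ 1, sqrt (w $ 2)])"
      using smooth_fn_continuous[of "box2 e" h] h continuous_on_eq_continuous_at[OF open_box2]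
      by (auto simp: line_flat_def)
    have cv: "isCont (\<lambda>w::real^2. vector [w $ 1, sqrt (w $ 2)] :: real^2) w"
    proof -
      have "(\<lambda>w::real^2. vector [w $ 1, sqrt (w $ 2)] :: real^2) =
          (\<lambda>w. (w $ 1) *\<^sub>R axis 1 1 + sqrt (w $ 2) *\<^sub>R axis 2 1)"
        by (simp add: fun_eq_iff vec_eq_iff forall_2)
      thus ?thesis by (auto intro!: continuous_intros)
    qed
    have c: "isCont (\<lambda>w. h (vector [w $ 1, sqrt (w $ 2)]) / sqrt (w $ 2) ^ m) w"
      using True by (intro continuous_intros isCont_o2[OF cv ch]) auto
    have "open {w::real^2. w $ 2 > 0}" by (intro open_Collect_less continuous_intros)
    hence "\<forall>\<^sub>F x in nhds w. x \<in> {w. w $ 2 > 0}" using True by (intro eventually_nhds_in_open) auto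
    hence "\<forall>\<^sub>F x in nhds w. root_glue m h x = h (vector [x $ 1, sqrt (x $ 2)]) / sqrt (x $ 2) ^ m"
      by eventually_elim (simp add: root_glue_def)
    from isCont_cong[OF this] c show ?thesis by simp
  next
    case False
    obtain C where C: "C \<ge> 0" "\<And>w. \<bar>w $ 1\<bar> \<le> d \<Longrightarrow> w $ 2 \<le> d\<^sup>2 \<Longrightarrow> \<bar>root_glue m h w\<bar> \<le> C * \<bar>w $ 2\<bar> ^ 1"
      using root_glue_bound[OF h d, of m 1] by blast
    have "\<forall>\<^sub>F x in nhds w. x \<in> {w. \<bar>w $ 1\<bar> < d \<and> w $ 2 < d\<^sup>2}"
      using op w by (intro eventually_nhds_in_open) auto
    hence ev: "\<forall>\<^sub>F x in nhds w. norm (root_glue m h x) \<le> C * \<bar>max (x $ 2) 0\<bar>"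
    proof eventually_elim
      case (elim x)
      thus ?case using C(2)[of x] C(1) by (cases "x $ 2 > 0") (auto simp: root_glue_def)
    qed
    have "((\<lambda>x::real^2. C * \<bar>max (x $ 2) 0\<bar>) \<longlongrightarrow> C * \<bar>max (w $ 2) 0\<bar>) (at w)"
      by (intro tendsto_intros)
    hence "(root_glue m h \<longlongrightarrow> 0) (at w)"
      using Lim_null_comparison[OF conjunct1[OF ev[unfolded eventually_nhds_conv_at]]] False
      by (auto simp: max_def split: if_splits)
    thus ?thesis using False by (simp add: isCont_def root_glue_def)
  qed
qed

lemma smooth_root_glue:
  assumes h: "line_flat e h" and d: "0 < d" "d < e"
  shows "smooth_fn {w. \<bar>w $ 1\<bar> < d \<and> w $ 2 < d\<^sup>2} (root_glue m h)"
proof (rule alg_imp_smooth_fn[where G = "{root_glue m h |m h. line_flat e h}"])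
  let ?G = "{root_glue m h |m h. line_flat e h}" and ?U = "{w::real^2. \<bar>w $ 1\<bar> < d \<and> w $ 2 < d\<^sup>2}"
  show "open ?U" by (intro open_Collect_conj open_Collect_less continuous_intros)
  show "alg ?G (root_glue m h)" using h by (intro alg_gen) blast
  show "continuous_on ?U g" if "g \<in> ?G" for g using that continuous_root_glue d by blast
  fix g and k :: "2" assume "g \<in> ?G"
  then obtain m h where g: "g = root_glue m h" "line_flat e h" by blast
  show "\<exists>g'. alg ?G g' \<and> (\<forall>x\<in>?U. ((\<lambda>t. g (x + t *\<^sub>R axis k 1)) has_real_derivative g' x) (at 0))"
  proof (cases "k = 1")
    case True
    have "alg ?G (root_glue m (partial 1 h))" using line_flat_partial_1[OF g(2)] by (intro alg_gen) blast
    thus ?thesis using root_glue_deriv_1[OF g(2) d] True g(1) by blast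
  next
    case False
    hence k: "k = 2" using exhaust_2[of k] by simp
    have "alg ?G (root_glue (Suc m) (partial 2 h))" "alg ?G (root_glue (Suc (Suc m)) h)"
      using line_flat_partial_2[OF g(2)] g(2) by (auto intro!: alg_gen)
    hence "alg ?G (\<lambda>w. 1 / 2 * root_glue (Suc m) (partial 2 h) w + - real m / 2 * root_glue (Suc (Suc m)) h w)"
      by (intro alg_add alg_mult alg_const)
    thus ?thesis using root_glue_deriv_2[OF g(2) d] k g(1) by blast
  qed
qed

text \<open>The parameter version of Borel's theorem produces an even and an odd part with the right
  Taylor series along v = 0. What remains is flat on that line, so its even part, and its odd part
  divided by v, stay smooth when v is replaced by a square root and the result is extended by zero
  to negative arguments.\<close>

theorem whitney_parity:
  assumes "sg g"
  obtains A B where "sg A" "sg B" "g \<simeq> (\<lambda>w. A (sq2 w) + w $ 2 * B (sq2 w))"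
proof -
  obtain U where U: "open U" "0 \<in> U" "smooth_fn U g" using assms by (rule sgE)
  obtain e0 where e0: "0 < e0" "e0 < 1" "box2 e0 \<subseteq> U" using box2_subset_nbhd[OF U(1,2)] .
  have g: "smooth_fn (box2 e0) g" by (rule smooth_fn_subset[OF U(3) e0(3)])
  define e where "e = e0 / 2"
  have e: "0 < e" "e < 1" "e < e0" using e0 by (auto simp: e_def)
  let ?K = "{w::real^2. \<bar>w $ 1\<bar> \<le> e \<and> \<bar>w $ 2\<bar> \<le> e}"
  have KK: "?K \<subseteq> box2 e0" "box2 e \<subseteq> ?K" using e by (auto simp: box2_def)
  have smA: "smooth_fn (box2 e0) (\<lambda>w. c * D2n n g w)" for c n
    by (intro smooth_fn_mult smooth_fn_const open_box2 smooth_fn_pd g)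
  \<comment> \<open>\<open>K\<close> collects the even Taylor coefficients in v: its
    \<open>n\<close>-th one is the \<open>2 * n\<close>-th one of \<open>g\<close>. \<open>L\<close>
    does the same with the odd ones.\<close>
  obtain K where K: "smooth_fn (box2 e) K" "\<And>n w. w \<in> box2 e \<Longrightarrow> w $ 2 = 0 \<Longrightarrow>
      D2n n K w = fact n * (1 / fact (2 * n) * D2n (2 * n) g w)"
    by (rule borel_with_parameter[of "box2 e0" "\<lambda>n w. 1 / fact (2 * n) * D2n (2 * n) g w" ?K "box2 e",
        OF open_box2 smA compact_cbox2 KK(1) open_box2 KK(2)]) blast
  obtain L where L: "smooth_fn (box2 e) L" "\<And>n w. w \<in> box2 e \<Longrightarrow> w $ 2 = 0 \<Longrightarrow>
      D2n n L w = fact n * (1 / fact (Suc (2 * n)) * D2n (Suc (2 * n)) g w)"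
    by (rule borel_with_parameter[of "box2 e0" "\<lambda>n w. 1 / fact (Suc (2 * n)) * D2n (Suc (2 * n)) g w" ?K "box2 e",
        OF open_box2 smA compact_cbox2 KK(1) open_box2 KK(2)]) blast
  have sc: "smooth_fn (box2 e) (\<lambda>w. K (sq2 w))" if "smooth_fn (box2 e) K" for K
    by (rule smooth_fn_compose[OF open_box2 open_box2 that smooth_map_sq2[OF open_box2]])
       (use sq2_box2 e in blast)
  define r where "r w = g w + (- 1 * K (sq2 w) + - 1 * (w $ 2 * L (sq2 w)))" for w
  have ge: "smooth_fn (box2 e) g" by (rule smooth_fn_subset[OF g]) (use KK in blast)
  have sL: "smooth_fn (box2 e) (\<lambda>w. w $ 2 * L (sq2 w))"
    by (intro smooth_fn_mult open_box2 smooth_fn_proj sc L(1))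
  have sm1: "smooth_fn (box2 e) (\<lambda>w. - 1 * K (sq2 w))" "smooth_fn (box2 e) (\<lambda>w. - 1 * (w $ 2 * L (sq2 w)))"
    by (intro smooth_fn_mult[OF open_box2 smooth_fn_const[OF open_box2]] sc K(1) sL)+
  note sm2 = smooth_fn_add[OF open_box2 sm1]
  have "D2n m r w = 0" if w: "w \<in> box2 e" "w $ 2 = 0" for m w
  proof -
    have "D2n m r w = D2n m g w - D2n m (\<lambda>w. K (sq2 w)) w - D2n m (\<lambda>w. w $ 2 * L (sq2 w)) w"
      unfolding r_def[abs_def]
      by (simp only: pd_add_on[OF open_box2 ge sm2 w(1)] pd_add_on[OF open_box2 sm1 w(1)]
          pd_cmult_on[OF open_box2 sc[OF K(1)] w(1)] pd_cmult_on[OF open_box2 sL w(1)])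
    also have "D2n m (\<lambda>w. w $ 2 * L (sq2 w)) w = real m * D2n (m - 1) (\<lambda>w. L (sq2 w)) w"
      using D2n_mult_second[OF open_box2 sc[OF L(1)] w(1)] w(2) by simp
    finally have *: "D2n m r w = D2n m g w - D2n m (\<lambda>w. K (sq2 w)) w - real m * D2n (m - 1) (\<lambda>w. L (sq2 w)) w" .
    consider n where "m = 2 * n" | n where "m = Suc (2 * n)" by (metis evenE oddE Suc_eq_plus1)
    thus ?thesis
    proof cases
      case 1
      have "real m * D2n (m - 1) (\<lambda>w. L (sq2 w)) w = 0"
      proof (cases n)
        case (Suc k)
        hence "m - 1 = Suc (2 * k)" using 1 by simp
        thus ?thesis using D2n_sq2(2)[OF e(2) L(1) w, of k] by simp
      qed (use 1 in simp)
      moreover have "D2n m (\<lambda>w. K (sq2 w)) w = D2n m g w"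
        using D2n_sq2(1)[OF e(2) K(1) w, of n] K(2)[OF w, of n] 1 by simp
      ultimately show ?thesis using * by simp
    next
      case 2
      have "D2n m (\<lambda>w. K (sq2 w)) w = 0" using D2n_sq2(2)[OF e(2) K(1) w, of n] 2 by simp
      moreover have "fact n * D2n (2 * n) (\<lambda>w. L (sq2 w)) w =
          fact n * (fact (2 * n) * (1 / fact (Suc (2 * n)) * D2n m g w))"
        unfolding D2n_sq2(1)[OF e(2) L(1) w] L(2)[OF w] 2 by (simp only: mult.left_commute)
      hence "D2n (m - 1) (\<lambda>w. L (sq2 w)) w = fact (2 * n) * (1 / fact (Suc (2 * n)) * D2n m g w)"
        unfolding 2 by (simp only: mult_left_cancel[OF fact_nonzero] diff_Suc_1)
      moreover have "real m * (fact (2 * n) * (1 / fact (Suc (2 * n)) * D2n m g w)) = D2n m g w"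
        unfolding 2 fact_Suc by (simp add: field_simps del: of_nat_Suc replicate_Suc)
      ultimately show ?thesis using * by simp
    qed
  qed
  hence r: "line_flat e r"
    using smooth_fn_add[OF open_box2 ge sm2] by (auto simp: line_flat_def r_def[abs_def])
  define re where "re w = 1 / 2 * r w + 1 / 2 * r (refl2 w)" for w
  define ro where "ro w = 1 / 2 * r w + - 1 / 2 * r (refl2 w)" for w
  have flat: "line_flat e re" "line_flat e ro"
    unfolding re_def[abs_def] ro_def[abs_def]
    by (intro line_flat_lincomb r line_flat_refl2)+
  define d where "d = e / 2"
  have d: "0 < d" "d < e" using e by (auto simp: d_def)
  let ?U = "{w::real^2. \<bar>w $ 1\<bar> < d \<and> w $ 2 < d\<^sup>2}"
  have opU: "open ?U" by (intro open_Collect_conj open_Collect_less continuous_intros)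
  have U0: "0 \<in> ?U" using d by simp
  have sgg: "sg (root_glue m h)" if "line_flat e h" for m h
    by (rule sgI[OF opU U0 smooth_root_glue[OF that d]])
  have b0: "0 \<in> box2 e" using e by (simp add: box2_def)
  show ?thesis
  \<comment> \<open>Exponent 0 substitutes the root into the even part; exponent 1 also divides by
    the root, the division by v that the odd part admits.\<close>
  proof (rule that[of "\<lambda>w. K w + root_glue 0 re w" "\<lambda>w. L w + root_glue 1 ro w"])
    show "sg (\<lambda>w. K w + root_glue 0 re w)" "sg (\<lambda>w. L w + root_glue 1 ro w)"
      using sgI[OF open_box2 b0 K(1)] sgI[OF open_box2 b0 L(1)] sgg flat by auto
    have "g w = K (sq2 w) + root_glue 0 re (sq2 w) + w $ 2 * (L (sq2 w) + root_glue 1 ro (sq2 w))"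
      if w: "w \<in> box2 e" for w
    proof -
      have refl: "vector [w $ 1, - w $ 2] = refl2 w" "vector [w $ 1, w $ 2] = w" "refl2 (refl2 w) = w"
        by (simp_all add: vec_eq_iff forall_2)
      have "root_glue 0 re (sq2 w) + w $ 2 * root_glue 1 ro (sq2 w) = r w"
      proof -
        consider "w $ 2 > 0" | "w $ 2 < 0" | "w $ 2 = 0" by linarith
        thus ?thesis
        proof cases
          case 3
          hence "r w = 0" using r w unfolding line_flat_def by (metis pd_Nil replicate_0)
          thus ?thesis using 3 by (simp add: root_glue_def)
        qed (auto simp: root_glue_def refl re_def ro_def)
      qed
      thus ?thesis by (simp add: r_def algebra_simps)
    qed
    moreover have "\<forall>\<^sub>F w in nhds 0. w \<in> box2 e" using open_box2 b0 by (rule eventually_nhds_in_open)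
    ultimately show "g \<simeq> (\<lambda>w. K (sq2 w) + root_glue 0 re (sq2 w) + w $ 2 * (L (sq2 w) + root_glue 1 ro (sq2 w)))"
      by (auto elim: eventually_mono)
  qed
qed

subsection \<open>The homogeneous linear system\<close>

text \<open>For forms $\xi$ of degree $n+1$ and $\theta,\omega$ of degree $n$ with coefficients
  $X_i$, $H_i$, $O_i$ at $u^i v^{*}$, these are the coefficients at $u^i v^{n-i}$ of
  $\xi_u + (v+du)\theta_u + (pu+qv)\omega_u$,
  $\xi_v + (v+du)\theta_v + u\theta_u + (pu+qv)\omega_v + (qu+rv)\omega_u$ and
  $u\theta_v + (qu+rv)\omega_v$.\<close>

definition cE where
  "cE d p q X H O' i = real (Suc i) * X (Suc i) + real (Suc i) * H (Suc i) + d * (real i * H i)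
     + p * (real i * O' i) + q * (real (Suc i) * O' (Suc i))"

definition cF where
  "cF n d p q r X H O' i = (real n + 1 - real i) * X i + real n * H i
     + (if i = 0 then 0 else (real n + 1 - real i) * (d * H (i - 1) + p * O' (i - 1)))
     + q * (real n * O' i) + r * (real (Suc i) * O' (Suc i))"

definition cG where
  "cG n q r H O' i = (if i = 0 then 0 else (real n + 1 - real i) * (H (i - 1) + q * O' (i - 1)))
     + r * ((real n - real i) * O' i)"

text \<open>This is \<xi>_uv = \<xi>_vu read on coefficients: the u-derivative of the second
  expression minus the v-derivative of the first one is free of \<open>X\<close>.\<close>

lemma cF_cE_combination:
  "real (Suc i) * cF n d p q r X H O' (Suc i) - (real n - real i) * cE d p q X H O' i =
    real (Suc i) * real i * (H (Suc i) + q * O' (Suc i))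
    + real (Suc i) * real (Suc (Suc i)) * (r * O' (Suc (Suc i)))
    + (real n - real i) * (p * O' i + d * H i)"
  by (simp add: cF_def cE_def algebra_simps)

text \<open>Cramer's rule in multiplied form, so that no hypothesis on the determinant is needed;
  \<open>2 * n - 2 - i\<close> is minus the determinant.\<close>

lemma linear_2x2:
  fixes i n a b :: real
  assumes "i * a + (i + 2) * b = S" "(n - i - 1) * a + (n - i - 2) * b = g"
  shows "(2 * n - 2 - i) * a = (i + 2) * g - (n - i - 2) * S"
    and "(2 * n - 2 - i) * b = (n - i - 1) * S - i * g"
  unfolding assms[symmetric] by (simp_all add: algebra_simps)

lemma linear_2x2_conv:
  fixes i n a b :: real
  assumes "2 * n - 2 - i \<noteq> 0"
    "a = ((i + 2) * g - (n - i - 2) * S) / (2 * n - 2 - i)"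
    "b = ((n - i - 1) * S - i * g) / (2 * n - 2 - i)"
  shows "i * a + (i + 2) * b = S" "(n - i - 1) * a + (n - i - 2) * b = g"
proof -
  define D where "D = 2 * n - 2 - i"
  have D: "D \<noteq> 0" using assms(1) by (simp add: D_def)
  have aD: "D * a = (i + 2) * g - (n - i - 2) * S" "D * b = (n - i - 1) * S - i * g"
    using D assms(2,3) by (simp_all flip: D_def)
  have "D * (i * a + (i + 2) * b) = i * (D * a) + (i + 2) * (D * b)" by (simp add: algebra_simps)
  also have "\<dots> = D * S" unfolding aD by (simp add: D_def algebra_simps)
  finally show "i * a + (i + 2) * b = S" using D by simp
  have "D * ((n - i - 1) * a + (n - i - 2) * b) = (n - i - 1) * (D * a) + (n - i - 2) * (D * b)"
    by (simp add: algebra_simps)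
  also have "\<dots> = D * g" unfolding aD by (simp add: D_def algebra_simps)
  finally show "(n - i - 1) * a + (n - i - 2) * b = g" using D by simp
qed

text \<open>\<open>H 0 = 0\<close> encodes that the v^n coefficient of the second component belongs
  to \<open>b\<close> and cannot be corrected. The values at \<open>Suc n\<close> lie beyond the
  degree and terminate the recursion.\<close>

lemma coefficient_system_unique:
  assumes n: "2 \<le> n" and r: "r \<noteq> 0"
    and E: "\<And>i. i \<le> n \<Longrightarrow> cE d p q X H O' i = 0"
    and F: "\<And>i. i \<le> n \<Longrightarrow> cF n d p q r X H O' i = 0"
    and G: "\<And>i. i \<le> n \<Longrightarrow> cG n q r H O' i = 0"
    and z: "H 0 = 0" "O' (Suc n) = 0" "H (Suc n) = 0"
  shows "\<And>i. i \<le> n \<Longrightarrow> H i = 0" "\<And>i. i \<le> n \<Longrightarrow> O' i = 0" "\<And>i. i \<le> Suc n \<Longrightarrow> X i = 0"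
proof -
  have main: "O' i = 0 \<and> O' (Suc i) = 0 \<and> H i = 0" if "i \<le> n" for i
    using that
  proof (induction i)
    case 0
    \<comment> \<open>At the indices 0 and 1 the third expression involves only \<open>O'\<close>,
      given \<open>H 0 = 0\<close>, and so starts the recursion. At index 1 the coefficient is n -
      1, which is nonzero for n \<ge> 2.\<close>
    have "O' 0 = 0" using G[of 0] n r by (simp add: cG_def)
    moreover have "O' 1 = 0" using G[of 1] n r z calculation by (simp add: cG_def)
    ultimately show ?case using z by simp
  next
    case (Suc i)
    hence IH: "O' i = 0" "O' (Suc i) = 0" "H i = 0" by auto
    define a where "a = H (Suc i)"
    define b where "b = r * O' (Suc (Suc i))"
    have "real (Suc i) * (real i * a + (real i + 2) * b) = 0"
      using cF_cE_combination[of i n d p q r X H O'] E[of i] F[of "Suc i"] Suc.prems IH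
      by (simp add: a_def b_def algebra_simps)
    hence 1: "real i * a + (real i + 2) * b = 0" by simp
    have 2: "(real n - real i - 1) * a + (real n - real i - 2) * b = 0"
    proof (cases "Suc (Suc i) \<le> n")
      case True
      thus ?thesis using G[of "Suc (Suc i)"] IH by (simp add: cG_def a_def b_def algebra_simps)
    next
      \<comment> \<open>At the last index no third equation is left. Its place is taken by
        \<open>O' (Suc n) = 0\<close>, because the coefficient of \<open>a\<close> vanishes
        there.\<close>
      case False
      hence "n = Suc i" using Suc.prems by simp
      thus ?thesis using z by (simp add: b_def)
    qed
    have D: "2 * real n - 2 - real i \<noteq> 0" using n Suc.prems by linarith
    have "a = 0" "b = 0" using linear_2x2[OF 1 2] D by auto
    thus ?case using IH r by (simp add: a_def b_def)
  qed
  show "H i = 0" "O' i = 0" if "i \<le> n" for i using main[OF that] by auto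
  show "X i = 0" if "i \<le> Suc n" for i
  proof (cases i)
    case 0
    thus ?thesis using F[of 0] main[of 0] by (simp add: cF_def)
  next
    case (Suc j)
    hence "H (Suc j) = 0" using that main[of "Suc j"] z(3) by (cases "j = n") auto
    thus ?thesis using E[of j] main[of j] Suc that by (simp add: cE_def)
  qed
qed

lemma coefficient_system_solvable:
  assumes n: "2 \<le> n" and r: "r \<noteq> 0"
  shows "\<exists>X H O'. H 0 = 0 \<and> H (Suc n) = 0 \<and> O' (Suc n) = 0 \<and>
    (\<forall>i\<le>n. cE d p q X H O' i = e i \<and> cF n d p q r X H O' i = f i \<and> cG n q r H O' i = g i)"
proof -
  \<comment> \<open>Extending \<open>g\<close> by zero beyond degree \<open>n\<close> makes the last
    step of the recursion return \<open>O' (Suc n) = 0\<close>: both terms in the numerator of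
    \<open>B\<close> vanish.\<close>
  define g' where "g' i = (if i \<le> n then g i else 0)" for i
  define S where "S i O0 k = (real (Suc i) * f (Suc i) - (real n - real i) * e i
     - (real n - real i) * (p * O0 + d * (k - q * O0))) / real (Suc i)" for i O0 k
  define A where "A i O0 k = ((real i + 2) * g' (Suc (Suc i)) - (real n - real i - 2) * S i O0 k)
     / (2 * real n - 2 - real i)" for i O0 k
  define B where "B i O0 k = ((real n - real i - 1) * S i O0 k - real i * g' (Suc (Suc i)))
     / (2 * real n - 2 - real i)" for i O0 k
  define O0 where "O0 = g 0 / (r * real n)"
  define O1 where "O1 = (g 1 - real n * (q * O0)) / (r * (real n - 1))"
  \<comment> \<open>The state holds \<open>O'\<close> at i and i + 1 together with k = H + q O' at
    i. The third start value q O0 expresses \<open>H 0 = 0\<close>.\<close>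
  define st where "st = rec_nat (O0, O1, q * O0) (\<lambda>i (a, b, k). (b, B i a k / r, A i a k))"
  define O' where "O' i = fst (st i)" for i
  define k where "k i = snd (snd (st i))" for i
  have stS: "st (Suc i) = (fst (snd (st i)), B i (O' i) (k i) / r, A i (O' i) (k i))" for i
    by (simp add: st_def O'_def k_def split: prod.splits)
  have st0: "st 0 = (O0, O1, q * O0)" by (simp add: st_def)
  have Orec: "O' (Suc (Suc i)) = B i (O' i) (k i) / r" for i by (simp add: O'_def[of "Suc (Suc i)"] stS)
  have krec: "k (Suc i) = A i (O' i) (k i)" for i by (simp add: k_def[of "Suc i"] stS)
  have init: "O' 0 = O0" "O' (Suc 0) = O1" "k 0 = q * O0" by (simp_all add: O'_def k_def st0 stS)
  define H where "H i = (if i \<le> n then k i - q * O' i else 0)" for i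
  have kH: "k i = H i + q * O' i" if "i \<le> n" for i using that by (simp add: H_def)
  \<comment> \<open>The first equation determines every \<open>X\<close> of positive index, and the
    second equation at index 0 the remaining one. The other instances of the second equation follow
    from \<open>cF_cE_combination\<close>.\<close>
  define X where "X i = (case i of 0 \<Rightarrow> (f 0 - real n * H 0 - q * (real n * O' 0) - r * O' 1) / (real n + 1)
     | Suc j \<Rightarrow> (e j - real (Suc j) * H (Suc j) - d * (real j * H j) - p * (real j * O' j)
          - q * (real (Suc j) * O' (Suc j))) / real (Suc j))" for i
  have rel: "real i * k (Suc i) + (real i + 2) * (r * O' (Suc (Suc i))) = S i (O' i) (k i)"
    "(real n - real i - 1) * k (Suc i) + (real n - real i - 2) * (r * O' (Suc (Suc i))) = g' (Suc (Suc i))"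
    if "i < n" for i
  proof -
    have "2 * real n - 2 - real i \<noteq> 0" using n that by linarith
    note * = linear_2x2_conv[OF this, of "k (Suc i)" "g' (Suc (Suc i))" "S i (O' i) (k i)" "r * O' (Suc (Suc i))"]
    show "real i * k (Suc i) + (real i + 2) * (r * O' (Suc (Suc i))) = S i (O' i) (k i)"
      "(real n - real i - 1) * k (Suc i) + (real n - real i - 2) * (r * O' (Suc (Suc i))) = g' (Suc (Suc i))"
      using * r by (simp_all add: krec Orec A_def B_def)
  qed
  have On: "O' (Suc n) = 0"
  proof -
    obtain m where m: "n = Suc m" using n by (cases n) auto
    hence "real n - real m - 1 = 0" "g' (Suc (Suc m)) = 0" by (auto simp: g'_def)
    thus ?thesis using Orec[of m] m by (simp add: B_def)
  qed
  have E: "cE d p q X H O' i = e i" for i by (simp add: cE_def X_def field_simps del: of_nat_Suc)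
  have G: "cG n q r H O' i = g i" if "i \<le> n" for i
  proof -
    consider "i = 0" | "i = Suc 0" | j where "i = Suc (Suc j)" by (metis not0_implies_Suc)
    thus ?thesis
    proof cases
      case 1
      thus ?thesis using n r by (simp add: cG_def init O0_def)
    next
      case 2
      have "r * (real n - 1) \<noteq> 0" using n r by simp
      moreover have "H 0 = 0" by (simp add: H_def init)
      ultimately show ?thesis using 2 n r by (simp add: cG_def init O1_def)
    next
      case 3
      have "g' i = g i" using that by (simp add: g'_def)
      thus ?thesis using rel(2)[of j] 3 that kH[of "Suc j"] by (simp add: cG_def algebra_simps)
    qed
  qed
  have F: "cF n d p q r X H O' i = f i" if "i \<le> n" for i
  proof (cases i)
    case 0
    thus ?thesis by (simp add: cF_def X_def field_simps)
  next
    case (Suc j)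
    have "real (Suc j) * cF n d p q r X H O' (Suc j) =
      (real n - real j) * e j + (real (Suc j) * (real j * k (Suc j) + (real j + 2) * (r * O' (Suc (Suc j))))
      + (real n - real j) * (p * O' j + d * H j))"
      using cF_cE_combination[of j n d p q r X H O'] kH[of "Suc j"] Suc that
      by (simp add: E algebra_simps)
    also have "\<dots> = real (Suc j) * f (Suc j)"
      using rel(1)[of j] Suc that kH[of j] by (simp add: S_def)
    finally show ?thesis using Suc by simp
  qed
  have "H 0 = 0" "H (Suc n) = 0" by (simp_all add: H_def init)
  thus ?thesis using On E F G by blast
qed

subsection \<open>Linearisation of the first fundamental form\<close>

text \<open>The coefficients of the first fundamental form of the map with components
  \<open>x\<close>, \<open>g\<close>, \<open>z\<close>.\<close>

definition Qf :: "2 \<Rightarrow> 2 \<Rightarrow> (real^2 \<Rightarrow> real) \<Rightarrow> (real^2 \<Rightarrow> real) \<Rightarrow> (real^2 \<Rightarrow> real) \<Rightarrow> real^2 \<Rightarrow> real" where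
  "Qf k l x g z w = partial k x w * partial l x w + partial k g w * partial l g w + partial k z w * partial l z w"

text \<open>The squares carry a factor 1/2, so that \<open>p\<close>, \<open>q\<close>,
  \<open>r\<close> are the entries of the Hessian, like the constants in the normal form of a
  Whitney metric.\<close>

definition quadr :: "real \<Rightarrow> real \<Rightarrow> real \<Rightarrow> real^2 \<Rightarrow> real" where
  "quadr p q r w = p / 2 * (w $ 1)\<^sup>2 + q * (w $ 1 * w $ 2) + r / 2 * (w $ 2)\<^sup>2"

lemma sg_Qf [simp, intro]: "sg x \<Longrightarrow> sg g \<Longrightarrow> sg z \<Longrightarrow> sg (Qf k l x g z)"
  unfolding Qf_def[abs_def] by (intro sg_add sg_mult sg_partial)

lemma sg_quadr [simp, intro]: "sg (quadr p q r)"
  unfolding quadr_def[abs_def] by (intro sg_add sg_mult sg_power sg_proj sg_const)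

lemma partial_quadr:
  "partial 1 (quadr p q r) = (\<lambda>w. p * w $ 1 + q * w $ 2)"
  "partial 2 (quadr p q r) = (\<lambda>w. q * w $ 1 + r * w $ 2)"
  by (auto simp: fun_eq_iff quadr_def intro!: partial_eqI derivative_eq_intros)

definition lin :: "real \<Rightarrow> real \<Rightarrow> real^2 \<Rightarrow> real" where
  "lin a b w = a * w $ 1 + b * w $ 2"

lemma sg_lin [simp, intro]: "sg (lin a b)"
  unfolding lin_def[abs_def] by (intro sg_add sg_mult sg_proj sg_const)

lemma partial_lin: "partial 1 (lin a b) = (\<lambda>w. a)" "partial 2 (lin a b) = (\<lambda>w. b)"
  by (auto simp: fun_eq_iff lin_def intro!: partial_eqI derivative_eq_intros)

lemma vo_1_iff: "vo (Suc 0) h \<longleftrightarrow> h 0 = 0"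
  by (simp add: vo_Suc)

lemma vo_proj [simp]: "vo (Suc 0) (\<lambda>w. w $ i)"
  by (simp add: vo_1_iff)

lemma vo_lin [simp]: "vo (Suc 0) (lin a b)"
  by (simp add: vo_1_iff lin_def)

text \<open>The leading part of the derivative of \<open>Qf\<close>: the base point has linear part $x_1 u$ in its first
  component and quadratic forms in the other two.\<close>
definition LL where
  "LL x1 c d p q r k l \<xi> \<gamma> \<omega> w =
    (partial k \<xi> w * partial l (lin x1 0) w + partial k (lin x1 0) w * partial l \<xi> w)
    + (partial k \<gamma> w * partial l (quadr (2 * x1 * d) (x1 * c) 0) w
       + partial k (quadr (2 * x1 * d) (x1 * c) 0) w * partial l \<gamma> w)
    + (partial k \<omega> w * partial l (quadr p q r) w + partial k (quadr p q r) w * partial l \<omega> w)"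

lemma sg_LL [simp, intro]: "sg \<xi> \<Longrightarrow> sg \<gamma> \<Longrightarrow> sg \<omega> \<Longrightarrow> sg (LL x1 c d p q r k l \<xi> \<gamma> \<omega>)"
  unfolding LL_def[abs_def] by (intro sg_add sg_mult sg_partial sg_lin sg_quadr)

text \<open>Removing the part linear in the increment leaves, exactly, increment times (new minus
  model) plus (old minus model) times increment. Both terms gain \<open>s\<close>, the order to
  which the gradients agree with that of the model \<open>m\<close>.\<close>

lemma product_diff_linearised:
  assumes "sg a" "sg a'" "sg m"
    and "vo (Suc s) (\<lambda>w. a w - m w)" "vo (Suc s) (\<lambda>w. a' w - m w)"
    and "vo k (\<lambda>w. a' w - a w)" "N \<le> (k - 1) + s"
  shows "vo N (\<lambda>w. (partial i a' w * partial j a' w - partial i a w * partial j a w)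
     - (partial i (\<lambda>w. a' w - a w) w * partial j m w + partial i m w * partial j (\<lambda>w. a' w - a w) w))"
proof -
  let ?D = "\<lambda>i w. partial i (\<lambda>w. a' w - a w) w"
  have 1: "vo N (\<lambda>w. ?D i w * (partial j a' w - partial j m w))"
    using assms vo_partial_diff[OF assms(2,3,5), of j] vo_partial[OF assms(6), of i]
    by (intro vo_mult[of _ _ "k - 1" s]) auto
  have 2: "vo N (\<lambda>w. (partial i a w - partial i m w) * ?D j w)"
    using assms vo_partial_diff[OF assms(1,3,4), of i] vo_partial[OF assms(6), of j]
    by (intro vo_mult[of _ _ s "k - 1"]) auto
  have "vo N (\<lambda>w. ?D i w * (partial j a' w - partial j m w) + (partial i a w - partial i m w) * ?D j w)"
    using assms by (intro vo_add 1 2) auto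
  moreover have E: "(\<lambda>w. (partial i a' w * partial j a' w - partial i a w * partial j a w)
     - (?D i w * partial j m w + partial i m w * ?D j w)) \<simeq>
     (\<lambda>w. ?D i w * (partial j a' w - partial j m w) + (partial i a w - partial i m w) * ?D j w)"
    using partial_diff[OF assms(2,1), of i] partial_diff[OF assms(2,1), of j]
  proof eventually_elim
    case (elim w)
    show ?case unfolding elim by (simp add: algebra_simps)
  qed
  ultimately show ?thesis by (simp only: vo_cong[OF E])
qed

text \<open>The orders balance. An increment of order n + 1 in x meets a base known modulo order 2,
  increments of order n in the other components meet bases known modulo order 3, and each pair
  leaves an error of order n + 1.\<close>

lemma Qf_diff:
  assumes sg: "sg x" "sg g" "sg z" "sg x'" "sg g'" "sg z'"
    and base: "vo 2 (\<lambda>w. x w - lin x1 0 w)" "vo 3 (\<lambda>w. g w - quadr (2 * x1 * d) (x1 * c) 0 w)"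
      "vo 3 (\<lambda>w. z w - quadr p q r w)"
    and base': "vo 2 (\<lambda>w. x' w - lin x1 0 w)" "vo 3 (\<lambda>w. g' w - quadr (2 * x1 * d) (x1 * c) 0 w)"
      "vo 3 (\<lambda>w. z' w - quadr p q r w)"
    and ord: "vo (Suc n) (\<lambda>w. x' w - x w)" "vo n (\<lambda>w. g' w - g w)" "vo n (\<lambda>w. z' w - z w)"
    and n: "1 \<le> n"
  shows "vo (Suc n) (\<lambda>w. Qf k l x' g' z' w - Qf k l x g z w
     - LL x1 c d p q r k l (\<lambda>w. x' w - x w) (\<lambda>w. g' w - g w) (\<lambda>w. z' w - z w) w)"
proof -
  let ?t = "\<lambda>a a' m w. (partial k a' w * partial l a' w - partial k a w * partial l a w)
     - (partial k (\<lambda>w. a' w - a w) w * partial l m w + partial k m w * partial l (\<lambda>w. a' w - a w) w)"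
  have st: "sg (?t a a' m)" if "sg a" "sg a'" "sg m" for a a' m
    using that by (intro sg_diff sg_mult sg_partial sg_add)
  have "vo (Suc n) (\<lambda>w. ?t x x' (lin x1 0) w + ?t g g' (quadr (2 * x1 * d) (x1 * c) 0) w + ?t z z' (quadr p q r) w)"
    using n base base' 
    by (intro vo_add sg_add st sg sg_lin sg_quadr
        product_diff_linearised[OF _ _ _ _ _ ord(1), where s = 1]
        product_diff_linearised[OF _ _ _ _ _ ord(2), where s = 2]
        product_diff_linearised[OF _ _ _ _ _ ord(3), where s = 2])
       (auto simp: numeral_2_eq_2 numeral_3_eq_3)
  thus ?thesis by (simp add: Qf_def LL_def algebra_simps)
qed

lemma LL_cong_vo:
  assumes sg: "sg \<xi>" "sg \<gamma>" "sg \<omega>" "sg \<xi>'" "sg \<gamma>'" "sg \<omega>'"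
    and "vo (Suc (Suc n)) (\<lambda>w. \<xi> w - \<xi>' w)" "vo (Suc n) (\<lambda>w. \<gamma> w - \<gamma>' w)" "vo (Suc n) (\<lambda>w. \<omega> w - \<omega>' w)"
  shows "vo (Suc n) (\<lambda>w. LL x1 c d p q r k l \<xi> \<gamma> \<omega> w - LL x1 c d p q r k l \<xi>' \<gamma>' \<omega>' w)"
proof -
  have t: "vo (Suc n) (\<lambda>w. (partial k a w * partial l m w + partial k m w * partial l a w)
      - (partial k a' w * partial l m w + partial k m w * partial l a' w))"
    if "sg a" "sg a'" "sg m" "vo j (\<lambda>w. a w - a' w)" "vo (Suc s) m" "Suc n \<le> j - 1 + s" for a a' m j s
  proof -
    have "vo (Suc n) (\<lambda>w. (partial k a w - partial k a' w) * partial l m w + partial k m w * (partial l a w - partial l a' w))"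
      using that vo_partial_diff[OF that(1,2,4)] vo_partial[OF that(5)]
      by (intro vo_add vo_mult[of _ _ "j - 1" s] vo_mult[of _ _ s "j - 1"]) auto
    thus ?thesis by (simp add: algebra_simps)
  qed
  have q: "vo (Suc 1) (quadr a b c)" for a b c
    by (simp add: vo_Suc forall_2 partial_quadr) (simp add: quadr_def)
  note t1 = t[OF sg(1,4) sg_lin assms(7), of 0] and t2 = t[OF sg(2,5) sg_quadr assms(8) q]
    and t3 = t[OF sg(3,6) sg_quadr assms(9) q]
  have "vo (Suc n) (\<lambda>w. 
     ((partial k \<xi> w * partial l (lin x1 0) w + partial k (lin x1 0) w * partial l \<xi> w)
      - (partial k \<xi>' w * partial l (lin x1 0) w + partial k (lin x1 0) w * partial l \<xi>' w))
     + ((partial k \<gamma> w * partial l (quadr (2 * x1 * d) (x1 * c) 0) w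
       + partial k (quadr (2 * x1 * d) (x1 * c) 0) w * partial l \<gamma> w)
      - (partial k \<gamma>' w * partial l (quadr (2 * x1 * d) (x1 * c) 0) w
       + partial k (quadr (2 * x1 * d) (x1 * c) 0) w * partial l \<gamma>' w))
     + ((partial k \<omega> w * partial l (quadr p q r) w + partial k (quadr p q r) w * partial l \<omega> w)
      - (partial k \<omega>' w * partial l (quadr p q r) w + partial k (quadr p q r) w * partial l \<omega>' w)))"
    by (rule vo_add vo_add[OF _ _ t1] t1 t2 t3 | intro sg_add sg_diff sg_mult sg_partial sg sg_lin sg_quadr | simp)+
  thus ?thesis by (simp add: LL_def algebra_simps)
qed

lemma tc_u_p1: "sg h \<Longrightarrow> tc (\<lambda>w. w $ 1 * partial 1 h w) i j = real i * tc h i j"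
  by (cases i) (auto simp: tc_mult_u tc_partial_1)

lemma tc_v_p2: "sg h \<Longrightarrow> tc (\<lambda>w. w $ 2 * partial 2 h w) i j = real j * tc h i j"
  by (cases j) (auto simp: tc_mult_v tc_partial_2)

lemma tc_u_p2: "sg h \<Longrightarrow> tc (\<lambda>w. w $ 1 * partial 2 h w) i j =
    (if i = 0 then 0 else real (Suc j) * tc h (i - 1) (Suc j))"
  by (simp add: tc_mult_u tc_partial_2)

lemma tc_v_p1: "sg h \<Longrightarrow> tc (\<lambda>w. w $ 2 * partial 1 h w) i j =
    (if j = 0 then 0 else real (Suc i) * tc h (Suc i) (j - 1))"
  by (simp add: tc_mult_v tc_partial_1)

text \<open>Cut off at \<open>n\<close>, since truncated subtraction would otherwise turn an index
  beyond the degree into the coefficient of a pure power of u.\<close>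

definition hc :: "nat \<Rightarrow> (real^2 \<Rightarrow> real) \<Rightarrow> nat \<Rightarrow> real" where
  "hc n h i = (if i \<le> n then tc h i (n - i) else 0)"

text \<open>Scaling by \<open>x1\<close> and \<open>x1 * c\<close> reduces a general base point to
  the normalised system, with \<open>d\<close> replaced by \<open>2 * d / c\<close>. The factor 2 in
  the diagonal coefficients comes from the symmetry of the form.\<close>

lemma tc_LL:
  fixes x1 c :: real
  assumes sg: "sg \<xi>" "sg \<gamma>" "sg \<omega>" and i: "i \<le> n" and c: "c \<noteq> 0"
  defines "X \<equiv> \<lambda>i. x1 * hc (Suc n) \<xi> i" and "H \<equiv> \<lambda>i. x1 * c * hc n \<gamma> i" and "O' \<equiv> hc n \<omega>"
  shows "tc (LL x1 c d p q r 1 1 \<xi> \<gamma> \<omega>) i (n - i) = 2 * cE (2 * d / c) p q X H O' i"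
    "tc (LL x1 c d p q r 1 2 \<xi> \<gamma> \<omega>) i (n - i) = cF n (2 * d / c) p q r X H O' i"
    "tc (LL x1 c d p q r 2 2 \<xi> \<gamma> \<omega>) i (n - i) = 2 * cG n q r H O' i"
proof -
  have e: "Suc n - i = Suc (n - i)" "n - (i - 1) = Suc (n - i)" if "i \<noteq> 0" using i that by auto
  have e': "Suc n - i = Suc (n - i)" using i by auto
  have "LL x1 c d p q r 1 1 \<xi> \<gamma> \<omega> =
    (\<lambda>w. 2 * x1 * partial 1 \<xi> w + (4 * x1 * d * (w $ 1 * partial 1 \<gamma> w) + 2 * x1 * c * (w $ 2 * partial 1 \<gamma> w))
       + (2 * p * (w $ 1 * partial 1 \<omega> w) + 2 * q * (w $ 2 * partial 1 \<omega> w)))"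
    by (simp add: LL_def fun_eq_iff partial_lin partial_quadr algebra_simps)
  hence "tc (LL x1 c d p q r 1 1 \<xi> \<gamma> \<omega>) i (n - i) =
    2 * x1 * (real (Suc i) * tc \<xi> (Suc i) (n - i)) + (4 * x1 * d * (real i * tc \<gamma> i (n - i))
      + 2 * x1 * c * (if n - i = 0 then 0 else real (Suc i) * tc \<gamma> (Suc i) (n - i - 1)))
      + (2 * p * (real i * tc \<omega> i (n - i))
      + 2 * q * (if n - i = 0 then 0 else real (Suc i) * tc \<omega> (Suc i) (n - i - 1)))"
    using sg by (simp add: tc_u_p1 tc_v_p1 tc_partial_1)
  thus "tc (LL x1 c d p q r 1 1 \<xi> \<gamma> \<omega>) i (n - i) = 2 * cE (2 * d / c) p q X H O' i"
    using i c by (auto simp: cE_def X_def H_def O'_def hc_def e' algebra_simps)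
  have "LL x1 c d p q r 1 2 \<xi> \<gamma> \<omega> =
    (\<lambda>w. x1 * partial 2 \<xi> w + (x1 * c * (w $ 1 * partial 1 \<gamma> w) + 2 * x1 * d * (w $ 1 * partial 2 \<gamma> w)
       + x1 * c * (w $ 2 * partial 2 \<gamma> w))
       + (q * (w $ 1 * partial 1 \<omega> w) + r * (w $ 2 * partial 1 \<omega> w)
       + p * (w $ 1 * partial 2 \<omega> w) + q * (w $ 2 * partial 2 \<omega> w)))"
    by (simp add: LL_def fun_eq_iff partial_lin partial_quadr algebra_simps)
  hence "tc (LL x1 c d p q r 1 2 \<xi> \<gamma> \<omega>) i (n - i) =
    x1 * (real (Suc (n - i)) * tc \<xi> i (Suc (n - i))) + (x1 * c * (real i * tc \<gamma> i (n - i))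
      + 2 * x1 * d * (if i = 0 then 0 else real (Suc (n - i)) * tc \<gamma> (i - 1) (Suc (n - i)))
      + x1 * c * (real (n - i) * tc \<gamma> i (n - i)))
      + (q * (real i * tc \<omega> i (n - i))
      + r * (if n - i = 0 then 0 else real (Suc i) * tc \<omega> (Suc i) (n - i - 1))
      + p * (if i = 0 then 0 else real (Suc (n - i)) * tc \<omega> (i - 1) (Suc (n - i)))
      + q * (real (n - i) * tc \<omega> i (n - i)))"
    using sg by (simp add: tc_u_p1 tc_v_p1 tc_u_p2 tc_v_p2 tc_partial_2)
  thus "tc (LL x1 c d p q r 1 2 \<xi> \<gamma> \<omega>) i (n - i) = cF n (2 * d / c) p q r X H O' i"
    using i c by (auto simp: cF_def X_def H_def O'_def hc_def e e' of_nat_diff algebra_simps)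
  have "LL x1 c d p q r 2 2 \<xi> \<gamma> \<omega> =
    (\<lambda>w. 2 * x1 * c * (w $ 1 * partial 2 \<gamma> w) + (2 * q * (w $ 1 * partial 2 \<omega> w) + 2 * r * (w $ 2 * partial 2 \<omega> w)))"
    by (simp add: LL_def fun_eq_iff partial_lin partial_quadr algebra_simps)
  hence "tc (LL x1 c d p q r 2 2 \<xi> \<gamma> \<omega>) i (n - i) =
      2 * x1 * c * (if i = 0 then 0 else real (Suc (n - i)) * tc \<gamma> (i - 1) (Suc (n - i)))
      + (2 * q * (if i = 0 then 0 else real (Suc (n - i)) * tc \<omega> (i - 1) (Suc (n - i)))
      + 2 * r * (real (n - i) * tc \<omega> i (n - i)))"
    using sg by (simp add: tc_u_p2 tc_v_p2)
  thus "tc (LL x1 c d p q r 2 2 \<xi> \<gamma> \<omega>) i (n - i) = 2 * cG n q r H O' i"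
    using i c by (auto simp: cG_def H_def O'_def hc_def e of_nat_diff algebra_simps)
qed

lemma vo_LL:
  assumes sg: "sg \<xi>" "sg \<gamma>" "sg \<omega>"
    and "vo (Suc n) \<xi>" "vo n \<gamma>" "vo n \<omega>"
  shows "vo n (LL x1 c d p q r k l \<xi> \<gamma> \<omega>)"
proof (cases n)
  case (Suc m)
  have "vo n (\<lambda>w. LL x1 c d p q r k l \<xi> \<gamma> \<omega> w - LL x1 c d p q r k l (\<lambda>w. 0) (\<lambda>w. 0) (\<lambda>w. 0) w)"
    using assms unfolding Suc by (intro LL_cong_vo) auto
  thus ?thesis by (simp add: LL_def[abs_def])
qed simp

lemma hc_hpoly: "i \<le> n \<Longrightarrow> hc n (hpoly n C) i = C i"
  by (simp add: hc_def tc_hpoly)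

lemma linear_system_solvable:
  assumes n: "2 \<le> n" and nz: "r \<noteq> 0" "x1 \<noteq> 0" "c \<noteq> 0"
    and sg: "sg e" "sg f" "sg g" and vo: "vo n e" "vo n f" "vo n g"
  obtains X H O' where "H 0 = 0"
    "vo (Suc n) (\<lambda>w. e w - LL x1 c d p q r 1 1 (hpoly (Suc n) X) (hpoly n H) (hpoly n O') w)"
    "vo (Suc n) (\<lambda>w. f w - LL x1 c d p q r 1 2 (hpoly (Suc n) X) (hpoly n H) (hpoly n O') w)"
    "vo (Suc n) (\<lambda>w. g w - LL x1 c d p q r 2 2 (hpoly (Suc n) X) (hpoly n H) (hpoly n O') w)"
proof -
  obtain X H O' where *: "H 0 = 0" "H (Suc n) = 0" "O' (Suc n) = 0"
    "\<forall>i\<le>n. cE (2 * d / c) p q X H O' i = tc e i (n - i) / 2 \<and>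
       cF n (2 * d / c) p q r X H O' i = tc f i (n - i) \<and> cG n q r H O' i = tc g i (n - i) / 2"
    using coefficient_system_solvable[OF n nz(1), of "2 * d / c" p q "\<lambda>i. tc e i (n - i) / 2"
        "\<lambda>i. tc f i (n - i)" "\<lambda>i. tc g i (n - i) / 2"] by blast
  define X' where "X' i = X i / x1" for i
  define H' where "H' i = H i / (x1 * c)" for i
  let ?L = "\<lambda>k l. LL x1 c d p q r k l (hpoly (Suc n) X') (hpoly n H') (hpoly n O')"
  have hcs: "x1 * hc (Suc n) (hpoly (Suc n) X') i = X i" if "i \<le> Suc n" for i
    using nz that by (simp add: hc_hpoly X'_def)
  have hcs2: "x1 * c * hc n (hpoly n H') i = H i" "hc n (hpoly n O') i = O' i" if "i \<le> Suc n" for i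
  proof -
    show "x1 * c * hc n (hpoly n H') i = H i"
      using nz that * by (cases "i = Suc n") (auto simp: hc_hpoly H'_def hc_def[of n _ "Suc n"])
    show "hc n (hpoly n O') i = O' i"
      using that * by (cases "i = Suc n") (auto simp: hc_hpoly hc_def[of n _ "Suc n"])
  qed
  have t: "tc (?L 1 1) i (n - i) = tc e i (n - i)" "tc (?L 1 2) i (n - i) = tc f i (n - i)"
    "tc (?L 2 2) i (n - i) = tc g i (n - i)" if "i \<le> n" for i
  proof -
    have 1: "cE (2 * d / c) p q (\<lambda>i. x1 * hc (Suc n) (hpoly (Suc n) X') i)
       (\<lambda>i. x1 * c * hc n (hpoly n H') i) (hc n (hpoly n O')) i = cE (2 * d / c) p q X H O' i"
      unfolding cE_def using that by (simp add: hcs hcs2)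
    have 2: "cF n (2 * d / c) p q r (\<lambda>i. x1 * hc (Suc n) (hpoly (Suc n) X') i)
       (\<lambda>i. x1 * c * hc n (hpoly n H') i) (hc n (hpoly n O')) i = cF n (2 * d / c) p q r X H O' i"
      unfolding cF_def using that by (simp add: hcs hcs2)
    have 3: "cG n q r (\<lambda>i. x1 * c * hc n (hpoly n H') i) (hc n (hpoly n O')) i = cG n q r H O' i"
      unfolding cG_def using that by (simp add: hcs2)
    note t = tc_LL[where c = c and n = n, OF sg_hpoly sg_hpoly sg_hpoly that nz(3)]
    show "tc (?L 1 1) i (n - i) = tc e i (n - i)"
      unfolding t 1 using *(4)[rule_format, OF that] by auto
    show "tc (?L 1 2) i (n - i) = tc f i (n - i)"
      unfolding t 2 using *(4)[rule_format, OF that] by auto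
    show "tc (?L 2 2) i (n - i) = tc g i (n - i)"
      unfolding t 3 using *(4)[rule_format, OF that] by auto
  qed
  have voL: "vo n (?L k l)" for k l
    by (intro vo_LL vo_hpoly sg_hpoly)
  show ?thesis
  proof (rule that[of H' X' O'])
    show "H' 0 = 0" using * by (simp add: H'_def)
    show "vo (Suc n) (\<lambda>w. e w - ?L 1 1 w)"
      by (subst vo_Suc_iff_tc) (use sg vo voL t in \<open>auto intro!: vo_diff\<close>)
    show "vo (Suc n) (\<lambda>w. f w - ?L 1 2 w)"
      by (subst vo_Suc_iff_tc) (use sg vo voL t in \<open>auto intro!: vo_diff\<close>)
    show "vo (Suc n) (\<lambda>w. g w - ?L 2 2 w)"
      by (subst vo_Suc_iff_tc) (use sg vo voL t in \<open>auto intro!: vo_diff\<close>)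
  qed
qed

lemma linear_system_unique:
  assumes n: "2 \<le> n" and nz: "r \<noteq> 0" "x1 \<noteq> 0" "c \<noteq> 0"
    and sg: "sg \<xi>" "sg \<gamma>" "sg \<omega>" and vo: "vo (Suc n) \<xi>" "vo n \<gamma>" "vo n \<omega>"
    and g0: "tc \<gamma> 0 n = 0"
    and L: "vo (Suc n) (LL x1 c d p q r 1 1 \<xi> \<gamma> \<omega>)" "vo (Suc n) (LL x1 c d p q r 1 2 \<xi> \<gamma> \<omega>)"
      "vo (Suc n) (LL x1 c d p q r 2 2 \<xi> \<gamma> \<omega>)"
  shows "vo (Suc (Suc n)) \<xi>" "vo (Suc n) \<gamma>" "vo (Suc n) \<omega>"
proof -
  have z: "tc (LL x1 c d p q r k l \<xi> \<gamma> \<omega>) i (n - i) = 0"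
    if "vo (Suc n) (LL x1 c d p q r k l \<xi> \<gamma> \<omega>)" "i \<le> n" for k l i
    by (rule vo_tcD[OF _ that(1)]) (use sg that in auto)
  note t = tc_LL[OF sg _ nz(3), where n = n]
  let ?X = "\<lambda>i. x1 * hc (Suc n) \<xi> i" and ?H = "\<lambda>i. x1 * c * hc n \<gamma> i" and ?O = "hc n \<omega>"
  have E: "cE (2 * d / c) p q ?X ?H ?O i = 0" "cF n (2 * d / c) p q r ?X ?H ?O i = 0"
    "cG n q r ?H ?O i = 0" if "i \<le> n" for i
    using z[OF L(1) that] z[OF L(2) that] z[OF L(3) that] t[OF that] by simp_all
  have b: "?H 0 = 0" "?O (Suc n) = 0" "?H (Suc n) = 0" using g0 by (simp_all add: hc_def)
  note u = coefficient_system_unique[where H = ?H and X = ?X and O' = ?O, OF n nz(1) E b]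
  have "hc (Suc n) \<xi> i = 0" if "i \<le> Suc n" for i using u(3)[OF _ _ _ that] nz by auto
  thus "vo (Suc (Suc n)) \<xi>"
    by (subst vo_Suc_iff_tc) (use sg vo in \<open>auto simp: hc_def\<close>)
  have "hc n \<gamma> i = 0" "hc n \<omega> i = 0" if "i \<le> n" for i
    using u(1)[OF _ _ _ that] u(2)[OF _ _ _ that] nz by auto
  thus "vo (Suc n) \<gamma>" "vo (Suc n) \<omega>"
    by (subst vo_Suc_iff_tc; use sg vo in \<open>auto simp: hc_def\<close>)+
qed

subsection \<open>Formal solution of the isometric embedding problem\<close>

text \<open>Germs in one variable are lifted to the plane, so that two-variable composition applies to them.\<close>
definition bl :: "(real \<Rightarrow> real) \<Rightarrow> real^2 \<Rightarrow> real" where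
  "bl b w = b (w $ 1)"

definition g2 :: "(real \<Rightarrow> real) \<Rightarrow> (real^2 \<Rightarrow> real) \<Rightarrow> (real^2 \<Rightarrow> real) \<Rightarrow> real^2 \<Rightarrow> real" where
  "g2 b x y w = x w * y w + bl b (pairm y (\<lambda>w. 0) w)"

text \<open>A third component of the form $Z(x) + W^2$ loses no formal power series with the right 2-jet,
  but unlike a general germ it lets the smooth map be recognised as a cross cap.\<close>
definition zf :: "(real^2 \<Rightarrow> real) \<Rightarrow> (real^2 \<Rightarrow> real) \<Rightarrow> (real^2 \<Rightarrow> real) \<Rightarrow> real^2 \<Rightarrow> real" where
  "zf x W Z w = Z (pairm x (\<lambda>w. 0) w) + (W w)\<^sup>2"

lemma sg_comp0: "sg h \<Longrightarrow> sg x \<Longrightarrow> x 0 = 0 \<Longrightarrow> sg (\<lambda>w. h (pairm x (\<lambda>w. 0) w))"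
  by (rule sg_compose[of h x "\<lambda>w. 0"]) simp_all

lemma sg_bl: "sg (bl b) \<Longrightarrow> sg y \<Longrightarrow> y 0 = 0 \<Longrightarrow> sg (\<lambda>w. bl b (pairm y (\<lambda>w. 0) w))"
  by (rule sg_comp0)

lemma sg_g2: "sg (bl b) \<Longrightarrow> sg x \<Longrightarrow> sg y \<Longrightarrow> y 0 = 0 \<Longrightarrow> sg (g2 b x y)"
  unfolding g2_def[abs_def] by (intro sg_add sg_mult sg_bl)

lemma sg_zf: "sg x \<Longrightarrow> sg W \<Longrightarrow> sg Z \<Longrightarrow> x 0 = 0 \<Longrightarrow> sg (zf x W Z)"
  unfolding zf_def[abs_def] by (intro sg_add sg_power sg_comp0[of Z x])

lemma vo_power: "sg f \<Longrightarrow> vo (Suc 0) f \<Longrightarrow> vo n (\<lambda>w. f w ^ n)"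
proof (induction n)
  case (Suc n)
  thus ?case using vo_mult[of f "\<lambda>w. f w ^ n" "Suc 0" n "Suc n"] by simp
qed simp

lemma vo_power_diff:
  assumes "sg f" "sg g" "vo (Suc 0) f" "vo (Suc 0) g" "vo 2 (\<lambda>w. f w - g w)" "1 \<le> n"
  shows "vo (Suc n) (\<lambda>w. f w ^ n - g w ^ n)"
  using assms(6)
proof (induction n rule: dec_induct)
  case base
  thus ?case using assms(5) by (simp add: numeral_2_eq_2)
next
  case (step n)
  have "vo (Suc (Suc n)) (\<lambda>w. f w * f w ^ n - g w * g w ^ n)"
    using assms step by (intro vo_mult_diff[where i = "Suc 0" and j = n and k = 2 and l = "Suc n"]) (auto intro: vo_power)
  thus ?case by simp
qed

lemma vo_quadr: "vo 2 (quadr a b c)"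
  by (simp add: numeral_2_eq_2 vo_Suc forall_2 partial_quadr) (simp add: quadr_def)

lemma vo_base:
  assumes "sg f" "sg m" "vo N (\<lambda>w. f w - m w)" "vo N m"
  shows "vo N f"
  using vo_add[of "\<lambda>w. f w - m w" m N] assms by simp

lemma g2_base:
  assumes "sg (bl b)" "vo 3 (bl b)" "sg x" "sg y"
    "vo 2 (\<lambda>w. x w - lin x1 0 w)" "vo 2 (\<lambda>w. y w - lin d c w)"
  shows "vo 3 (\<lambda>w. g2 b x y w - quadr (2 * x1 * d) (x1 * c) 0 w)"
proof -
  have v: "vo (Suc 0) x" "vo (Suc 0) y"
    using assms vo_base[of x "lin x1 0" "Suc 0"] vo_base[of y "lin d c" "Suc 0"]
      vo_mono[OF assms(5), of "Suc 0"] vo_mono[OF assms(6), of "Suc 0"] by simp_all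
  hence y0: "y 0 = 0" by (simp add: vo_1_iff)
  have "vo 3 (\<lambda>w. x w * y w - lin x1 0 w * lin d c w)"
    using assms v by (intro vo_mult_diff[where i = "Suc 0" and j = "Suc 0" and k = 2 and l = 2]) auto
  moreover have "vo 3 (\<lambda>w. bl b (pairm y (\<lambda>w. 0) w))"
    using assms y0 by (intro vo_compose) auto
  ultimately have "vo 3 (\<lambda>w. (x w * y w - lin x1 0 w * lin d c w) + bl b (pairm y (\<lambda>w. 0) w))"
    using assms y0 by (intro vo_add sg_diff sg_mult sg_bl) auto
  thus ?thesis by (simp add: g2_def lin_def quadr_def power2_eq_square algebra_simps)
qed

text \<open>As \<open>b\<close> has order 3, a change of order k in y alters b(y) only at order k +
  2, and so do the products of small terms. What survives is x1 u times the change of y.\<close>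

lemma g2_diff:
  assumes "sg (bl b)" "vo 3 (bl b)" "sg x" "sg y" "sg x'" "sg y'" "x 0 = 0" "y 0 = 0" "y' 0 = 0"
    "vo k (\<lambda>w. y' w - y w)" "vo 2 (\<lambda>w. x' w - lin x1 0 w)" "vo (Suc k) (\<lambda>w. x' w - x w)"
  shows "vo (Suc (Suc k)) (\<lambda>w. g2 b x' y' w - g2 b x y w - x1 * (w $ 1 * (y' w - y w)))"
proof -
  have b1: "vo (Suc (Suc k)) (\<lambda>w. bl b (pairm y' (\<lambda>w. 0) w) - bl b (pairm y (\<lambda>w. 0) w))"
    using assms by (intro vo_compose_diff[where h = "bl b" and m = k and k = 3]) auto
  have b2: "vo (Suc (Suc k)) (\<lambda>w. (x' w - lin x1 0 w) * (y' w - y w))"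
    using assms by (intro vo_mult[where m = 2 and n = k]) auto
  have b3: "vo (Suc (Suc k)) (\<lambda>w. (x' w - x w) * y w)"
    using assms by (intro vo_mult[where m = "Suc k" and n = "Suc 0"]) (auto simp: vo_1_iff)
  have "vo (Suc (Suc k)) (\<lambda>w. (bl b (pairm y' (\<lambda>w. 0) w) - bl b (pairm y (\<lambda>w. 0) w)) +
      ((x' w - lin x1 0 w) * (y' w - y w) + (x' w - x w) * y w))"
    using assms by (intro vo_add b1 b2 b3 sg_add sg_mult sg_diff sg_bl) auto
  thus ?thesis by (simp add: g2_def lin_def algebra_simps)
qed

text \<open>The square contributes twice the linear part of W times its increment, and the new term
  of Z its value on the linear part of x. The square of the increment has order 2n - 2, which is
  negligible from n = 3 on.\<close>

lemma zf_diff: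
  assumes sg: "sg x" "sg W" "sg Z" "sg x'" "sg t" and z: "x 0 = 0" "x' 0 = 0"
    and x: "vo (Suc n) (\<lambda>w. x' w - x w)" "vo 2 (\<lambda>w. x' w - lin x1 0 w)"
    and W: "vo 2 (\<lambda>w. W w - lin w0 w1 w)" and t: "vo (n - 1) t" and n: "3 \<le> n"
  shows "vo (Suc n) (\<lambda>w. zf x' (\<lambda>w. W w + t w) (\<lambda>w. Z w + \<sigma> * w $ 1 ^ n) w - zf x W Z w
    - (\<sigma> * x1 ^ n * w $ 1 ^ n + 2 * (lin w0 w1 w * t w)))"
proof -
  have "vo (Suc n) (\<lambda>w. Z (pairm x' (\<lambda>w. 0) w) - Z (pairm x (\<lambda>w. 0) w))"
    using assms by (intro vo_compose_diff[where h = Z and m = "Suc n" and k = 0]) auto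
  moreover have "vo (Suc n) (\<lambda>w. \<sigma> * (x' w ^ n - lin x1 0 w ^ n))"
    using assms by (intro vo_mult_left vo_power_diff sg_diff sg_power) (auto simp: vo_1_iff lin_def)
  moreover have "vo (Suc n) (\<lambda>w. 2 * ((W w - lin w0 w1 w) * t w))"
    using assms by (intro vo_mult_left vo_mult[where m = 2 and n = "n - 1"]) auto
  moreover have "vo (Suc n) (\<lambda>w. t w * t w)"
    using assms by (intro vo_mult[where m = "n - 1" and n = "n - 1"]) auto
  ultimately have "vo (Suc n) (\<lambda>w. (Z (pairm x' (\<lambda>w. 0) w) - Z (pairm x (\<lambda>w. 0) w)) +
      (\<sigma> * (x' w ^ n - lin x1 0 w ^ n) + (2 * ((W w - lin w0 w1 w) * t w) + t w * t w)))"
    using sg z by (intro vo_add sg_add sg_mult sg_diff sg_power sg_const sg_proj sg_lin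
        sg_comp0[of Z x] sg_comp0[of Z x'])
  thus ?thesis by (simp add: zf_def lin_def power2_eq_square power_mult_distrib algebra_simps)
qed

lemma hpoly_factor_u:
  assumes "H 0 = 0" "1 \<le> n"
  shows "vo (Suc n) (\<lambda>w. hpoly n H w - w $ 1 * hpoly (n - 1) (\<lambda>i. H (Suc i)) w)"
proof (subst vo_Suc_iff_tc)
  show "\<forall>i\<le>n. tc (\<lambda>w. hpoly n H w - w $ 1 * hpoly (n - 1) (\<lambda>i. H (Suc i)) w) i (n - i) = 0"
    using assms by (auto simp: tc_mult_u tc_hpoly)
  show "vo n (\<lambda>w. hpoly n H w - w $ 1 * hpoly (n - 1) (\<lambda>i. H (Suc i)) w)"
    using assms by (intro vo_diff vo_hpoly sg_mult sg_hpoly sg_proj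
        vo_mult[where m = "Suc 0" and n = "n - 1"]) auto
qed auto

text \<open>Division of a form by w0 u + w1 v, possible up to a multiple of u^n because
  \<open>w1\<close> is nonzero. Thus corrections of Z and W together reach every correction of the
  third component.\<close>

lemma hpoly_split:
  fixes w0 w1 :: real
  assumes "w1 \<noteq> 0" "1 \<le> n"
  obtains s T where "vo (Suc n) (\<lambda>w. hpoly n O' w - (s * w $ 1 ^ n + 2 * (lin w0 w1 w * hpoly (n - 1) T w)))"
proof -
  define T where "T = rec_nat (O' 0 / (2 * w1)) (\<lambda>i t. (O' (Suc i) - 2 * w0 * t) / (2 * w1))"
  have T0: "2 * w1 * T 0 = O' 0" using assms by (simp add: T_def)
  have TS: "2 * w1 * T (Suc i) = O' (Suc i) - 2 * w0 * T i" for i using assms by (simp add: T_def)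
  define s where "s = O' n - 2 * w0 * T (n - 1)"
  have tcp: "tc (\<lambda>w. w $ 1 ^ n) i (n - i) = (if i = n then 1 else 0)" if "i \<le> n" for i
    using tc_monom[of n 0 i "n - i"] that by auto
  have eq: "(\<lambda>w. hpoly n O' w - (s * w $ 1 ^ n + 2 * (lin w0 w1 w * hpoly (n - 1) T w))) =
     (\<lambda>w. hpoly n O' w - (s * w $ 1 ^ n + (2 * w0 * (w $ 1 * hpoly (n - 1) T w) + 2 * w1 * (w $ 2 * hpoly (n - 1) T w))))"
    by (simp add: lin_def algebra_simps)
  have "vo (Suc n) (\<lambda>w. hpoly n O' w - (s * w $ 1 ^ n + 2 * (lin w0 w1 w * hpoly (n - 1) T w)))"
  proof (subst vo_Suc_iff_tc)
    show "vo n (\<lambda>w. hpoly n O' w - (s * w $ 1 ^ n + 2 * (lin w0 w1 w * hpoly (n - 1) T w)))"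
      using assms by (intro vo_diff vo_add vo_hpoly vo_mult_left vo_power vo_mult[where m = "Suc 0" and n = "n - 1"]
          sg_add sg_mult sg_hpoly sg_lin sg_power sg_proj sg_const) auto
    show "\<forall>i\<le>n. tc (\<lambda>w. hpoly n O' w - (s * w $ 1 ^ n + 2 * (lin w0 w1 w * hpoly (n - 1) T w))) i (n - i) = 0"
    proof (intro allI impI)
      fix i assume i: "i \<le> n"
      have "tc (\<lambda>w. hpoly n O' w - (s * w $ 1 ^ n + 2 * (lin w0 w1 w * hpoly (n - 1) T w))) i (n - i)
        = O' i - (s * (if i = n then 1 else 0) + (2 * w0 * (if i = 0 then 0 else T (i - 1))
          + 2 * w1 * (if i = n then 0 else T i)))"
        unfolding eq using i assms by (auto simp: tc_mult_u tc_mult_v tc_hpoly tcp)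
      also have "\<dots> = 0"
        using i T0 TS[of "i - 1"] assms by (cases i) (auto simp: s_def)
      finally show "tc (\<lambda>w. hpoly n O' w - (s * w $ 1 ^ n + 2 * (lin w0 w1 w * hpoly (n - 1) T w))) i (n - i) = 0" .
    qed
  qed auto
  thus ?thesis by (rule that)
qed

locale formal_embedding =
  fixes E F G :: "real^2 \<Rightarrow> real" and b :: "real \<Rightarrow> real" and x1 c d p q r w0 w1 :: real
  assumes metric: "sg E" "sg F" "sg G"
    and b: "sg (bl b)" "vo 3 (bl b)"
    and nz: "x1 \<noteq> 0" "c \<noteq> 0" "r \<noteq> 0" "w1 \<noteq> 0"
begin

definition approx :: "nat \<Rightarrow> (real^2 \<Rightarrow> real) \<times> (real^2 \<Rightarrow> real) \<times> (real^2 \<Rightarrow> real) \<times> (real^2 \<Rightarrow> real) \<Rightarrow> bool" where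
  "approx n = (\<lambda>(x, y, W, Z). sg x \<and> sg y \<and> sg W \<and> sg Z \<and>
     vo 2 (\<lambda>w. x w - lin x1 0 w) \<and> vo 2 (\<lambda>w. y w - lin d c w) \<and> vo 2 (\<lambda>w. W w - lin w0 w1 w) \<and>
     vo 2 Z \<and> vo 3 (\<lambda>w. zf x W Z w - quadr p q r w) \<and>
     vo n (\<lambda>w. E w - Qf 1 1 x (g2 b x y) (zf x W Z) w) \<and>
     vo n (\<lambda>w. F w - Qf 1 2 x (g2 b x y) (zf x W Z) w) \<and>
     vo n (\<lambda>w. G w - Qf 2 2 x (g2 b x y) (zf x W Z) w))"

lemma at0: "sg f \<Longrightarrow> vo 2 (\<lambda>w. f w - lin \<alpha> \<beta> w) \<Longrightarrow> f 0 = 0"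
  using vo_at0[of 2 "\<lambda>w. f w - lin \<alpha> \<beta> w"] by (simp add: lin_def)

text \<open>The linear system gives corrections of the three components, which are then traced back
  to the building blocks: division by x1 u yields the one for y, division by w0 u + w1 v those for W
  and Z. All of them have order at least 2, so the base jets survive.\<close>

lemma improve:
  assumes "3 \<le> n" "approx n (x, y, W, Z)"
  shows "\<exists>x' y' W' Z'. approx (Suc n) (x', y', W', Z') \<and> vo (n - 1) (\<lambda>w. x' w - x w) \<and>
     vo (n - 1) (\<lambda>w. y' w - y w) \<and> vo (n - 1) (\<lambda>w. W' w - W w) \<and> vo (n - 1) (\<lambda>w. Z' w - Z w)"
proof -
  note n = assms(1)
  have sg: "sg x" "sg y" "sg W" "sg Z" and base: "vo 2 (\<lambda>w. x w - lin x1 0 w)" "vo 2 (\<lambda>w. y w - lin d c w)"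
     "vo 2 (\<lambda>w. W w - lin w0 w1 w)" "vo 2 Z" "vo 3 (\<lambda>w. zf x W Z w - quadr p q r w)"
    and res: "vo n (\<lambda>w. E w - Qf 1 1 x (g2 b x y) (zf x W Z) w)"
     "vo n (\<lambda>w. F w - Qf 1 2 x (g2 b x y) (zf x W Z) w)"
     "vo n (\<lambda>w. G w - Qf 2 2 x (g2 b x y) (zf x W Z) w)"
    using assms(2) by (auto simp: approx_def)
  have z: "x 0 = 0" "y 0 = 0" using at0 sg base by blast+
  have sgz: "sg (g2 b x y)" "sg (zf x W Z)" using sg z b by (auto intro: sg_g2 sg_zf)
  obtain X H O' where S: "H 0 = 0"
    "vo (Suc n) (\<lambda>w. (E w - Qf 1 1 x (g2 b x y) (zf x W Z) w) - LL x1 c d p q r 1 1 (hpoly (Suc n) X) (hpoly n H) (hpoly n O') w)"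
    "vo (Suc n) (\<lambda>w. (F w - Qf 1 2 x (g2 b x y) (zf x W Z) w) - LL x1 c d p q r 1 2 (hpoly (Suc n) X) (hpoly n H) (hpoly n O') w)"
    "vo (Suc n) (\<lambda>w. (G w - Qf 2 2 x (g2 b x y) (zf x W Z) w) - LL x1 c d p q r 2 2 (hpoly (Suc n) X) (hpoly n H) (hpoly n O') w)"
    by (rule linear_system_solvable[of n r x1 c "\<lambda>w. E w - Qf 1 1 x (g2 b x y) (zf x W Z) w"
          "\<lambda>w. F w - Qf 1 2 x (g2 b x y) (zf x W Z) w" "\<lambda>w. G w - Qf 2 2 x (g2 b x y) (zf x W Z) w" d p q])
       (use n nz metric sgz sg res in auto)
  obtain s T where T: "vo (Suc n) (\<lambda>w. hpoly n O' w - (s * w $ 1 ^ n + 2 * (lin w0 w1 w * hpoly (n - 1) T w)))"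
    by (rule hpoly_split[of w1 n O' w0]) (use nz n in auto)
  define \<eta> where "\<eta> = hpoly (n - 1) (\<lambda>i. H (Suc i) / x1)"
  define \<sigma> where "\<sigma> = s / x1 ^ n"
  define x' where "x' w = x w + hpoly (Suc n) X w" for w
  define y' where "y' w = y w + \<eta> w" for w
  define W' where "W' w = W w + hpoly (n - 1) T w" for w
  define Z' where "Z' w = Z w + \<sigma> * w $ 1 ^ n" for w
  have sg': "sg x'" "sg y'" "sg W'" "sg Z'"
    using sg unfolding x'_def[abs_def] y'_def[abs_def] W'_def[abs_def] Z'_def[abs_def] \<eta>_def by auto
  have dx: "vo (Suc n) (\<lambda>w. x' w - x w)" and dy: "vo (n - 1) (\<lambda>w. y' w - y w)"
    and dW: "vo (n - 1) (\<lambda>w. W' w - W w)" and dZ: "vo n (\<lambda>w. Z' w - Z w)"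
    by (auto simp: x'_def y'_def W'_def Z'_def \<eta>_def vo_hpoly intro!: vo_mult_left vo_power)
  have vb: "vo 2 (\<lambda>w. f' w - m w)" if "vo 2 (\<lambda>w. f w - m w)" "vo k (\<lambda>w. f' w - f w)" "2 \<le> k"
    "sg f" "sg f'" "sg m" for f f' m k
    using vo_trans[OF that(5,4,6) vo_mono[OF that(2,3)] that(1)] .
  have base': "vo 2 (\<lambda>w. x' w - lin x1 0 w)" "vo 2 (\<lambda>w. y' w - lin d c w)" "vo 2 (\<lambda>w. W' w - lin w0 w1 w)"
  proof -
    show "vo 2 (\<lambda>w. x' w - lin x1 0 w)" by (rule vb[OF base(1) dx]) (use n sg sg' in simp_all)
    show "vo 2 (\<lambda>w. y' w - lin d c w)" by (rule vb[OF base(2) dy]) (use n sg sg' in simp_all)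
    show "vo 2 (\<lambda>w. W' w - lin w0 w1 w)" by (rule vb[OF base(3) dW]) (use n sg sg' in simp_all)
  qed
  have "vo 2 (\<lambda>w. Z' w - 0)" by (rule vb[OF _ dZ]) (use base(4) n sg sg' in simp_all)
  hence Z2: "vo 2 Z'" by simp
  have z': "x' 0 = 0" "y' 0 = 0" using at0 sg' base' by blast+
  have sgz': "sg (g2 b x' y')" "sg (zf x' W' Z')" using sg' z' b by (auto intro: sg_g2 sg_zf)
  have nn: "Suc (Suc (n - 1)) = Suc n" "Suc (n - 1) = n" using n by auto
  have "vo (Suc (n - 1)) (\<lambda>w. x' w - x w)" by (rule vo_mono[OF dx]) simp
  note gd = g2_diff[OF b sg(1,2) sg'(1,2) z z'(2) dy base'(1) this]
  have "vo (Suc n) (\<lambda>w. (g2 b x' y' w - g2 b x y w) - w $ 1 * hpoly (n - 1) (\<lambda>i. H (Suc i)) w)"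
  proof -
    have eta: "x1 * (w $ 1 * (y' w - y w)) = w $ 1 * hpoly (n - 1) (\<lambda>i. H (Suc i)) w" for w
      using nz by (simp add: y'_def \<eta>_def hpoly_def sum_distrib_left field_simps)
    show ?thesis using gd unfolding eta nn(1) .
  qed
  hence dg: "vo (Suc n) (\<lambda>w. (g2 b x' y' w - g2 b x y w) - hpoly n H w)"
    by (rule vo_trans[OF sg_diff[OF sgz'(1) sgz(1)] sg_mult[OF sg_proj sg_hpoly] sg_hpoly _
          vo_swap[OF sg_hpoly sg_mult[OF sg_proj sg_hpoly] hpoly_factor_u[where H = H and n = n, OF S(1)]]])
       (use n in simp)
  have "vo (Suc n) (\<lambda>w. (zf x' W' Z' w - zf x W Z w) - (\<sigma> * x1 ^ n * w $ 1 ^ n + 2 * (lin w0 w1 w * hpoly (n - 1) T w)))"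
    unfolding W'_def[abs_def] Z'_def[abs_def]
    by (rule zf_diff) (use sg sg' z z' dx base base' n vo_hpoly in auto)
  moreover have "\<sigma> * x1 ^ n = s" using nz by (simp add: \<sigma>_def)
  ultimately have dz0: "vo (Suc n) (\<lambda>w. (zf x' W' Z' w - zf x W Z w) - (s * w $ 1 ^ n + 2 * (lin w0 w1 w * hpoly (n - 1) T w)))"
    by simp
  have sgm: "sg (\<lambda>w. s * w $ 1 ^ n + 2 * (lin w0 w1 w * hpoly (n - 1) T w))"
    by (intro sg_add sg_mult sg_power sg_hpoly sg_lin sg_proj sg_const)
  have dz: "vo (Suc n) (\<lambda>w. (zf x' W' Z' w - zf x W Z w) - hpoly n O' w)"
    by (rule vo_trans[OF sg_diff[OF sgz'(2) sgz(2)] sgm sg_hpoly dz0 vo_swap[OF sg_hpoly sgm T]])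
  have vg: "vo n (\<lambda>w. g2 b x' y' w - g2 b x y w)"
    by (rule vo_base[OF _ sg_hpoly vo_mono[OF dg] vo_hpoly]) (use sgz sgz' in auto)
  have vz: "vo n (\<lambda>w. zf x' W' Z' w - zf x W Z w)"
    by (rule vo_base[OF _ sg_hpoly vo_mono[OF dz] vo_hpoly]) (use sgz sgz' in auto)
  have zb: "vo 3 (\<lambda>w. zf x' W' Z' w - quadr p q r w)"
    by (rule vo_trans[OF sgz'(2) sgz(2) sg_quadr vo_mono[OF vz n] base(5)])
  note gb = g2_base[OF b sg(1,2) base(1,2)] and gb' = g2_base[OF b sg'(1,2) base'(1,2)]
  have main: "vo (Suc n) (\<lambda>w. M w - Qf k l x' (g2 b x' y') (zf x' W' Z') w)"
    if M: "sg M" "vo (Suc n) (\<lambda>w. (M w - Qf k l x (g2 b x y) (zf x W Z) w)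
        - LL x1 c d p q r k l (hpoly (Suc n) X) (hpoly n H) (hpoly n O') w)" for k l M
  proof -
    let ?D = "LL x1 c d p q r k l (\<lambda>w. x' w - x w) (\<lambda>w. g2 b x' y' w - g2 b x y w) (\<lambda>w. zf x' W' Z' w - zf x W Z w)"
    let ?P = "LL x1 c d p q r k l (hpoly (Suc n) X) (hpoly n H) (hpoly n O')"
    have 1: "vo (Suc n) (\<lambda>w. Qf k l x' (g2 b x' y') (zf x' W' Z') w - Qf k l x (g2 b x y) (zf x W Z) w - ?D w)"
      by (rule Qf_diff[OF sg(1) sgz sg'(1) sgz' base(1) gb base(5) base'(1) gb' zb dx vg vz]) (use n in auto)
    have "vo (Suc (Suc n)) (\<lambda>w. x' w - x w - hpoly (Suc n) X w)" by (simp add: x'_def)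
    hence 2: "vo (Suc n) (\<lambda>w. ?D w - ?P w)"
      using sg sg' sgz sgz' by (intro LL_cong_vo dg dz sg_diff sg_hpoly) auto
    have "vo (Suc n) (\<lambda>w. ((M w - Qf k l x (g2 b x y) (zf x W Z) w) - ?P w) -
       ((Qf k l x' (g2 b x' y') (zf x' W' Z') w - Qf k l x (g2 b x y) (zf x W Z) w - ?D w) + (?D w - ?P w)))"
      using sg sg' sgz sgz' M(1) by (intro vo_diff vo_add M(2) 1 2) auto
    thus ?thesis by (simp add: algebra_simps)
  qed
  have "approx (Suc n) (x', y', W', Z')"
    unfolding approx_def using sg' base' Z2 zb main[OF metric(1) S(2)] main[OF metric(2) S(3)] main[OF metric(3) S(4)]
    by simp
  moreover have "vo (n - 1) (\<lambda>w. x' w - x w)" by (rule vo_mono[OF dx]) simp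
  moreover have "vo (n - 1) (\<lambda>w. Z' w - Z w)" by (rule vo_mono[OF dZ]) simp
  ultimately show ?thesis using dy dW by blast
qed

lemma Qf_cont:
  assumes "sg x" "sg g" "sg z" "sg x'" "sg g'" "sg z'" "vo (Suc N) (\<lambda>w. x w - x' w)"
    "vo (Suc N) (\<lambda>w. g w - g' w)" "vo (Suc N) (\<lambda>w. z w - z' w)"
  shows "vo N (\<lambda>w. Qf k l x g z w - Qf k l x' g' z' w)"
proof -
  have t: "vo N (\<lambda>w. partial k a w * partial l a w - partial k a' w * partial l a' w)"
    if "sg a" "sg a'" "vo (Suc N) (\<lambda>w. a w - a' w)" for a a'
    using that vo_partial_diff[OF that] by (intro vo_mult_diff[where i = 0 and j = 0 and k = N and l = N]) auto
  have "vo N (\<lambda>w. (partial k x w * partial l x w - partial k x' w * partial l x' w)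
    + (partial k g w * partial l g w - partial k g' w * partial l g' w)
    + (partial k z w * partial l z w - partial k z' w * partial l z' w))"
    using assms by (intro vo_add t sg_add sg_diff sg_mult sg_partial) auto
  thus ?thesis by (simp add: Qf_def algebra_simps)
qed

text \<open>The approximations are Cauchy for the filtration by order, so each building block has a
  smooth limit. The equations pass to the limit because forming the first fundamental form loses
  only one order.\<close>

lemma limit:
  assumes "approx 3 s0"
  shows "\<exists>x y W Z. \<forall>n. approx n (x, y, W, Z)"
proof -
  \<comment> \<open>The shift by 3 is due to \<open>improve\<close>, which starts there; it grants
    agreement to order n + 2, of which order n is recorded.\<close>
  have "\<exists>s. \<forall>n. (approx (n + 3) (s n) \<and> (n = 0 \<longrightarrow> s n = s0)) \<and>
     (case s n of (x, y, W, Z) \<Rightarrow> case s (Suc n) of (x', y', W', Z') \<Rightarrow>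
       vo n (\<lambda>w. x' w - x w) \<and> vo n (\<lambda>w. y' w - y w) \<and> vo n (\<lambda>w. W' w - W w) \<and> vo n (\<lambda>w. Z' w - Z w))"
  proof (rule dependent_nat_choice)
    show "\<exists>s. approx (0 + 3) s \<and> (0 = 0 \<longrightarrow> s = s0)" by (rule exI[of _ s0]) (use assms in simp)
    fix s and n :: nat assume s: "approx (n + 3) s \<and> (n = 0 \<longrightarrow> s = s0)"
    obtain x y W Z where sd: "s = (x, y, W, Z)" by (metis prod_cases4)
    obtain x' y' W' Z' where *: "approx (Suc (n + 3)) (x', y', W', Z')" "vo (n + 2) (\<lambda>w. x' w - x w)"
     "vo (n + 2) (\<lambda>w. y' w - y w)" "vo (n + 2) (\<lambda>w. W' w - W w)" "vo (n + 2) (\<lambda>w. Z' w - Z w)"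
      using improve[of "n + 3" x y W Z] s sd by auto
    show "\<exists>s'. (approx (Suc n + 3) s' \<and> (Suc n = 0 \<longrightarrow> s' = s0)) \<and>
      (case s of (x, y, W, Z) \<Rightarrow> case s' of (x', y', W', Z') \<Rightarrow>
       vo n (\<lambda>w. x' w - x w) \<and> vo n (\<lambda>w. y' w - y w) \<and> vo n (\<lambda>w. W' w - W w) \<and> vo n (\<lambda>w. Z' w - Z w))"
      using * unfolding sd by (intro exI[of _ "(x', y', W', Z')"]) (auto elim: vo_mono)
  qed
  then obtain s where s': "\<forall>n. (approx (n + 3) (s n) \<and> (n = 0 \<longrightarrow> s n = s0)) \<and>
     (case s n of (x, y, W, Z) \<Rightarrow> case s (Suc n) of (x', y', W', Z') \<Rightarrow>
       vo n (\<lambda>w. x' w - x w) \<and> vo n (\<lambda>w. y' w - y w) \<and> vo n (\<lambda>w. W' w - W w) \<and> vo n (\<lambda>w. Z' w - Z w))"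
    by (rule exE)
  note s = conjunct1[OF conjunct1[OF s'[rule_format]]] conjunct2[OF s'[rule_format]]
  define X where "X n = fst (s n)" for n
  define Y where "Y n = fst (snd (s n))" for n
  define V where "V n = fst (snd (snd (s n)))" for n
  define Q where "Q n = snd (snd (snd (s n)))" for n
  have sn: "s n = (X n, Y n, V n, Q n)" for n by (simp add: X_def Y_def V_def Q_def)
  have ap: "approx (n + 3) (X n, Y n, V n, Q n)" for n using s(1)[of n] by (simp add: sn)
  hence sgs: "sg (X n)" "sg (Y n)" "sg (V n)" "sg (Q n)" for n by (auto simp: approx_def)
  have step: "vo n (\<lambda>w. X (Suc n) w - X n w)" "vo n (\<lambda>w. Y (Suc n) w - Y n w)"
    "vo n (\<lambda>w. V (Suc n) w - V n w)" "vo n (\<lambda>w. Q (Suc n) w - Q n w)" for n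
    using s(2)[of n] by (simp_all add: sn)
  obtain x where x: "sg x" "\<And>n. vo n (\<lambda>w. x w - X n w)"
    by (rule germ_completeness[where x = X, OF sgs(1) step(1)]) blast
  obtain y where y: "sg y" "\<And>n. vo n (\<lambda>w. y w - Y n w)"
    by (rule germ_completeness[where x = Y, OF sgs(2) step(2)]) blast
  obtain W where W: "sg W" "\<And>n. vo n (\<lambda>w. W w - V n w)"
    by (rule germ_completeness[where x = V, OF sgs(3) step(3)]) blast
  obtain Z where Z: "sg Z" "\<And>n. vo n (\<lambda>w. Z w - Q n w)"
    by (rule germ_completeness[where x = Q, OF sgs(4) step(4)]) blast
  have lim2: "vo 2 (\<lambda>w. f w - m w)" if "vo 2 (\<lambda>w. f w - g w)" "vo 2 (\<lambda>w. g w - m w)" "sg f" "sg g" "sg m"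
    for f g m :: "real^2 \<Rightarrow> real"
    using vo_trans[OF that(3,4,5,1,2)] .
  have base: "vo 2 (\<lambda>w. x w - lin x1 0 w)" "vo 2 (\<lambda>w. y w - lin d c w)" "vo 2 (\<lambda>w. W w - lin w0 w1 w)"
  proof -
    show "vo 2 (\<lambda>w. x w - lin x1 0 w)"
      by (rule lim2[OF x(2)[of 2]]) (use ap[of 2] x(1) sgs in \<open>simp_all add: approx_def\<close>)
    show "vo 2 (\<lambda>w. y w - lin d c w)"
      by (rule lim2[OF y(2)[of 2]]) (use ap[of 2] y(1) sgs in \<open>simp_all add: approx_def\<close>)
    show "vo 2 (\<lambda>w. W w - lin w0 w1 w)"
      by (rule lim2[OF W(2)[of 2]]) (use ap[of 2] W(1) sgs in \<open>simp_all add: approx_def\<close>)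
  qed
  have Z2: "vo 2 Z" using vo_base[OF Z(1) sgs(4)[of 2] Z(2)] ap[of 2] by (simp add: approx_def)
  have z0: "x 0 = 0" "y 0 = 0" using at0 base x(1) y(1) by blast+
  have Xz: "X n 0 = 0" "Y n 0 = 0" for n using at0 ap[of n] by (auto simp: approx_def)
  have sgz: "sg (g2 b x y)" "sg (zf x W Z)" "sg (g2 b (X n) (Y n))" "sg (zf (X n) (V n) (Q n))" for n
    using x(1) y(1) W(1) Z(1) sgs z0 Xz b by (auto intro: sg_g2 sg_zf)
  have gd: "vo n (\<lambda>w. g2 b x y w - g2 b (X n) (Y n) w)" for n
  proof -
    have a1: "vo n (\<lambda>w. x w * y w - X n w * Y n w)"
      using x y sgs by (intro vo_mult_diff[where i = 0 and j = 0 and k = n and l = n]) auto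
    have a2: "vo n (\<lambda>w. bl b (pairm y (\<lambda>w. 0) w) - bl b (pairm (Y n) (\<lambda>w. 0) w))"
      using y sgs z0 Xz b by (intro vo_compose_diff[where h = "bl b" and m = n and k = 0]) auto
    have "vo n (\<lambda>w. (x w * y w - X n w * Y n w) + (bl b (pairm y (\<lambda>w. 0) w) - bl b (pairm (Y n) (\<lambda>w. 0) w)))"
      using x y sgs z0 Xz b by (intro vo_add a1 a2 sg_diff sg_mult sg_bl) auto
    thus ?thesis by (simp add: g2_def algebra_simps)
  qed
  have zd: "vo n (\<lambda>w. zf x W Z w - zf (X n) (V n) (Q n) w)" for n
  proof -
    have a1: "vo n (\<lambda>w. W w * W w - V n w * V n w)"
      using W sgs by (intro vo_mult_diff[where i = 0 and j = 0 and k = n and l = n]) auto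
    have a2: "vo n (\<lambda>w. Z (pairm x (\<lambda>w. 0) w) - Z (pairm (X n) (\<lambda>w. 0) w))"
      using x Z sgs z0 Xz by (intro vo_compose_diff[where h = Z and m = n and k = 0]) auto
    have a3: "vo n (\<lambda>w. Z (pairm (X n) (\<lambda>w. 0) w) - Q n (pairm (X n) (\<lambda>w. 0) w))"
      using Z sgs Xz by (intro vo_compose[of "\<lambda>w. Z w - Q n w"]) auto
    have "vo n (\<lambda>w. (W w * W w - V n w * V n w) + ((Z (pairm x (\<lambda>w. 0) w) - Z (pairm (X n) (\<lambda>w. 0) w))
       + (Z (pairm (X n) (\<lambda>w. 0) w) - Q n (pairm (X n) (\<lambda>w. 0) w))))"
      using W Z x sgs z0 Xz a3 by (intro vo_add a1 a2 sg_add sg_diff sg_mult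
          sg_comp0[of Z x] sg_comp0[of Z "X n"] sg_comp0[of "Q n" "X n"])
    thus ?thesis by (simp add: zf_def power2_eq_square algebra_simps)
  qed
  have zb: "vo 3 (\<lambda>w. zf x W Z w - quadr p q r w)"
    using vo_trans[OF sgz(2) sgz(4)[of 3] sg_quadr zd] ap[of 3] by (simp add: approx_def)
  have res: "vo n (\<lambda>w. M w - Qf k l x (g2 b x y) (zf x W Z) w)"
    if "sg M" "vo (Suc n + 3) (\<lambda>w. M w - Qf k l (X (Suc n)) (g2 b (X (Suc n)) (Y (Suc n))) (zf (X (Suc n)) (V (Suc n)) (Q (Suc n))) w)"
    for n k l M
  proof -
    have "vo n (\<lambda>w. Qf k l x (g2 b x y) (zf x W Z) w -
        Qf k l (X (Suc n)) (g2 b (X (Suc n)) (Y (Suc n))) (zf (X (Suc n)) (V (Suc n)) (Q (Suc n))) w)"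
      by (intro Qf_cont x gd zd sgz sgs)
    hence "vo n (\<lambda>w. Qf k l (X (Suc n)) (g2 b (X (Suc n)) (Y (Suc n))) (zf (X (Suc n)) (V (Suc n)) (Q (Suc n))) w
       - Qf k l x (g2 b x y) (zf x W Z) w)"
      by (rule vo_swap[rotated 2]) (intro sg_Qf x sgz sgs)+
    moreover have "vo n (\<lambda>w. M w - Qf k l (X (Suc n)) (g2 b (X (Suc n)) (Y (Suc n))) (zf (X (Suc n)) (V (Suc n)) (Q (Suc n))) w)"
      by (rule vo_mono[OF that(2)]) simp
    ultimately show ?thesis
      by (intro vo_trans[OF that(1) sg_Qf[OF sgs(1) sgz(3,4)] sg_Qf[OF x(1) sgz(1,2)]])
  qed
  have "approx n (x, y, W, Z)" for n
    using ap[of "Suc n"] res[OF metric(1), of n 1 1] res[OF metric(2), of n 1 2] res[OF metric(3), of n 2 2]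
      x(1) y(1) W(1) Z(1) base Z2 zb
    unfolding approx_def by simp
  thus ?thesis by blast
qed

end

lemma partial_at0: 
  shows "sg h \<Longrightarrow> partial 1 h 0 = tc h (Suc 0) 0" "partial 2 h 0 = tc h 0 (Suc 0)"
  using tc_partial_1[of h 0 0] tc_partial_2[of h 0 0] by simp_all

section \<open>The quadratic equations for the low-order jets and the formal theorems\<close>

lemma Qf_jet:
  assumes sg: "sg x" "sg g" "sg z"
    and z: "tc x 0 (Suc 0) = 0" "tc g (Suc 0) 0 = 0" "tc g 0 (Suc 0) = 0" "tc z (Suc 0) 0 = 0" "tc z 0 (Suc 0) = 0"
  defines "x10 \<equiv> tc x (Suc 0) 0" and "x20 \<equiv> tc x (Suc (Suc 0)) 0" and "x11 \<equiv> tc x (Suc 0) (Suc 0)"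
    and "x02 \<equiv> tc x 0 (Suc (Suc 0))" and "x30 \<equiv> tc x (Suc (Suc (Suc 0))) 0"
    and "x21 \<equiv> tc x (Suc (Suc 0)) (Suc 0)" and "x12 \<equiv> tc x (Suc 0) (Suc (Suc 0))"
    and "x03 \<equiv> tc x 0 (Suc (Suc (Suc 0)))"
    and "g20 \<equiv> tc g (Suc (Suc 0)) 0" and "g11 \<equiv> tc g (Suc 0) (Suc 0)" and "g02 \<equiv> tc g 0 (Suc (Suc 0))"
    and "z20 \<equiv> tc z (Suc (Suc 0)) 0" and "z11 \<equiv> tc z (Suc 0) (Suc 0)" and "z02 \<equiv> tc z 0 (Suc (Suc 0))"
  shows "Qf 1 1 x g z 0 = x10\<^sup>2" "Qf 1 2 x g z 0 = 0" "Qf 2 2 x g z 0 = 0"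
    "tc (Qf 1 1 x g z) (Suc 0) 0 = 4 * x10 * x20" "tc (Qf 1 1 x g z) 0 (Suc 0) = 2 * x10 * x11"
    "tc (Qf 1 2 x g z) (Suc 0) 0 = x10 * x11" "tc (Qf 1 2 x g z) 0 (Suc 0) = 2 * x10 * x02"
    "tc (Qf 2 2 x g z) (Suc 0) 0 = 0" "tc (Qf 2 2 x g z) 0 (Suc 0) = 0"
    "tc (Qf 1 1 x g z) (Suc (Suc 0)) 0 = 4 * x20\<^sup>2 + 6 * x10 * x30 + 4 * g20\<^sup>2 + 4 * z20\<^sup>2"
    "tc (Qf 1 1 x g z) (Suc 0) (Suc 0) = 4 * x20 * x11 + 4 * x10 * x21 + 4 * g20 * g11 + 4 * z20 * z11"
    "tc (Qf 1 1 x g z) 0 (Suc (Suc 0)) = x11\<^sup>2 + 2 * x10 * x12 + g11\<^sup>2 + z11\<^sup>2"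
    "tc (Qf 1 2 x g z) (Suc (Suc 0)) 0 = 2 * x20 * x11 + x10 * x21 + 2 * g20 * g11 + 2 * z20 * z11"
    "tc (Qf 1 2 x g z) (Suc 0) (Suc 0) = 4 * x20 * x02 + x11\<^sup>2 + 2 * x10 * x12
       + 4 * g20 * g02 + g11\<^sup>2 + 4 * z20 * z02 + z11\<^sup>2"
    "tc (Qf 1 2 x g z) 0 (Suc (Suc 0)) = 2 * x11 * x02 + 3 * x10 * x03 + 2 * g11 * g02 + 2 * z11 * z02"
    "tc (Qf 2 2 x g z) (Suc (Suc 0)) 0 = x11\<^sup>2 + g11\<^sup>2 + z11\<^sup>2"
    "tc (Qf 2 2 x g z) (Suc 0) (Suc 0) = 4 * x11 * x02 + 4 * g11 * g02 + 4 * z11 * z02"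
    "tc (Qf 2 2 x g z) 0 (Suc (Suc 0)) = 4 * x02\<^sup>2 + 4 * g02\<^sup>2 + 4 * z02\<^sup>2"
  unfolding assms(9-)
  using sg
  by (simp_all add: Qf_def[abs_def] tc_mult_low tc_partial_1 tc_partial_2 partial_at0 z power2_eq_square algebra_simps)

text \<open>The equations become triangular after one elimination. \<open>E01 = 2 * F10\<close> is
  the compatibility of two equations for x11, the positivity conditions make the square roots for r
  and c real, and \<open>s\<close> is the free sign of c.\<close>

lemma jet_equations_solvable:
  fixes E0 E10 E01 E20 E11 E02 F10 F01 F20 F11 F02 G20 G11 G02 s :: real
  assumes E0: "0 < E0" and adm: "E01 = 2 * F10" and s: "s = 1 \<or> s = - 1"
    and pos: "0 < E0 * G02 - F01\<^sup>2"
      "0 < 4 * (E0 * G20 - F10\<^sup>2) * (E0 * G02 - F01\<^sup>2) - (E0 * G11 - 2 * F10 * F01)\<^sup>2"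
  obtains x10 x20 x11 x02 x30 x21 x12 x03 c d p q r where "0 < x10" "0 < s * c" "0 < r"
    "E0 = x10\<^sup>2" "E10 = 4 * x10 * x20" "E01 = 2 * x10 * x11" "F10 = x10 * x11" "F01 = 2 * x10 * x02"
    "E20 = 4 * x20\<^sup>2 + 6 * x10 * x30 + 4 * (x10 * d)\<^sup>2 + p\<^sup>2"
    "E11 = 4 * x20 * x11 + 4 * x10 * x21 + 4 * (x10 * d) * (x10 * c) + 2 * p * q"
    "E02 = x11\<^sup>2 + 2 * x10 * x12 + (x10 * c)\<^sup>2 + q\<^sup>2"
    "F20 = 2 * x20 * x11 + x10 * x21 + 2 * (x10 * d) * (x10 * c) + p * q"
    "F11 = 4 * x20 * x02 + x11\<^sup>2 + 2 * x10 * x12 + (x10 * c)\<^sup>2 + p * r + q\<^sup>2"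
    "F02 = 2 * x11 * x02 + 3 * x10 * x03 + q * r"
    "G20 = x11\<^sup>2 + (x10 * c)\<^sup>2 + q\<^sup>2" "G11 = 4 * x11 * x02 + 2 * q * r" "G02 = 4 * x02\<^sup>2 + r\<^sup>2"
proof -
  define x10 where "x10 = sqrt E0"
  have x10: "0 < x10" "x10\<^sup>2 = E0" using E0 by (auto simp: x10_def)
  define x20 x11 x02 where "x20 = E10 / (4 * x10)" and "x11 = F10 / x10" and "x02 = F01 / (2 * x10)"
  have eq: "E10 = 4 * x10 * x20" "F10 = x10 * x11" "F01 = 2 * x10 * x02"
    using x10 by (auto simp: x20_def x11_def x02_def)
  have D: "E0 * G02 - F01\<^sup>2 = E0 * (G02 - 4 * x02\<^sup>2)" "E0 * G20 - F10\<^sup>2 = E0 * (G20 - x11\<^sup>2)"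
    "E0 * G11 - 2 * F10 * F01 = E0 * (G11 - 4 * x11 * x02)"
    unfolding eq(2,3) x10(2)[symmetric] by (simp_all add: power2_eq_square algebra_simps)
  have r2: "0 < G02 - 4 * x02\<^sup>2" using pos(1) E0 unfolding D(1) by (simp add: zero_less_mult_iff)
  define r where "r = sqrt (G02 - 4 * x02\<^sup>2)"
  have r: "0 < r" "r\<^sup>2 = G02 - 4 * x02\<^sup>2" using r2 by (auto simp: r_def)
  define q where "q = (G11 - 4 * x11 * x02) / (2 * r)"
  have q: "G11 = 4 * x11 * x02 + 2 * q * r" using r by (simp add: q_def field_simps)
  \<comment> \<open>Completing the square identifies the discriminant with a positive multiple of
    the future value of (x10 c)^2.\<close>
  have "4 * (E0 * G20 - F10\<^sup>2) * (E0 * G02 - F01\<^sup>2) - (E0 * G11 - 2 * F10 * F01)\<^sup>2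
     = 4 * E0\<^sup>2 * r\<^sup>2 * (G20 - x11\<^sup>2 - q\<^sup>2)"
  proof -
    have "G11 - 4 * x11 * x02 = 2 * q * r" using q by simp
    thus ?thesis unfolding D r(2)[symmetric] by (simp add: power2_eq_square algebra_simps)
  qed
  hence "0 < 4 * E0\<^sup>2 * r\<^sup>2 * (G20 - x11\<^sup>2 - q\<^sup>2)" using pos(2) by simp
  moreover have "0 < 4 * E0\<^sup>2 * r\<^sup>2" using E0 r(1) by simp
  ultimately have m: "0 < G20 - x11\<^sup>2 - q\<^sup>2" by (rule zero_less_mult_pos)
  define c where "c = s * sqrt (G20 - x11\<^sup>2 - q\<^sup>2) / x10"
  have ss: "s * s = 1" using s by auto
  have c: "(x10 * c)\<^sup>2 = G20 - x11\<^sup>2 - q\<^sup>2"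
  proof -
    have "x10 * c = s * sqrt (G20 - x11\<^sup>2 - q\<^sup>2)" using x10 by (simp add: c_def)
    moreover have "s\<^sup>2 = 1" using ss by (simp add: power2_eq_square)
    ultimately show ?thesis using m by (simp add: power_mult_distrib)
  qed
  have sc: "0 < s * c"
  proof -
    have "s * c = sqrt (G20 - x11\<^sup>2 - q\<^sup>2) / x10" using ss by (simp add: c_def)
    thus ?thesis using m x10 by simp
  qed
  hence c0: "c \<noteq> 0" by auto
  define x12 where "x12 = (E02 - x11\<^sup>2 - (x10 * c)\<^sup>2 - q\<^sup>2) / (2 * x10)"
  have x12: "E02 = x11\<^sup>2 + 2 * x10 * x12 + (x10 * c)\<^sup>2 + q\<^sup>2" using x10 by (simp add: x12_def)
  define p where "p = (F11 - 4 * x20 * x02 - x11\<^sup>2 - 2 * x10 * x12 - (x10 * c)\<^sup>2 - q\<^sup>2) / r"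
  have p: "F11 = 4 * x20 * x02 + x11\<^sup>2 + 2 * x10 * x12 + (x10 * c)\<^sup>2 + p * r + q\<^sup>2" using r by (simp add: p_def)
  define x03 where "x03 = (F02 - 2 * x11 * x02 - q * r) / (3 * x10)"
  have x03: "F02 = 2 * x11 * x02 + 3 * x10 * x03 + q * r" using x10 by (simp add: x03_def)
  \<comment> \<open>The combination E11 - 4 F20 cancels x21 and isolates the product of x10 d and
    x10 c, which is \<open>k\<close>.\<close>
  define k where "k = - (E11 - 4 * F20 + 4 * x20 * x11 + 2 * p * q) / 4"
  define d where "d = k / (x10 * x10 * c)"
  have d: "(x10 * d) * (x10 * c) = k" using x10 c0 by (simp add: d_def)
  define x21 where "x21 = (F20 - 2 * x20 * x11 - 2 * k - p * q) / x10"
  have x21: "F20 = 2 * x20 * x11 + x10 * x21 + 2 * k + p * q" using x10 by (simp add: x21_def)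
  have e11: "E11 = 4 * x20 * x11 + 4 * x10 * x21 + 4 * k + 2 * p * q"
  proof -
    have "4 * k = - (E11 - 4 * F20 + 4 * x20 * x11 + 2 * p * q)" by (simp add: k_def)
    thus ?thesis using x21 by (simp add: algebra_simps)
  qed
  define x30 where "x30 = (E20 - 4 * x20\<^sup>2 - 4 * (x10 * d)\<^sup>2 - p\<^sup>2) / (6 * x10)"
  have x30: "E20 = 4 * x20\<^sup>2 + 6 * x10 * x30 + 4 * (x10 * d)\<^sup>2 + p\<^sup>2" using x10 by (simp add: x30_def)
  show ?thesis
  proof (rule that[of x10 c r x20 x11 x02 x30 d p x21 q x12 x03])
    show "E11 = 4 * x20 * x11 + 4 * x10 * x21 + 4 * (x10 * d) * (x10 * c) + 2 * p * q"
      using e11 d by (simp add: mult.assoc)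
    show "F20 = 2 * x20 * x11 + x10 * x21 + 2 * (x10 * d) * (x10 * c) + p * q"
      using x21 d by (simp add: mult.assoc)
  qed (use x10 sc r eq adm x30 x12 p x03 c q in \<open>simp_all\<close>)
qed

lemma tc_lin: "tc (lin a b) i j = (if i = 1 \<and> j = 0 then a else if i = 0 \<and> j = 1 then b else 0)"
proof -
  have 1: "tc (\<lambda>w. w $ 1) i j = (if i = 1 \<and> j = 0 then 1 else 0)" using tc_monom[of 1 0 i j] by simp
  have 2: "tc (\<lambda>w. w $ 2) i j = (if i = 0 \<and> j = 1 then 1 else 0)" using tc_monom[of 0 1 i j] by simp
  show ?thesis unfolding lin_def[abs_def] by (subst tc_add) (auto simp: 1 2)
qed

lemma tc_quadr: "tc (quadr p q r) i j =
   (if i = 2 \<and> j = 0 then p / 2 else if i = 1 \<and> j = 1 then q else if i = 0 \<and> j = 2 then r / 2 else 0)"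
proof -
  have 1: "tc (\<lambda>w. (w $ 1)\<^sup>2) i j = (if i = 2 \<and> j = 0 then 1 else 0)" using tc_monom[of 2 0 i j] by simp
  have 2: "tc (\<lambda>w. (w $ 2)\<^sup>2) i j = (if i = 0 \<and> j = 2 then 1 else 0)" using tc_monom[of 0 2 i j] by simp
  have 3: "tc (\<lambda>w. w $ 1 * w $ 2) i j = (if i = 1 \<and> j = 1 then 1 else 0)" using tc_monom[of 1 1 i j] by simp
  have "tc (quadr p q r) i j = p / 2 * tc (\<lambda>w. (w $ 1)\<^sup>2) i j + q * tc (\<lambda>w. w $ 1 * w $ 2) i j
      + r / 2 * tc (\<lambda>w. (w $ 2)\<^sup>2) i j"
    unfolding quadr_def[abs_def]
    by (simp only: tc_add tc_cmult sg_add sg_mult sg_const sg_power sg_proj)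
  thus ?thesis by (auto simp: 1 2 3)
qed

lemma tc_eq_of_vo: "sg f \<Longrightarrow> sg g \<Longrightarrow> vo N (\<lambda>w. f w - g w) \<Longrightarrow> i + j < N \<Longrightarrow> tc f i j = tc g i j"
  using vo_tcD[of "\<lambda>w. f w - g w" N i j] by simp

lemma vo_3_iff:
  assumes "sg h"
  shows "vo 3 h \<longleftrightarrow> h 0 = 0 \<and> tc h (Suc 0) 0 = 0 \<and> tc h 0 (Suc 0) = 0 \<and> tc h (Suc (Suc 0)) 0 = 0 \<and>
    tc h (Suc 0) (Suc 0) = 0 \<and> tc h 0 (Suc (Suc 0)) = 0"
proof -
  have "(\<forall>i j. i + j < 3 \<longrightarrow> tc h i j = 0) \<longleftrightarrow> tc h 0 0 = 0 \<and> tc h (Suc 0) 0 = 0 \<and> tc h 0 (Suc 0) = 0 \<and>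
    tc h (Suc (Suc 0)) 0 = 0 \<and> tc h (Suc 0) (Suc 0) = 0 \<and> tc h 0 (Suc (Suc 0)) = 0"
  proof (rule iffI, goal_cases)
    case 1
    from 1[rule_format, of 0 0] 1 show ?case by simp
  next
    case 2
    show ?case
  proof (intro allI impI)
    fix i j :: nat assume "i + j < 3"
    with 2 have *: "tc h 0 0 = 0 \<and> tc h (Suc 0) 0 = 0 \<and> tc h 0 (Suc 0) = 0 \<and>
      tc h (Suc (Suc 0)) 0 = 0 \<and> tc h (Suc 0) (Suc 0) = 0 \<and> tc h 0 (Suc (Suc 0)) = 0" "i + j < 3" by auto
    hence "(i = 0 \<and> j = 0) \<or> (i = Suc 0 \<and> j = 0) \<or> (i = 0 \<and> j = Suc 0) \<or> (i = Suc (Suc 0) \<and> j = 0)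
      \<or> (i = Suc 0 \<and> j = Suc 0) \<or> (i = 0 \<and> j = Suc (Suc 0))" by linarith
    thus "tc h i j = 0" using * by auto
  qed
  qed
  thus ?thesis using vo_iff_tc[OF assms, of 3] by simp
qed

lemma vo_cancel_u:
  assumes "sg h" "vo (Suc n) (\<lambda>w. w $ 1 * h w)"
  shows "vo n h"
  unfolding vo_iff_tc[OF assms(1)]
proof (intro allI impI)
  fix i j assume "i + j < n"
  hence "tc (\<lambda>w. w $ 1 * h w) (Suc i) j = 0" using assms by (intro vo_tcD[OF _ assms(2)]) auto
  thus "tc h i j = 0" by (simp add: tc_mult_u_Suc[OF assms(1)])
qed

theorem formal_existence:
  assumes sg: "sg E" "sg F" "sg G" and b: "sg (bl b)" "vo 3 (bl b)"
    and E0: "0 < E 0" and F0: "F 0 = 0" and G0: "G 0 = 0" "tc G (Suc 0) 0 = 0" "tc G 0 (Suc 0) = 0"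
    and adm: "tc E 0 (Suc 0) = 2 * tc F (Suc 0) 0" and s: "s = 1 \<or> s = - (1::real)"
    and pos: "0 < E 0 * tc G 0 (Suc (Suc 0)) - (tc F 0 (Suc 0))\<^sup>2"
      "0 < 4 * (E 0 * tc G (Suc (Suc 0)) 0 - (tc F (Suc 0) 0)\<^sup>2) * (E 0 * tc G 0 (Suc (Suc 0)) - (tc F 0 (Suc 0))\<^sup>2)
         - (E 0 * tc G (Suc 0) (Suc 0) - 2 * tc F (Suc 0) 0 * tc F 0 (Suc 0))\<^sup>2"
  obtains x y W Z x1 c d p q r w0 w1 where "sg x" "sg y" "sg W" "sg Z"
    "vo 2 (\<lambda>w. x w - lin x1 0 w)" "vo 2 (\<lambda>w. y w - lin d c w)" "vo 2 (\<lambda>w. W w - lin w0 w1 w)"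
    "vo 2 Z" "vo 3 (\<lambda>w. zf x W Z w - quadr p q r w)" "0 < x1" "0 < s * c" "0 < r" "w1 \<noteq> 0"
    "\<And>n. vo n (\<lambda>w. E w - Qf 1 1 x (g2 b x y) (zf x W Z) w)"
    "\<And>n. vo n (\<lambda>w. F w - Qf 1 2 x (g2 b x y) (zf x W Z) w)"
    "\<And>n. vo n (\<lambda>w. G w - Qf 2 2 x (g2 b x y) (zf x W Z) w)"
proof -
  obtain x10 x20 x11 x02 x30 x21 x12 x03 c d p q r where j: "0 < x10" "0 < s * c" "0 < r"
    "E 0 = x10\<^sup>2" "tc E (Suc 0) 0 = 4 * x10 * x20" "tc E 0 (Suc 0) = 2 * x10 * x11"
    "tc F (Suc 0) 0 = x10 * x11" "tc F 0 (Suc 0) = 2 * x10 * x02"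
    "tc E (Suc (Suc 0)) 0 = 4 * x20\<^sup>2 + 6 * x10 * x30 + 4 * (x10 * d)\<^sup>2 + p\<^sup>2"
    "tc E (Suc 0) (Suc 0) = 4 * x20 * x11 + 4 * x10 * x21 + 4 * (x10 * d) * (x10 * c) + 2 * p * q"
    "tc E 0 (Suc (Suc 0)) = x11\<^sup>2 + 2 * x10 * x12 + (x10 * c)\<^sup>2 + q\<^sup>2"
    "tc F (Suc (Suc 0)) 0 = 2 * x20 * x11 + x10 * x21 + 2 * (x10 * d) * (x10 * c) + p * q"
    "tc F (Suc 0) (Suc 0) = 4 * x20 * x02 + x11\<^sup>2 + 2 * x10 * x12 + (x10 * c)\<^sup>2 + p * r + q\<^sup>2"
    "tc F 0 (Suc (Suc 0)) = 2 * x11 * x02 + 3 * x10 * x03 + q * r"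
    "tc G (Suc (Suc 0)) 0 = x11\<^sup>2 + (x10 * c)\<^sup>2 + q\<^sup>2" "tc G (Suc 0) (Suc 0) = 4 * x11 * x02 + 2 * q * r"
    "tc G 0 (Suc (Suc 0)) = 4 * x02\<^sup>2 + r\<^sup>2"
    by (rule jet_equations_solvable[OF E0 adm s pos])
  \<comment> \<open>Chosen so that k x^2 + (w0 u + w1 v)^2 has Hessian entries p, q, r: w1 is read
    off from v^2, w0 from uv, and the constant \<open>k\<close> below from u^2.\<close>
  define w1 w0 where "w1 = sqrt (r / 2)" and "w0 = q / (2 * sqrt (r / 2))"
  have w1: "0 < w1" "w1 * w1 = r / 2" using j(3) by (auto simp: w1_def)
  have w0: "2 * w0 * w1 = q" using w1 j(3) by (simp add: w0_def w1_def)
  define k where "k = (p - 2 * w0\<^sup>2) / (2 * x10\<^sup>2)"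
  have k: "2 * k * x10\<^sup>2 = p - 2 * w0\<^sup>2" using j(1) by (simp add: k_def)
  \<comment> \<open>Terms up to degree three are needed, because x_u is a unit and the 2-jet of the
    metric therefore sees third-order coefficients of x.\<close>
  define x where "x w = lin x10 0 w + (hpoly 2 (\<lambda>i. if i = 0 then x02 else if i = 1 then x11 else x20) w
    + hpoly 3 (\<lambda>i. if i = 0 then x03 else if i = 1 then x12 else if i = 2 then x21 else x30) w)" for w
  define Z where "Z w = k * (w $ 1)\<^sup>2" for w :: "real^2"
  have sgx: "sg x" and sgZ: "sg Z" unfolding x_def[abs_def] Z_def[abs_def] by auto
  have bx: "vo 2 (\<lambda>w. x w - lin x10 0 w)"
    unfolding x_def by (simp, intro vo_add sg_hpoly vo_hpoly vo_mono[OF vo_hpoly]) auto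
  have x0: "x 0 = 0" using vo_at0[OF bx] by (simp add: lin_def)
  have Z2: "vo 2 Z" unfolding Z_def[abs_def] by (intro vo_mult_left vo_power sg_power) auto
  have sgz: "sg (zf x (lin w0 w1) Z)" using sgx sgZ x0 by (intro sg_zf) auto
  have bz: "vo 3 (\<lambda>w. zf x (lin w0 w1) Z w - quadr p q r w)"
  proof -
    have v: "vo (Suc 0) x" using x0 by (simp add: vo_1_iff)
    have "vo 3 (\<lambda>w. k * (x w * x w - lin x10 0 w * lin x10 0 w))"
      using sgx v bx by (intro vo_mult_left vo_mult_diff[where i = "Suc 0" and j = "Suc 0" and k = 2 and l = 2]) auto
    moreover have "zf x (lin w0 w1) Z w - quadr p q r w = k * (x w * x w - lin x10 0 w * lin x10 0 w)" for w
    proof -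
      have "quadr p q r w = (2 * k * x10\<^sup>2 + 2 * w0\<^sup>2) / 2 * (w $ 1)\<^sup>2 + (2 * w0 * w1) * (w $ 1 * w $ 2)
         + (2 * (w1 * w1)) / 2 * (w $ 2)\<^sup>2"
        unfolding quadr_def k w0 w1(2) by simp
      also have "\<dots> = k * (lin x10 0 w * lin x10 0 w) + (lin w0 w1 w)\<^sup>2"
        by (simp add: lin_def power2_eq_square algebra_simps)
      finally show ?thesis by (simp add: zf_def Z_def power2_eq_square algebra_simps)
    qed
    ultimately show ?thesis by simp
  qed
  have y0: "lin d c 0 = 0" by (simp add: lin_def)
  have sgg: "sg (g2 b x (lin d c))" by (rule sg_g2[OF b(1) sgx sg_lin y0])
  have bg: "vo 3 (\<lambda>w. g2 b x (lin d c) w - quadr (2 * x10 * d) (x10 * c) 0 w)"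
    by (rule g2_base[OF b sgx sg_lin bx]) simp
  note tg = tc_eq_of_vo[OF sgg sg_quadr bg] and tz = tc_eq_of_vo[OF sgz sg_quadr bz]
  have tx: "tc x i j = tc (lin x10 0) i j + (tc (hpoly 2 (\<lambda>i. if i = 0 then x02 else if i = 1 then x11 else x20)) i j
    + tc (hpoly 3 (\<lambda>i. if i = 0 then x03 else if i = 1 then x12 else if i = 2 then x21 else x30)) i j)" for i j
    unfolding x_def[abs_def] by simp
  note txs = tx tc_lin tc_hpoly
  have c1: "tc x 0 (Suc 0) = 0" "tc (g2 b x (lin d c)) (Suc 0) 0 = 0" "tc (g2 b x (lin d c)) 0 (Suc 0) = 0"
    "tc (zf x (lin w0 w1) Z) (Suc 0) 0 = 0" "tc (zf x (lin w0 w1) Z) 0 (Suc 0) = 0"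
    by (simp_all add: txs tg tz tc_quadr)
  note J = Qf_jet[OF sgx sgg sgz c1]
  have tx': "tc x (Suc 0) 0 = x10" "tc x (Suc (Suc 0)) 0 = x20" "tc x (Suc 0) (Suc 0) = x11"
    "tc x 0 (Suc (Suc 0)) = x02" "tc x (Suc (Suc (Suc 0))) 0 = x30" "tc x (Suc (Suc 0)) (Suc 0) = x21"
    "tc x (Suc 0) (Suc (Suc 0)) = x12" "tc x 0 (Suc (Suc (Suc 0))) = x03"
    by (simp_all add: txs)
  have tg': "tc (g2 b x (lin d c)) (Suc (Suc 0)) 0 = x10 * d" "tc (g2 b x (lin d c)) (Suc 0) (Suc 0) = x10 * c"
    "tc (g2 b x (lin d c)) 0 (Suc (Suc 0)) = 0"
    by (simp_all add: tg tc_quadr)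
  have tz': "tc (zf x (lin w0 w1) Z) (Suc (Suc 0)) 0 = p / 2" "tc (zf x (lin w0 w1) Z) (Suc 0) (Suc 0) = q"
    "tc (zf x (lin w0 w1) Z) 0 (Suc (Suc 0)) = r / 2"
    by (simp_all add: tz tc_quadr)
  interpret formal_embedding E F G b x10 c d p q r w0 w1
    using sg b j(1-3) w1 by unfold_locales auto
  have "approx 3 (x, lin d c, lin w0 w1, Z)"
    unfolding approx_def prod.case
  proof (intro conjI)
    show "vo 3 (\<lambda>w. E w - Qf 1 1 x (g2 b x (lin d c)) (zf x (lin w0 w1) Z) w)"
      using sg sgx sgg sgz by (subst vo_3_iff) (auto simp: J tx' tg' tz' j power2_eq_square)
    show "vo 3 (\<lambda>w. F w - Qf 1 2 x (g2 b x (lin d c)) (zf x (lin w0 w1) Z) w)"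
      using sg sgx sgg sgz by (subst vo_3_iff) (auto simp: J tx' tg' tz' j F0 power2_eq_square)
    show "vo 3 (\<lambda>w. G w - Qf 2 2 x (g2 b x (lin d c)) (zf x (lin w0 w1) Z) w)"
      using sg sgx sgg sgz by (subst vo_3_iff) (auto simp: J tx' tg' tz' j G0 power2_eq_square)
  qed (use sgx sgZ bx Z2 bz in simp_all)
  from limit[OF this] obtain x y W Z where "\<forall>n. approx n (x, y, W, Z)" by blast
  hence A: "sg x" "sg y" "sg W" "sg Z"
    "vo 2 (\<lambda>w. x w - lin x10 0 w)" "vo 2 (\<lambda>w. y w - lin d c w)" "vo 2 (\<lambda>w. W w - lin w0 w1 w)"
    "vo 2 Z" "vo 3 (\<lambda>w. zf x W Z w - quadr p q r w)"
    "vo n (\<lambda>w. E w - Qf 1 1 x (g2 b x y) (zf x W Z) w)"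
    "vo n (\<lambda>w. F w - Qf 1 2 x (g2 b x y) (zf x W Z) w)"
    "vo n (\<lambda>w. G w - Qf 2 2 x (g2 b x y) (zf x W Z) w)" for n
    unfolding approx_def by blast+
  show ?thesis
    by (rule that[OF A(1-9) j(1-3) _ A(10-12)]) (use w1 in auto)
qed

text \<open>The argument starts at degree 3, where the equations for the difference are linear at
  leading order. The hypotheses provide equal base jets and, since x runs one order ahead, agreement
  of x to order 4.\<close>

theorem formal_uniqueness:
  assumes b: "sg (bl b)" "vo 3 (bl b)" "sg (bl b')" "vo 3 (bl b')" "\<And>n. vo n (\<lambda>w. bl b' w - bl b w)"
    and sg: "sg x" "sg y" "sg z" "sg x'" "sg y'" "sg z'"
    and base: "vo 2 (\<lambda>w. x w - lin 1 0 w)" "vo 2 (\<lambda>w. y w - lin 0 c w)" "vo 3 (\<lambda>w. z w - quadr p q r w)"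
    and base': "vo 2 (\<lambda>w. x' w - lin 1 0 w)" "vo 2 (\<lambda>w. y' w - lin 0 c w)" "vo 3 (\<lambda>w. z' w - quadr p q r w)"
    and nz: "c \<noteq> 0" "r \<noteq> 0"
    and x4: "vo 4 (\<lambda>w. x' w - x w)"
    and Q: "\<And>n. vo n (\<lambda>w. Qf 1 1 x' (g2 b' x' y') z' w - Qf 1 1 x (g2 b x y) z w)"
      "\<And>n. vo n (\<lambda>w. Qf 1 2 x' (g2 b' x' y') z' w - Qf 1 2 x (g2 b x y) z w)"
      "\<And>n. vo n (\<lambda>w. Qf 2 2 x' (g2 b' x' y') z' w - Qf 2 2 x (g2 b x y) z w)"
  shows "vo n (\<lambda>w. x' w - x w) \<and> vo n (\<lambda>w. y' w - y w) \<and> vo n (\<lambda>w. z' w - z w)"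
proof -
  have at0: "f 0 = 0" if "sg f" "vo 2 (\<lambda>w. f w - lin \<alpha> \<beta> w)" for f \<alpha> \<beta>
    using vo_at0[OF that(2)] by (simp add: lin_def)
  have z0: "x 0 = 0" "y 0 = 0" "x' 0 = 0" "y' 0 = 0"
    using at0[OF sg(1) base(1)] at0[OF sg(2) base(2)] at0[OF sg(4) base'(1)] at0[OF sg(5) base'(2)] by auto
  let ?g = "g2 b x y" and ?g' = "g2 b' x' y'"
  have sgg: "sg ?g" "sg ?g'" using b sg z0 by (auto intro: sg_g2)
  have bg: "vo 3 (\<lambda>w. ?g w - quadr (2 * 1 * 0) (1 * c) 0 w)" "vo 3 (\<lambda>w. ?g' w - quadr (2 * 1 * 0) (1 * c) 0 w)"
    using g2_base[OF b(1,2) sg(1,2) base(1,2)] g2_base[OF b(3,4) sg(4,5) base'(1,2)] by auto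
  \<comment> \<open>The orders are staggered: x is one ahead of z, and y one behind because it
    enters the second component with a factor u.\<close>
  have main: "vo (k + 4) (\<lambda>w. x' w - x w) \<and> vo (k + 2) (\<lambda>w. y' w - y w) \<and> vo (k + 3) (\<lambda>w. z' w - z w)" for k
  proof (induction k)
    case 0
    have "vo 2 (\<lambda>w. y' w - y w)"
      using vo_trans[OF sg(5) sg_lin sg(2) base'(2) vo_swap[OF sg(2) sg_lin base(2)]] .
    moreover have "vo 3 (\<lambda>w. z' w - z w)"
      using vo_trans[OF sg(6) sg_quadr sg(3) base'(3) vo_swap[OF sg(3) sg_quadr base(3)]] .
    ultimately show ?case using x4 by (simp add: numeral_2_eq_2)
  next
    case (Suc k)
    define n where "n = k + 3"
    have n: "k + 4 = Suc n" "k + 2 = n - 1" "Suc (Suc (n - 1)) = Suc n" "Suc (n - 1) = n" by (auto simp: n_def)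
    have IH: "vo (Suc n) (\<lambda>w. x' w - x w)" "vo (n - 1) (\<lambda>w. y' w - y w)" "vo n (\<lambda>w. z' w - z w)"
      using Suc n by (auto simp: n_def)
    have IH1: "vo (Suc (n - 1)) (\<lambda>w. x' w - x w)" by (rule vo_mono[OF IH(1)]) simp
    have e1: "vo (Suc n) (\<lambda>w. g2 b x' y' w - ?g w - w $ 1 * (y' w - y w))"
      using g2_diff[OF b(1,2) sg(1,2,4,5) z0(1,2,4) IH(2) base'(1) IH1] n by simp
    \<comment> \<open>Exchanging \<open>b\<close> and \<open>b'\<close> changes the second component
      by a flat germ only.\<close>
    have e2: "vo (Suc n) (\<lambda>w. ?g' w - g2 b x' y' w)"
    proof -
      have "vo (Suc n) (\<lambda>w. bl b' (pairm y' (\<lambda>w. 0) w) - bl b (pairm y' (\<lambda>w. 0) w))"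
        using b sg z0 by (intro vo_compose[of "\<lambda>w. bl b' w - bl b w"]) auto
      thus ?thesis by (simp add: g2_def)
    qed
    have sgb: "sg (g2 b x' y')" using b sg z0 by (intro sg_g2)
    have dg: "vo (Suc n) (\<lambda>w. (?g' w - ?g w) - w $ 1 * (y' w - y w))"
    proof -
      have "vo (Suc n) (\<lambda>w. (g2 b x' y' w - ?g w - w $ 1 * (y' w - y w)) + (?g' w - g2 b x' y' w))"
        using sgg sgb sg by (intro vo_add e1 e2) auto
      thus ?thesis by (simp add: algebra_simps)
    qed
    have uy: "vo n (\<lambda>w. w $ 1 * (y' w - y w))"
      using sg IH(2) n by (intro vo_mult[where m = "Suc 0" and n = "n - 1"]) auto
    have suy: "sg (\<lambda>w. w $ 1 * (y' w - y w))" using sg by auto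
    have vg: "vo n (\<lambda>w. ?g' w - ?g w)"
      by (rule vo_base[OF sg_diff[OF sgg(2,1)] suy vo_mono[OF dg] uy]) simp
    have L: "vo (Suc n) (LL 1 c 0 p q r i j (\<lambda>w. x' w - x w) (\<lambda>w. ?g' w - ?g w) (\<lambda>w. z' w - z w))"
      if "vo (Suc n) (\<lambda>w. Qf i j x' ?g' z' w - Qf i j x ?g z w)" for i j
    proof -
      have sL: "sg (LL 1 c 0 p q r i j (\<lambda>w. x' w - x w) (\<lambda>w. ?g' w - ?g w) (\<lambda>w. z' w - z w))"
        using sg sgg by (intro sg_LL) auto
      have "vo (Suc n) (\<lambda>w. Qf i j x' ?g' z' w - Qf i j x ?g z w -
        LL 1 c 0 p q r i j (\<lambda>w. x' w - x w) (\<lambda>w. ?g' w - ?g w) (\<lambda>w. z' w - z w) w)"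
        by (rule Qf_diff[OF sg(1) sgg(1) sg(3,4) sgg(2) sg(6) base(1) bg(1) base(3) base'(1) bg(2) base'(3) IH(1) vg IH(3)])
           (simp add: n_def)
      from vo_diff[OF _ _ that this] show ?thesis using sg sgg sL by simp
    qed
    \<comment> \<open>Up to order n + 1 the change of the second component is divisible by u, so it
      has no v^n term. This is the condition \<open>H 0 = 0\<close> of the linear system.\<close>
    have t0: "tc (\<lambda>w. ?g' w - ?g w) 0 n = 0"
    proof -
      have "tc (\<lambda>w. ?g' w - ?g w) 0 n = tc (\<lambda>w. w $ 1 * (y' w - y w)) 0 n"
        by (rule tc_eq_of_vo[OF _ _ dg]) (use sg sgg in auto)
      thus ?thesis using sg by (simp add: tc_mult_u)
    qed
    have res: "vo (Suc (Suc n)) (\<lambda>w. x' w - x w)" "vo (Suc n) (\<lambda>w. ?g' w - ?g w)" "vo (Suc n) (\<lambda>w. z' w - z w)"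
      by (rule linear_system_unique[where n = n, OF _ nz(2) _ nz(1) _ _ _ IH(1) vg IH(3) t0 L[OF Q(1)] L[OF Q(2)] L[OF Q(3)]];
          use sg sgg in \<open>auto simp: n_def\<close>)+
    have "vo (Suc n) (\<lambda>w. w $ 1 * (y' w - y w))"
      by (rule vo_base[OF suy sg_diff[OF sgg(2,1)] vo_swap[OF sg_diff[OF sgg(2,1)] suy dg] res(2)])
    hence "vo n (\<lambda>w. y' w - y w)" by (rule vo_cancel_u[OF sg_diff[OF sg(5,2)]])
    moreover have "Suc k + 4 = Suc (Suc n)" "Suc k + 2 = n" "Suc k + 3 = Suc n" by (auto simp: n_def)
    ultimately show ?case using res by (simp only:)
  qed
  show ?thesis using main[of n] by (auto elim: vo_mono)
qed

subsection \<open>Admissible singular points\<close>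

lemma smooth_germ_fn_compose:
  fixes f :: "real^'n::finite \<Rightarrow> real^'m::finite"
  assumes "smooth_germ_fn (f p) h" "smooth_germ_map p f"
  shows "smooth_germ_fn p (\<lambda>w. h (f w))"
proof -
  obtain V where V: "open V" "f p \<in> V" "smooth_fn V h" using assms(1) by (auto simp: smooth_germ_fn_def)
  obtain U where U: "open U" "p \<in> U" "smooth_map U f" using assms(2) by (auto simp: smooth_germ_map_def)
  have o: "open {w \<in> U. f w \<in> V}" by (rule open_smooth_vimage[OF U(1) V(1) U(3)])
  have m: "smooth_map {w \<in> U. f w \<in> V} f" by (rule smooth_map_subset[OF U(3)]) auto
  have "smooth_fn {w \<in> U. f w \<in> V} (\<lambda>w. h (f w))" by (rule smooth_fn_compose[OF o V(1,3) m]) auto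
  thus ?thesis using o U V unfolding smooth_germ_fn_def by (intro exI[of _ "{w \<in> U. f w \<in> V}"]) auto
qed

lemma sg_component: "smooth_germ_map 0 f \<Longrightarrow> sg (\<lambda>w. f w $ i)"
  by (auto simp: smooth_germ_fn_def smooth_germ_map_def smooth_map_def)

lemma smooth_germ_map_continuous:
  assumes "smooth_germ_map p f"
  shows "filterlim f (nhds (f p)) (nhds p)"
proof -
  obtain U where U: "open U" "p \<in> U" "smooth_map U f" using assms by (auto simp: smooth_germ_map_def)
  have "isCont f p" using smooth_map_continuous[OF U(1,3)] U continuous_on_eq_continuous_at by blast
  thus ?thesis by (metis isCont_def tendsto_at_iff_tendsto_nhds)
qed

lemma eventually_germ_compose:
  assumes "\<forall>\<^sub>F y in nhds (f p). P y" "smooth_germ_map p f"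
  shows "\<forall>\<^sub>F x in nhds p. P (f x)"
  using eventually_compose_filterlim[OF assms(1) smooth_germ_map_continuous[OF assms(2)]] .

lemma bl_strip:
  assumes e: "\<forall>n. \<forall>t\<in>ball 0 e. ((deriv ^^ n) b) differentiable (at t)"
  defines "U \<equiv> {w::real^2. \<bar>w $ 1\<bar> < e}"
  shows "smooth_fn U (bl b)"
    and "\<And>ks w. w \<in> U \<Longrightarrow> pd ks (bl b) w = (if set ks \<subseteq> {1} then (deriv ^^ length ks) b (w $ 1) else 0)"
proof -
  have oU: "open U" unfolding U_def by (intro open_Collect_less continuous_intros)
  have D: "((\<lambda>t. (deriv ^^ n) b ((w + t *\<^sub>R axis k 1) $ 1)) has_real_derivative
     (if k = 1 then (deriv ^^ Suc n) b (w $ 1) else 0)) (at 0)" if "w \<in> U" for n w and k :: "2"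
  proof (cases "k = 1")
    case True
    have "w $ 1 \<in> ball 0 e" using that by (simp add: U_def)
    hence "((deriv ^^ n) b has_real_derivative (deriv ^^ Suc n) b (w $ 1)) (at (0 + w $ 1))"
      using e by (auto simp: DERIV_deriv_iff_real_differentiable)
    hence "((\<lambda>t. (deriv ^^ n) b (t + w $ 1)) has_real_derivative (deriv ^^ Suc n) b (w $ 1)) (at 0)"
      by (simp only: DERIV_shift)
    hence "((\<lambda>t. (deriv ^^ n) b (w $ 1 + t)) has_real_derivative (deriv ^^ Suc n) b (w $ 1)) (at 0)"
      by (simp only: add.commute)
    thus ?thesis using True by simp
  next
    case False
    hence "k = 2" using exhaust_2[of k] by simp
    thus ?thesis by simp
  qed
  have c: "continuous_on U (\<lambda>w. (deriv ^^ n) b (w $ 1))" for n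
  proof -
    have 1: "continuous_on (ball 0 e) ((deriv ^^ n) b)"
      using e by (intro continuous_at_imp_continuous_on ballI differentiable_imp_continuous_within) auto
    have 2: "continuous_on U (\<lambda>w. w $ 1)" by (intro continuous_intros)
    show ?thesis by (rule continuous_on_compose2[OF 1 2]) (auto simp: U_def)
  qed
  show "smooth_fn U (bl b)"
  proof (rule smooth_fn_coinduct[OF oU, where P = "\<lambda>h. (\<exists>n. h = (\<lambda>w. (deriv ^^ n) b (w $ 1))) \<or> h = (\<lambda>w. 0)"])
    fix h and k :: "2" assume h: "(\<exists>n. h = (\<lambda>w::real^2. (deriv ^^ n) b (w $ 1))) \<or> h = (\<lambda>w. 0)"
    thus "\<exists>h'. ((\<exists>n. h' = (\<lambda>w::real^2. (deriv ^^ n) b (w $ 1))) \<or> h' = (\<lambda>w. 0)) \<and>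
       (\<forall>x\<in>U. ((\<lambda>t. h (x + t *\<^sub>R axis k 1)) has_real_derivative h' x) (at 0))"
    proof (elim disjE exE)
      fix n assume n: "h = (\<lambda>w::real^2. (deriv ^^ n) b (w $ 1))"
      show ?thesis
      proof (cases "k = 1")
        case True
        thus ?thesis using D[where n = n and k = k] n
          by (intro exI[of _ "\<lambda>w. (deriv ^^ Suc n) b (w $ 1)"] conjI disjI1 exI[of _ "Suc n"]) auto
      next
        case False
        thus ?thesis using D[where n = n and k = k] n by (intro exI[of _ "\<lambda>w. 0"]) auto
      qed
    qed (auto intro!: exI[of _ "\<lambda>w. 0"])
  next
    fix h assume "(\<exists>n. h = (\<lambda>w::real^2. (deriv ^^ n) b (w $ 1))) \<or> h = (\<lambda>w. 0)"
    thus "continuous_on U h" using c by auto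
  next
    have "bl b = (\<lambda>w. (deriv ^^ 0) b (w $ 1))" by (simp add: bl_def[abs_def])
    thus "(\<exists>n. bl b = (\<lambda>w. (deriv ^^ n) b (w $ 1))) \<or> bl b = (\<lambda>w. 0)" by blast
  qed
  show "pd ks (bl b) w = (if set ks \<subseteq> {1} then (deriv ^^ length ks) b (w $ 1) else 0)" if "w \<in> U" for ks w
    using that
  proof (induction ks arbitrary: w)
    case (Cons k ks)
    show ?case
    proof (cases "set ks \<subseteq> {1}")
      case True
      have "pd (k # ks) (bl b) w = partial k (\<lambda>w. (deriv ^^ length ks) b (w $ 1)) w"
        unfolding pd_Cons by (rule partial_cong) (use Cons oU True in \<open>auto simp: eventually_nhds\<close>)
      also have "\<dots> = (if k = 1 then (deriv ^^ Suc (length ks)) b (w $ 1) else 0)"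
        by (rule partial_eqI[OF D[OF Cons.prems]])
      finally show ?thesis using True by simp
    next
      case False
      have "pd (k # ks) (bl b) w = partial k (\<lambda>w. 0) w"
        unfolding pd_Cons by (rule partial_cong) (use Cons oU False in \<open>auto simp: eventually_nhds\<close>)
      thus ?thesis using False by simp
    qed
  qed (simp add: bl_def)
qed

lemma bl_germ:
  assumes "smooth_germ_real 0 b"
  shows "sg (bl b)" "pd ks (bl b) 0 = (if set ks \<subseteq> {1} then (deriv ^^ length ks) b 0 else 0)"
proof -
  obtain e where e: "e > 0" "\<forall>n. \<forall>t\<in>ball 0 e. ((deriv ^^ n) b) differentiable (at t)"
    using assms unfolding smooth_germ_real_def by blast
  let ?U = "{w::real^2. \<bar>w $ 1\<bar> < e}"
  have oU: "open ?U" by (intro open_Collect_less continuous_intros)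
  show "sg (bl b)" by (rule sgI[OF oU _ bl_strip(1)[OF e(2)]]) (use e in simp)
  show "pd ks (bl b) 0 = (if set ks \<subseteq> {1} then (deriv ^^ length ks) b 0 else 0)"
    using bl_strip(2)[OF e(2), of 0 ks] e(1) by simp
qed

lemma bl_vo_3:
  assumes "smooth_germ_real 0 b" "b 0 = 0" "deriv b 0 = 0" "deriv (deriv b) 0 = 0"
  shows "vo 3 (bl b)"
  unfolding vo_def
proof (intro allI impI)
  fix ks :: "2 list" assume "length ks < 3"
  hence "length ks = 0 \<or> length ks = Suc 0 \<or> length ks = Suc (Suc 0)" by linarith
  hence "(deriv ^^ length ks) b 0 = 0" using assms by auto
  thus "pd ks (bl b) 0 = 0" using bl_germ(2)[OF assms(1)] by simp
qed

lemma bl_jet_eq: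
  assumes "smooth_germ_real 0 b" "smooth_germ_real 0 b'" "jet_eq_real 0 b b'"
  shows "vo n (\<lambda>w. bl b w - bl b' w)"
proof -
  have "jet_eq 0 (bl b) (bl b')"
    using assms(3) by (simp add: jet_eq_def jet_eq_real_def bl_germ(2)[OF assms(1)] bl_germ(2)[OF assms(2)])
  thus ?thesis using jet_eq_iff_vo[OF bl_germ(1)[OF assms(1)] bl_germ(1)[OF assms(2)]] by blast
qed

lemma lin_0 [simp]: "lin a b 0 = 0" and quadr_0 [simp]: "quadr p q r 0 = 0"
  by (simp_all add: lin_def quadr_def)

lemma vo_2_iff: "sg h \<Longrightarrow> vo 2 h \<longleftrightarrow> h 0 = 0 \<and> tc h (Suc 0) 0 = 0 \<and> tc h 0 (Suc 0) = 0"
  by (simp add: numeral_2_eq_2 vo_Suc forall_2 vo_1_iff partial_at0)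

lemma quadr_twice: "quadr (2 * a) q (2 * r) w = a * (w $ 1 * w $ 1) + q * (w $ 1 * w $ 2) + r * (w $ 2 * w $ 2)"
  by (simp add: quadr_def power2_eq_square)

text \<open>As \<open>h\<close> has order 2, its 2-jet is a quadratic form, on which only the linear
  parts of the substituted germs act.\<close>

lemma second_order_compose:
  assumes sg: "sg h" "sg x" "sg y" and v: "vo 2 h"
    and b: "vo 2 (\<lambda>w. x w - lin \<alpha> \<beta> w)" "vo 2 (\<lambda>w. y w - lin \<gamma> \<delta> w)"
  defines "P \<equiv> tc h (Suc (Suc 0)) 0" and "Q \<equiv> tc h (Suc 0) (Suc 0)" and "R \<equiv> tc h 0 (Suc (Suc 0))"
  shows "tc (\<lambda>w. h (pairm x y w)) (Suc (Suc 0)) 0 = P * \<alpha>\<^sup>2 + Q * \<alpha> * \<gamma> + R * \<gamma>\<^sup>2"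
    "tc (\<lambda>w. h (pairm x y w)) (Suc 0) (Suc 0) = 2 * P * \<alpha> * \<beta> + Q * (\<alpha> * \<delta> + \<beta> * \<gamma>) + 2 * R * \<gamma> * \<delta>"
    "tc (\<lambda>w. h (pairm x y w)) 0 (Suc (Suc 0)) = P * \<beta>\<^sup>2 + Q * \<beta> * \<delta> + R * \<delta>\<^sup>2"
proof -
  have z: "x 0 = 0" "y 0 = 0" using vo_at0[OF b(1)] vo_at0[OF b(2)] by (simp_all add: lin_def)
  let ?q = "quadr (2 * P) Q (2 * R)"
  have "vo 3 (\<lambda>w. h w - ?q w)"
    using sg v by (subst vo_3_iff) (auto simp: tc_quadr vo_2_iff P_def Q_def R_def)
  hence "vo 3 (\<lambda>w. h (pairm x y w) - ?q (pairm x y w))"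
    using sg z by (intro vo_compose[of "\<lambda>w. h w - ?q w"]) auto
  moreover have "vo 3 (\<lambda>w. ?q (pairm x y w) - ?q (pairm (lin \<alpha> \<beta>) (lin \<gamma> \<delta>) w))"
    using sg z b vo_quadr by (intro vo_compose_diff[where h = ?q and m = 2 and k = 2]) (auto simp: lin_def)
  ultimately have "vo 3 (\<lambda>w. h (pairm x y w) - ?q (pairm (lin \<alpha> \<beta>) (lin \<gamma> \<delta>) w))"
    by (rule vo_trans[rotated 3]) (rule sg_compose; use sg z in \<open>auto simp: lin_def\<close>)+
  moreover have "?q (pairm (lin \<alpha> \<beta>) (lin \<gamma> \<delta>) w) = quadr (2 * (P * \<alpha>\<^sup>2 + Q * \<alpha> * \<gamma> + R * \<gamma>\<^sup>2))
     (2 * P * \<alpha> * \<beta> + Q * (\<alpha> * \<delta> + \<beta> * \<gamma>) + 2 * R * \<gamma> * \<delta>) (2 * (P * \<beta>\<^sup>2 + Q * \<beta> * \<delta> + R * \<delta>\<^sup>2)) w" for w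
    unfolding quadr_twice by (simp add: lin_def power2_eq_square algebra_simps)
  ultimately have "vo 3 (\<lambda>w. h (pairm x y w) - quadr (2 * (P * \<alpha>\<^sup>2 + Q * \<alpha> * \<gamma> + R * \<gamma>\<^sup>2))
     (2 * P * \<alpha> * \<beta> + Q * (\<alpha> * \<delta> + \<beta> * \<gamma>) + 2 * R * \<gamma> * \<delta>) (2 * (P * \<beta>\<^sup>2 + Q * \<beta> * \<delta> + R * \<delta>\<^sup>2)) w)"
    by simp
  note t = tc_eq_of_vo[OF sg_compose[OF sg z] sg_quadr this]
  show "tc (\<lambda>w. h (pairm x y w)) (Suc (Suc 0)) 0 = P * \<alpha>\<^sup>2 + Q * \<alpha> * \<gamma> + R * \<gamma>\<^sup>2"
    "tc (\<lambda>w. h (pairm x y w)) (Suc 0) (Suc 0) = 2 * P * \<alpha> * \<beta> + Q * (\<alpha> * \<delta> + \<beta> * \<gamma>) + 2 * R * \<gamma> * \<delta>"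
    "tc (\<lambda>w. h (pairm x y w)) 0 (Suc (Suc 0)) = P * \<beta>\<^sup>2 + Q * \<beta> * \<delta> + R * \<delta>\<^sup>2"
    by (simp_all add: t tc_quadr)
qed

lemma linear_part:
  assumes "sg x" "x 0 = 0"
  shows "vo 2 (\<lambda>w. x w - lin (tc x (Suc 0) 0) (tc x 0 (Suc 0)) w)"
  using assms by (subst vo_2_iff) (auto simp: tc_lin)

text \<open>The determinant of the Hessian at the origin, in terms of Taylor coefficients.\<close>

definition disc2 :: "(real^2 \<Rightarrow> real) \<Rightarrow> real" where
  "disc2 h = 4 * tc h (Suc (Suc 0)) 0 * tc h 0 (Suc (Suc 0)) - (tc h (Suc 0) (Suc 0))\<^sup>2"

lemma disc2_pd: "pd [1,1] h 0 * pd [2,2] h 0 - (pd [1,2] h 0)\<^sup>2 = disc2 h"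
  by (simp add: disc2_def tc_def fact_Suc)

text \<open>At a critical point the Hessian transforms as a quadratic form, so its determinant picks
  up the squared Jacobian and nondegeneracy is independent of coordinates.\<close>

lemma disc2_compose:
  assumes "sg h" "sg x" "sg y" "vo 2 h" "x 0 = 0" "y 0 = 0"
  shows "disc2 (\<lambda>w. h (pairm x y w)) =
     disc2 h * (tc x (Suc 0) 0 * tc y 0 (Suc 0) - tc x 0 (Suc 0) * tc y (Suc 0) 0)\<^sup>2"
  unfolding disc2_def second_order_compose[OF assms(1-4) linear_part[OF assms(2,5)] linear_part[OF assms(3,6)]]
  by (simp add: power2_eq_square algebra_simps)

lemma min_imp_partial_zero:
  assumes "sg h" "h 0 = 0" "\<forall>\<^sub>F w in nhds 0. 0 \<le> h w"
  shows "partial k h 0 = 0"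
proof -
  obtain U where U: "open U" "0 \<in> U" "smooth_fn U h" using assms(1) by (rule sgE)
  obtain V where V: "open V" "0 \<in> V" "\<And>w. w \<in> V \<Longrightarrow> 0 \<le> h w" using assms(3) by (auto simp: eventually_nhds)
  have "\<forall>\<^sub>F t in nhds 0. 0 + t *\<^sub>R axis k 1 \<in> V" by (rule eventually_along_axis[OF V(1,2)])
  then obtain d where d: "d > 0" "\<And>t. \<bar>t\<bar> < d \<Longrightarrow> t *\<^sub>R axis k 1 \<in> V"
    unfolding eventually_nhds_metric by auto
  have "((\<lambda>t. h (0 + t *\<^sub>R axis k 1)) has_real_derivative partial k h 0) (at 0)"
    using smooth_fn_axis_deriv[OF U(3,2), of "[]" k] by simp
  from DERIV_local_min[OF this d(1)] show ?thesis using d V assms(2) by simp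
qed

text \<open>Otherwise the u-derivative would be negative just to the right of the origin, and the
  mean value theorem would push \<open>h\<close> below zero there.\<close>

lemma min_imp_second_nonneg:
  assumes "sg h" "h 0 = 0" "\<forall>\<^sub>F w in nhds 0. 0 \<le> h w"
  shows "0 \<le> tc h (Suc (Suc 0)) 0"
proof (rule ccontr)
  assume neg: "\<not> 0 \<le> tc h (Suc (Suc 0)) 0"
  have p0: "partial 1 h 0 = 0" by (rule min_imp_partial_zero[OF assms])
  have "partial 1 (partial 1 h) 0 = 2 * tc h (Suc (Suc 0)) 0"
    using assms(1) by (simp add: partial_at0 tc_partial_1)
  hence n: "partial 1 (partial 1 h) 0 < 0" using neg by simp
  obtain U where U: "open U" "0 \<in> U" "smooth_fn U h" using assms(1) by (rule sgE)
  obtain V where V: "open V" "0 \<in> V" "\<And>w. w \<in> V \<Longrightarrow> 0 \<le> h w" using assms(3) by (auto simp: eventually_nhds)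
  have "\<forall>\<^sub>F t in nhds 0. 0 + t *\<^sub>R axis 1 1 \<in> U \<inter> V" by (rule eventually_along_axis) (use U V in auto)
  then obtain d where d: "d > 0" "\<And>t. \<bar>t\<bar> < d \<Longrightarrow> t *\<^sub>R axis 1 1 \<in> U \<inter> V"
    unfolding eventually_nhds_metric by auto
  have "((\<lambda>t. partial 1 h (0 + t *\<^sub>R axis 1 1)) has_real_derivative partial 1 (partial 1 h) 0) (at 0)"
    using smooth_fn_axis_deriv[OF U(3,2), of "[1]" 1] by (simp add: pd_Cons)
  from DERIV_neg_dec_right[OF this n] obtain e where e: "e > 0"
    "\<And>t. 0 < t \<Longrightarrow> t < e \<Longrightarrow> partial 1 h (t *\<^sub>R axis 1 1) < 0" using p0 by auto
  define t where "t = min d e / 2"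
  have t: "0 < t" "t < d" "t < e" using d e by (auto simp: t_def)
  have D: "((\<lambda>t. h (0 + t *\<^sub>R axis 1 1)) has_real_derivative partial 1 h (0 + s *\<^sub>R axis 1 1)) (at s)"
    if "0 \<le> s" "s \<le> t" for s
    using d(2)[of s] that t by (intro smooth_fn_line_deriv[OF U(3)]) auto
  from MVT2[OF t(1) D] obtain z where z: "0 < z" "z < t"
    "h (0 + t *\<^sub>R axis 1 1) - h (0 + 0 *\<^sub>R axis 1 1) = (t - 0) * partial 1 h (0 + z *\<^sub>R axis 1 1)" by auto
  have "partial 1 h (z *\<^sub>R axis 1 1) < 0" using e(2)[of z] z t by simp
  hence "h (t *\<^sub>R axis 1 1) < 0" using z t(1) assms(2) by (simp add: mult_pos_neg)
  moreover have "0 \<le> h (t *\<^sub>R axis 1 1)" using V(3) d(2)[of t] t by simp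
  ultimately show False by simp
qed

text \<open>Restriction to lines shows that the Hessian is positive semidefinite, and a semidefinite
  form of nonzero determinant is definite.\<close>

lemma min_nondegenerate:
  assumes h: "sg h" "h 0 = 0" "\<forall>\<^sub>F w in nhds 0. 0 \<le> h w" and d: "disc2 h \<noteq> 0"
  shows "0 < tc h (Suc (Suc 0)) 0" "0 < tc h 0 (Suc (Suc 0))" "0 < disc2 h"
proof -
  define P Q R where "P = tc h (Suc (Suc 0)) 0" and "Q = tc h (Suc 0) (Suc 0)" and "R = tc h 0 (Suc (Suc 0))"
  have v: "vo 2 h"
    using min_imp_partial_zero[OF h, of 1] min_imp_partial_zero[OF h, of 2] h by (simp add: vo_2_iff partial_at0)
  have form: "0 \<le> P * \<alpha>\<^sup>2 + Q * \<alpha> * \<gamma> + R * \<gamma>\<^sup>2" for \<alpha> \<gamma>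
  proof -
    let ?m = "pairm (lin \<alpha> 0) (lin \<gamma> 0)"
    have z: "lin \<alpha> 0 0 = 0" "lin \<gamma> 0 0 = 0" by (auto simp: lin_def)
    have s: "sg (\<lambda>w. h (?m w))" by (rule sg_compose[OF h(1) sg_lin sg_lin z])
    have "\<forall>\<^sub>F w in nhds 0. 0 \<le> h (?m w)"
      using eventually_compose_filterlim[OF h(3) continuous_pairm_0[OF sg_lin sg_lin z]] .
    hence "0 \<le> tc (\<lambda>w. h (?m w)) (Suc (Suc 0)) 0"
      by (rule min_imp_second_nonneg[OF s, rotated]) (use h z in \<open>simp add: pairm_0\<close>)
    thus ?thesis
      using second_order_compose(1)[OF h(1) sg_lin sg_lin v, of \<alpha> 0 \<alpha> 0 \<gamma> 0 \<gamma> 0] by (simp add: P_def Q_def R_def)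
  qed
  have d': "4 * P * R - Q\<^sup>2 \<noteq> 0" using d by (simp add: disc2_def P_def Q_def R_def)
  have P0: "0 \<le> P" and R0: "0 \<le> R" using form[of 1 0] form[of 0 1] by auto
  have "R \<noteq> 0"
  proof
    assume R: "R = 0"
    hence "Q \<noteq> 0" using d' by auto
    \<comment> \<open>In this direction the form takes the value -1.\<close>
    thus False using form[of 1 "- (P + 1) / Q"] R by simp
  qed
  hence R: "0 < R" using R0 by simp
  \<comment> \<open>In the direction (2R, -Q) the form equals R times the discriminant.\<close>
  have "P * (2 * R)\<^sup>2 + Q * (2 * R) * (- Q) + R * (- Q)\<^sup>2 = R * (4 * P * R - Q\<^sup>2)"
    by (simp add: power2_eq_square algebra_simps)
  hence "0 \<le> R * (4 * P * R - Q\<^sup>2)" using form[of "2 * R" "- Q"] by simp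
  hence D: "0 < 4 * P * R - Q\<^sup>2" using R d' by (simp add: zero_le_mult_iff)
  hence "P \<noteq> 0" by auto
  thus "0 < tc h (Suc (Suc 0)) 0" using P0 by (simp add: P_def)
  show "0 < tc h 0 (Suc (Suc 0))" using R by (simp add: R_def)
  show "0 < disc2 h" using D by (simp add: disc2_def P_def Q_def R_def)
qed

text \<open>E times the form is (E a + F c)^2 plus c^2 times the determinant; for E = 0 the
  determinant condition forces F = 0.\<close>

lemma psd_form_nonneg:
  fixes E F G :: real
  assumes "0 \<le> E" "0 \<le> G" "0 \<le> E * G - F\<^sup>2"
  shows "0 \<le> E * a * a + F * (a * c + c * a) + G * c * c"
proof (cases "E = 0")
  case True
  hence "F = 0" using assms(3) by simp
  thus ?thesis using True assms by (simp add: mult.assoc)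
next
  case False
  hence E: "0 < E" using assms by simp
  have "E * (E * a * a + F * (a * c + c * a) + G * c * c) = (E * a + F * c)\<^sup>2 + (E * G - F\<^sup>2) * c\<^sup>2"
    by (simp add: power2_eq_square algebra_simps)
  also have "\<dots> \<ge> 0" using assms by simp
  finally show ?thesis using E by (simp add: zero_le_mult_iff)
qed

lemma pb_form_alt: "pb_form E F G \<psi> k l = (\<lambda>w.
   E (\<psi> w) * partial k (\<lambda>y. \<psi> y $ 1) w * partial l (\<lambda>y. \<psi> y $ 1) w
   + F (\<psi> w) * (partial k (\<lambda>y. \<psi> y $ 1) w * partial l (\<lambda>y. \<psi> y $ 2) w
      + partial k (\<lambda>y. \<psi> y $ 2) w * partial l (\<lambda>y. \<psi> y $ 1) w)
   + G (\<psi> w) * partial k (\<lambda>y. \<psi> y $ 2) w * partial l (\<lambda>y. \<psi> y $ 2) w)"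
  by (simp add: pb_form_def[abs_def] Let_def)

lemma sg_pb_form:
  assumes "smooth_germ_map 0 \<psi>" "smooth_germ_fn (\<psi> 0) E" "smooth_germ_fn (\<psi> 0) F" "smooth_germ_fn (\<psi> 0) G"
  shows "sg (pb_form E F G \<psi> k l)"
  unfolding pb_form_alt
  using smooth_germ_fn_compose[OF assms(2,1)] smooth_germ_fn_compose[OF assms(3,1)]
    smooth_germ_fn_compose[OF assms(4,1)] sg_component[OF assms(1)]
  by (intro sg_add sg_mult sg_partial)

lemma pb_det:
  "pbE E F G \<psi> w * pbG E F G \<psi> w - (pbF E F G \<psi> w)\<^sup>2 =
   (E (\<psi> w) * G (\<psi> w) - (F (\<psi> w))\<^sup>2) * (jac_det2 \<psi> w)\<^sup>2"
  by (simp add: pbE_def pbF_def pbG_def pb_form_alt jac_det2_def power2_eq_square algebra_simps)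

lemma sg_jac_det2:
  assumes "smooth_germ_map 0 \<psi>"
  shows "sg (jac_det2 \<psi>)"
  unfolding jac_det2_def[abs_def] using sg_component[OF assms] by (intro sg_diff sg_mult sg_partial)

text \<open>At a critical zero of \<open>h\<close> a smooth factor enters the Hessian through its
  value alone, so the squared Jacobian of a chart does not affect nondegeneracy.\<close>

lemma disc2_mult:
  assumes "sg h" "sg j" "vo 2 h"
  shows "disc2 (\<lambda>w. h w * (j w)\<^sup>2) = disc2 h * (j 0) ^ 4"
  using assms tc_mult_low[of h "\<lambda>w. (j w)\<^sup>2"]
  by (simp add: disc2_def vo_2_iff power2_eq_square power4_eq_xxxx algebra_simps)

lemma disc2_cong: "f \<simeq> g \<Longrightarrow> disc2 f = disc2 g"
  unfolding disc2_def by (simp add: tc_cong)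

text \<open>EG - F^2 is nonnegative and vanishes at p, so its Hessian there is semidefinite, and
  nondegeneracy makes it definite. The two final inequalities are this definiteness, in the form
  needed to solve for the 2-jet.\<close>

lemma cross_cap_point_data:
  assumes wm: "whitney_metric U E F G" and p: "p \<in> U" and np: "\<not> pos_def_at E F G p"
  obtains \<psi> where "coords_at p \<psi>"
    "sg (pbE E F G \<psi>)" "sg (pbF E F G \<psi>)" "sg (pbG E F G \<psi>)"
    "0 < pbE E F G \<psi> 0" "pbF E F G \<psi> 0 = 0" "pbG E F G \<psi> 0 = 0"
    "tc (pbG E F G \<psi>) (Suc 0) 0 = 0" "tc (pbG E F G \<psi>) 0 (Suc 0) = 0"
    "tc (pbE E F G \<psi>) 0 (Suc 0) = 2 * tc (pbF E F G \<psi>) (Suc 0) 0"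
    "0 < pbE E F G \<psi> 0 * tc (pbG E F G \<psi>) 0 (Suc (Suc 0)) - (tc (pbF E F G \<psi>) 0 (Suc 0))\<^sup>2"
    "0 < 4 * (pbE E F G \<psi> 0 * tc (pbG E F G \<psi>) (Suc (Suc 0)) 0 - (tc (pbF E F G \<psi>) (Suc 0) 0)\<^sup>2)
        * (pbE E F G \<psi> 0 * tc (pbG E F G \<psi>) 0 (Suc (Suc 0)) - (tc (pbF E F G \<psi>) 0 (Suc 0))\<^sup>2)
      - (pbE E F G \<psi> 0 * tc (pbG E F G \<psi>) (Suc 0) (Suc 0)
          - 2 * tc (pbF E F G \<psi>) (Suc 0) 0 * tc (pbF E F G \<psi>) 0 (Suc 0))\<^sup>2"
proof -
  have U: "open U" "smooth_fn U E" "smooth_fn U F" "smooth_fn U G"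
    and psd: "\<And>x. x \<in> U \<Longrightarrow> 0 \<le> E x \<and> 0 \<le> G x \<and> 0 \<le> E x * G x - (F x)\<^sup>2"
    and icc: "intrinsic_cross_cap E F G p"
    using wm p np unfolding whitney_metric_def psd_metric_def by auto
  define D where "D x = E x * G x - (F x)\<^sup>2" for x
  have smD: "smooth_fn U D" unfolding D_def[abs_def] by (intro smooth_fn_diff smooth_fn_mult smooth_fn_power U)
  have gms: "smooth_germ_fn p E" "smooth_germ_fn p F" "smooth_germ_fn p G" "smooth_germ_fn p D"
    using U p smD by (auto simp: smooth_germ_fn_def)
  have Dp: "D p = 0"
  proof (cases "E p = 0")
    case True
    thus ?thesis using psd[OF p] by (simp add: D_def)
  next
    case False
    thus ?thesis using psd[OF p] np by (auto simp: D_def pos_def_at_def)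
  qed
  obtain \<psi>1 where \<psi>1: "admissible_coords E F G p \<psi>1"
    "partial 2 (pbE E F G \<psi>1) 0 = 2 * partial 1 (pbF E F G \<psi>1) 0"
    "partial 1 (pbG E F G \<psi>1) 0 = 0" "partial 2 (pbG E F G \<psi>1) 0 = 0"
    using icc unfolding intrinsic_cross_cap_def admissible_point_def by blast
  \<comment> \<open>Admissibility and nondegeneracy may be witnessed by different coordinates; the
    latter is transferred to \<open>\<psi>1\<close> below.\<close>
  obtain \<psi>2 where \<psi>2: "admissible_coords E F G p \<psi>2"
    "disc2 (\<lambda>w. pbE E F G \<psi>2 w * pbG E F G \<psi>2 w - (pbF E F G \<psi>2 w)\<^sup>2) \<noteq> 0"
    using icc unfolding intrinsic_cross_cap_def Let_def disc2_pd by blast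
  have c1: "local_diffeo \<psi>1 0" "\<psi>1 0 = p" and c2: "local_diffeo \<psi>2 0" "\<psi>2 0 = p"
    using \<psi>1(1) \<psi>2(1) unfolding admissible_coords_def coords_at_def by auto
  note g1 = local_diffeo_imp_smooth_germ[OF c1(1)] and gm2 = local_diffeo_imp_smooth_germ[OF c2(1)]
  define h where "h \<psi> w = D (\<psi> w)" for \<psi> :: "real^2 \<Rightarrow> real^2" and w
  have hfacts: "sg (h \<psi>)" "h \<psi> 0 = 0" "\<forall>\<^sub>F w in nhds 0. 0 \<le> h \<psi> w" "vo 2 (h \<psi>)"
    if "smooth_germ_map 0 \<psi>" "\<psi> 0 = p" for \<psi>
  proof -
    show 1: "sg (h \<psi>)" unfolding h_def[abs_def] by (rule smooth_germ_fn_compose) (use gms that in auto)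
    show 2: "h \<psi> 0 = 0" using Dp that by (simp add: h_def)
    have "\<forall>\<^sub>F x in nhds (\<psi> 0). x \<in> U" using U p that by (intro eventually_nhds_in_open) auto
    hence "\<forall>\<^sub>F w in nhds 0. \<psi> w \<in> U" by (rule eventually_germ_compose) (rule that)
    thus 3: "\<forall>\<^sub>F w in nhds 0. 0 \<le> h \<psi> w" by eventually_elim (use psd in \<open>simp add: h_def D_def\<close>)
    show "vo 2 (h \<psi>)"
      using min_imp_partial_zero[OF 1 2 3, of 1] min_imp_partial_zero[OF 1 2 3, of 2] 1 2
      by (simp add: vo_2_iff partial_at0)
  qed
  note h1 = hfacts[OF g1 c1(2)] and h2 = hfacts[OF gm2 c2(2)]
  have det: "(\<lambda>w. pbE E F G \<psi> w * pbG E F G \<psi> w - (pbF E F G \<psi> w)\<^sup>2) = (\<lambda>w. h \<psi> w * (jac_det2 \<psi> w)\<^sup>2)" for \<psi>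
    unfolding pb_det h_def D_def by simp
  have d2: "disc2 (h \<psi>2) \<noteq> 0"
    using \<psi>2(2) unfolding det by (simp add: disc2_mult[OF h2(1) sg_jac_det2[OF gm2] h2(4)])
  have d1: "disc2 (h \<psi>1) \<noteq> 0"
  proof -
    obtain A B \<kappa> where L: "open A" "0 \<in> A" "open B" "\<psi>1 ` A = B" "smooth_map A \<psi>1" "smooth_map B \<kappa>"
      "\<And>x. x \<in> A \<Longrightarrow> \<kappa> (\<psi>1 x) = x" "\<And>y. y \<in> B \<Longrightarrow> \<psi>1 (\<kappa> y) = y"
      by (rule local_diffeoE[OF c1(1)]) blast
    have pB: "p \<in> B" using L c1 by auto
    have "local_diffeo \<kappa> p" using local_diffeo_inverse[OF L(1-7)] c1(2) by simp
    hence "local_diffeo (\<lambda>w. \<kappa> (\<psi>2 w)) 0" using local_diffeo_compose[OF c2(1), of \<kappa>] c2(2) by simp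
    note gth = local_diffeo_imp_smooth_germ[OF this]
    define x y where "x w = \<kappa> (\<psi>2 w) $ 1" and "y w = \<kappa> (\<psi>2 w) $ 2" for w
    have xy: "pairm x y = (\<lambda>w. \<kappa> (\<psi>2 w))" by (simp add: fun_eq_iff vec_eq_iff forall_2 x_def y_def)
    have sgxy: "sg x" "sg y" unfolding x_def[abs_def] y_def[abs_def] using sg_component[OF gth] by auto
    have "\<kappa> p = 0" using L(7)[OF L(2)] c1(2) by simp
    hence z: "x 0 = 0" "y 0 = 0" by (simp_all add: x_def y_def c2(2))
    have "\<forall>\<^sub>F x in nhds (\<psi>2 0). x \<in> B" using L pB c2(2) by (intro eventually_nhds_in_open) auto
    hence "\<forall>\<^sub>F w in nhds 0. \<psi>2 w \<in> B" by (rule eventually_germ_compose[OF _ gm2])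
    hence "h \<psi>2 \<simeq> (\<lambda>w. h \<psi>1 (pairm x y w))" by eventually_elim (use L(8) in \<open>simp add: h_def xy\<close>)
    hence "disc2 (h \<psi>2) = disc2 (\<lambda>w. h \<psi>1 (pairm x y w))" by (rule disc2_cong)
    thus ?thesis using d2 disc2_compose[OF h1(1) sgxy h1(4) z] by auto
  qed
  let ?E = "pbE E F G \<psi>1" and ?F = "pbF E F G \<psi>1" and ?G = "pbG E F G \<psi>1"
  have sg1: "sg ?E" "sg ?F" "sg ?G"
    unfolding pbE_def pbF_def pbG_def using gms c1(2) by (auto intro!: sg_pb_form[OF g1])
  let ?d = "\<lambda>w. ?E w * ?G w - (?F w)\<^sup>2"
  have j0: "jac_det2 \<psi>1 0 \<noteq> 0" by (rule local_diffeo_jac_nonzero[OF c1(1)])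
  have dd: "disc2 ?d \<noteq> 0" unfolding det using d1 j0 by (simp add: disc2_mult[OF h1(1) sg_jac_det2[OF g1] h1(4)])
  have dn: "\<forall>\<^sub>F w in nhds 0. 0 \<le> ?d w" using h1(3)
  proof eventually_elim
    case (elim w)
    thus ?case using fun_cong[OF det[of \<psi>1], of w] by simp
  qed
  have F0: "?F 0 = 0" and G0: "?G 0 = 0" using \<psi>1(1) by (auto simp: admissible_coords_def)
  have sgd: "sg ?d" using sg1 by auto
  note nd = min_nondegenerate[OF sgd _ dn dd]
  have G1: "tc ?G (Suc 0) 0 = 0" "tc ?G 0 (Suc 0) = 0" and EF: "tc ?E 0 (Suc 0) = 2 * tc ?F (Suc 0) 0"
    using \<psi>1(2-4) sg1 by (simp_all add: partial_at0)
  \<comment> \<open>With F, G and the gradient of G zero at the origin, no derivative of E enters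
    the Hessian of EG - F^2.\<close>
  have td: "tc ?d (Suc (Suc 0)) 0 = ?E 0 * tc ?G (Suc (Suc 0)) 0 - (tc ?F (Suc 0) 0)\<^sup>2"
    "tc ?d (Suc 0) (Suc 0) = ?E 0 * tc ?G (Suc 0) (Suc 0) - 2 * tc ?F (Suc 0) 0 * tc ?F 0 (Suc 0)"
    "tc ?d 0 (Suc (Suc 0)) = ?E 0 * tc ?G 0 (Suc (Suc 0)) - (tc ?F 0 (Suc 0))\<^sup>2"
    using sg1 by (simp_all add: power2_eq_square tc_mult_low F0 G0 G1)
  have pos: "0 < ?E 0 * tc ?G 0 (Suc (Suc 0)) - (tc ?F 0 (Suc 0))\<^sup>2" "0 < disc2 ?d"
    using nd F0 G0 td by auto
  have "0 \<le> ?E 0"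
    using psd_form_nonneg psd[OF p] by (simp add: pbE_def pb_form_alt c1(2))
  \<comment> \<open>Otherwise a positive second-order coefficient would be minus a square.\<close>
  moreover have "?E 0 \<noteq> 0"
  proof
    assume "?E 0 = 0"
    hence "0 < - (tc ?F 0 (Suc 0))\<^sup>2" using pos(1) by simp
    thus False using zero_le_power2[of "tc ?F 0 (Suc 0)"] by linarith
  qed
  ultimately have E0: "0 < ?E 0" by simp
  have "coords_at p \<psi>1" using c1 by (simp add: coords_at_def)
  from that[OF this sg1 E0 F0 G0 G1 EF pos(1)] show ?thesis using pos(2) unfolding disc2_def td .
qed

subsection \<open>Jets in Whitney normal coordinates\<close>

lemma g2_jet:
  assumes "sg (bl b)" "vo 3 (bl b)" "sg x" "sg y" "x 0 = 0" "y 0 = 0"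
  shows "tc (g2 b x y) (Suc 0) 0 = 0" "tc (g2 b x y) 0 (Suc 0) = 0"
    "tc (g2 b x y) (Suc (Suc 0)) 0 = tc x (Suc 0) 0 * tc y (Suc 0) 0"
    "tc (g2 b x y) (Suc 0) (Suc 0) = tc x (Suc 0) 0 * tc y 0 (Suc 0) + tc x 0 (Suc 0) * tc y (Suc 0) 0"
    "tc (g2 b x y) 0 (Suc (Suc 0)) = tc x 0 (Suc 0) * tc y 0 (Suc 0)"
proof -
  have s: "sg (\<lambda>w. bl b (pairm y (\<lambda>w. 0) w))" using assms by (intro sg_bl)
  have "vo 3 (\<lambda>w. bl b (pairm y (\<lambda>w. 0) w))" using assms by (intro vo_compose[of "bl b"]) auto
  hence t: "tc (\<lambda>w. bl b (pairm y (\<lambda>w. 0) w)) i j = 0" if "i + j < 3" for i j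
    using vo_tcD[OF s _ that] by blast
  have e: "tc (g2 b x y) i j = tc (\<lambda>w. x w * y w) i j" if "i + j < 3" for i j
    unfolding g2_def[abs_def] using assms s t[OF that] by (subst tc_add) auto
  show "tc (g2 b x y) (Suc 0) 0 = 0" "tc (g2 b x y) 0 (Suc 0) = 0"
    "tc (g2 b x y) (Suc (Suc 0)) 0 = tc x (Suc 0) 0 * tc y (Suc 0) 0"
    "tc (g2 b x y) (Suc 0) (Suc 0) = tc x (Suc 0) 0 * tc y 0 (Suc 0) + tc x 0 (Suc 0) * tc y (Suc 0) 0"
    "tc (g2 b x y) 0 (Suc (Suc 0)) = tc x 0 (Suc 0) * tc y 0 (Suc 0)"
    using assms by (simp_all add: e tc_mult_low)
qed

definition normal_jet where
  "normal_jet E F G a20 a11 a02 \<longleftrightarrow> (0::real) < a02 \<and>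
     taylor2_at0 E 1 0 0 (2 * a20\<^sup>2) (2 * a20 * a11) (2 * (1 + a11\<^sup>2)) \<and>
     taylor2_at0 F 0 0 0 (2 * a20 * a11) (a20 * a02 + a11\<^sup>2 + 1) (2 * a11 * a02) \<and>
     taylor2_at0 G 0 0 0 (2 * (1 + a11\<^sup>2)) (2 * a11 * a02) (2 * a02\<^sup>2)"

lemma taylor2_tc:
  assumes "sg h" "taylor2_at0 h c0 cu cv cuu cuv cvv"
  shows "h 0 = c0" "tc h (Suc 0) 0 = cu" "tc h 0 (Suc 0) = cv" "tc h (Suc (Suc 0)) 0 = cuu / 2"
    "tc h (Suc 0) (Suc 0) = cuv" "tc h 0 (Suc (Suc 0)) = cvv / 2"
  using assms by (auto simp: taylor2_at0_def partial_at0) (simp_all add: tc_def fact_Suc)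

text \<open>In normal coordinates the equations for the 2-jet can be read off one at a time. The
  nonnegativity assumption on z fixes the sign of its v^2 coefficient, whereas for y_v only the
  square is determined; everything else in the low-order jets is forced.\<close>

lemma normal_jet_rigid:
  assumes nj: "normal_jet E F G a20 a11 a02" and sgm: "sg E" "sg F" "sg G"
    and b: "sg (bl b)" "vo 3 (bl b)" and sg: "sg x" "sg y" "sg z"
    and x0: "x 0 = 0" "y 0 = 0" "tc x (Suc 0) 0 = 1"
    and z: "vo 2 z" "tc x 0 (Suc 0) = 0 \<Longrightarrow> 0 \<le> tc z 0 (Suc (Suc 0))"
    and Q: "vo 3 (\<lambda>w. Qf 1 1 x (g2 b x y) z w - E w)" "vo 3 (\<lambda>w. Qf 1 2 x (g2 b x y) z w - F w)"
      "vo 3 (\<lambda>w. Qf 2 2 x (g2 b x y) z w - G w)"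
  shows "tc x 0 (Suc 0) = 0" "(tc y 0 (Suc 0))\<^sup>2 = 1" "vo 2 (\<lambda>w. x w - lin 1 0 w)"
    "vo 2 (\<lambda>w. y w - lin 0 (tc y 0 (Suc 0)) w)" "vo 3 (\<lambda>w. z w - quadr a20 a11 a02 w)"
    "vo 4 (\<lambda>w. x w - lin 1 0 w)"
proof -
  let ?g = "g2 b x y"
  have sgg: "sg ?g" by (rule sg_g2[OF b(1) sg(1,2) x0(2)])
  have sQ: "sg (Qf k l x ?g z)" for k l by (intro sg_Qf sg sgg)
  note tE = tc_eq_of_vo[OF sQ sgm(1) Q(1)] and tF = tc_eq_of_vo[OF sQ sgm(2) Q(2)]
    and tG = tc_eq_of_vo[OF sQ sgm(3) Q(3)]
  have a02: "0 < a02" using nj by (simp add: normal_jet_def)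
  note jE = taylor2_tc[OF sgm(1)] and jF = taylor2_tc[OF sgm(2)] and jG = taylor2_tc[OF sgm(3)]
  have TE: "taylor2_at0 E 1 0 0 (2 * a20\<^sup>2) (2 * a20 * a11) (2 * (1 + a11\<^sup>2))"
    and TF: "taylor2_at0 F 0 0 0 (2 * a20 * a11) (a20 * a02 + a11\<^sup>2 + 1) (2 * a11 * a02)"
    and TG: "taylor2_at0 G 0 0 0 (2 * (1 + a11\<^sup>2)) (2 * a11 * a02) (2 * a02\<^sup>2)"
    using nj by (auto simp: normal_jet_def)
  note gj = g2_jet[OF b sg(1,2) x0(1,2)]
  have z1: "tc z (Suc 0) 0 = 0" "tc z 0 (Suc 0) = 0" "z 0 = 0" using z(1) vo_2_iff[OF sg(3)] by auto
  \<comment> \<open>At the origin G is the square of x_v, as the other two components are critical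
    there.\<close>
  have "Qf 2 2 x ?g z 0 = G 0" using tG[of 0 0] by simp
  hence "(tc x 0 (Suc 0))\<^sup>2 = 0"
    using jG(1)[OF TG] gj z1 by (simp add: Qf_def partial_at0 power2_eq_square)
  thus x01: "tc x 0 (Suc 0) = 0" by simp
  note J = Qf_jet[OF sg(1) sgg sg(3) x01 gj(1,2) z1(1,2)]
  define c d where "c = tc y 0 (Suc 0)" and "d = tc y (Suc 0) 0"
  have g': "tc ?g (Suc (Suc 0)) 0 = d" "tc ?g (Suc 0) (Suc 0) = c" "tc ?g 0 (Suc (Suc 0)) = 0"
    using gj(3-5) x01 x0(3) by (simp_all add: c_def d_def)
  define p q r where "p = 2 * tc z (Suc (Suc 0)) 0" and "q = tc z (Suc 0) (Suc 0)" and "r = 2 * tc z 0 (Suc (Suc 0))"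
  have z': "tc z (Suc (Suc 0)) 0 = p / 2" "tc z (Suc 0) (Suc 0) = q" "tc z 0 (Suc (Suc 0)) = r / 2"
    by (simp_all add: p_def q_def r_def)
  have x2: "tc x (Suc (Suc 0)) 0 = 0" "tc x (Suc 0) (Suc 0) = 0" "tc x 0 (Suc (Suc 0)) = 0"
    using J(4,5,7) tE[of "Suc 0" 0] tE[of 0 "Suc 0"] tF[of 0 "Suc 0"] jE(2,3)[OF TE] jF(3)[OF TF] x0(3) by simp_all
  note J' = J(10-18)[unfolded x2 g' z' x0(3)]
  have r0: "0 \<le> r" using z(2)[OF x01] by (simp add: r_def)
  have "r\<^sup>2 = a02\<^sup>2" using J'(9) tG[of 0 "Suc (Suc 0)"] jG(6)[OF TG] by (simp add: power2_eq_square)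
  hence r: "r = a02" using r0 a02 by (simp add: power2_eq_iff)
  have "2 * q * r = 2 * a11 * a02" using J'(8) tG[of "Suc 0" "Suc 0"] jG(5)[OF TG] by simp
  hence q: "q = a11" using r a02 by simp
  have c1: "c\<^sup>2 = 1" using J'(7) tG[of "Suc (Suc 0)" 0] jG(4)[OF TG] q by simp
  have x12: "tc x (Suc 0) (Suc (Suc 0)) = 0" using J'(3) tE[of 0 "Suc (Suc 0)"] jE(6)[OF TE] q c1 by simp
  have "p * r = a20 * a02" using J'(5) tF[of "Suc 0" "Suc 0"] jF(5)[OF TF] q c1 x12 by simp
  hence p: "p = a20" using r a02 by simp
  \<comment> \<open>F and E give two equations containing x21 and the product d c in different
    proportions, so both vanish.\<close>
  have x21: "tc x (Suc (Suc 0)) (Suc 0) + 2 * d * c = 0"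
    using J'(4) tF[of "Suc (Suc 0)" 0] jF(4)[OF TF] p q by simp
  have "4 * tc x (Suc (Suc 0)) (Suc 0) + 4 * d * c = 0"
    using J'(2) tE[of "Suc 0" "Suc 0"] jE(5)[OF TE] p q by simp
  hence "d * c = 0" using x21 by linarith
  hence d0: "d = 0" using c1 by auto
  have x21': "tc x (Suc (Suc 0)) (Suc 0) = 0" using x21 d0 by simp
  have x30: "tc x (Suc (Suc (Suc 0))) 0 = 0"
    using J'(1) tE[of "Suc (Suc 0)" 0] jE(4)[OF TE] p d0 by (simp add: power2_eq_square)
  have x03: "tc x 0 (Suc (Suc (Suc 0))) = 0"
    using J'(6) tF[of 0 "Suc (Suc 0)"] jF(6)[OF TF] r q by simp
  show "(tc y 0 (Suc 0))\<^sup>2 = 1" using c1 by (simp add: c_def)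
  show v2: "vo 2 (\<lambda>w. x w - lin 1 0 w)" using linear_part[OF sg(1) x0(1)] x0(3) x01 by simp
  show "vo 2 (\<lambda>w. y w - lin 0 (tc y 0 (Suc 0)) w)" using linear_part[OF sg(2) x0(2)] d0 by (simp add: d_def)
  show "vo 3 (\<lambda>w. z w - quadr a20 a11 a02 w)"
    using sg z1 z' p q r by (subst vo_3_iff) (auto simp: tc_quadr)
  have s: "sg (\<lambda>w. x w - lin 1 0 w)" using sg by auto
  have "vo (Suc (Suc 2)) (\<lambda>w. x w - lin 1 0 w)"
  proof (subst vo_Suc_iff_tc[OF s])
    show v3: "vo (Suc 2) (\<lambda>w. x w - lin 1 0 w)"
    proof (subst vo_Suc_iff_tc[OF s v2], intro allI impI)
      fix i :: nat assume "i \<le> 2"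
      hence "i = 0 \<or> i = Suc 0 \<or> i = Suc (Suc 0)" by linarith
      thus "tc (\<lambda>w. x w - lin 1 0 w) i (2 - i) = 0" using x2 sg by (auto simp: tc_lin numeral_2_eq_2)
    qed
    show "\<forall>i\<le>Suc 2. tc (\<lambda>w. x w - lin 1 0 w) i (Suc 2 - i) = 0"
    proof (intro allI impI)
      fix i :: nat assume "i \<le> Suc 2"
      hence "i = 0 \<or> i = Suc 0 \<or> i = Suc (Suc 0) \<or> i = Suc (Suc (Suc 0))" by linarith
      thus "tc (\<lambda>w. x w - lin 1 0 w) i (Suc 2 - i) = 0" using x30 x21' x12 x03 sg
        by (auto simp: tc_lin numeral_2_eq_2)
    qed
  qed
  thus "vo 4 (\<lambda>w. x w - lin 1 0 w)" by (simp add: numeral_eq_Suc)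
qed

subsection \<open>First fundamental forms of maps\<close>

lemma vpartial_inner_Qf:
  assumes "(\<lambda>w. f w $ 1) \<simeq> x" "(\<lambda>w. f w $ 2) \<simeq> g" "(\<lambda>w. f w $ 3) \<simeq> z"
  shows "(\<lambda>w. vpartial k f w \<bullet> vpartial l f w) \<simeq> Qf k l x g z"
  using geq_partial[OF assms(1), of k] geq_partial[OF assms(2), of k] geq_partial[OF assms(3), of k]
    geq_partial[OF assms(1), of l] geq_partial[OF assms(2), of l] geq_partial[OF assms(3), of l]
  by eventually_elim (simp add: vpartial_def Qf_def inner_vec_def sum_3)

lemma pb_form_first_fundamental:
  fixes f :: "real^2 \<Rightarrow> real^3"
  assumes "smooth_germ_map 0 \<psi>" "smooth_germ_map (\<psi> 0) f"
  shows "pb_form (ffE f) (ffF f) (ffG f) \<psi> k l \<simeq> (\<lambda>w. vpartial k (f \<circ> \<psi>) w \<bullet> vpartial l (f \<circ> \<psi>) w)"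
proof -
  obtain U where U: "open U" "0 \<in> U" "smooth_map U \<psi>" using assms(1) by (auto simp: smooth_germ_map_def)
  obtain V where V: "open V" "\<psi> 0 \<in> V" "smooth_map V f" using assms(2) by (auto simp: smooth_germ_map_def)
  have "\<forall>\<^sub>F x in nhds (\<psi> 0). x \<in> V" using V by (intro eventually_nhds_in_open) auto
  hence "\<forall>\<^sub>F w in nhds 0. \<psi> w \<in> V" by (rule eventually_germ_compose[OF _ assms(1)])
  moreover have "\<forall>\<^sub>F w in nhds 0. w \<in> U" using U by (intro eventually_nhds_in_open) auto
  ultimately show ?thesis
  proof eventually_elim
    case (elim w)
    have c: "partial k (\<lambda>y. f (\<psi> y) $ i) w = partial 1 (\<lambda>y. f y $ i) (\<psi> w) * partial k (\<lambda>y. \<psi> y $ 1) w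
      + partial 2 (\<lambda>y. f y $ i) (\<psi> w) * partial k (\<lambda>y. \<psi> y $ 2) w" for k i
      by (rule partial_compose2[OF U(1) V(1) smooth_map_component[OF V(3)] U(3) elim(2,1)])
    show ?case
      unfolding pb_form_alt
      by (simp add: ffE_def ffF_def ffG_def vpartial_def inner_vec_def sum_3 c algebra_simps)
  qed
qed

lemma ff_eq: "ffE f = (\<lambda>w. vpartial 1 f w \<bullet> vpartial 1 f w)" "ffF f = (\<lambda>w. vpartial 1 f w \<bullet> vpartial 2 f w)"
  "ffG f = (\<lambda>w. vpartial 2 f w \<bullet> vpartial 2 f w)"
  by (simp_all add: ffE_def ffF_def ffG_def)

lemma smooth_germ_map_compose:
  fixes f :: "real^'n::finite \<Rightarrow> real^'m::finite" and g :: "real^'m \<Rightarrow> real^'l::finite"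
  assumes "smooth_germ_map (f p) g" "smooth_germ_map p f"
  shows "smooth_germ_map p (\<lambda>w. g (f w))"
proof -
  obtain V where V: "open V" "f p \<in> V" "smooth_map V g" using assms(1) by (auto simp: smooth_germ_map_def)
  obtain U where U: "open U" "p \<in> U" "smooth_map U f" using assms(2) by (auto simp: smooth_germ_map_def)
  have o: "open {w \<in> U. f w \<in> V}" by (rule open_smooth_vimage[OF U(1) V(1) U(3)])
  have m: "smooth_map {w \<in> U. f w \<in> V} f" by (rule smooth_map_subset[OF U(3)]) auto
  have "smooth_map {w \<in> U. f w \<in> V} (\<lambda>w. g (f w))" by (rule smooth_map_compose[OF o V(1,3) m]) auto
  thus ?thesis using o U V unfolding smooth_germ_map_def by (intro exI[of _ "{w \<in> U. f w \<in> V}"]) auto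
qed

lemma smooth_germ_map_vec3:
  assumes "smooth_germ_fn p f" "smooth_germ_fn p g" "smooth_germ_fn p h"
  shows "smooth_germ_map p (\<lambda>q. vector [f q, g q, h q] :: real^3)"
proof -
  obtain A where A: "open A" "p \<in> A" "smooth_fn A f" using assms(1) by (auto simp: smooth_germ_fn_def)
  obtain B where B: "open B" "p \<in> B" "smooth_fn B g" using assms(2) by (auto simp: smooth_germ_fn_def)
  obtain C where C: "open C" "p \<in> C" "smooth_fn C h" using assms(3) by (auto simp: smooth_germ_fn_def)
  have "smooth_map (A \<inter> B \<inter> C) (\<lambda>q. vector [f q, g q, h q] :: real^3)"
    using A B C by (intro smooth_map_vec3) (auto intro: smooth_fn_subset)
  thus ?thesis using A B C unfolding smooth_germ_map_def by (intro exI[of _ "A \<inter> B \<inter> C"]) auto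
qed

lemma pairm_local_diffeo:
  assumes "sg x" "sg y" "tc x (Suc 0) 0 * tc y 0 (Suc 0) - tc x 0 (Suc 0) * tc y (Suc 0) 0 \<noteq> 0"
  shows "local_diffeo (pairm x y) 0"
    and "jac_det2 (pairm x y) 0 = tc x (Suc 0) 0 * tc y 0 (Suc 0) - tc x 0 (Suc 0) * tc y (Suc 0) 0"
proof -
  obtain U where U: "open U" "0 \<in> U" "smooth_fn U x" "smooth_fn U y" using assms(1,2) by (rule sg_common)
  have s: "smooth_map U (pairm x y)" using smooth_map_vec2[OF U(3,4)] by (simp add: pairm_def[abs_def])
  show j: "jac_det2 (pairm x y) 0 = tc x (Suc 0) 0 * tc y 0 (Suc 0) - tc x 0 (Suc 0) * tc y (Suc 0) 0"
    using assms(1,2) by (simp add: jac_det2_def partial_at0)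
  show "local_diffeo (pairm x y) 0"
    by (rule local_diffeoI_jac[OF U(1) s U(2)]) (use assms(3) j in simp)
qed

subsection \<open>Recognition of cross caps\<close>

lemma local_diffeo_shrink:
  fixes \<phi> :: "real^2 \<Rightarrow> real^2"
  assumes "local_diffeo \<phi> p" "open N" "p \<in> N"
  obtains A B \<kappa> where "open A" "p \<in> A" "A \<subseteq> N" "open B" "\<phi> ` A = B" "smooth_map A \<phi>" "smooth_map B \<kappa>"
    "\<And>x. x \<in> A \<Longrightarrow> \<kappa> (\<phi> x) = x" "\<And>y. y \<in> B \<Longrightarrow> \<phi> (\<kappa> y) = y \<and> \<kappa> y \<in> A"
proof -
  obtain U V \<kappa> where L: "open U" "p \<in> U" "open V" "\<phi> ` U = V" "\<kappa> ` V = U" "smooth_map U \<phi>" "smooth_map V \<kappa>"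
    "\<And>x. x \<in> U \<Longrightarrow> \<kappa> (\<phi> x) = x" "\<And>y. y \<in> V \<Longrightarrow> \<phi> (\<kappa> y) = y"
    by (rule local_diffeoE[OF assms(1)]) blast
  let ?A = "U \<inter> N" and ?B = "{y \<in> V. \<kappa> y \<in> N}"
  show ?thesis
  proof (rule that[of ?A ?B \<kappa>])
    show "open ?B" by (rule open_smooth_vimage[OF L(3) assms(2) L(7)])
    show "\<phi> ` ?A = ?B"
    proof (intro equalityI subsetI)
      fix y assume "y \<in> ?B"
      hence "y = \<phi> (\<kappa> y)" "\<kappa> y \<in> ?A" using L(5,9) by auto
      thus "y \<in> \<phi> ` ?A" by blast
    qed (use L(4,8) in auto)
    show "smooth_map ?A \<phi>" by (rule smooth_map_subset[OF L(6)]) auto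
    show "smooth_map ?B \<kappa>" by (rule smooth_map_subset[OF L(7)]) auto
  qed (use L assms in auto)
qed

definition shear_map :: "(real^2 \<Rightarrow> real) \<Rightarrow> real^3 \<Rightarrow> real^2" where
  "shear_map Z w = vector [w $ 1, w $ 3 - Z (vector [w $ 1, 0])]"

text \<open>On a map (x, A + W B, Z(x) + W^2), with A and B taken at (x, W^2),
  \<open>shear_map Z\<close> recovers (x, W^2). The target map then yields (B, W B, W^2), the
  standard cross cap in the source coordinates (B, W).\<close>

definition flatten :: "(real^2 \<Rightarrow> real) \<Rightarrow> (real^2 \<Rightarrow> real) \<Rightarrow> (real^2 \<Rightarrow> real) \<Rightarrow> real^3 \<Rightarrow> real^3" where
  "flatten A B Z w = vector [B (shear_map Z w), w $ 2 - A (shear_map Z w), shear_map Z w $ 2]"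

text \<open>The inverse is explicit. Apart from shears it only inverts the planar map sending (s, t)
  to (B(s, t), t), so the planar inverse function theorem suffices in dimension three.\<close>

lemma flatten_local_diffeo:
  assumes sg: "sg A" "sg B" "sg Z" and z: "B 0 = 0" "Z 0 = 0" and B1: "partial 1 B 0 \<noteq> 0"
  shows "local_diffeo (flatten A B Z) 0"
proof -
  define \<beta> where "\<beta> = pairm B (\<lambda>w. w $ 2)"
  have lb: "local_diffeo \<beta> 0"
    unfolding \<beta>_def using B1 sg tc_lin[of 0 1]
    by (intro pairm_local_diffeo) (auto simp: partial_at0 lin_def[abs_def])
  obtain NA where NA: "open NA" "0 \<in> NA" "smooth_fn NA A" using sg(1) by (rule sgE)
  obtain NB where NB: "open NB" "0 \<in> NB" "smooth_fn NB B" using sg(2) by (rule sgE)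
  obtain NZ where NZ: "open NZ" "0 \<in> NZ" "smooth_fn NZ Z" using sg(3) by (rule sgE)
  obtain P Q \<kappa> where L: "open P" "0 \<in> P" "P \<subseteq> NA \<inter> NB" "open Q" "\<beta> ` P = Q" "smooth_map P \<beta>" "smooth_map Q \<kappa>"
    "\<And>x. x \<in> P \<Longrightarrow> \<kappa> (\<beta> x) = x" "\<And>y. y \<in> Q \<Longrightarrow> \<beta> (\<kappa> y) = y \<and> \<kappa> y \<in> P"
    by (rule local_diffeo_shrink[OF lb, of "NA \<inter> NB"]) (use NA NB in auto)
  have k2: "\<kappa> y $ 2 = y $ 2" "B (\<kappa> y) = y $ 1" if "y \<in> Q" for y
  proof -
    have "\<beta> (\<kappa> y) $ 2 = y $ 2" "\<beta> (\<kappa> y) $ 1 = y $ 1" using L(9)[OF that] by auto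
    thus "\<kappa> y $ 2 = y $ 2" "B (\<kappa> y) = y $ 1" by (simp_all add: \<beta>_def)
  qed
  define ax :: "real^3 \<Rightarrow> real^2" where "ax w = vector [w $ 1, 0]" for w
  define S where "S = {w \<in> UNIV. ax w \<in> NZ}"
  have sax: "smooth_map V ax" if "open V" for V
    unfolding ax_def[abs_def] by (intro smooth_map_vec2 smooth_fn_proj smooth_fn_const that)
  have oS: "open S" unfolding S_def by (rule open_smooth_vimage[OF open_UNIV NZ(1) sax[OF open_UNIV]])
  have sZ: "smooth_fn S (\<lambda>w. Z (ax w))"
    by (rule smooth_fn_compose[OF oS NZ(1,3) sax[OF oS]]) (auto simp: S_def)
  have sshear: "smooth_map S (shear_map Z)"
    unfolding shear_map_def[abs_def] ax_def[symmetric]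
    by (intro smooth_map_vec2 smooth_fn_diff smooth_fn_proj sZ oS)
  define U where "U = {w \<in> S. shear_map Z w \<in> P}"
  have oU: "open U" unfolding U_def by (rule open_smooth_vimage[OF oS L(1) sshear])
  have sshU: "smooth_map U (shear_map Z)" by (rule smooth_map_subset[OF sshear]) (auto simp: U_def)
  have v0: "vector [0, 0] = (0 :: real^2)" by (simp add: vec_eq_iff forall_2)
  have U0: "0 \<in> U" using L(2) NZ z by (simp add: U_def S_def ax_def shear_map_def v0)
  define out :: "real^3 \<Rightarrow> real^2" where "out v = vector [v $ 1, v $ 3]" for v
  have sout: "smooth_map V out" if "open V" for V
    unfolding out_def[abs_def] by (intro smooth_map_vec2 smooth_fn_proj that)
  define R where "R = {v \<in> UNIV. out v \<in> Q}"
  have oR: "open R" unfolding R_def by (rule open_smooth_vimage[OF open_UNIV L(4) sout[OF open_UNIV]])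
  have skR: "smooth_map R (\<lambda>v. \<kappa> (out v))"
    by (rule smooth_map_compose[OF oR L(4,7) sout[OF oR]]) (auto simp: R_def)
  define bx :: "real^3 \<Rightarrow> real^2" where "bx v = vector [\<kappa> (out v) $ 1, 0]" for v
  have sbx: "smooth_map R bx"
    unfolding bx_def[abs_def] by (intro smooth_map_vec2 smooth_map_component[OF skR] smooth_fn_const oR)
  define V where "V = {v \<in> R. bx v \<in> NZ}"
  have oV: "open V" unfolding V_def by (rule open_smooth_vimage[OF oR NZ(1) sbx])
  have VR: "V \<subseteq> R" by (auto simp: V_def)
  define inv where "inv v = (vector [\<kappa> (out v) $ 1, v $ 2 + A (\<kappa> (out v)), v $ 3 + Z (bx v)] :: real^3)" for v
  have k: "\<kappa> (out v) \<in> P" "\<kappa> (out v) $ 2 = v $ 3" "B (\<kappa> (out v)) = v $ 1" if "v \<in> V" for v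
    using that VR L(9)[of "out v"] k2[of "out v"] by (auto simp: R_def out_def)
  have shinv: "shear_map Z (inv v) = \<kappa> (out v)" if "v \<in> V" for v
    using k[OF that] by (simp add: shear_map_def inv_def bx_def vec_eq_iff forall_2)
  have invU: "inv v \<in> U" if "v \<in> V" for v
    using that shinv[OF that] k[OF that] by (simp add: U_def S_def ax_def inv_def V_def bx_def)
  have fi: "flatten A B Z (inv v) = v" if "v \<in> V" for v
    unfolding flatten_def shinv[OF that] using k[OF that] by (simp add: vec_eq_iff forall_3 inv_def)
  have out_fl: "out (flatten A B Z w) = \<beta> (shear_map Z w)" for w
    by (simp add: out_def flatten_def \<beta>_def vec_eq_iff forall_2)
  have ko: "\<kappa> (out (flatten A B Z w)) = shear_map Z w" if "w \<in> U" for w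
    unfolding out_fl using that L(8) by (simp add: U_def)
  have flV: "flatten A B Z w \<in> V" if "w \<in> U" for w
  proof -
    have "out (flatten A B Z w) \<in> Q" unfolding out_fl using that L(5) by (auto simp: U_def)
    moreover have "bx (flatten A B Z w) = ax w" unfolding bx_def ko[OF that] by (simp add: shear_map_def ax_def)
    ultimately show ?thesis using that by (simp add: V_def R_def U_def S_def)
  qed
  have "inv (flatten A B Z w) = w" if "w \<in> U" for w
    unfolding inv_def bx_def ko[OF that]
    by (simp add: vec_eq_iff forall_3 flatten_def shear_map_def)
  moreover have "smooth_map U (flatten A B Z)"
  proof -
    have sA: "smooth_fn U (\<lambda>w. A (shear_map Z w))"
      by (rule smooth_fn_compose[OF oU NA(1,3) sshU]) (use L(3) in \<open>auto simp: U_def\<close>)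
    have sB: "smooth_fn U (\<lambda>w. B (shear_map Z w))"
      by (rule smooth_fn_compose[OF oU NB(1,3) sshU]) (use L(3) in \<open>auto simp: U_def\<close>)
    show ?thesis
      unfolding flatten_def[abs_def]
      by (intro smooth_map_vec3 sB smooth_fn_diff smooth_fn_proj oU sA smooth_map_component[OF sshU])
  qed
  moreover have "smooth_map V inv"
  proof -
    have skV: "smooth_map V (\<lambda>v. \<kappa> (out v))" by (rule smooth_map_subset[OF skR VR])
    have sA: "smooth_fn V (\<lambda>v. A (\<kappa> (out v)))"
      by (rule smooth_fn_compose[OF oV NA(1,3) skV]) (use k L(3) in auto)
    have sZb: "smooth_fn V (\<lambda>v. Z (bx v))"
      by (rule smooth_fn_compose[OF oV NZ(1,3) smooth_map_subset[OF sbx VR]]) (auto simp: V_def)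
    show ?thesis
      unfolding inv_def[abs_def]
      by (intro smooth_map_vec3 smooth_fn_add smooth_fn_proj oV sA sZb smooth_map_component[OF skV])
  qed
  moreover have "flatten A B Z ` U = V"
    using flV fi invU by (auto simp: image_iff) metis
  ultimately show ?thesis
    unfolding local_diffeo_def using oU U0 oV fi by blast
qed

lemma cross_capI:
  assumes k: "local_diffeo \<kappa> p" "\<kappa> p = 0"
    and sg: "sg x" "sg W" "sg A" "sg B" "sg Z"
    and z: "x 0 = 0" "W 0 = 0" "B 0 = 0" "Z 0 = 0"
    and xW: "tc x (Suc 0) 0 \<noteq> 0" "tc x 0 (Suc 0) = 0" "tc W 0 (Suc 0) \<noteq> 0" and B1: "partial 1 B 0 \<noteq> 0"
    and f: "\<forall>\<^sub>F q in nhds p. f q = vector [x (\<kappa> q),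
       A (sq2 (pairm x W (\<kappa> q))) + W (\<kappa> q) * B (sq2 (pairm x W (\<kappa> q))),
       Z (pairm x (\<lambda>w. 0) (\<kappa> q)) + (W (\<kappa> q))\<^sup>2]" and fp: "f p = 0"
  shows "cross_cap f p"
proof -
  have sgsq: "sg (\<lambda>w. (w $ 2)\<^sup>2)" by (intro sg_power sg_proj)
  have sBq: "sg (\<lambda>w. B (sq2 w))" unfolding sq2_def by (rule sg_compose[OF sg(4) sg_proj sgsq]) auto
  have tB: "tc (\<lambda>w. B (sq2 w)) (Suc 0) 0 = partial 1 B 0"
  proof -
    have "tc (\<lambda>w. B (sq2 w)) (Suc 0) 0 = partial 1 (\<lambda>w. B (sq2 w)) 0" using sBq by (simp add: partial_at0)
    also have "\<dots> = partial 1 B (sq2 0) * partial 1 (\<lambda>w::real^2. w $ 1) 0 + partial 2 B (sq2 0) * partial 1 (\<lambda>w::real^2. (w $ 2)\<^sup>2) 0"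
      using geq_at0[OF partial_compose_germ[OF sg(4) sg_proj sgsq], of 1] by (simp add: sq2_def)
    also have "partial 1 (\<lambda>w::real^2. (w $ 2)\<^sup>2) 0 = 0" by (rule partial_eqI) auto
    also have "sq2 0 = 0" by (simp add: vec_eq_iff forall_2)
    finally show ?thesis by (simp add: partial_proj_fun)
  qed
  \<comment> \<open>The source coordinates (B, W) in terms of (x, W); their Jacobian at the origin
    is the u-derivative of B.\<close>
  define \<alpha> where "\<alpha> = pairm (\<lambda>w. B (sq2 w)) (\<lambda>w. w $ 2)"
  have la: "local_diffeo \<alpha> 0"
    unfolding \<alpha>_def using B1 sBq tB tc_lin[of 0 1] by (intro pairm_local_diffeo) (auto simp: lin_def[abs_def])
  have lm: "local_diffeo (pairm x W) 0" using sg xW by (intro pairm_local_diffeo) auto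
  have m0: "pairm x W 0 = 0" using z by (simp add: pairm_0)
  have "local_diffeo (\<lambda>w. \<alpha> (pairm x W w)) 0" using local_diffeo_compose[OF lm, of \<alpha>] la m0 by simp
  hence l1: "local_diffeo (\<lambda>q. \<alpha> (pairm x W (\<kappa> q))) p"
    using local_diffeo_compose[OF k(1), of "\<lambda>w. \<alpha> (pairm x W w)"] k(2) by simp
  have sq0: "sq2 0 = 0" by (simp add: vec_eq_iff forall_2)
  have z1: "\<alpha> (pairm x W (\<kappa> p)) = 0" using z by (simp add: k m0 \<alpha>_def vec_eq_iff forall_2 sq0)
  have l2: "local_diffeo (flatten A B Z) (f p)" unfolding fp by (rule flatten_local_diffeo[OF sg(3,4,5) z(3,4) B1])
  have "f p = vector [x (\<kappa> p), A (sq2 (pairm x W (\<kappa> p))) + W (\<kappa> p) * B (sq2 (pairm x W (\<kappa> p))),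
       Z (pairm x (\<lambda>w. 0) (\<kappa> p)) + (W (\<kappa> p))\<^sup>2]" by (rule eventually_nhds_x_imp_x[OF f])
  have eq: "\<forall>\<^sub>F q in nhds p. flatten A B Z (f q) = std_cross_cap (\<alpha> (pairm x W (\<kappa> q)))"
    using f
  proof eventually_elim
    case (elim q)
    have px: "pairm x (\<lambda>w. 0) (\<kappa> q) = vector [x (\<kappa> q), 0]" by (simp add: vec_eq_iff forall_2)
    have sh: "shear_map Z (f q) = sq2 (pairm x W (\<kappa> q))"
      unfolding elim px by (simp add: shear_map_def vec_eq_iff forall_2)
    have f2: "f q $ 2 = A (sq2 (pairm x W (\<kappa> q))) + W (\<kappa> q) * B (sq2 (pairm x W (\<kappa> q)))"
      unfolding elim by simp
    show ?case unfolding flatten_def sh f2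
      by (simp add: std_cross_cap_def \<alpha>_def mult.commute)
  qed
  have "flatten A B Z (f p) = 0"
  proof -
    have "flatten A B Z (f p) = std_cross_cap (\<alpha> (pairm x W (\<kappa> p)))" by (rule eventually_nhds_x_imp_x[OF eq])
    thus ?thesis using z1 by (simp add: std_cross_cap_def vec_eq_iff forall_3)
  qed
  thus ?thesis unfolding cross_cap_def using l1 z1 l2 eq by blast
qed

subsection \<open>The main theorem\<close>

lemma local_diffeo_inverse_germ:
  fixes \<phi> :: "real^2 \<Rightarrow> real^2"
  assumes "local_diffeo \<phi> p"
  obtains \<kappa> where "local_diffeo \<kappa> (\<phi> p)" "\<kappa> (\<phi> p) = p" "\<forall>\<^sub>F x in nhds p. \<kappa> (\<phi> x) = x"
    "\<forall>\<^sub>F y in nhds (\<phi> p). \<phi> (\<kappa> y) = y" "jac_det2 \<kappa> (\<phi> p) * jac_det2 \<phi> p = 1"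
proof -
  obtain U V \<kappa> where L: "open U" "p \<in> U" "open V" "\<phi> ` U = V" "\<kappa> ` V = U" "smooth_map U \<phi>" "smooth_map V \<kappa>"
    "\<And>x. x \<in> U \<Longrightarrow> \<kappa> (\<phi> x) = x" "\<And>y. y \<in> V \<Longrightarrow> \<phi> (\<kappa> y) = y"
    "\<And>x. x \<in> U \<Longrightarrow> jac_det2 \<kappa> (\<phi> x) * jac_det2 \<phi> x = 1"
    by (rule local_diffeoE[OF assms]) blast
  have "\<phi> p \<in> V" using L(2,4) by auto
  show ?thesis
  proof (rule that[of \<kappa>])
    show "local_diffeo \<kappa> (\<phi> p)" by (rule local_diffeo_inverse[OF L(1-4,6-8)])
    show "\<forall>\<^sub>F x in nhds p. \<kappa> (\<phi> x) = x" using L(1,2,8) by (auto simp: eventually_nhds)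
    show "\<forall>\<^sub>F y in nhds (\<phi> p). \<phi> (\<kappa> y) = y" using L(3,9) \<open>\<phi> p \<in> V\<close> by (auto simp: eventually_nhds)
  qed (use L in auto)
qed

lemma jac_det2_compose_germ:
  assumes "smooth_germ_map p f" "smooth_germ_map (f p) g"
  shows "jac_det2 (\<lambda>x. g (f x)) p = jac_det2 g (f p) * jac_det2 f p"
proof -
  obtain U where U: "open U" "p \<in> U" "smooth_map U f" using assms(1) by (auto simp: smooth_germ_map_def)
  obtain V where V: "open V" "f p \<in> V" "smooth_map V g" using assms(2) by (auto simp: smooth_germ_map_def)
  show ?thesis by (rule jac_det2_compose[OF U(1) V(1,3) U(3,2) V(2)])
qed

lemma jet_eqI_geq:
  assumes "h \<simeq> Q" "sg Q" "sg M" "\<And>n. vo n (\<lambda>w. M w - Q w)"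
  shows "jet_eq 0 h M"
proof -
  have sh: "sg h" by (rule sg_cong[OF geq_sym[OF assms(1)] assms(2)])
  have e: "(\<lambda>w. h w - M w) \<simeq> (\<lambda>w. Q w - M w)" using assms(1) by eventually_elim simp
  have "vo n (\<lambda>w. h w - M w)" for n
    unfolding vo_cong[OF e] by (rule vo_swap[OF assms(3,2,4)])
  thus ?thesis using jet_eq_iff_vo[OF sh assms(3)] by blast
qed

text \<open>The v-derivative of a function of v^2 is divisible by v, which kills the coefficients of
  v and of uv.\<close>

lemma sq2_compose_jet:
  assumes "sg A"
  shows "sg (\<lambda>w. A (sq2 w))" "tc (\<lambda>w. A (sq2 w)) 0 (Suc 0) = 0"
    "tc (\<lambda>w. A (sq2 w)) (Suc 0) (Suc 0) = 0" "tc (\<lambda>w. A (sq2 w)) (Suc 0) 0 = partial 1 A 0"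
proof -
  have sgsq: "sg (\<lambda>w. (w $ 2)\<^sup>2)" by (intro sg_power sg_proj)
  have sB: "sg (\<lambda>w. B (sq2 w))" if "sg B" for B
    unfolding sq2_def by (rule sg_compose[OF that sg_proj sgsq]) auto
  show sA: "sg (\<lambda>w. A (sq2 w))" by (rule sB[OF assms])
  have psq: "partial k (\<lambda>w::real^2. (w $ 2)\<^sup>2) = (\<lambda>w. if k = 2 then 2 * w $ 2 else 0)" for k
    by (rule ext, rule partial_eqI) (auto intro!: derivative_eq_intros simp: axis_def)
  have pc: "partial k (\<lambda>w. A (sq2 w)) \<simeq> (\<lambda>w. partial 1 A (sq2 w) * (if 1 = k then 1 else 0)
      + partial 2 A (sq2 w) * (if k = 2 then 2 * w $ 2 else 0))" for k
    unfolding sq2_def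
    by (rule partial_compose_germ[OF assms sg_proj sgsq, of 1 k, unfolded psq partial_proj_fun]) simp_all
  have "partial 2 (\<lambda>w. A (sq2 w)) \<simeq> (\<lambda>w. w $ 2 * (2 * partial 2 A (sq2 w)))"
    using pc[of 2] by eventually_elim simp
  note t2 = tc_cong[OF this]
  have "sg (\<lambda>w. 2 * partial 2 A (sq2 w))" using sB[OF sg_partial[OF assms]] by auto
  thus "tc (\<lambda>w. A (sq2 w)) 0 (Suc 0) = 0" "tc (\<lambda>w. A (sq2 w)) (Suc 0) (Suc 0) = 0"
    using tc_mult_v_0[of "\<lambda>w. 2 * partial 2 A (sq2 w)"] by (simp_all only: tc_Suc_2 t2)
  have "sq2 0 = 0" by (simp add: vec_eq_iff forall_2)
  thus "tc (\<lambda>w. A (sq2 w)) (Suc 0) 0 = partial 1 A 0"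
    using geq_at0[OF pc[of 1]] sA by (simp add: partial_at0)
qed

lemma cross_cap_existence:
  assumes wm: "whitney_metric U E F G" "p \<in> U" "\<not> pos_def_at E F G p"
    and b: "smooth_germ_real 0 b" "b 0 = 0" "deriv b 0 = 0" "deriv (deriv b) 0 = 0"
  shows "\<exists>f. smooth_germ_map p f \<and> cross_cap f p \<and>
     formally_isometric (ffE f) (ffF f) (ffG f) E F G p \<and> characteristic_function f p b"
proof -
  obtain \<psi> where \<psi>: "coords_at p \<psi>"
    and sgM: "sg (pbE E F G \<psi>)" "sg (pbF E F G \<psi>)" "sg (pbG E F G \<psi>)"
    and D: "0 < pbE E F G \<psi> 0" "pbF E F G \<psi> 0 = 0" "pbG E F G \<psi> 0 = 0"
    "tc (pbG E F G \<psi>) (Suc 0) 0 = 0" "tc (pbG E F G \<psi>) 0 (Suc 0) = 0"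
    "tc (pbE E F G \<psi>) 0 (Suc 0) = 2 * tc (pbF E F G \<psi>) (Suc 0) 0"
    "0 < pbE E F G \<psi> 0 * tc (pbG E F G \<psi>) 0 (Suc (Suc 0)) - (tc (pbF E F G \<psi>) 0 (Suc 0))\<^sup>2"
    "0 < 4 * (pbE E F G \<psi> 0 * tc (pbG E F G \<psi>) (Suc (Suc 0)) 0 - (tc (pbF E F G \<psi>) (Suc 0) 0)\<^sup>2)
        * (pbE E F G \<psi> 0 * tc (pbG E F G \<psi>) 0 (Suc (Suc 0)) - (tc (pbF E F G \<psi>) 0 (Suc 0))\<^sup>2)
      - (pbE E F G \<psi> 0 * tc (pbG E F G \<psi>) (Suc 0) (Suc 0)
          - 2 * tc (pbF E F G \<psi>) (Suc 0) 0 * tc (pbF E F G \<psi>) 0 (Suc 0))\<^sup>2"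
    by (rule cross_cap_point_data[OF wm])
  have ld: "local_diffeo \<psi> 0" and \<psi>0: "\<psi> 0 = p" using \<psi> by (auto simp: coords_at_def)
  obtain \<kappa> where k: "local_diffeo \<kappa> p" "\<kappa> p = 0" "\<forall>\<^sub>F w in nhds 0. \<kappa> (\<psi> w) = w"
     "\<forall>\<^sub>F q in nhds p. \<psi> (\<kappa> q) = q" "jac_det2 \<kappa> p * jac_det2 \<psi> 0 = 1"
    by (rule local_diffeo_inverse_germ[OF ld, unfolded \<psi>0])
  \<comment> \<open>The sign of y_v is chosen to make (x, y) positively oriented with respect to the
    original coordinates, even if the chart \<open>\<psi>\<close> reverses orientation.\<close>
  define s where "s = (if 0 < jac_det2 \<kappa> p then 1 else - 1 :: real)"
  have s: "s = 1 \<or> s = - 1" by (auto simp: s_def)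
  note sgb = bl_germ(1)[OF b(1)] and vob = bl_vo_3[OF b]
  obtain x y W Z x1 c d p' q r w0 w1 where S: "sg x" "sg y" "sg W" "sg Z"
    "vo 2 (\<lambda>w. x w - lin x1 0 w)" "vo 2 (\<lambda>w. y w - lin d c w)" "vo 2 (\<lambda>w. W w - lin w0 w1 w)"
    "vo 2 Z" "vo 3 (\<lambda>w. zf x W Z w - quadr p' q r w)" "0 < x1" "0 < s * c" "0 < r" "w1 \<noteq> 0"
    and iso: "\<And>n. vo n (\<lambda>w. pbE E F G \<psi> w - Qf 1 1 x (g2 b x y) (zf x W Z) w)"
    "\<And>n. vo n (\<lambda>w. pbF E F G \<psi> w - Qf 1 2 x (g2 b x y) (zf x W Z) w)"
    "\<And>n. vo n (\<lambda>w. pbG E F G \<psi> w - Qf 2 2 x (g2 b x y) (zf x W Z) w)"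
    by (rule formal_existence[OF sgM sgb vob D(1-6) s D(7,8)]) blast
  let ?g = "g2 b x y" and ?z = "zf x W Z"
  have z0: "x 0 = 0" "y 0 = 0" "W 0 = 0" "Z 0 = 0"
    using vo_at0[OF S(5)] vo_at0[OF S(6)] vo_at0[OF S(7)] vo_at0[OF S(8)] by simp_all
  note tx = tc_eq_of_vo[OF S(1) sg_lin S(5)] and ty = tc_eq_of_vo[OF S(2) sg_lin S(6)]
    and tW = tc_eq_of_vo[OF S(3) sg_lin S(7)]
  have tcs: "tc x (Suc 0) 0 = x1" "tc x 0 (Suc 0) = 0" "tc y (Suc 0) 0 = d" "tc y 0 (Suc 0) = c"
    "tc W 0 (Suc 0) = w1" by (simp_all add: tx ty tW tc_lin)
  have c0: "c \<noteq> 0" using S(11) by auto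
  have sgg: "sg ?g" by (rule sg_g2[OF sgb S(1,2) z0(2)])
  have sgz: "sg ?z" by (rule sg_zf[OF S(1,3,4) z0(1)])
  have vz: "vo 2 ?z" by (rule vo_base[OF sgz sg_quadr vo_mono[OF S(9)] vo_quadr]) simp
  define f where "f q = (vector [x (\<kappa> q), ?g (\<kappa> q), ?z (\<kappa> q)] :: real^3)" for q
  note gk = local_diffeo_imp_smooth_germ[OF k(1)] and g\<psi> = local_diffeo_imp_smooth_germ[OF ld]
  have cmp: "smooth_germ_fn p (\<lambda>q. h (\<kappa> q))" if "sg h" for h
    by (rule smooth_germ_fn_compose[OF _ gk]) (simp add: k(2) that)
  have smf: "smooth_germ_map p f"
    unfolding f_def[abs_def] by (rule smooth_germ_map_vec3[OF cmp[OF S(1)] cmp[OF sgg] cmp[OF sgz]])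
  have cc: "cross_cap f p"
  proof -
    have lm: "local_diffeo (pairm x W) 0" using S(10,13) by (intro pairm_local_diffeo S) (simp add: tcs)
    have m0: "pairm x W 0 = 0" using z0 by (simp add: pairm_0)
    obtain \<iota> where i: "local_diffeo \<iota> 0" "\<iota> 0 = 0" "\<forall>\<^sub>F w in nhds 0. \<iota> (pairm x W w) = w"
      "\<forall>\<^sub>F w in nhds 0. pairm x W (\<iota> w) = w" "jac_det2 \<iota> 0 * jac_det2 (pairm x W) 0 = 1"
      by (rule local_diffeo_inverse_germ[OF lm, unfolded m0])
    note gi = local_diffeo_imp_smooth_germ[OF i(1)]
    \<comment> \<open>From here on y and the second component are regarded as functions of (x, W),
      so that x becomes the first coordinate and parity in W can be exploited.\<close>
    define h where "h w = y (\<iota> w)" for w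
    define gw where "gw w = ?g (\<iota> w)" for w
    have sgh: "sg h" unfolding h_def[abs_def] by (rule smooth_germ_fn_compose[OF _ gi]) (simp add: i(2) S)
    have sgw: "sg gw" unfolding gw_def[abs_def] by (rule smooth_germ_fn_compose[OF _ gi]) (simp add: i(2) sgg)
    have h0: "h 0 = 0" by (simp add: h_def i(2) z0)
    have gw_eq: "gw \<simeq> g2 b (\<lambda>w. w $ 1) h"
      using i(4)
    proof eventually_elim
      case (elim w)
      have "x (\<iota> w) = w $ 1" using arg_cong[OF elim, of "\<lambda>v. v $ 1"] by simp
      thus ?case by (simp add: gw_def g2_def h_def bl_def)
    qed
    have tw: "tc gw 0 (Suc 0) = 0" "tc gw (Suc 0) (Suc 0) = tc h 0 (Suc 0)"
    proof -
      have t1: "tc (\<lambda>w. w $ 1) (Suc 0) 0 = 1" "tc (\<lambda>w. w $ 1) 0 (Suc 0) = 0"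
        using tc_lin[of 1 0] by (simp_all add: lin_def[abs_def])
      have z1: "(0 :: real^2) $ 1 = 0" by simp
      show "tc gw 0 (Suc 0) = 0" "tc gw (Suc 0) (Suc 0) = tc h 0 (Suc 0)"
        unfolding tc_cong[OF gw_eq] g2_jet[OF sgb vob sg_proj sgh z1 h0] t1 by simp_all
    qed
    have hy: "y \<simeq> (\<lambda>w. h (pairm x W w))" using i(3) by eventually_elim (simp add: h_def)
    have "partial 2 y 0 = partial 2 (\<lambda>w. h (pairm x W w)) 0" by (rule geq_at0[OF geq_partial[OF hy]])
    also have "\<dots> = partial 1 h 0 * partial 2 x 0 + partial 2 h 0 * partial 2 W 0"
      using geq_at0[OF partial_compose_germ[OF sgh S(1,3) z0(1,3), of 2]] by (simp add: m0)
    finally have "c = tc h 0 (Suc 0) * w1" by (simp add: partial_at0 tcs)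
    hence th: "tc h 0 (Suc 0) \<noteq> 0" using c0 by auto
    obtain A B where AB: "sg A" "sg B" "gw \<simeq> (\<lambda>w. A (sq2 w) + w $ 2 * B (sq2 w))"
      by (rule whitney_parity[OF sgw])
    note jA = sq2_compose_jet[OF AB(1)] and jB = sq2_compose_jet[OF AB(2)]
    have sw: "sg (\<lambda>w. w $ 2 * B (sq2 w))" using jB(1) by auto
    have sq0: "sq2 0 = 0" by (simp add: vec_eq_iff forall_2)
    \<comment> \<open>In these coordinates the second component is u h + b(h). It has no linear term
      in v, and its uv coefficient is the v-slope of h; by parity these two numbers are B(0) and the
      u-derivative of B.\<close>
    have B0: "B 0 = 0"
      using tw(1) tc_cong[OF AB(3), of 0 "Suc 0"] jA(1,2) sw tc_mult_v_Suc[OF jB(1), of 0 0] sq0 by simp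
    have "partial 1 B 0 = tc h 0 (Suc 0)"
      using tw(2) tc_cong[OF AB(3), of "Suc 0" "Suc 0"] jA(1,3) sw tc_mult_v_Suc[OF jB(1), of "Suc 0" 0] jB(4) by simp
    hence B1: "partial 1 B 0 \<noteq> 0" using th by simp
    have "(\<lambda>w. gw (pairm x W w)) \<simeq> (\<lambda>w. A (sq2 (pairm x W w)) + pairm x W w $ 2 * B (sq2 (pairm x W w)))"
      by (rule geq_compose[OF AB(3) S(1,3) z0(1,3)])
    hence "?g \<simeq> (\<lambda>w. A (sq2 (pairm x W w)) + W w * B (sq2 (pairm x W w)))"
      using i(3) by eventually_elim (simp add: gw_def)
    hence "\<forall>\<^sub>F w in nhds (\<kappa> p). ?g w = A (sq2 (pairm x W w)) + W w * B (sq2 (pairm x W w))"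
      by (simp add: k(2))
    hence "\<forall>\<^sub>F q in nhds p. ?g (\<kappa> q) = A (sq2 (pairm x W (\<kappa> q))) + W (\<kappa> q) * B (sq2 (pairm x W (\<kappa> q)))"
      by (rule eventually_germ_compose[OF _ gk])
    hence fe: "\<forall>\<^sub>F q in nhds p. f q = vector [x (\<kappa> q),
       A (sq2 (pairm x W (\<kappa> q))) + W (\<kappa> q) * B (sq2 (pairm x W (\<kappa> q))),
       Z (pairm x (\<lambda>w. 0) (\<kappa> q)) + (W (\<kappa> q))\<^sup>2]"
      by eventually_elim (simp add: f_def zf_def)
    have "b 0 = 0" by (rule b(2))
    hence fp: "f p = 0"
      using z0 by (simp add: f_def k(2) g2_def zf_def bl_def pairm_0 vec_eq_iff forall_3)
    show ?thesis
      by (rule cross_capI[OF k(1,2) S(1,3) AB(1,2) S(4) z0(1,3) B0 z0(4) _ tcs(2) _ B1 fe fp])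
         (use S(10,13) tcs in auto)
  qed
  have fi: "formally_isometric (ffE f) (ffF f) (ffG f) E F G p"
  proof -
    have comp: "(\<lambda>w. (f \<circ> \<psi>) w $ 1) \<simeq> x" "(\<lambda>w. (f \<circ> \<psi>) w $ 2) \<simeq> ?g" "(\<lambda>w. (f \<circ> \<psi>) w $ 3) \<simeq> ?z"
      using k(3) by (eventually_elim, simp add: f_def)+
    have smf': "smooth_germ_map (\<psi> 0) f" using smf \<psi>0 by simp
    have "pb_form (ffE f) (ffF f) (ffG f) \<psi> i j \<simeq> Qf i j x ?g ?z" for i j
      by (rule geq_trans[OF pb_form_first_fundamental[OF g\<psi> smf'] vpartial_inner_Qf[OF comp]])
    hence "jet_eq 0 (pbE (ffE f) (ffF f) (ffG f) \<psi>) (pbE E F G \<psi>)"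
      "jet_eq 0 (pbF (ffE f) (ffF f) (ffG f) \<psi>) (pbF E F G \<psi>)"
      "jet_eq 0 (pbG (ffE f) (ffF f) (ffG f) \<psi>) (pbG E F G \<psi>)"
      using jet_eqI_geq[OF _ sg_Qf[OF S(1) sgg sgz] sgM(1) iso(1)]
        jet_eqI_geq[OF _ sg_Qf[OF S(1) sgg sgz] sgM(2) iso(2)]
        jet_eqI_geq[OF _ sg_Qf[OF S(1) sgg sgz] sgM(3) iso(3)]
      by (simp_all add: pbE_def[of "ffE f"] pbF_def[of "ffE f"] pbG_def[of "ffE f"])
    thus ?thesis unfolding formally_isometric_def using \<psi> by blast
  qed
  have cf: "characteristic_function f p b"
  proof -
    define xy where "xy q = pairm x y (\<kappa> q)" for q
    have lxy: "local_diffeo (pairm x y) 0" and jxy: "jac_det2 (pairm x y) 0 = x1 * c"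
      using pairm_local_diffeo[OF S(1,2)] S(10) c0 by (simp_all add: tcs)
    have m0: "pairm x y 0 = 0" using z0 by (simp add: pairm_0)
    obtain \<iota> where i: "local_diffeo \<iota> 0" "\<iota> 0 = 0" "\<forall>\<^sub>F w in nhds 0. \<iota> (pairm x y w) = w"
      "\<forall>\<^sub>F w in nhds 0. pairm x y (\<iota> w) = w" "jac_det2 \<iota> 0 * jac_det2 (pairm x y) 0 = 1"
      by (rule local_diffeo_inverse_germ[OF lxy, unfolded m0])
    note gi = local_diffeo_imp_smooth_germ[OF i(1)] and gxy = local_diffeo_imp_smooth_germ[OF lxy]
    define z' where "z' w = ?z (\<iota> w)" for w
    have sgz': "sg z'" unfolding z'_def[abs_def] by (rule smooth_germ_fn_compose[OF _ gi]) (simp add: i(2) sgz)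
    have vz': "vo 2 z'"
    proof -
      have "vo 2 (\<lambda>w. ?z (pairm (\<lambda>w. \<iota> w $ 1) (\<lambda>w. \<iota> w $ 2) w))"
        by (rule vo_compose[OF sgz sg_component[OF gi] sg_component[OF gi] _ _ vz]) (simp_all add: i(2))
      thus ?thesis by (simp add: pairm_eta z'_def[abs_def])
    qed
    have zz: "?z \<simeq> (\<lambda>w. z' (pairm x y w))" using i(3) by eventually_elim (simp add: z'_def)
    \<comment> \<open>Since x has no v-slope, the v^2 coefficient of the third component is that of
      z in (x, y) times c^2; the sign of r carries over.\<close>
    have "r / 2 = tc ?z 0 (Suc (Suc 0))" by (simp add: tc_eq_of_vo[OF sgz sg_quadr S(9)] tc_quadr)
    also have "\<dots> = tc z' 0 (Suc (Suc 0)) * c\<^sup>2"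
      unfolding tc_cong[OF zz] second_order_compose(3)[OF sgz' S(1,2) vz' S(5,6)] by simp
    finally have "0 < tc z' 0 (Suc (Suc 0)) * c\<^sup>2" using S(12) by (simp add: mult.commute)
    hence zvv: "0 < tc z' 0 (Suc (Suc 0))" using c0 by (simp add: zero_less_mult_iff)
    have vz'0: "z' 0 = 0" "partial 1 z' 0 = 0" "partial 2 z' 0 = 0"
      using vz' vo_2_iff[OF sgz'] sgz' by (simp_all add: partial_at0)
    have ldxy: "local_diffeo xy p"
      unfolding xy_def[abs_def] using local_diffeo_compose[OF k(1), of "pairm x y"] lxy k(2) by simp
    have "jac_det2 xy p = x1 * c * jac_det2 \<kappa> p"
      using jac_det2_compose_germ[OF gk, of "pairm x y"] gxy k(2) jxy by (simp add: xy_def[abs_def])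
    moreover have "0 < c * jac_det2 \<kappa> p"
    proof -
      have "jac_det2 \<kappa> p \<noteq> 0" using k(5) by auto
      thus ?thesis using S(11) by (auto simp: s_def zero_less_mult_iff split: if_splits)
    qed
    ultimately have jpos: "0 < jac_det2 xy p" using S(10) by (simp add: mult.assoc)
    have "\<forall>\<^sub>F w in nhds (\<kappa> p). \<iota> (pairm x y w) = w" using i(3) by (simp add: k(2))
    hence "\<forall>\<^sub>F q in nhds p. \<iota> (pairm x y (\<kappa> q)) = \<kappa> q" by (rule eventually_germ_compose[OF _ gk])
    hence fe: "\<forall>\<^sub>F q in nhds p. f q = vector [xy q $ 1, xy q $ 1 * xy q $ 2 + b (xy q $ 2), z' (xy q)]"
      by eventually_elim (simp add: f_def xy_def g2_def bl_def z'_def)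
    \<comment> \<open>The map is built in normal form already, so the isometry is the
      identity.\<close>
    have oi: "orient_isometry (\<lambda>v. v)"
      unfolding orient_isometry_def
      by (intro exI[of _ "mat 1"] exI[of _ 0])
         (simp add: rotation_matrix_def orthogonal_matrix_id det_I matrix_vector_mul_lid)
    have "cc_normal_form f p (\<lambda>v. v) xy b z'"
      unfolding cc_normal_form_def
      using oi ldxy jpos b sgz' vz'0 zvv fe
      by (simp add: xy_def k(2) m0 tc_def fact_Suc)
    thus ?thesis unfolding characteristic_function_def by blast
  qed
  show ?thesis using smf cc fi cf by blast
qed

text \<open>Transports one normal form to the chart \<open>\<psi>\<close>. The last conclusion ties
  the sign of y_v to the orientation of \<open>\<psi>\<close> alone, so it is the same for all
  normal forms considered over that chart.\<close>

lemma normal_coords_data: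
  assumes wn: "coords_at p \<psi>" and nf: "cc_normal_form f p T xy b z"
    and x1: "partial 1 (\<lambda>w. xy (\<psi> w) $ 1) 0 = 1"
    and sgM: "sg M1" "sg M2" "sg M3"
    and jets: "jet_eq 0 (ffE (T \<circ> f \<circ> \<psi>)) M1" "jet_eq 0 (ffF (T \<circ> f \<circ> \<psi>)) M2" "jet_eq 0 (ffG (T \<circ> f \<circ> \<psi>)) M3"
  defines "X \<equiv> \<lambda>w. xy (\<psi> w) $ 1" and "Y \<equiv> \<lambda>w. xy (\<psi> w) $ 2" and "Z \<equiv> \<lambda>w. z (xy (\<psi> w))"
  shows "sg X" "sg Y" "sg Z" "X 0 = 0" "Y 0 = 0" "tc X (Suc 0) 0 = 1" "vo 2 Z"
    "tc X 0 (Suc 0) = 0 \<Longrightarrow> 0 \<le> tc Z 0 (Suc (Suc 0))"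
    "vo n (\<lambda>w. Qf 1 1 X (g2 b X Y) Z w - M1 w)" "vo n (\<lambda>w. Qf 1 2 X (g2 b X Y) Z w - M2 w)"
    "vo n (\<lambda>w. Qf 2 2 X (g2 b X Y) Z w - M3 w)"
    "tc X 0 (Suc 0) = 0 \<Longrightarrow> 0 < tc Y 0 (Suc 0) * jac_det2 \<psi> 0"
proof -
  have ld: "local_diffeo \<psi> 0" and \<psi>0: "\<psi> 0 = p" using wn by (auto simp: coords_at_def)
  have N: "local_diffeo xy p" "xy p = 0" "0 < jac_det2 xy p" "smooth_germ_real 0 b" "b 0 = 0" "deriv b 0 = 0"
    "deriv (deriv b) 0 = 0" "sg z" "z 0 = 0" "partial 1 z 0 = 0" "partial 2 z 0 = 0" "0 < pd [2,2] z 0"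
    and ev: "\<forall>\<^sub>F q in nhds p. T (f q) = vector [xy q $ 1, xy q $ 1 * xy q $ 2 + b (xy q $ 2), z (xy q)]"
    using nf unfolding cc_normal_form_def by auto
  note g\<psi> = local_diffeo_imp_smooth_germ[OF ld] and gx = local_diffeo_imp_smooth_germ[OF N(1)]
  have gc: "smooth_germ_map 0 (\<lambda>w. xy (\<psi> w))" by (rule smooth_germ_map_compose[OF _ g\<psi>]) (simp add: \<psi>0 gx)
  show sgX: "sg X" and sgY: "sg Y" unfolding X_def Y_def using sg_component[OF gc] by auto
  show sgZ: "sg Z"
    unfolding Z_def by (rule smooth_germ_fn_compose[OF _ gc]) (simp add: \<psi>0 N(2,8))
  show X0: "X 0 = 0" and Y0: "Y 0 = 0" by (simp_all add: X_def Y_def \<psi>0 N(2))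
  show X1: "tc X (Suc 0) 0 = 1" using x1 sgX by (simp add: partial_at0 X_def)
  have XY: "pairm X Y = (\<lambda>w. xy (\<psi> w))" unfolding X_def Y_def by (rule pairm_eta)
  have vz: "vo 2 z" using N(8-11) by (simp add: vo_2_iff partial_at0)
  have "vo 2 (\<lambda>w. z (pairm X Y w))" by (rule vo_compose[OF N(8) sgX sgY X0 Y0 vz])
  thus "vo 2 Z" by (simp add: XY Z_def)
  show "0 \<le> tc Z 0 (Suc (Suc 0))" if "tc X 0 (Suc 0) = 0"
  proof -
    have "Z = (\<lambda>w. z (pairm X Y w))" by (simp add: XY Z_def)
    hence "tc Z 0 (Suc (Suc 0)) = tc z 0 (Suc (Suc 0)) * (tc Y 0 (Suc 0))\<^sup>2"
      using second_order_compose(3)[OF N(8) sgX sgY vz linear_part[OF sgX X0] linear_part[OF sgY Y0]] that by simp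
    moreover have "0 < tc z 0 (Suc (Suc 0))" using N(12) by (simp add: tc_def fact_Suc)
    ultimately show ?thesis by simp
  qed
  show "0 < tc Y 0 (Suc 0) * jac_det2 \<psi> 0" if "tc X 0 (Suc 0) = 0"
  proof -
    have "jac_det2 (pairm X Y) 0 = jac_det2 xy p * jac_det2 \<psi> 0"
      unfolding XY using jac_det2_compose_germ[OF g\<psi>, of xy] gx \<psi>0 by simp
    moreover have "jac_det2 (pairm X Y) 0 = tc Y 0 (Suc 0)"
      using sgX sgY X1 that by (simp add: jac_det2_def partial_at0)
    ultimately have "tc Y 0 (Suc 0) * jac_det2 \<psi> 0 = jac_det2 xy p * (jac_det2 \<psi> 0)\<^sup>2"
      by (simp add: power2_eq_square)
    thus ?thesis using N(3) local_diffeo_jac_nonzero[OF ld] by simp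
  qed
  have "\<forall>\<^sub>F w in nhds 0. T (f (\<psi> w)) = vector [xy (\<psi> w) $ 1, xy (\<psi> w) $ 1 * xy (\<psi> w) $ 2 + b (xy (\<psi> w) $ 2), z (xy (\<psi> w))]"
    by (rule eventually_germ_compose[OF _ g\<psi>]) (simp add: \<psi>0 ev)
  hence comp: "(\<lambda>w. (T \<circ> f \<circ> \<psi>) w $ 1) \<simeq> X" "(\<lambda>w. (T \<circ> f \<circ> \<psi>) w $ 2) \<simeq> g2 b X Y" "(\<lambda>w. (T \<circ> f \<circ> \<psi>) w $ 3) \<simeq> Z"
    by (eventually_elim, simp add: X_def Y_def Z_def g2_def bl_def)+
  have sgg: "sg (g2 b X Y)" by (rule sg_g2[OF bl_germ(1)[OF N(4)] sgX sgY Y0])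
  have main: "vo n (\<lambda>w. Qf i j X (g2 b X Y) Z w - M w)"
    if "jet_eq 0 (\<lambda>w. vpartial i (T \<circ> f \<circ> \<psi>) w \<bullet> vpartial j (T \<circ> f \<circ> \<psi>) w) M" "sg M" for i j M
  proof -
    note e = vpartial_inner_Qf[OF comp, of i j]
    have sQ: "sg (Qf i j X (g2 b X Y) Z)" by (rule sg_Qf[OF sgX sgg sgZ])
    have sh: "sg (\<lambda>w. vpartial i (T \<circ> f \<circ> \<psi>) w \<bullet> vpartial j (T \<circ> f \<circ> \<psi>) w)"
      by (rule sg_cong[OF geq_sym[OF e] sQ])
    have e': "(\<lambda>w. Qf i j X (g2 b X Y) Z w - M w) \<simeq> (\<lambda>w. vpartial i (T \<circ> f \<circ> \<psi>) w \<bullet> vpartial j (T \<circ> f \<circ> \<psi>) w - M w)"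
      using e by eventually_elim (simp only:)
    show ?thesis unfolding vo_cong[OF e'] using jet_eq_iff_vo[OF sh that(2)] that(1) by blast
  qed
  show "vo n (\<lambda>w. Qf 1 1 X (g2 b X Y) Z w - M1 w)" using main[OF jets(1)[unfolded ff_eq] sgM(1)] .
  show "vo n (\<lambda>w. Qf 1 2 X (g2 b X Y) Z w - M2 w)" using main[OF jets(2)[unfolded ff_eq] sgM(2)] .
  show "vo n (\<lambda>w. Qf 2 2 X (g2 b X Y) Z w - M3 w)" using main[OF jets(3)[unfolded ff_eq] sgM(3)] .
qed

text \<open>Rigidity of the low-order jets puts both maps over the same base point, up to y_v = 1 or
  y_v = -1. Positivity of both Jacobians makes these signs agree, and the linear uniqueness argument
  takes over.\<close>

lemma cross_cap_uniqueness:
  assumes gm: "smooth_germ_fn p E" "smooth_germ_fn p F" "smooth_germ_fn p G"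
    and wn: "whitney_normal_coords E F G p \<psi>"
    and nf1: "cc_normal_form f1 p T1 xy1 b1 z1" and x1: "partial 1 (\<lambda>w. xy1 (\<psi> w) $ 1) 0 = 1"
    and j1: "jet_eq 0 (ffE (T1 \<circ> f1 \<circ> \<psi>)) (pbE E F G \<psi>)" "jet_eq 0 (ffF (T1 \<circ> f1 \<circ> \<psi>)) (pbF E F G \<psi>)"
      "jet_eq 0 (ffG (T1 \<circ> f1 \<circ> \<psi>)) (pbG E F G \<psi>)"
    and nf2: "cc_normal_form f2 p T2 xy2 b2 z2" and x2: "partial 1 (\<lambda>w. xy2 (\<psi> w) $ 1) 0 = 1"
    and j2: "jet_eq 0 (ffE (T2 \<circ> f2 \<circ> \<psi>)) (pbE E F G \<psi>)" "jet_eq 0 (ffF (T2 \<circ> f2 \<circ> \<psi>)) (pbF E F G \<psi>)"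
      "jet_eq 0 (ffG (T2 \<circ> f2 \<circ> \<psi>)) (pbG E F G \<psi>)"
    and bb: "jet_eq_real 0 b1 b2"
  shows "jet_eq 0 (\<lambda>w. xy1 (\<psi> w) $ 1) (\<lambda>w. xy2 (\<psi> w) $ 1) \<and>
    jet_eq 0 (\<lambda>w. xy1 (\<psi> w) $ 2) (\<lambda>w. xy2 (\<psi> w) $ 2) \<and>
    jet_eq 0 (\<lambda>w. z1 (xy1 (\<psi> w))) (\<lambda>w. z2 (xy2 (\<psi> w)))"
proof -
  have co: "coords_at p \<psi>" using wn by (simp add: whitney_normal_coords_def)
  have ld: "local_diffeo \<psi> 0" and \<psi>0: "\<psi> 0 = p" using co by (auto simp: coords_at_def)
  note g\<psi> = local_diffeo_imp_smooth_germ[OF ld]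
  have sgM: "sg (pbE E F G \<psi>)" "sg (pbF E F G \<psi>)" "sg (pbG E F G \<psi>)"
    unfolding pbE_def pbF_def pbG_def using gm \<psi>0 by (auto intro!: sg_pb_form[OF g\<psi>])
  obtain a20 a11 a02 where nj: "normal_jet (pbE E F G \<psi>) (pbF E F G \<psi>) (pbG E F G \<psi>) a20 a11 a02"
    using wn unfolding whitney_normal_coords_def normal_jet_def by blast
  have B1: "smooth_germ_real 0 b1" "b1 0 = 0" "deriv b1 0 = 0" "deriv (deriv b1) 0 = 0"
    and B2: "smooth_germ_real 0 b2" "b2 0 = 0" "deriv b2 0 = 0" "deriv (deriv b2) 0 = 0"
    using nf1 nf2 by (auto simp: cc_normal_form_def)
  note bl1 = bl_germ(1)[OF B1(1)] bl_vo_3[OF B1] and bl2 = bl_germ(1)[OF B2(1)] bl_vo_3[OF B2]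
  define X1 Y1 Z1 where "X1 = (\<lambda>w. xy1 (\<psi> w) $ 1)" and "Y1 = (\<lambda>w. xy1 (\<psi> w) $ 2)" and "Z1 = (\<lambda>w. z1 (xy1 (\<psi> w)))"
  define X2 Y2 Z2 where "X2 = (\<lambda>w. xy2 (\<psi> w) $ 1)" and "Y2 = (\<lambda>w. xy2 (\<psi> w) $ 2)" and "Z2 = (\<lambda>w. z2 (xy2 (\<psi> w)))"
  note d1 = normal_coords_data[OF co nf1 x1 sgM j1, folded X1_def Y1_def Z1_def]
  note d2 = normal_coords_data[OF co nf2 x2 sgM j2, folded X2_def Y2_def Z2_def]
  have o1: "X1 0 = 0" "Y1 0 = 0" and o2: "X2 0 = 0" "Y2 0 = 0"
    using d1(4,5) d2(4,5) by (simp_all add: X1_def Y1_def X2_def Y2_def)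
  note r1 = normal_jet_rigid[OF nj sgM bl1 d1(1-3) o1 d1(6-11)]
  note r2 = normal_jet_rigid[OF nj sgM bl2 d2(1-3) o2 d2(6-11)]
  have ceq: "tc Y1 0 (Suc 0) = tc Y2 0 (Suc 0)"
  proof -
    have "tc Y1 0 (Suc 0) = 1 \<or> tc Y1 0 (Suc 0) = - 1" "tc Y2 0 (Suc 0) = 1 \<or> tc Y2 0 (Suc 0) = - 1"
      using r1(2) r2(2) by (simp_all add: power2_eq_1_iff)
    thus ?thesis using d1(12)[OF r1(1)] d2(12)[OF r2(1)] by auto
  qed
  have a02: "a02 \<noteq> 0" using nj by (auto simp: normal_jet_def)
  have c0: "tc Y2 0 (Suc 0) \<noteq> 0" using r2(2) by auto
  have x4: "vo 4 (\<lambda>w. X1 w - X2 w)"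
    by (rule vo_trans[OF d1(1) sg_lin d2(1) r1(6) vo_swap[OF d2(1) sg_lin r2(6)]])
  have sgg: "sg (g2 b1 X1 Y1)" "sg (g2 b2 X2 Y2)"
    using sg_g2[OF bl1(1) d1(1,2) o1(2)] sg_g2[OF bl2(1) d2(1,2) o2(2)] by auto
  have sQ: "sg (Qf i j X1 (g2 b1 X1 Y1) Z1)" "sg (Qf i j X2 (g2 b2 X2 Y2) Z2)" for i j
    using sg_Qf[OF d1(1) sgg(1) d1(3)] sg_Qf[OF d2(1) sgg(2) d2(3)] by auto
  have Q: "vo n (\<lambda>w. Qf 1 1 X1 (g2 b1 X1 Y1) Z1 w - Qf 1 1 X2 (g2 b2 X2 Y2) Z2 w)"
    "vo n (\<lambda>w. Qf 1 2 X1 (g2 b1 X1 Y1) Z1 w - Qf 1 2 X2 (g2 b2 X2 Y2) Z2 w)"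
    "vo n (\<lambda>w. Qf 2 2 X1 (g2 b1 X1 Y1) Z1 w - Qf 2 2 X2 (g2 b2 X2 Y2) Z2 w)" for n
    using vo_trans[OF sQ(1) sgM(1) sQ(2) d1(9) vo_swap[OF sQ(2) sgM(1) d2(9)]]
      vo_trans[OF sQ(1) sgM(2) sQ(2) d1(10) vo_swap[OF sQ(2) sgM(2) d2(10)]]
      vo_trans[OF sQ(1) sgM(3) sQ(2) d1(11) vo_swap[OF sQ(2) sgM(3) d2(11)]] by auto
  \<comment> \<open>The second map serves as the base point, hence the reversed order of the
    data.\<close>
  have u: "vo n (\<lambda>w. X1 w - X2 w) \<and> vo n (\<lambda>w. Y1 w - Y2 w) \<and> vo n (\<lambda>w. Z1 w - Z2 w)" for n
    by (rule formal_uniqueness[OF bl2 bl1 bl_jet_eq[OF B1(1) B2(1) bb] d2(1-3) d1(1-3) r2(3,4,5) r1(3)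
          r1(4)[unfolded ceq] r1(5) c0 a02 x4 Q])
  hence "jet_eq 0 X1 X2 \<and> jet_eq 0 Y1 Y2 \<and> jet_eq 0 Z1 Z2"
    using jet_eq_iff_vo[OF d1(1) d2(1)] jet_eq_iff_vo[OF d1(2) d2(2)] jet_eq_iff_vo[OF d1(3) d2(3)] by auto
  thus ?thesis by (simp add: X1_def Y1_def Z1_def X2_def Y2_def Z2_def)
qed

theorem mainTheorem1:
  fixes U :: "(real^2) set" and E F G :: "real^2 \<Rightarrow> real"
    and p :: "real^2" and b :: "real \<Rightarrow> real"
  assumes "whitney_metric U E F G" and "p \<in> U" and "\<not> pos_def_at E F G p"
    and "smooth_germ_real 0 b" and "b 0 = 0" and "deriv b 0 = 0" and "deriv (deriv b) 0 = 0"
  shows "(\<exists>f. smooth_germ_map p f \<and> cross_cap f p \<and>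
            formally_isometric (ffE f) (ffF f) (ffG f) E F G p \<and>
            (\<exists>b'. characteristic_function f p b' \<and> jet_eq_real 0 b' b))
       \<and> (\<forall>\<psi> f1 f2 T1 T2 xy1 xy2 b1 b2 z1 z2.
            whitney_normal_coords E F G p \<psi> \<and>
            smooth_germ_map p f1 \<and> cross_cap f1 p \<and> cc_normal_form f1 p T1 xy1 b1 z1 \<and>
            jet_eq_real 0 b1 b \<and> partial 1 (\<lambda>w. xy1 (\<psi> w) $ 1) 0 = 1 \<and>
            jet_eq 0 (ffE (T1 \<circ> f1 \<circ> \<psi>)) (pbE E F G \<psi>) \<and>
            jet_eq 0 (ffF (T1 \<circ> f1 \<circ> \<psi>)) (pbF E F G \<psi>) \<and>
            jet_eq 0 (ffG (T1 \<circ> f1 \<circ> \<psi>)) (pbG E F G \<psi>) \<and>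
            smooth_germ_map p f2 \<and> cross_cap f2 p \<and> cc_normal_form f2 p T2 xy2 b2 z2 \<and>
            jet_eq_real 0 b2 b \<and> partial 1 (\<lambda>w. xy2 (\<psi> w) $ 1) 0 = 1 \<and>
            jet_eq 0 (ffE (T2 \<circ> f2 \<circ> \<psi>)) (pbE E F G \<psi>) \<and>
            jet_eq 0 (ffF (T2 \<circ> f2 \<circ> \<psi>)) (pbF E F G \<psi>) \<and>
            jet_eq 0 (ffG (T2 \<circ> f2 \<circ> \<psi>)) (pbG E F G \<psi>)
          \<longrightarrow> jet_eq 0 (\<lambda>w. xy1 (\<psi> w) $ 1) (\<lambda>w. xy2 (\<psi> w) $ 1) \<and>
              jet_eq 0 (\<lambda>w. xy1 (\<psi> w) $ 2) (\<lambda>w. xy2 (\<psi> w) $ 2) \<and>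
              jet_eq 0 (\<lambda>w. z1 (xy1 (\<psi> w))) (\<lambda>w. z2 (xy2 (\<psi> w))))"
proof (rule conjI)
  \<comment> \<open>The construction has \<open>b\<close> itself as characteristic function, so
    equality of Taylor series holds by reflexivity.\<close>
  have "jet_eq_real 0 b b" by (simp add: jet_eq_real_def)
  thus "\<exists>f. smooth_germ_map p f \<and> cross_cap f p \<and>
            formally_isometric (ffE f) (ffF f) (ffG f) E F G p \<and>
            (\<exists>b'. characteristic_function f p b' \<and> jet_eq_real 0 b' b)"
    using cross_cap_existence[OF assms] by blast
next
  have gm: "smooth_germ_fn p E" "smooth_germ_fn p F" "smooth_germ_fn p G"
    using assms(1,2) by (auto simp: whitney_metric_def psd_metric_def smooth_germ_fn_def)
  show "\<forall>\<psi> f1 f2 T1 T2 xy1 xy2 b1 b2 z1 z2.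
            whitney_normal_coords E F G p \<psi> \<and>
            smooth_germ_map p f1 \<and> cross_cap f1 p \<and> cc_normal_form f1 p T1 xy1 b1 z1 \<and>
            jet_eq_real 0 b1 b \<and> partial 1 (\<lambda>w. xy1 (\<psi> w) $ 1) 0 = 1 \<and>
            jet_eq 0 (ffE (T1 \<circ> f1 \<circ> \<psi>)) (pbE E F G \<psi>) \<and>
            jet_eq 0 (ffF (T1 \<circ> f1 \<circ> \<psi>)) (pbF E F G \<psi>) \<and>
            jet_eq 0 (ffG (T1 \<circ> f1 \<circ> \<psi>)) (pbG E F G \<psi>) \<and>
            smooth_germ_map p f2 \<and> cross_cap f2 p \<and> cc_normal_form f2 p T2 xy2 b2 z2 \<and>
            jet_eq_real 0 b2 b \<and> partial 1 (\<lambda>w. xy2 (\<psi> w) $ 1) 0 = 1 \<and>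
            jet_eq 0 (ffE (T2 \<circ> f2 \<circ> \<psi>)) (pbE E F G \<psi>) \<and>
            jet_eq 0 (ffF (T2 \<circ> f2 \<circ> \<psi>)) (pbF E F G \<psi>) \<and>
            jet_eq 0 (ffG (T2 \<circ> f2 \<circ> \<psi>)) (pbG E F G \<psi>)
          \<longrightarrow> jet_eq 0 (\<lambda>w. xy1 (\<psi> w) $ 1) (\<lambda>w. xy2 (\<psi> w) $ 1) \<and>
              jet_eq 0 (\<lambda>w. xy1 (\<psi> w) $ 2) (\<lambda>w. xy2 (\<psi> w) $ 2) \<and>
              jet_eq 0 (\<lambda>w. z1 (xy1 (\<psi> w))) (\<lambda>w. z2 (xy2 (\<psi> w)))"
  proof (intro allI impI, elim conjE, goal_cases)
    case (1 \<psi> f1 f2 T1 T2 xy1 xy2 b1 b2 z1 z2)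
    have "jet_eq_real 0 b1 b2" using 1(5,13) by (simp add: jet_eq_real_def)
    thus ?case by (rule cross_cap_uniqueness[OF gm 1(1,4,6-9,12,14-17)])
  qed
qed

end
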